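(* Let $1<p<\infty$, $1/p+1/q=1$, and let $(a,b)\in L^\infty\times L^\infty$ be a Fredholm $\alpha$-matching pair (with respect to $H^p$) with subordinated pair $(c,d)$, $c=ab^{-1}$, $d=ba_\alpha^{-1}$. Put $\kappa_1:=\operatorname{ind}T(c)$ and $\kappa_2:=\operatorname{ind}T(d)$ on $H^p$. Consider $T(a)\pm H_\alpha(b)$ on $H^p$. Then: (i) If $\kappa_1\ge 0$ and $\kappa_2\ge 1$, then $T(a)+H_\alpha(b)$ and $T(a)-H_\alpha(b)$ are invertible from the right and $$\ker(T(a)+H_\alpha(b))=\operatorname{im}\mathbf P_\alpha^-(c)\dotplus\varphi_\alpha^+(\operatorname{im}\mathbf P_\alpha^+(d)),$$ $$\ker(T(a)-H_\alpha(b))=\operatorname{im}\mathbf P_\alpha^+(c)\dotplus\varphi_\alpha^-(\operatorname{im}\mathbf P_\alpha^-(d)),$$ where $\varphi_\alpha^\pm=\varphi^\pm_{\alpha;(a,b)}$. Here, for $g\in\{c,d\}$ with $n=\operatorname{ind}T(g)>0$ and Wiener–Hopf factorization $g=g_-t^{-n}g_+$ in $H^p$, the space $\operatorname{im}\mathbf P_\alpha^\pm(g)$ has the basis $\{g_+^{-1}(\chi^{m-k-1}\pm\boldsymbol\sigma_\alpha(g)\chi^{m+k}):k=0,\dots,m-1\}$ if $n=2m$, and the basis $\{g_+^{-1}(\chi^{m+k}\pm\boldsymbol\sigma_\alpha(g)\chi^{m-k}):k=0,\dots,m\}\setminus\{0\}$ if $n=2m+1$; if $n=0$ the space is $\{0\}$.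 (ii) If $\kappa_1\le -1$ and $\kappa_2\le 0$, then $T(a)+H_\alpha(b)$ and $T(a)-H_\alpha(b)$ are invertible from the left and $$\operatorname{coker}(T(a)+H_\alpha(b))=\operatorname{im}\mathbf P_\alpha^-(\overline d)\dotplus\varphi_\alpha^+(\operatorname{im}\mathbf P_\alpha^+(\overline c)),$$ $$\operatorname{coker}(T(a)-H_\alpha(b))=\operatorname{im}\mathbf P_\alpha^+(\overline d)\dotplus\varphi_\alpha^-(\operatorname{im}\mathbf P_\alpha^-(\overline c)),$$ where $\varphi_\alpha^\pm=\varphi^\pm_{\alpha;(\overline a,\overline b_\alpha)}$, all objects on the right being taken on $H^q$, and $\operatorname{im}\mathbf P_\alpha^\pm(\overline d)=\{0\}$ for $\kappa_2=0$. (iii) If $\kappa_1\ge 0$ and $\kappa_2\le 0$, then $$\ker(T(a)+H_\alpha(b))=\operatorname{im}\mathbf P_\alpha^-(c),\qquad \operatorname{coker}(T(a)+H_\alpha(b))=\operatorname{im}\mathbf P_\alpha^+(\overline d),$$ $$\ker(T(a)-H_\alpha(b))=\operatorname{im}\mathbf P_\alpha^+(c),\qquad \operatorname{coker}(T(a)-H_\alpha(b))=\operatorname{im}\mathbf P_\alpha^-(\overline d),$$ where $\mathbf P_\alpha^\pm(\overline d)$ is taken on $H^q$.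
   Context: $\mathbb T$ is the unit circle, $L^p=L^p(\mathbb T)$. For $1\le p\le\infty$, $H^p=\{f\in L^p:\widehat f_n=0,\ n<0\}$, $\overline{H^p}=\{f\in L^p:\widehat f_n=0,\ n>0\}$; elements of $H^p$ are identified with their analytic extensions to the open unit disc, and for $f\in\overline{H^p}$, $f(\infty):=\widehat f_0$. For $1<p<\infty$, $P:\sum_{n\in\mathbb Z}\widehat f_nt^n\mapsto\sum_{n\ge0}\widehat f_nt^n$ on $L^p$, $Q=I-P$. Fix $\beta\in\mathbb C$, $|\beta|>1$, $\lambda:=i\sqrt{|\beta|^2-1}$, $\alpha(t)=\dfrac{t-\beta}{\overline\beta t-1}$ (a map of $\mathbb T$ onto itself, $\alpha\circ\alpha=\mathrm{id}$), $a_\alpha:=a\circ\alpha$, $\chi(t):=(\overline\beta t-1)/\lambda$, and $J_\alpha\varphi(t):=\chi(t)^{-1}\varphi(\alpha(t))$. For $a\in L^\infty$, on $H^p$: $T(a)\varphi=P(a\varphi)$, $H_\alpha(a)\varphi=P(aQJ_\alpha\varphi)$. The dual of $H^p$ is identified with $H^q$ via $\langle f,g\rangle=\frac1{2\pi}\int_{\mathbb T}f\overline g\,|dt|$; $\operatorname{coker}A:=\ker A^*\subset H^q$; one has $(T(a)\pm H_\alpha(b))^*=T(\overline a)\pm H_\alpha(\overline b_\alpha)$ with $\overline b_\alpha=\overline{b\circ\alpha}$. $A$ is Fredholm if its range is closed and $\ker A$, $\operatorname{coker}A$ are finite-dimensional; $\operatorname{ind}A=\dim\ker A-\dim\operatorname{coker}A$.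 $(a,b)\in L^\infty\times L^\infty$ is an $\alpha$-matching pair if $a$ is invertible in $L^\infty$ and $aa_\alpha=bb_\alpha$ (so $b$ is invertible too). Its subordinated pair is $(c,d)$, $c=ab^{-1}$, $d=ba_\alpha^{-1}$; then $cc_\alpha=dd_\alpha=1$. The pair $(a,b)$ is Fredholm if $T(c),T(d)$ are Fredholm on $H^p$. The pair $(\overline a,\overline b_\alpha)$ is $\alpha$-matching with subordinated pair $(\overline d,\overline c)$. For $g\in L^\infty$ with $gg_\alpha=1$: $\mathbf P_\alpha(g):=J_\alpha QgP|_{\ker T(g)}$ maps $\ker T(g)$ to itself with square $I$, and $\mathbf P_\alpha^\pm(g):=\frac12(I\pm\mathbf P_\alpha(g))$ are complementary projections on $\ker T(g)$. Wiener–Hopf factorization of $g$ in $H^p$, where $T(g)$ is Fredholm on $H^p$ with index $n$: $g=g_-t^{-n}g_+$, $g_-(\infty)=1$, $g_+\in H^q$, $g_+^{-1}\in H^p$, $g_-\in\overline{H^p}$, $g_-^{-1}\in\overline{H^q}$, and $g_+^{-1}Pg_-^{-1}I$, defined on $\operatorname{span}\{t^k:k\ge0\}$, extends to a bounded operator on $H^p$ (it exists and is unique). If also $gg_\alpha=1$, the $\alpha$-signature is $\boldsymbol\sigma_\alpha(g):=(\lambda/\overline\beta)^n\,g_+^{-1}(1/\overline\beta)\in\{-1,1\}$. If $T(g)$ is Fredholm with index $\kappa\ge0$, $T_r^{-1}(g):=T^{-1}(gt^{\kappa})T(t^{\kappa})$, a right inverse of $T(g)$. For an $\alpha$-matching pair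 $(a,b)$ with subordinated pair $(c,d)$, $T(c)$ Fredholm of non-negative index, and $s\in\ker T(d)$: $$2\varphi^\pm_{\alpha;(a,b)}(s):=T_r^{-1}(c)T(a_\alpha^{-1})s\mp J_\alpha QcP\,T_r^{-1}(c)T(a_\alpha^{-1})s\pm J_\alpha Qa_\alpha^{-1}s.$$ For the pair $(\overline a,\overline b_\alpha)$ on $H^q$ the same formula is used with $a,c,d$ replaced by $\overline a,\overline d,\overline c$. When the space is $H^q$, the operators $P$, $Q$, $J_\alpha$, $T(\cdot)$, $H_\alpha(\cdot)$, Fredholmness and index, the projections $\mathbf P_\alpha^\pm(g)$ on $\ker T(g)\subset H^q$, the Wiener–Hopf factorization, the $\alpha$-signature $\boldsymbol\sigma_\alpha(g)$, the right inverse $T_r^{-1}(g)$ and the maps $\varphi^\pm_\alpha$ are defined in the same way with $p$ and $q$ interchanged (so that, in the Wiener–Hopf factorization of $g$ in $H^q$, $g_+\in H^p$, $g_+^{-1}\in H^q$, $g_-\in\overline{H^q}$, $g_-^{-1}\in\overline{H^p}$, and the bounded extension is on $H^q$). $\dotplus$ denotes direct sum.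
   Formalization: In (iii) the cokernel signs are exchanged: coker(T(a)+H_α(b)) = im P_α^-(d̄) and coker(T(a)-H_α(b)) = im P_α^+(d̄); as printed the two equalities fail whenever κ_2<0, e.g. for a=b=t. *)

theory Defs
  imports "HOL-Analysis.Analysis"
begin

section \<open>Functions on the unit circle modulo null sets\<close>

text \<open>Normalised arc length, as a Borel measure on the plane carried by the unit circle.  The values
  of a function off the circle are therefore irrelevant.\<close>

definition circ :: "complex measure" where
  "circ = distr (uniform_measure lborel {0..2 * pi}) borel cis"

lemma sets_circ [simp, measurable_cong]: "sets circ = sets borel"
  by (simp add: circ_def)

lemma space_circ [simp]: "space circ = UNIV"
  by (simp add: circ_def)

lemma emeasure_circ_UNIV: "emeasure circ UNIV = 1"
proof -
  have "cis \<in> borel_measurable borel"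
    by (intro borel_measurable_continuous_onI continuous_intros)
  then have "cis \<in> measurable (uniform_measure lborel {0..2 * pi}) borel"
    by (simp cong: measurable_cong_sets)
  then show ?thesis
    unfolding circ_def
    by (subst emeasure_distr) (auto simp: emeasure_uniform_measure ennreal_divide_self)
qed

definition ae_eq :: "(complex \<Rightarrow> complex) \<Rightarrow> (complex \<Rightarrow> complex) \<Rightarrow> bool" where
  "ae_eq f g \<longleftrightarrow> f \<in> borel_measurable borel \<and> g \<in> borel_measurable borel \<and>
     (AE t in circ. f t = g t)"

quotient_type lfun = "complex \<Rightarrow> complex" / partial: ae_eq
  unfolding part_equivp_def
proof (intro conjI allI)
  show "\<exists>f. ae_eq f f"
    by (rule exI[of _ "\<lambda>_. 0"]) (simp add: ae_eq_def)
  show "ae_eq f g \<longleftrightarrow> ae_eq f f \<and> ae_eq g g \<and> ae_eq f = ae_eq g" for f g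
  proof
    assume *: "ae_eq f g"
    then have "AE t in circ. f t = g t" by (simp add: ae_eq_def)
    then have "AE t in circ. (f t = h t) = (g t = h t)" for h
      by eventually_elim simp
    then have "(AE t in circ. f t = h t) \<longleftrightarrow> (AE t in circ. g t = h t)" for h
      by (rule eventually_subst)
    then have "ae_eq f h \<longleftrightarrow> ae_eq g h" for h
      using * by (simp add: ae_eq_def)
    then have "ae_eq f = ae_eq g" ..
    moreover have "ae_eq f f" "ae_eq g g"
      using * by (simp_all add: ae_eq_def)
    ultimately show "ae_eq f f \<and> ae_eq g g \<and> ae_eq f = ae_eq g"
      by blast
  next
    assume "ae_eq f f \<and> ae_eq g g \<and> ae_eq f = ae_eq g"
    then show "ae_eq f g" by simp
  qed
qed

lemma ae_eq_map:
  assumes "ae_eq f g" "h \<in> borel_measurable borel"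
  shows "ae_eq (\<lambda>t. h (f t)) (\<lambda>t. h (g t))"
proof -
  have m [measurable]: "f \<in> borel_measurable borel" "g \<in> borel_measurable borel"
    "h \<in> borel_measurable borel" and "AE t in circ. f t = g t"
    using assms by (auto simp: ae_eq_def)
  from this(4) have "AE t in circ. h (f t) = h (g t)"
    by eventually_elim simp
  then show ?thesis by (simp add: ae_eq_def)
qed

lemma ae_eq_map2:
  assumes "ae_eq f1 g1" "ae_eq f2 g2"
    and "\<And>f g :: complex \<Rightarrow> complex. f \<in> borel_measurable borel \<Longrightarrow> g \<in> borel_measurable borel \<Longrightarrow>
      (\<lambda>t. h (f t) (g t)) \<in> borel_measurable borel"
  shows "ae_eq (\<lambda>t. h (f1 t) (f2 t)) (\<lambda>t. h (g1 t) (g2 t))"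
proof -
  have ae: "AE t in circ. f1 t = g1 t" "AE t in circ. f2 t = g2 t"
    using assms by (auto simp: ae_eq_def)
  then have "AE t in circ. h (f1 t) (f2 t) = h (g1 t) (g2 t)"
    by eventually_elim simp
  then show ?thesis using assms by (simp add: ae_eq_def)
qed

instantiation lfun :: comm_ring_1
begin

lift_definition zero_lfun :: lfun is "\<lambda>_. 0" by (simp add: ae_eq_def)
lift_definition one_lfun :: lfun is "\<lambda>_. 1" by (simp add: ae_eq_def)
lift_definition plus_lfun :: "lfun \<Rightarrow> lfun \<Rightarrow> lfun" is "\<lambda>f g t. f t + g t"
  by (rule ae_eq_map2) simp_all
lift_definition uminus_lfun :: "lfun \<Rightarrow> lfun" is "\<lambda>f t. - f t"
  by (rule ae_eq_map) simp_all
lift_definition minus_lfun :: "lfun \<Rightarrow> lfun \<Rightarrow> lfun" is "\<lambda>f g t. f t - g t"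
  by (rule ae_eq_map2) simp_all
lift_definition times_lfun :: "lfun \<Rightarrow> lfun \<Rightarrow> lfun" is "\<lambda>f g t. f t * g t"
  by (rule ae_eq_map2) simp_all

instance
proof
  show "(0::lfun) \<noteq> 1"
  proof (transfer, unfold ae_eq_def, safe)
    assume "AE t in circ. (0::complex) = 1"
    then show False
      using emeasure_circ_UNIV by (auto simp: AE_iff_null null_sets_def)
  qed
qed (transfer; auto simp: ae_eq_def algebra_simps)+

end

text \<open>Pointwise inverse, with value 0 where the function vanishes; it is the multiplicative inverse
  exactly for the almost everywhere non-zero functions.\<close>

instantiation lfun :: inverse
begin

lift_definition inverse_lfun :: "lfun \<Rightarrow> lfun" is "\<lambda>f t. inverse (f t)"
  by (rule ae_eq_map) simp_all
definition divide_lfun :: "lfun \<Rightarrow> lfun \<Rightarrow> lfun" where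
  "divide_lfun f g = f * inverse g"

instance ..

end

lift_definition lscale :: "complex \<Rightarrow> lfun \<Rightarrow> lfun" is "\<lambda>c f t. c * f t"
  by (rule ae_eq_map) simp_all

lift_definition lcnj :: "lfun \<Rightarrow> lfun" is "\<lambda>f t. cnj (f t)"
  by (rule ae_eq_map) (auto intro: borel_measurable_continuous_onI continuous_intros)

lift_definition lintegral :: "lfun \<Rightarrow> complex" is "\<lambda>f. \<integral>t. f t \<partial>circ"
  by (rule integral_cong_AE) (auto simp: ae_eq_def)

global_interpretation lfun: vector_space lscale
  by unfold_locales (transfer; auto simp: ae_eq_def algebra_simps)+

definition fin_dim :: "lfun set \<Rightarrow> bool" where
  "fin_dim S \<longleftrightarrow> (\<exists>B. finite B \<and> S \<subseteq> lfun.span B)"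

definition is_basis :: "lfun set \<Rightarrow> lfun set \<Rightarrow> bool" where
  "is_basis B S \<longleftrightarrow> lfun.independent B \<and> lfun.span B = S"

definition is_direct_sum :: "lfun set \<Rightarrow> lfun set \<Rightarrow> lfun set \<Rightarrow> bool" where
  "is_direct_sum U X Y \<longleftrightarrow> lfun.subspace X \<and> lfun.subspace Y \<and>
     U = {x + y | x y. x \<in> X \<and> y \<in> Y} \<and> X \<inter> Y = {0}"


section \<open>Lebesgue and Hardy spaces\<close>

lemma ae_eq_powr:
  assumes "ae_eq f g"
  shows "(\<lambda>t. cmod (f t) powr p) \<in> borel_measurable circ" "(\<lambda>t. cmod (g t) powr p) \<in> borel_measurable circ"
    "AE t in circ. cmod (f t) powr p = cmod (g t) powr p"
proof -
  have [measurable]: "f \<in> borel_measurable borel" "g \<in> borel_measurable borel"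
    and "AE t in circ. f t = g t"
    using assms by (auto simp: ae_eq_def)
  from this(3) show "AE t in circ. cmod (f t) powr p = cmod (g t) powr p"
    by eventually_elim simp
  show "(\<lambda>t. cmod (f t) powr p) \<in> borel_measurable circ" by measurable
  show "(\<lambda>t. cmod (g t) powr p) \<in> borel_measurable circ" by measurable
qed

lift_definition in_Lp :: "real \<Rightarrow> lfun \<Rightarrow> bool" is
  "\<lambda>p f. integrable circ (\<lambda>t. cmod (f t) powr p)"
  by (rule integrable_cong_AE; rule ae_eq_powr)

definition Lp :: "real \<Rightarrow> lfun set" where
  "Lp p = {f. in_Lp p f}"

lift_definition lp_norm :: "real \<Rightarrow> lfun \<Rightarrow> real" is
  "\<lambda>p f. (\<integral>t. cmod (f t) powr p \<partial>circ) powr (1 / p)"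
  by (rule arg_cong[where f = "\<lambda>x. x powr _"], rule integral_cong_AE; rule ae_eq_powr)

lift_definition in_Linf :: "lfun \<Rightarrow> bool" is "\<lambda>f. \<exists>C. AE t in circ. cmod (f t) \<le> C"
proof -
  fix f g assume *: "ae_eq f g"
  then have "AE t in circ. f t = g t" by (simp add: ae_eq_def)
  then have "AE t in circ. (cmod (f t) \<le> C) = (cmod (g t) \<le> C)" for C
    by eventually_elim simp
  then have "(AE t in circ. cmod (f t) \<le> C) \<longleftrightarrow> (AE t in circ. cmod (g t) \<le> C)" for C
    by (rule eventually_subst)
  then show "(\<exists>C. AE t in circ. cmod (f t) \<le> C) = (\<exists>C. AE t in circ. cmod (g t) \<le> C)"
    by simp
qed

definition Linf :: "lfun set" where
  "Linf = {f. in_Linf f}"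

definition conj_exp :: "real \<Rightarrow> real" where
  "conj_exp p = p / (p - 1)"

definition monomial :: "int \<Rightarrow> lfun" where
  "monomial n = abs_lfun (\<lambda>t. t powi n)"

definition fcoeff :: "lfun \<Rightarrow> int \<Rightarrow> complex" where
  "fcoeff f n = lintegral (f * monomial (- n))"

definition Hardy :: "real \<Rightarrow> lfun set" where
  "Hardy p = {f \<in> Lp p. \<forall>n<0. fcoeff f n = 0}"

definition Hardy_bar :: "real \<Rightarrow> lfun set" where
  "Hardy_bar p = {f \<in> Lp p. \<forall>n>0. fcoeff f n = 0}"

definition disc_value :: "lfun \<Rightarrow> complex \<Rightarrow> complex" where
  "disc_value f z = (\<Sum>n. fcoeff f (int n) * z ^ n)"

text \<open>The Riesz projection.  Its values are singled out by their Fourier coefficients; these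
  determine an integrable function, so the definition does not depend on the exponent, and on
  \<open>Lp p\<close> with \<open>1 < p < \<infinity>\<close> it yields the usual bounded projection onto \<open>Hardy p\<close>.\<close>

definition Riesz_P :: "lfun \<Rightarrow> lfun" where
  "Riesz_P f = (THE h. h \<in> Lp 1 \<and> (\<forall>n. fcoeff h n = (if n \<ge> 0 then fcoeff f n else 0)))"

definition Riesz_Q :: "lfun \<Rightarrow> lfun" where
  "Riesz_Q f = f - Riesz_P f"


section \<open>Operators on Hardy spaces\<close>

text \<open>An operator on \<open>Hardy p\<close> is a function on \<open>lfun\<close> of which only the values on \<open>Hardy p\<close> matter.\<close>

definition bounded_op :: "real \<Rightarrow> (lfun \<Rightarrow> lfun) \<Rightarrow> bool" where
  "bounded_op p A \<longleftrightarrow>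
     (\<forall>f\<in>Hardy p. A f \<in> Hardy p) \<and>
     (\<forall>f\<in>Hardy p. \<forall>g\<in>Hardy p. A (f + g) = A f + A g) \<and>
     (\<forall>c. \<forall>f\<in>Hardy p. A (lscale c f) = lscale c (A f)) \<and>
     (\<exists>C. \<forall>f\<in>Hardy p. lp_norm p (A f) \<le> C * lp_norm p f)"

definition pairing :: "lfun \<Rightarrow> lfun \<Rightarrow> complex" where
  "pairing f g = lintegral (f * lcnj g)"

definition adjoint_op :: "real \<Rightarrow> (lfun \<Rightarrow> lfun) \<Rightarrow> lfun \<Rightarrow> lfun" where
  "adjoint_op p A g =
     (THE h. h \<in> Hardy (conj_exp p) \<and> (\<forall>f\<in>Hardy p. pairing (A f) g = pairing f h))"

definition ker :: "real \<Rightarrow> (lfun \<Rightarrow> lfun) \<Rightarrow> lfun set" where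
  "ker p A = {f \<in> Hardy p. A f = 0}"

definition coker :: "real \<Rightarrow> (lfun \<Rightarrow> lfun) \<Rightarrow> lfun set" where
  "coker p A = ker (conj_exp p) (adjoint_op p A)"

definition fredholm :: "real \<Rightarrow> (lfun \<Rightarrow> lfun) \<Rightarrow> bool" where
  "fredholm p A \<longleftrightarrow>
     closedin (Metric_space.mtopology (Hardy p) (\<lambda>f g. lp_norm p (f - g))) (A ` Hardy p) \<and>
     fin_dim (ker p A) \<and> fin_dim (coker p A)"

definition fredholm_index :: "real \<Rightarrow> (lfun \<Rightarrow> lfun) \<Rightarrow> int" where
  "fredholm_index p A = int (lfun.dim (ker p A)) - int (lfun.dim (coker p A))"

definition right_invertible :: "real \<Rightarrow> (lfun \<Rightarrow> lfun) \<Rightarrow> bool" where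
  "right_invertible p A \<longleftrightarrow> bounded_op p A \<and> (\<exists>B. bounded_op p B \<and> (\<forall>f\<in>Hardy p. A (B f) = f))"

definition left_invertible :: "real \<Rightarrow> (lfun \<Rightarrow> lfun) \<Rightarrow> bool" where
  "left_invertible p A \<longleftrightarrow> bounded_op p A \<and> (\<exists>B. bounded_op p B \<and> (\<forall>f\<in>Hardy p. B (A f) = f))"

definition toeplitz :: "lfun \<Rightarrow> lfun \<Rightarrow> lfun" where
  "toeplitz a f = Riesz_P (a * f)"


section \<open>The Carleman shift\<close>

definition lam :: "complex \<Rightarrow> complex" where
  "lam \<beta> = \<i> * complex_of_real (sqrt ((cmod \<beta>)\<^sup>2 - 1))"

definition alpha :: "complex \<Rightarrow> complex \<Rightarrow> complex" where
  "alpha \<beta> t = (t - \<beta>) / (cnj \<beta> * t - 1)"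

definition chi :: "complex \<Rightarrow> lfun" where
  "chi \<beta> = abs_lfun (\<lambda>t. (cnj \<beta> * t - 1) / lam \<beta>)"

text \<open>Composition with the shift, defined through a representative.  For \<open>\<bar>\<beta>\<bar> > 1\<close> the shift is a
  diffeomorphism of the circle and so preserves null sets, whence the choice of the representative
  is immaterial.\<close>

definition compose_alpha :: "complex \<Rightarrow> lfun \<Rightarrow> lfun" where
  "compose_alpha \<beta> f = abs_lfun (rep_lfun f \<circ> alpha \<beta>)"

definition J_alpha :: "complex \<Rightarrow> lfun \<Rightarrow> lfun" where
  "J_alpha \<beta> f = inverse (chi \<beta>) * compose_alpha \<beta> f"

definition hankel :: "complex \<Rightarrow> lfun \<Rightarrow> lfun \<Rightarrow> lfun" where
  "hankel \<beta> b f = Riesz_P (b * Riesz_Q (J_alpha \<beta> f))"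

text \<open>Sign pitfall for cokernels.  The adjoint of \<open>T(a) \<plusminus> H(b)\<close> is \<open>T(a') \<plusminus> H(b')\<close> with
  \<open>a' = lcnj a\<close> and \<open>b' = lcnj (compose_alpha \<beta> b)\<close>, with the same sign, and the pair \<open>(a', b')\<close> has
  the subordinated pair \<open>(lcnj d, lcnj c)\<close>.  So \<open>P\<^sup>-(lcnj d)\<close> belongs to the cokernel of
  \<open>T(a) + H(b)\<close>, just as \<open>P\<^sup>-(c)\<close> belongs to its kernel, and \<open>P\<^sup>+(lcnj d)\<close> to the cokernel of
  \<open>T(a) - H(b)\<close>.  For example, if \<open>a\<close> and \<open>b\<close> are both the identity \<open>t\<close>, then \<open>c = 1\<close>,
  \<open>d = t / \<alpha>(t)\<close>, the indices of \<open>T(c)\<close> and \<open>T(d)\<close> are 0 and -2, and the cokernel of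
  \<open>T(a) + H(b)\<close> is spanned by \<open>g(t) = t / (\<beta> - t) + 1 / \<lambda>\<close>, for which
  \<open>J_alpha \<beta> (lcnj d * g) = - g\<close>.\<close>

definition matching_pair :: "complex \<Rightarrow> lfun \<Rightarrow> lfun \<Rightarrow> bool" where
  "matching_pair \<beta> a b \<longleftrightarrow> a \<in> Linf \<and> b \<in> Linf \<and> (\<exists>a'\<in>Linf. a * a' = 1) \<and>
     a * compose_alpha \<beta> a = b * compose_alpha \<beta> b"

definition sub_c :: "lfun \<Rightarrow> lfun \<Rightarrow> lfun" where
  "sub_c a b = a * inverse b"

definition sub_d :: "complex \<Rightarrow> lfun \<Rightarrow> lfun \<Rightarrow> lfun" where
  "sub_d \<beta> a b = b * inverse (compose_alpha \<beta> a)"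

definition fredholm_pair :: "real \<Rightarrow> complex \<Rightarrow> lfun \<Rightarrow> lfun \<Rightarrow> bool" where
  "fredholm_pair p \<beta> a b \<longleftrightarrow>
     fredholm p (toeplitz (sub_c a b)) \<and> fredholm p (toeplitz (sub_d \<beta> a b))"

text \<open>Below, the parameter \<open>s\<close> is a sign, \<open>1\<close> or \<open>-1\<close>, standing for the upper or the lower choice in
  \<open>\<plusminus>\<close>.\<close>

definition proj_alpha :: "complex \<Rightarrow> complex \<Rightarrow> lfun \<Rightarrow> lfun \<Rightarrow> lfun" where
  "proj_alpha \<beta> s g f = lscale (1 / 2) (f + lscale s (J_alpha \<beta> (Riesz_Q (g * Riesz_P f))))"

definition im_proj :: "real \<Rightarrow> complex \<Rightarrow> complex \<Rightarrow> lfun \<Rightarrow> lfun set" where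
  "im_proj p \<beta> s g = proj_alpha \<beta> s g ` ker p (toeplitz g)"

definition toeplitz_right_inv :: "real \<Rightarrow> lfun \<Rightarrow> lfun \<Rightarrow> lfun" where
  "toeplitz_right_inv p g f =
     (let k = fredholm_index p (toeplitz g)
      in the_inv_into (Hardy p) (toeplitz (g * monomial k)) (toeplitz (monomial k) f))"

definition phi_alpha :: "real \<Rightarrow> complex \<Rightarrow> complex \<Rightarrow> lfun \<Rightarrow> lfun \<Rightarrow> lfun \<Rightarrow> lfun" where
  "phi_alpha p \<beta> s a b f =
     (let c = sub_c a b;
          ai = inverse (compose_alpha \<beta> a);
          u = toeplitz_right_inv p c (toeplitz ai f)
      in lscale (1 / 2)
           (u - lscale s (J_alpha \<beta> (Riesz_Q (c * Riesz_P u)))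
              + lscale s (J_alpha \<beta> (Riesz_Q (ai * f)))))"


section \<open>Wiener--Hopf factorization\<close>

text \<open>By linearity it suffices to prescribe the bounded extension of \<open>g\<^sub>+\<inverse> P g\<^sub>-\<inverse> I\<close> on monomials.\<close>

definition wiener_hopf :: "real \<Rightarrow> lfun \<Rightarrow> lfun \<Rightarrow> lfun \<Rightarrow> bool" where
  "wiener_hopf p g gm gp \<longleftrightarrow>
     g = gm * monomial (- fredholm_index p (toeplitz g)) * gp \<and>
     fcoeff gm 0 = 1 \<and>
     gp * inverse gp = 1 \<and> gm * inverse gm = 1 \<and>
     gp \<in> Hardy (conj_exp p) \<and> inverse gp \<in> Hardy p \<and>
     gm \<in> Hardy_bar p \<and> inverse gm \<in> Hardy_bar (conj_exp p) \<and>
     (\<exists>B. bounded_op p B \<and>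
        (\<forall>k::nat. B (monomial (int k)) = inverse gp * Riesz_P (inverse gm * monomial (int k))))"

text \<open>The plus factor of the factorization, which exists and is unique if \<open>T(g)\<close> is Fredholm on
  \<open>Hardy p\<close>.\<close>

definition wh_plus :: "real \<Rightarrow> lfun \<Rightarrow> lfun" where
  "wh_plus p g = (THE gp. \<exists>gm. wiener_hopf p g gm gp)"

definition alpha_signature :: "real \<Rightarrow> complex \<Rightarrow> lfun \<Rightarrow> complex" where
  "alpha_signature p \<beta> g =
     (lam \<beta> / cnj \<beta>) powi (fredholm_index p (toeplitz g)) *
     disc_value (inverse (wh_plus p g)) (1 / cnj \<beta>)"

end

theory Submission
  imports Defs "HOL-Complex_Analysis.Complex_Analysis"
begin

text \<open>Let \<open>s = \<plusminus>1\<close> be the sign.  As \<open>J\<^sub>\<alpha>\<close> exchanges \<open>H\<^sup>p\<close> with the range of \<open>Q\<close>, a function \<open>f \<in> H\<^sup>p\<close> is in the kernel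
  of \<open>T(a) + s H\<^sub>\<alpha>(b)\<close> iff \<open>k = a f + s b J\<^sub>\<alpha> f\<close> has only negative frequencies, and the matching condition says
  precisely that \<open>d J\<^sub>\<alpha> k = s k\<close>.  So \<open>h = s J\<^sub>\<alpha> k\<close> satisfies \<open>J\<^sub>\<alpha>(d h) = s h\<close>, that is
  \<open>h \<in> im P\<^sub>\<alpha>\<^sup>s(d)\<close>, and \<open>f\<close> solves \<open>c f + s J\<^sub>\<alpha> f = a\<^sub>\<alpha>\<inverse> h\<close>.  The homogeneous equation has the solution space
  \<open>im P\<^sub>\<alpha>\<^sup>-\<^sup>s(c)\<close>, and for \<open>ind T(c) \<ge> 0\<close> the map \<open>\<phi>\<^sub>\<alpha>\<close> gives a particular solution.  Solving first for \<open>h\<close> and then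
  for \<open>f\<close> with a right-hand side \<open>y\<close> produces the one-sided inverses, and cokernels are kernels for the
  conjugate pair.

  Underneath, a Fredholm \<open>T(g)\<close> becomes invertible when \<open>g\<close> is multiplied by \<open>t\<close> to the power of its index, by
  Coburn's lemma.  Hahn--Banach arguments are replaced by nearest points in the uniformly convex space
  \<open>L\<^sup>p\<close>: they separate points from closed subspaces by explicit elements of \<open>L\<^sup>q\<close>.\<close>

section \<open>Representatives\<close>

text \<open>The identities above are pure algebra in the ring of classes; the work lies in making
  the solutions exist and depend boundedly on the data. Fredholmness supplies a closed range and two
  finite dimensions only. Coburn's lemma kills one of the two kernels, the other has a basis dual to
  its first Fourier coefficients, and correcting by that basis makes T(g t^k), with k the index,
  bijective; a Baire argument then bounds the inverse. Fredholmness on the conjugate space is never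
  derived: bijectivity is carried there by adjoints. Coburn's lemma rests on the fact that a nonzero
  analytic function cannot vanish on a set of positive measure; this is shown in H^2, which suffices
  because one of two conjugate exponents is at least 2. The operator T^{-1}(g t^k) T(t^k) is a right
  inverse of T(g) for k \<ge> 0 and a left inverse for k \<le> 0, so a single construction serves
  both one-sided inverses. The shift enters through two normalisations: \<chi>(\<alpha>(t)) =
  1/\<chi>(t), which makes \<open>J\<close> an involution, and |\<alpha>'| = |\<chi>|^{-2}, which
  makes it self-adjoint for the pairing.\<close>

lemma rep_lfun_measurable [measurable]: "rep_lfun f \<in> borel_measurable borel"
  using Quotient3_rep_reflp[OF Quotient3_lfun] by (auto simp: ae_eq_def)

lemma lfun_eq_iff: "f = g \<longleftrightarrow> (AE t in circ. rep_lfun f t = rep_lfun g t)"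
  using Quotient3_rel_rep[OF Quotient3_lfun, of f g] by (auto simp: ae_eq_def)

lemma lfun_eqI: "(AE t in circ. rep_lfun f t = rep_lfun g t) \<Longrightarrow> f = g"
  by (simp add: lfun_eq_iff)

lemma rep_abs_lfun:
  "f \<in> borel_measurable borel \<Longrightarrow> AE t in circ. rep_lfun (abs_lfun f) t = f t"
  using Quotient3_rep_abs[OF Quotient3_lfun, of f] by (auto simp: ae_eq_def)

lemma ae_eqI: "f \<in> borel_measurable borel \<Longrightarrow> ae_eq f f"
  by (simp add: ae_eq_def)

lemma rep_lfun_zero: "AE t in circ. rep_lfun 0 t = 0"
  unfolding zero_lfun_def by (simp add: rep_abs_lfun)

lemma rep_lfun_one: "AE t in circ. rep_lfun 1 t = 1"
  unfolding one_lfun_def by (simp add: rep_abs_lfun)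

lemma measurable_cnj [measurable (raw)]:
  "f \<in> borel_measurable M \<Longrightarrow> (\<lambda>t. cnj (f t)) \<in> borel_measurable M"
  by (rule measurable_compose[where g = cnj])
     (auto intro!: borel_measurable_continuous_onI continuous_intros)

lemma rep_lfun_add: "AE t in circ. rep_lfun (f + g) t = rep_lfun f t + rep_lfun g t"
  unfolding plus_lfun_def by (simp add: rep_abs_lfun)

lemma rep_lfun_minus: "AE t in circ. rep_lfun (f - g) t = rep_lfun f t - rep_lfun g t"
  unfolding minus_lfun_def by (simp add: rep_abs_lfun)

lemma rep_lfun_times: "AE t in circ. rep_lfun (f * g) t = rep_lfun f t * rep_lfun g t"
  unfolding times_lfun_def by (simp add: rep_abs_lfun)

lemma rep_lfun_inverse: "AE t in circ. rep_lfun (inverse f) t = inverse (rep_lfun f t)"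
  unfolding inverse_lfun_def by (simp add: rep_abs_lfun)

lemma rep_lfun_lscale: "AE t in circ. rep_lfun (lscale c f) t = c * rep_lfun f t"
  unfolding lscale_def by (simp add: rep_abs_lfun)

lemma rep_lfun_lcnj: "AE t in circ. rep_lfun (lcnj f) t = cnj (rep_lfun f t)"
  unfolding lcnj_def by (simp add: rep_abs_lfun)

lemma powi_measurable [measurable]: "(\<lambda>t::complex. t powi n) \<in> borel_measurable borel"
proof (cases "n \<ge> 0")
  case True
  then show ?thesis by (simp add: power_int_def)
next
  case False
  then show ?thesis by (simp add: power_int_def)
qed

lemma rep_lfun_monomial: "AE t in circ. rep_lfun (monomial n) t = t powi n"
  unfolding monomial_def by (intro rep_abs_lfun powi_measurable)

lemma AE_circ_norm: "AE t in circ. cmod t = 1"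
proof -
  have "cis \<in> borel_measurable borel"
    by (intro borel_measurable_continuous_onI continuous_intros)
  then have "cis \<in> measurable (uniform_measure lborel {0..2 * pi}) borel"
    by (simp cong: measurable_cong_sets)
  then show ?thesis
    unfolding circ_def by (subst AE_distr_iff) auto
qed

interpretation circ: finite_measure circ
  by (rule finite_measureI) (simp add: emeasure_circ_UNIV)

lemma measure_circ_UNIV [simp]: "measure circ UNIV = 1"
  by (simp add: measure_def emeasure_circ_UNIV)

lemma lfun_eqI_AE:
  "AE t in circ. rep_lfun f t = F t \<Longrightarrow> AE t in circ. rep_lfun g t = F t \<Longrightarrow> f = g"
  by (rule lfun_eqI) (auto elim: eventually_elim2)

lemma abs_lfun_eqI:
  assumes "F \<in> borel_measurable borel" "AE t in circ. rep_lfun f t = F t"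
  shows "abs_lfun F = f"
  using lfun_eqI_AE[OF rep_abs_lfun[OF assms(1)] assms(2)] .

lemma lscale_times_left: "lscale c f * g = lscale c (f * g)"
  by transfer (auto simp: ae_eq_def algebra_simps)

lemma lscale_times_right: "f * lscale c g = lscale c (f * g)"
  by transfer (auto simp: ae_eq_def algebra_simps)

lemma lcnj_simps [simp]:
  "lcnj (f + g) = lcnj f + lcnj g" "lcnj (f - g) = lcnj f - lcnj g" "lcnj (- f) = - lcnj f"
  "lcnj (f * g) = lcnj f * lcnj g" "lcnj (inverse f) = inverse (lcnj f)"
  "lcnj (lscale c f) = lscale (cnj c) (lcnj f)" "lcnj (lcnj f) = f" "lcnj 0 = 0" "lcnj 1 = 1"
  by (transfer; auto simp: ae_eq_def)+

lemma monomial_mult: "monomial m * monomial n = monomial (m + n)"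
proof (rule lfun_eqI_AE[where F = "\<lambda>t. t powi m * t powi n"])
  show "AE t in circ. rep_lfun (monomial m * monomial n) t = t powi m * t powi n"
    using rep_lfun_times[of "monomial m" "monomial n"] rep_lfun_monomial[of m] rep_lfun_monomial[of n]
    by eventually_elim simp
  show "AE t in circ. rep_lfun (monomial (m + n)) t = t powi m * t powi n"
    using rep_lfun_monomial[of "m + n"] AE_circ_norm
    by eventually_elim (metis norm_zero power_int_add zero_neq_one)
qed

lemma monomial_0 [simp]: "monomial 0 = 1"
  using rep_lfun_monomial[of 0] rep_lfun_one by (intro lfun_eqI_AE[where F = "\<lambda>_. 1"]) auto

lemma monomial_cancel [simp]: "monomial n * monomial (- n) = 1" "monomial (- n) * monomial n = 1"
  by (simp_all add: monomial_mult)

lemma lcnj_monomial [simp]: "lcnj (monomial n) = monomial (- n)"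
proof (rule lfun_eqI_AE[where F = "\<lambda>t. t powi (- n)"])
  show "AE t in circ. rep_lfun (lcnj (monomial n)) t = t powi (- n)"
    using rep_lfun_lcnj[of "monomial n"] rep_lfun_monomial[of n] AE_circ_norm
  proof eventually_elim
    case (elim t)
    then have "cnj t = inverse t"
      by (metis complex_norm_square inverse_unique mult.commute of_real_1 one_power2)
    then show ?case using elim
      by (auto simp: power_int_def)
  qed
qed (rule rep_lfun_monomial)

lemma lfun_one_scale: "lscale c f = lscale c 1 * f"
  by (simp add: lscale_times_left)

section \<open>Lebesgue spaces on the circle\<close>

lemma in_Lp_iff: "in_Lp p f \<longleftrightarrow> integrable circ (\<lambda>t. cmod (rep_lfun f t) powr p)"
  by (metis Quotient3_abs_rep Quotient3_lfun ae_eqI in_Lp.abs_eq rep_lfun_measurable)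

lemma Lp_iff: "f \<in> Lp p \<longleftrightarrow> integrable circ (\<lambda>t. cmod (rep_lfun f t) powr p)"
  by (simp add: Lp_def in_Lp_iff)

lemma lp_norm_eq: "lp_norm p f = (\<integral>t. cmod (rep_lfun f t) powr p \<partial>circ) powr (1 / p)"
  by (metis Quotient3_abs_rep Quotient3_lfun ae_eqI lp_norm.abs_eq rep_lfun_measurable)

lemma lintegral_eq: "lintegral f = (\<integral>t. rep_lfun f t \<partial>circ)"
  by (metis Quotient3_abs_rep Quotient3_lfun ae_eqI lintegral.abs_eq rep_lfun_measurable)

lemma Linf_iff: "f \<in> Linf \<longleftrightarrow> (\<exists>C. AE t in circ. cmod (rep_lfun f t) \<le> C)"
  by (metis Quotient3_abs_rep Quotient3_lfun ae_eqI in_Linf.abs_eq rep_lfun_measurable Linf_def mem_Collect_eq)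

lemma lp_norm_nonneg [simp]: "lp_norm p f \<ge> 0"
  by (simp add: lp_norm_eq)

lemma lp_norm_powr:
  assumes "p > 0"
  shows "lp_norm p f powr p = (\<integral>t. cmod (rep_lfun f t) powr p \<partial>circ)"
  using assms by (simp add: lp_norm_eq powr_powr integral_nonneg_AE)

lemma integrable_powr_mono:
  assumes "integrable circ (\<lambda>t. G t powr p)" "AE t in circ. cmod (F t) \<le> G t" "p > 0"
    and [measurable]: "F \<in> borel_measurable borel"
  shows "integrable circ (\<lambda>t. cmod (F t) powr p)"
proof (rule Bochner_Integration.integrable_bound[OF assms(1)])
  show "AE t in circ. norm (cmod (F t) powr p) \<le> norm (G t powr p)"
    using assms(2) by eventually_elim (use assms(3) in \<open>auto intro!: powr_mono2\<close>)
qed measurable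

lemma Lp_cong:
  assumes "AE t in circ. rep_lfun f t = F t" "F \<in> borel_measurable borel"
  shows "f \<in> Lp p \<longleftrightarrow> integrable circ (\<lambda>t. cmod (F t) powr p)"
  unfolding Lp_iff
proof (rule integrable_cong_AE)
  show "AE t in circ. cmod (rep_lfun f t) powr p = cmod (F t) powr p"
    using assms(1) by eventually_elim simp
qed (use assms(2) in measurable)

lemma lp_norm_cong:
  assumes "AE t in circ. rep_lfun f t = F t" "F \<in> borel_measurable borel"
  shows "lp_norm p f = (\<integral>t. cmod (F t) powr p \<partial>circ) powr (1 / p)"
proof -
  have "(\<integral>t. cmod (rep_lfun f t) powr p \<partial>circ) = (\<integral>t. cmod (F t) powr p \<partial>circ)"
  proof (rule integral_cong_AE)
    show "AE t in circ. cmod (rep_lfun f t) powr p = cmod (F t) powr p"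
      using assms(1) by eventually_elim simp
  qed (use assms(2) in measurable)
  then show ?thesis by (simp add: lp_norm_eq)
qed

lemma lintegral_cong:
  assumes "AE t in circ. rep_lfun f t = F t" "F \<in> borel_measurable borel"
  shows "lintegral f = (\<integral>t. F t \<partial>circ)"
  unfolding lintegral_eq
  by (rule integral_cong_AE) (use assms in measurable)

lemma zero_Lp [simp]: "0 \<in> Lp p"
  by (subst Lp_cong[OF rep_lfun_zero]) auto

lemma Lp_mono_AE:
  assumes "g \<in> Lp p" "p > 0" "AE t in circ. cmod (rep_lfun f t) \<le> C * cmod (rep_lfun g t)"
  shows "f \<in> Lp p"
  unfolding Lp_iff
proof (rule integrable_powr_mono[where G = "\<lambda>t. \<bar>C\<bar> * cmod (rep_lfun g t)"])
  show "integrable circ (\<lambda>t. (\<bar>C\<bar> * cmod (rep_lfun g t)) powr p)"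
    using assms(1) by (simp add: powr_mult Lp_iff)
  show "AE t in circ. cmod (rep_lfun f t) \<le> \<bar>C\<bar> * cmod (rep_lfun g t)"
    using assms(3) by eventually_elim (meson abs_ge_self mult_right_mono norm_ge_zero order_trans)
qed (use assms in auto)

lemma lp_norm_mono_AE:
  assumes "g \<in> Lp p" "p > 0" "C \<ge> 0" "AE t in circ. cmod (rep_lfun f t) \<le> C * cmod (rep_lfun g t)"
  shows "lp_norm p f \<le> C * lp_norm p g"
proof -
  have f: "f \<in> Lp p" using Lp_mono_AE assms by blast
  have "(\<integral>t. cmod (rep_lfun f t) powr p \<partial>circ) \<le> (\<integral>t. C powr p * cmod (rep_lfun g t) powr p \<partial>circ)"
  proof (rule integral_mono_AE)
    show "AE t in circ. cmod (rep_lfun f t) powr p \<le> C powr p * cmod (rep_lfun g t) powr p"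
      using assms(4)
    proof eventually_elim
      case (elim t)
      have "cmod (rep_lfun f t) powr p \<le> (C * cmod (rep_lfun g t)) powr p"
        using elim assms by (intro powr_mono2) auto
      then show ?case using assms by (simp add: powr_mult)
    qed
  qed (use f assms in \<open>auto simp: Lp_iff\<close>)
  also have "\<dots> = (C * lp_norm p g) powr p"
    using assms by (simp add: powr_mult lp_norm_powr)
  finally have "lp_norm p f powr p \<le> (C * lp_norm p g) powr p"
    using assms by (simp add: lp_norm_powr)
  then show ?thesis
    using assms by (meson lp_norm_nonneg mult_nonneg_nonneg not_le powr_less_mono2)
qed

lemma Lp_lscale: "f \<in> Lp p \<Longrightarrow> lscale c f \<in> Lp p"
  by (subst Lp_cong[OF rep_lfun_lscale]) (auto simp: norm_mult powr_mult Lp_iff)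

lemma lp_norm_lscale: "p > 0 \<Longrightarrow> lp_norm p (lscale c f) = cmod c * lp_norm p f"
  by (subst lp_norm_cong[OF rep_lfun_lscale])
     (auto simp: norm_mult powr_mult lp_norm_eq powr_powr integral_nonneg_AE)

section \<open>Convexity, the inequalities of Minkowski and Hoelder, comparison of exponents\<close>

lemma powr_convex_ineq:
  fixes x y :: real
  assumes "p \<ge> 1" "x \<ge> 0" "y \<ge> 0" "0 \<le> u" "u \<le> 1"
  shows "((1 - u) * x + u * y) powr p \<le> (1 - u) * x powr p + u * y powr p"
proof -
  \<comment> \<open>This settles a vanishing argument, for which the claim reads (u y)^p \<le> u
    y^p.\<close>
  have *: "v powr p \<le> v" if "0 \<le> v" "v \<le> 1" for v :: real
    using powr_mono'[of 1 p v] assms that by auto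
  consider "x = 0" | "y = 0" | "x > 0" "y > 0" using assms by linarith
  then show ?thesis
  proof cases
    case 1
    then show ?thesis using assms *[of u] by (auto simp: powr_mult intro!: mult_right_mono)
  next
    case 2
    then show ?thesis using assms *[of "1 - u"] by (auto simp: powr_mult intro!: mult_right_mono)
  next
    case 3
    then show ?thesis
      using convex_onD[OF powr_convex[OF assms(1)], of u x y] assms by simp
  qed
qed

lemma Lp_add:
  assumes "f \<in> Lp p" "g \<in> Lp p" "p \<ge> 1"
  shows "f + g \<in> Lp p"
proof (subst Lp_cong[OF rep_lfun_add])
  have I: "integrable circ (\<lambda>t. 2 powr p * (1/2 * cmod (rep_lfun f t) powr p + 1/2 * cmod (rep_lfun g t) powr p))"
    using assms by (auto simp: Lp_iff)
  show "integrable circ (\<lambda>t. cmod (rep_lfun f t + rep_lfun g t) powr p)"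
  proof (rule Bochner_Integration.integrable_bound[OF I])
    show "AE t in circ. norm (cmod (rep_lfun f t + rep_lfun g t) powr p)
      \<le> norm (2 powr p * (1/2 * cmod (rep_lfun f t) powr p + 1/2 * cmod (rep_lfun g t) powr p))"
    proof (rule AE_I2)
      fix t
      let ?x = "cmod (rep_lfun f t)" and ?y = "cmod (rep_lfun g t)"
      have "cmod (rep_lfun f t + rep_lfun g t) powr p \<le> (?x + ?y) powr p"
        using assms by (intro powr_mono2) (auto intro: norm_triangle_ineq)
      also have "?x + ?y = 2 * ((1 - 1/2) * ?x + 1/2 * ?y)" by simp
      also have "\<dots> powr p = 2 powr p * ((1 - 1/2) * ?x + 1/2 * ?y) powr p"
        by (subst powr_mult) auto
      also have "\<dots> \<le> 2 powr p * ((1 - 1/2) * ?x powr p + 1/2 * ?y powr p)"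
        by (intro mult_left_mono powr_convex_ineq) (use assms in auto)
      finally show "norm (cmod (rep_lfun f t + rep_lfun g t) powr p)
          \<le> norm (2 powr p * (1/2 * ?x powr p + 1/2 * ?y powr p))"
        by simp
    qed
  qed measurable
qed measurable

lemma Lp_uminus: "f \<in> Lp p \<Longrightarrow> - f \<in> Lp p"
  using Lp_lscale[of f p "-1"] by simp

lemma Lp_diff: "f \<in> Lp p \<Longrightarrow> g \<in> Lp p \<Longrightarrow> p \<ge> 1 \<Longrightarrow> f - g \<in> Lp p"
  using Lp_add[of f p "- g"] Lp_uminus[of g p] by simp

lemma lp_norm_uminus: "p > 0 \<Longrightarrow> lp_norm p (- f) = lp_norm p f"
  using lp_norm_lscale[of p "-1" f] by simp

lemma lp_norm_minus_commute: "p > 0 \<Longrightarrow> lp_norm p (f - g) = lp_norm p (g - f)"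
  using lp_norm_uminus[of p "f - g"] by simp

lemma lp_norm_zero [simp]: "lp_norm p 0 = 0"
  by (subst lp_norm_cong[OF rep_lfun_zero]) auto

lemma lp_norm_eq_0_iff:
  assumes "f \<in> Lp p" "p > 0"
  shows "lp_norm p f = 0 \<longleftrightarrow> f = 0"
proof
  assume "lp_norm p f = 0"
  then have "(\<integral>t. cmod (rep_lfun f t) powr p \<partial>circ) = 0"
    using lp_norm_powr[of p f] assms by simp
  then have "AE t in circ. cmod (rep_lfun f t) powr p = 0"
    using assms by (subst (asm) integral_nonneg_eq_0_iff_AE) (auto simp: Lp_iff)
  then show "f = 0"
    by (intro lfun_eqI_AE[OF _ rep_lfun_zero]) auto
qed simp

text \<open>The weights A/(A+B) and B/(A+B) write |f| + |g| as A + B times a convex combination of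
  the normalised functions |f|/A and |g|/B, so that convexity of x^p can be integrated. A vanishing
  norm is split off to permit the division.\<close>

lemma lp_norm_triangle:
  assumes f: "f \<in> Lp p" and g: "g \<in> Lp p" and p: "p \<ge> 1"
  shows "lp_norm p (f + g) \<le> lp_norm p f + lp_norm p g"
proof (cases "lp_norm p f = 0 \<or> lp_norm p g = 0")
  case True
  then show ?thesis using assms lp_norm_eq_0_iff[of f p] lp_norm_eq_0_iff[of g p] by auto
next
  case False
  define A where "A = lp_norm p f"
  define B where "B = lp_norm p g"
  have A: "A > 0" and B: "B > 0"
    using False lp_norm_nonneg[of p f] lp_norm_nonneg[of p g] by (auto simp: A_def B_def less_le)
  define F where "F = (\<lambda>t. cmod (rep_lfun f t))"
  define G where "G = (\<lambda>t. cmod (rep_lfun g t))"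
  have [measurable]: "F \<in> borel_measurable borel" "G \<in> borel_measurable borel"
    by (simp_all add: F_def G_def)
  define u where "u = B / (A + B)"
  have u: "0 \<le> u" "u \<le> 1" "1 - u = A / (A + B)" using A B by (auto simp: u_def field_simps)
  have le: "cmod (rep_lfun f t + rep_lfun g t) powr p
      \<le> (A + B) powr p * ((1 - u) * A powr (-p) * F t powr p + u * B powr (-p) * G t powr p)" for t
  proof -
    have "cmod (rep_lfun f t + rep_lfun g t) powr p \<le> (F t + G t) powr p"
      using p by (intro powr_mono2) (auto simp: F_def G_def intro: norm_triangle_ineq)
    also have "F t + G t = (A + B) * ((1 - u) * (F t / A) + u * (G t / B))"
    proof -
      have e: "(1 - u) * (F t / A) = F t / (A + B)" "u * (G t / B) = G t / (A + B)"
        using A B unfolding u(3) by (simp_all add: u_def)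
      show ?thesis unfolding e using A B by (simp add: add_divide_distrib[symmetric])
    qed
    also have "\<dots> powr p = (A + B) powr p * ((1 - u) * (F t / A) + u * (G t / B)) powr p"
      by (subst powr_mult) (use A B u in \<open>auto simp: F_def G_def\<close>)
    also have "\<dots> \<le> (A + B) powr p * ((1 - u) * (F t / A) powr p + u * (G t / B) powr p)"
      by (intro mult_left_mono powr_convex_ineq) (use p A B u in \<open>auto simp: F_def G_def\<close>)
    also have "(F t / A) powr p = A powr (-p) * F t powr p"
      using A by (subst powr_divide) (auto simp: F_def powr_minus field_simps)
    also have "(G t / B) powr p = B powr (-p) * G t powr p"
      using B by (subst powr_divide) (auto simp: G_def powr_minus field_simps)
    finally show ?thesis by (simp add: mult_ac)
  qed
  have iF: "integrable circ (\<lambda>t. F t powr p)" and iG: "integrable circ (\<lambda>t. G t powr p)"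
    using f g by (auto simp: F_def G_def Lp_iff)
  have IF: "(\<integral>t. F t powr p \<partial>circ) = A powr p" and IG: "(\<integral>t. G t powr p \<partial>circ) = B powr p"
    using p lp_norm_powr[of p f] lp_norm_powr[of p g] by (auto simp: A_def B_def F_def G_def)
  have "lp_norm p (f + g) powr p = (\<integral>t. cmod (rep_lfun (f + g) t) powr p \<partial>circ)"
    using p by (simp add: lp_norm_powr)
  also have "\<dots> \<le> (\<integral>t. (A + B) powr p * ((1 - u) * A powr (-p) * F t powr p + u * B powr (-p) * G t powr p) \<partial>circ)"
  proof (rule integral_mono_AE)
    show "integrable circ (\<lambda>t. cmod (rep_lfun (f + g) t) powr p)"
      using Lp_add[OF f g p] by (simp add: Lp_iff)
    show "AE t in circ. cmod (rep_lfun (f + g) t) powr p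
        \<le> (A + B) powr p * ((1 - u) * A powr (-p) * F t powr p + u * B powr (-p) * G t powr p)"
      using rep_lfun_add[of f g] by eventually_elim (simp add: le)
  qed (use iF iG in auto)
  also have "\<dots> = (A + B) powr p * ((1 - u) * A powr (-p) * A powr p + u * B powr (-p) * B powr p)"
    using iF iG by (simp add: IF IG)
  also have "\<dots> = (A + B) powr p"
    using A B by (simp add: powr_minus field_simps)
  finally have "lp_norm p (f + g) powr p \<le> (A + B) powr p" .
  then have "lp_norm p (f + g) \<le> A + B"
    using A B p by (meson add_pos_pos less_imp_le not_le powr_less_mono2 less_le_trans zero_less_one)
  then show ?thesis by (simp add: A_def B_def)
qed

lemma lp_norm_triangle_diff:
  "f \<in> Lp p \<Longrightarrow> g \<in> Lp p \<Longrightarrow> p \<ge> 1 \<Longrightarrow> lp_norm p (f - g) \<le> lp_norm p f + lp_norm p g"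
  using lp_norm_triangle[of f p "- g"] Lp_uminus[of g p] lp_norm_uminus[of p g] by simp

lemma Lp_1_iff: "f \<in> Lp 1 \<longleftrightarrow> integrable circ (rep_lfun f)"
  by (simp add: Lp_iff integrable_norm_iff)

lemma lp_norm_1: "lp_norm 1 f = (\<integral>t. cmod (rep_lfun f t) \<partial>circ)"
  by (simp add: lp_norm_eq)

lemma norm_lintegral_le: "cmod (lintegral f) \<le> lp_norm 1 f"
  by (simp add: lintegral_eq lp_norm_1)

lemma lintegral_add: "f \<in> Lp 1 \<Longrightarrow> g \<in> Lp 1 \<Longrightarrow> lintegral (f + g) = lintegral f + lintegral g"
  by (subst lintegral_cong[OF rep_lfun_add]) (auto simp: Lp_1_iff lintegral_eq)

lemma lintegral_diff: "f \<in> Lp 1 \<Longrightarrow> g \<in> Lp 1 \<Longrightarrow> lintegral (f - g) = lintegral f - lintegral g"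
  by (subst lintegral_cong[OF rep_lfun_minus]) (auto simp: Lp_1_iff lintegral_eq)

lemma lintegral_lscale: "lintegral (lscale c f) = c * lintegral f"
  by (subst lintegral_cong[OF rep_lfun_lscale]) (auto simp: lintegral_eq)

lemma lintegral_lcnj: "lintegral (lcnj f) = cnj (lintegral f)"
  by (subst lintegral_cong[OF rep_lfun_lcnj]) (auto simp: lintegral_eq)

lemma lintegral_0 [simp]: "lintegral 0 = 0"
  using lintegral_lscale[of 0 0] by simp

lemma lintegral_1 [simp]: "lintegral 1 = 1"
  by (subst lintegral_cong[OF rep_lfun_one]) auto

lemma conj_exp:
  assumes "p > 1"
  shows "conj_exp p > 1" "1 / p + 1 / conj_exp p = 1" "conj_exp (conj_exp p) = p"
  using assms by (auto simp: conj_exp_def field_simps)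

lemma conj_exp_eq: "p > 1 \<Longrightarrow> 1 / p + 1 / q = 1 \<Longrightarrow> q = conj_exp p"
  by (cases "q = 0") (auto simp: conj_exp_def field_simps)

text \<open>Young's inequality as it stands makes the product integrable; applied to the functions
  divided by their norms and integrated, it gives the bound, because 1/p + 1/q = 1.\<close>

lemma Holder:
  assumes p: "p > 1" and f: "f \<in> Lp p" and g: "g \<in> Lp (conj_exp p)"
  shows "f * g \<in> Lp 1" "lp_norm 1 (f * g) \<le> lp_norm p f * lp_norm (conj_exp p) g"
proof -
  define q where "q = conj_exp p"
  have q: "q > 1" "1 / p + 1 / q = 1" using conj_exp[OF p] by (auto simp: q_def)
  have g: "g \<in> Lp q" using g by (simp add: q_def)
  define F where "F = (\<lambda>t. cmod (rep_lfun f t))"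
  define G where "G = (\<lambda>t. cmod (rep_lfun g t))"
  have [measurable]: "F \<in> borel_measurable borel" "G \<in> borel_measurable borel"
    by (simp_all add: F_def G_def)
  have F0: "F t \<ge> 0" and G0: "G t \<ge> 0" for t by (auto simp: F_def G_def)
  have iF: "integrable circ (\<lambda>t. F t powr p)" and iG: "integrable circ (\<lambda>t. G t powr q)"
    using f g by (auto simp: F_def G_def Lp_iff)
  have iFG: "integrable circ (\<lambda>t. F t * G t)"
  proof (rule Bochner_Integration.integrable_bound)
    show "integrable circ (\<lambda>t. F t powr p / p + G t powr q / q)" using iF iG by auto
    show "AE t in circ. norm (F t * G t) \<le> norm (F t powr p / p + G t powr q / q)"
    proof (rule AE_I2)
      fix t
      have "F t * G t \<le> F t powr p / p + G t powr q / q"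
        by (rule Youngs_inequality) (use p q F0 G0 in auto)
      then show "norm (F t * G t) \<le> norm (F t powr p / p + G t powr q / q)"
        using F0[of t] G0[of t] by simp
    qed
  qed measurable
  have L1: "integrable circ (\<lambda>t. cmod (rep_lfun f t * rep_lfun g t))"
    using iFG by (simp add: F_def G_def norm_mult)
  then show *: "f * g \<in> Lp 1"
    by (subst Lp_cong[OF rep_lfun_times]) auto
  have nrm: "lp_norm 1 (f * g) = (\<integral>t. F t * G t \<partial>circ)"
    by (subst lp_norm_cong[OF rep_lfun_times]) (auto simp: F_def G_def norm_mult integral_nonneg_AE)
  define A where "A = lp_norm p f"
  define B where "B = lp_norm q g"
  show "lp_norm 1 (f * g) \<le> lp_norm p f * lp_norm (conj_exp p) g"
  proof (cases "A = 0 \<or> B = 0")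
    case True
    then have "f * g = 0"
      using f g p q lp_norm_eq_0_iff[of f p] lp_norm_eq_0_iff[of g q] by (auto simp: A_def B_def)
    then show ?thesis by simp
  next
    case False
    have A: "A > 0" and B: "B > 0"
      using False lp_norm_nonneg[of p f] lp_norm_nonneg[of q g] by (auto simp: A_def B_def less_le)
    have IF: "(\<integral>t. F t powr p \<partial>circ) = A powr p" and IG: "(\<integral>t. G t powr q \<partial>circ) = B powr q"
      using p q lp_norm_powr[of p f] lp_norm_powr[of q g] by (auto simp: A_def B_def F_def G_def)
    have "(\<integral>t. F t * G t \<partial>circ) \<le>
        (\<integral>t. A * B * (A powr (-p) * F t powr p / p + B powr (-q) * G t powr q / q) \<partial>circ)"
    proof (rule integral_mono)
      fix t
      have "(F t / A) * (G t / B) \<le> (F t / A) powr p / p + (G t / B) powr q / q"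
        by (rule Youngs_inequality) (use p q F0 G0 A B in auto)
      also have "(F t / A) powr p = A powr (-p) * F t powr p"
        using A by (subst powr_divide) (auto simp: F_def powr_minus field_simps)
      also have "(G t / B) powr q = B powr (-q) * G t powr q"
        using B by (subst powr_divide) (auto simp: G_def powr_minus field_simps)
      finally have "A * B * ((F t / A) * (G t / B)) \<le>
          A * B * (A powr (-p) * F t powr p / p + B powr (-q) * G t powr q / q)"
        using A B by (intro mult_left_mono) auto
      then show "F t * G t \<le> A * B * (A powr (-p) * F t powr p / p + B powr (-q) * G t powr q / q)"
        using A B by simp
    qed (use iF iG iFG in auto)
    also have "\<dots> = A * B * (A powr (-p) * A powr p / p + B powr (-q) * B powr q / q)"
      using iF iG by (simp add: IF IG)
    also have "\<dots> = A * B * (1 / p + 1 / q)"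
      using A B by (simp add: powr_minus)
    finally show ?thesis using q nrm by (simp add: A_def B_def q_def)
  qed
qed

text \<open>Young's inequality for x^r and the constant 1, with exponent p/r, bounds x^r by a convex
  combination of x^p and 1. After normalisation the constant is exactly 1, since \<open>circ\<close>
  has total mass 1.\<close>

lemma Lp_exponent_mono:
  assumes f: "f \<in> Lp p" and r: "1 \<le> r" "r \<le> p"
  shows "f \<in> Lp r" "lp_norm r f \<le> lp_norm p f"
proof -
  define F where "F = (\<lambda>t. cmod (rep_lfun f t))"
  have [measurable]: "F \<in> borel_measurable borel" by (simp add: F_def)
  have iF: "integrable circ (\<lambda>t. F t powr p)" using f by (simp add: F_def Lp_iff)
  have key: "x powr r \<le> r / p * x powr p + (1 - r / p)" if "x \<ge> 0" for x :: real
  proof (cases "r = p")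
    case False
    then have P: "p / r > 1" using r by simp
    have "x powr r * 1 \<le> (x powr r) powr (p / r) / (p / r) + 1 powr conj_exp (p / r) / conj_exp (p / r)"
      by (rule Youngs_inequality) (use conj_exp[OF P] P in auto)
    moreover have "1 / conj_exp (p / r) = 1 - r / p" using conj_exp(2)[OF P] by simp
    ultimately show ?thesis using r by (simp add: powr_powr mult_ac)
  qed (use r that in auto)
  show "f \<in> Lp r"
    unfolding Lp_iff F_def[symmetric]
  proof (rule Bochner_Integration.integrable_bound)
    show "integrable circ (\<lambda>t. r / p * F t powr p + (1 - r / p))" using iF by auto
    show "AE t in circ. norm (cmod (rep_lfun f t) powr r) \<le> norm (r / p * F t powr p + (1 - r / p))"
    proof (rule AE_I2)
      fix t
      show "norm (cmod (rep_lfun f t) powr r) \<le> norm (r / p * F t powr p + (1 - r / p))"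
        using key[of "F t"] by (simp add: F_def)
    qed
  qed measurable
  then have iFr: "integrable circ (\<lambda>t. F t powr r)" by (simp add: F_def Lp_iff)
  define A where "A = lp_norm p f"
  show "lp_norm r f \<le> lp_norm p f"
  proof (cases "A = 0")
    case True
    then show ?thesis using f r lp_norm_eq_0_iff[of f p] by (auto simp: A_def)
  next
    case False
    have A: "A > 0" using False lp_norm_nonneg[of p f] by (auto simp: A_def less_le)
    have IF: "(\<integral>t. F t powr p \<partial>circ) = A powr p"
      using r lp_norm_powr[of p f] by (auto simp: A_def F_def)
    have "lp_norm r f powr r = (\<integral>t. F t powr r \<partial>circ)"
      using r by (simp add: lp_norm_powr F_def)
    also have "\<dots> \<le> (\<integral>t. A powr r * (r / p * (A powr (-p) * F t powr p) + (1 - r / p)) \<partial>circ)"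
    proof (rule integral_mono)
      fix t
      have "(F t / A) powr r \<le> r / p * (F t / A) powr p + (1 - r / p)"
        by (rule key) (use A in \<open>auto simp: F_def\<close>)
      also have "(F t / A) powr p = A powr (-p) * F t powr p"
        using A by (subst powr_divide) (auto simp: F_def powr_minus field_simps)
      finally have "A powr r * (F t / A) powr r \<le> A powr r * (r / p * (A powr (-p) * F t powr p) + (1 - r / p))"
        by (intro mult_left_mono) auto
      moreover have "A powr r * (F t / A) powr r = F t powr r"
        using A by (subst powr_mult[symmetric]) (auto simp: F_def)
      ultimately show "F t powr r \<le> A powr r * (r / p * (A powr (-p) * F t powr p) + (1 - r / p))"
        by simp
    qed (use iF iFr in auto)
    also have "\<dots> = A powr r"
      using iF A by (simp add: IF powr_minus)
    finally have "lp_norm r f powr r \<le> A powr r" .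
    then show ?thesis
      using A r unfolding A_def
      by (metis (full_types) less_eq_real_def linorder_not_le lp_norm_nonneg powr_less_mono2 zero_less_one less_le_trans)
  qed
qed

section \<open>Bounded multipliers and Fourier coefficients\<close>

lemma Linf_bound:
  assumes "a \<in> Linf"
  obtains C where "C \<ge> 0" "AE t in circ. cmod (rep_lfun a t) \<le> C"
proof -
  obtain C where C: "AE t in circ. cmod (rep_lfun a t) \<le> C"
    using assms by (auto simp: Linf_iff)
  have "AE t in circ. cmod (rep_lfun a t) \<le> max C 0"
    using C by eventually_elim auto
  then show ?thesis using that[of "max C 0"] by auto
qed

lemma Linf_I:
  assumes "AE t in circ. rep_lfun f t = F t" "AE t in circ. cmod (F t) \<le> C"
  shows "f \<in> Linf"
  unfolding Linf_iff using assms by (auto intro!: exI[of _ C] elim: eventually_elim2)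

lemma Linf_mult_Lp:
  assumes "a \<in> Linf" "p > 0"
  obtains C where "C \<ge> 0" "\<And>f. f \<in> Lp p \<Longrightarrow> a * f \<in> Lp p \<and> lp_norm p (a * f) \<le> C * lp_norm p f"
proof -
  obtain C where C: "C \<ge> 0" "AE t in circ. cmod (rep_lfun a t) \<le> C"
    using Linf_bound[OF assms(1)] .
  show ?thesis
  proof (rule that[OF C(1)])
    fix f assume f: "f \<in> Lp p"
    have "AE t in circ. cmod (rep_lfun (a * f) t) \<le> C * cmod (rep_lfun f t)"
      using C(2) rep_lfun_times[of a f] by eventually_elim (auto simp: norm_mult intro: mult_right_mono)
    then show "a * f \<in> Lp p \<and> lp_norm p (a * f) \<le> C * lp_norm p f"
      using Lp_mono_AE[OF f assms(2)] lp_norm_mono_AE[OF f assms(2) C(1)] by blast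
  qed
qed

lemma Linf_times_Lp: "a \<in> Linf \<Longrightarrow> p > 0 \<Longrightarrow> f \<in> Lp p \<Longrightarrow> a * f \<in> Lp p"
  using Linf_mult_Lp by metis

lemma Linf_imp_Lp:
  assumes "a \<in> Linf" "p > 0" shows "a \<in> Lp p"
proof -
  have "(1::lfun) \<in> Lp p" by (subst Lp_cong[OF rep_lfun_one]) auto
  then show ?thesis using Linf_times_Lp[OF assms, of 1] by simp
qed

lemma Linf_times: "a \<in> Linf \<Longrightarrow> b \<in> Linf \<Longrightarrow> a * b \<in> Linf"
proof -
  assume a: "a \<in> Linf" and b: "b \<in> Linf"
  obtain C where C: "C \<ge> 0" "AE t in circ. cmod (rep_lfun a t) \<le> C" using Linf_bound[OF a] .
  obtain D where D: "D \<ge> 0" "AE t in circ. cmod (rep_lfun b t) \<le> D" using Linf_bound[OF b] .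
  show ?thesis
  proof (rule Linf_I[OF rep_lfun_times])
    show "AE t in circ. cmod (rep_lfun a t * rep_lfun b t) \<le> C * D"
      using C(2) D(2) by eventually_elim (auto simp: norm_mult intro!: mult_mono C)
  qed
qed

lemma Linf_add: "a \<in> Linf \<Longrightarrow> b \<in> Linf \<Longrightarrow> a + b \<in> Linf"
proof -
  assume a: "a \<in> Linf" and b: "b \<in> Linf"
  obtain C where C: "C \<ge> 0" "AE t in circ. cmod (rep_lfun a t) \<le> C" using Linf_bound[OF a] .
  obtain D where D: "D \<ge> 0" "AE t in circ. cmod (rep_lfun b t) \<le> D" using Linf_bound[OF b] .
  show ?thesis
  proof (rule Linf_I[OF rep_lfun_add])
    show "AE t in circ. cmod (rep_lfun a t + rep_lfun b t) \<le> C + D"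
      using C(2) D(2) by eventually_elim (meson add_mono norm_triangle_ineq order_trans)
  qed
qed

lemma Linf_lcnj: "a \<in> Linf \<Longrightarrow> lcnj a \<in> Linf"
proof -
  assume a: "a \<in> Linf"
  obtain C where C: "C \<ge> 0" "AE t in circ. cmod (rep_lfun a t) \<le> C" using Linf_bound[OF a] .
  show ?thesis by (rule Linf_I[OF rep_lfun_lcnj]) (use C in auto)
qed

lemma Linf_lscale: "a \<in> Linf \<Longrightarrow> lscale c a \<in> Linf"
proof -
  assume a: "a \<in> Linf"
  obtain C where C: "C \<ge> 0" "AE t in circ. cmod (rep_lfun a t) \<le> C" using Linf_bound[OF a] .
  have "AE t in circ. cmod (c * rep_lfun a t) \<le> cmod c * C"
    using C(2) by eventually_elim (simp add: norm_mult mult_left_mono)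
  then show ?thesis by (rule Linf_I[OF rep_lfun_lscale])
qed

lemma Linf_0 [simp]: "0 \<in> Linf" by (rule Linf_I[OF rep_lfun_zero, where C = 0]) auto
lemma Linf_1 [simp]: "1 \<in> Linf" by (rule Linf_I[OF rep_lfun_one, where C = 1]) auto

lemma AE_cmod_monomial: "AE t in circ. cmod (rep_lfun (monomial n) t) = 1"
  using rep_lfun_monomial[of n] AE_circ_norm by eventually_elim (simp add: norm_power_int)

lemma Linf_monomial [simp]: "monomial n \<in> Linf"
  by (rule Linf_I[OF _ , of _ "rep_lfun (monomial n)" 1])
     (use AE_cmod_monomial[of n] in \<open>auto elim: eventually_mono\<close>)

lemma Linf_power: "a \<in> Linf \<Longrightarrow> a ^ n \<in> Linf"
  by (induction n) (auto intro: Linf_times)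

lemma Lp_lcnj: "f \<in> Lp p \<Longrightarrow> lcnj f \<in> Lp p"
  by (subst Lp_cong[OF rep_lfun_lcnj]) (auto simp: Lp_iff)

lemma lp_norm_lcnj: "lp_norm p (lcnj f) = lp_norm p f"
  by (subst lp_norm_cong[OF rep_lfun_lcnj]) (auto simp: lp_norm_eq)

lemma Lp_sum: "(\<And>i. i \<in> I \<Longrightarrow> f i \<in> Lp p) \<Longrightarrow> p \<ge> 1 \<Longrightarrow> sum f I \<in> Lp p"
  by (induction I rule: infinite_finite_induct) (auto intro: Lp_add)

lemma lp_norm_sum_le:
  "(\<And>i. i \<in> I \<Longrightarrow> f i \<in> Lp p) \<Longrightarrow> p \<ge> 1 \<Longrightarrow> lp_norm p (sum f I) \<le> (\<Sum>i\<in>I. lp_norm p (f i))"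
proof (induction I rule: infinite_finite_induct)
  case (insert i I)
  then show ?case
    using lp_norm_triangle[of "f i" p "sum f I"] Lp_sum[of I f p] by fastforce
qed auto

lemma Lp_monomial_times: "p > 0 \<Longrightarrow> f \<in> Lp p \<Longrightarrow> monomial n * f \<in> Lp p"
  by (rule Linf_times_Lp) auto

lemma lp_norm_monomial_times:
  assumes "p > 0" "f \<in> Lp p" shows "lp_norm p (monomial n * f) \<le> lp_norm p f"
proof -
  have "AE t in circ. cmod (rep_lfun (monomial n * f) t) \<le> 1 * cmod (rep_lfun f t)"
    using AE_cmod_monomial[of n] rep_lfun_times[of "monomial n" f]
    by eventually_elim (simp add: norm_mult)
  from lp_norm_mono_AE[OF assms(2,1) _ this] show ?thesis by simp
qed

lemma fcoeff_add: "f \<in> Lp 1 \<Longrightarrow> g \<in> Lp 1 \<Longrightarrow> fcoeff (f + g) n = fcoeff f n + fcoeff g n"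
  using Lp_monomial_times[of 1 f "-n"] Lp_monomial_times[of 1 g "-n"]
  by (simp add: fcoeff_def mult.commute[of _ "monomial (-n)"] distrib_left lintegral_add)

lemma fcoeff_diff: "f \<in> Lp 1 \<Longrightarrow> g \<in> Lp 1 \<Longrightarrow> fcoeff (f - g) n = fcoeff f n - fcoeff g n"
  using Lp_monomial_times[of 1 f "-n"] Lp_monomial_times[of 1 g "-n"]
  by (simp add: fcoeff_def mult.commute[of _ "monomial (-n)"] right_diff_distrib lintegral_diff)

lemma fcoeff_lscale: "fcoeff (lscale c f) n = c * fcoeff f n"
  by (simp add: fcoeff_def lscale_times_left lintegral_lscale)

lemma fcoeff_zero [simp]: "fcoeff 0 n = 0"
  by (simp add: fcoeff_def)

lemma fcoeff_sum:
  "(\<And>i. i \<in> I \<Longrightarrow> f i \<in> Lp 1) \<Longrightarrow> fcoeff (sum f I) n = (\<Sum>i\<in>I. fcoeff (f i) n)"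
  by (induction I rule: infinite_finite_induct) (auto simp: fcoeff_add Lp_sum)

lemma fcoeff_lcnj: "fcoeff (lcnj f) n = cnj (fcoeff f (- n))"
  using lintegral_lcnj[of "f * monomial n"] by (simp add: fcoeff_def)

lemma fcoeff_monomial_times: "fcoeff (monomial k * f) n = fcoeff f (n - k)"
proof -
  have "monomial k * f * monomial (- n) = f * monomial (- (n - k))"
    by (simp add: monomial_mult[symmetric] mult_ac)
       (simp add: monomial_mult)
  then show ?thesis by (simp only: fcoeff_def)
qed

lemma norm_fcoeff_le: "f \<in> Lp 1 \<Longrightarrow> cmod (fcoeff f n) \<le> lp_norm 1 f"
  unfolding fcoeff_def
  using norm_lintegral_le[of "f * monomial (- n)"] lp_norm_monomial_times[of 1 f "-n"]
  by (simp add: mult.commute)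

lemma norm_fcoeff_le':
  assumes "f \<in> Lp p" "p \<ge> 1" shows "cmod (fcoeff f n) \<le> lp_norm p f"
  using norm_fcoeff_le[of f n] Lp_exponent_mono[OF assms(1), of 1] assms(2) by auto

lemma Lp_imp_L1: "f \<in> Lp p \<Longrightarrow> p \<ge> 1 \<Longrightarrow> f \<in> Lp 1"
  using Lp_exponent_mono(1)[of f p 1] by auto

text \<open>Riesz-Fischer. Along a fast subsequence the increments are summable in L^1, hence the
  subsequence converges almost everywhere; Fatou's lemma turns the Cauchy estimate into the bound
  (1/2)^j for the distance to the limit, which yields membership and convergence at once.\<close>

lemma Lp_complete:
  assumes f: "\<And>n. f n \<in> Lp p" and p: "p \<ge> 1"
    and Cauchy: "\<And>e. e > 0 \<Longrightarrow> \<exists>N. \<forall>m\<ge>N. \<forall>n\<ge>N. lp_norm p (f m - f n) < e"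
  obtains g where "g \<in> Lp p" "(\<lambda>n. lp_norm p (f n - g)) \<longlonglongrightarrow> 0"
proof -
  have "\<exists>N. \<forall>m\<ge>N. \<forall>n\<ge>N. lp_norm p (f m - f n) < (1/2) ^ k" for k :: nat
    by (rule Cauchy) auto
  then obtain N where N: "\<And>k m n. m \<ge> N k \<Longrightarrow> n \<ge> N k \<Longrightarrow> lp_norm p (f m - f n) < (1/2) ^ k"
    by metis
  \<comment> \<open>Summing the thresholds gives indices r j \<ge> N k for all j \<ge> k, so
    consecutive ones may both be inserted into the estimate for N k.\<close>
  define r where "r k = (\<Sum>j\<le>k. N j)" for k :: nat
  have rN: "r j \<ge> N k" if "k \<le> j" for j k
    unfolding r_def using that by (intro member_le_sum) auto
  define h where "h k = f (r (Suc k)) - f (r k)" for k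
  have h: "h k \<in> Lp p" for k unfolding h_def using f p by (intro Lp_diff)
  have h1: "lp_norm 1 (h k) \<le> (1/2) ^ k" for k
    using N[of k "r (Suc k)" "r k"] rN[of k "Suc k"] rN[of k k] Lp_exponent_mono(2)[OF h, of 1 k] p
    by (auto simp: h_def)
  define H where "H k t = rep_lfun (f (r (Suc k))) t - rep_lfun (f (r k)) t" for k t
  have [measurable]: "H k \<in> borel_measurable borel" for k unfolding H_def by measurable
  have hH: "AE t in circ. rep_lfun (h k) t = H k t" for k
    unfolding h_def H_def by (rule rep_lfun_minus)
  have iH: "integrable circ (\<lambda>t. cmod (H k t))" for k
    using Lp_cong[OF hH, of k 1] Lp_imp_L1[OF h p] by auto
  have IH: "(\<integral>t. cmod (H k t) \<partial>circ) = lp_norm 1 (h k)" for k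
    using lp_norm_cong[OF hH, of k 1] by (auto simp: integral_nonneg_AE)
  have "(\<integral>\<^sup>+t. (\<Sum>k. ennreal (cmod (H k t))) \<partial>circ) = (\<Sum>k. \<integral>\<^sup>+t. ennreal (cmod (H k t)) \<partial>circ)"
    by (rule nn_integral_suminf) measurable
  also have "\<dots> = (\<Sum>k. ennreal (lp_norm 1 (h k)))"
    by (subst nn_integral_eq_integral[OF iH]) (auto simp: IH)
  also have "\<dots> \<le> (\<Sum>k. ennreal ((1/2) ^ k))"
    by (intro suminf_le) (auto intro: h1 ennreal_leI)
  also have "\<dots> < \<infinity>"
    by (subst suminf_ennreal2) (auto intro: summable_geometric simp: less_top)
  finally have "AE t in circ. (\<Sum>k. ennreal (cmod (H k t))) \<noteq> \<infinity>"
    by (intro nn_integral_noteq_infinite) auto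
  then have AEc: "AE t in circ. summable (\<lambda>k. H k t)"
  proof eventually_elim
    case (elim t)
    then have "summable (\<lambda>k. cmod (H k t))"
      by (intro summable_suminf_not_top) auto
    then show ?case by (rule summable_norm_cancel)
  qed
  \<comment> \<open>\<open>lim\<close> makes F a Borel function on the whole plane; its values carry
    meaning only at the points of convergence.\<close>
  define F where "F t = lim (\<lambda>k. rep_lfun (f (r k)) t)" for t
  have [measurable]: "F \<in> borel_measurable borel"
    unfolding F_def by measurable
  have AEF: "AE t in circ. (\<lambda>k. rep_lfun (f (r k)) t) \<longlonglongrightarrow> F t"
    using AEc
  proof eventually_elim
    case (elim t)
    have eq: "(\<Sum>j<k. H j t) = rep_lfun (f (r k)) t - rep_lfun (f (r 0)) t" for k
      unfolding H_def by (rule sum_lessThan_telescope)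
    obtain S where "(\<lambda>k. \<Sum>j<k. H j t) \<longlonglongrightarrow> S"
      using elim by (auto simp: summable_def sums_def)
    then have "(\<lambda>k. (rep_lfun (f (r k)) t - rep_lfun (f (r 0)) t) + rep_lfun (f (r 0)) t)
        \<longlonglongrightarrow> S + rep_lfun (f (r 0)) t"
      unfolding eq by (intro tendsto_intros)
    then have "convergent (\<lambda>k. rep_lfun (f (r k)) t)"
      by (auto simp: convergent_def)
    then show ?case
      by (simp add: F_def convergent_LIMSEQ_iff)
  qed
  have key: "f m - abs_lfun F \<in> Lp p \<and> lp_norm p (f m - abs_lfun F) \<le> (1/2) ^ j" if m: "m \<ge> N j" for m j
  proof -
    have repm: "AE t in circ. rep_lfun (f m - abs_lfun F) t = rep_lfun (f m) t - F t"
      using rep_lfun_minus[of "f m" "abs_lfun F"] rep_abs_lfun[of F] by (auto elim: eventually_elim2)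
    define u where "u k t = ennreal (cmod (rep_lfun (f m) t - rep_lfun (f (r k)) t) powr p)" for k t
    have [measurable]: "u k \<in> borel_measurable borel" for k unfolding u_def by measurable
    have bnd: "(\<integral>\<^sup>+t. u k t \<partial>circ) \<le> ennreal (((1/2) ^ j) powr p)" if "k \<ge> j" for k
    proof -
      have d: "f m - f (r k) \<in> Lp p" using f p by (intro Lp_diff)
      have i: "integrable circ (\<lambda>t. cmod (rep_lfun (f m) t - rep_lfun (f (r k)) t) powr p)"
        using Lp_cong[OF rep_lfun_minus, of "f m" "f (r k)" p] d by auto
      have "(\<integral>t. cmod (rep_lfun (f m) t - rep_lfun (f (r k)) t) powr p \<partial>circ) =
          lp_norm p (f m - f (r k)) powr p"
        using p by (subst lp_norm_cong[OF rep_lfun_minus]) (auto simp: powr_powr integral_nonneg_AE)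
      also have "\<dots> \<le> ((1/2) ^ j) powr p"
        using p N[of j m "r k"] m rN[of j k] that by (intro powr_mono2) auto
      finally show ?thesis
        unfolding u_def by (subst nn_integral_eq_integral[OF i]) (auto intro: ennreal_leI)
    qed
    have "(\<integral>\<^sup>+t. ennreal (cmod (rep_lfun (f m) t - F t) powr p) \<partial>circ) = (\<integral>\<^sup>+t. liminf (\<lambda>k. u k t) \<partial>circ)"
    proof (rule nn_integral_cong_AE)
      show "AE t in circ. ennreal (cmod (rep_lfun (f m) t - F t) powr p) = liminf (\<lambda>k. u k t)"
        using AEF
      proof eventually_elim
        case (elim t)
        have "(\<lambda>k. u k t) \<longlonglongrightarrow> ennreal (cmod (rep_lfun (f m) t - F t) powr p)"
          unfolding u_def using p
          by (intro tendsto_ennrealI tendsto_powr2 tendsto_intros elim) auto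
        then show ?case by (intro lim_imp_Liminf[symmetric]) auto
      qed
    qed
    also have "\<dots> \<le> liminf (\<lambda>k. \<integral>\<^sup>+t. u k t \<partial>circ)"
      by (rule nn_integral_liminf) measurable
    also have "\<dots> \<le> liminf (\<lambda>k::nat. ennreal (((1/2) ^ j) powr p))"
      by (rule Liminf_mono) (use bnd in \<open>auto simp: eventually_sequentially\<close>)
    also have "\<dots> = ennreal (((1/2) ^ j) powr p)"
      by (rule Liminf_const) auto
    finally have nn: "(\<integral>\<^sup>+t. ennreal (cmod (rep_lfun (f m) t - F t) powr p) \<partial>circ) \<le> ennreal (((1/2) ^ j) powr p)" .
    have i: "integrable circ (\<lambda>t. cmod (rep_lfun (f m) t - F t) powr p)"
      by (rule integrableI_bounded) (use nn in \<open>auto intro: le_less_trans\<close>)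
    have mem: "f m - abs_lfun F \<in> Lp p"
      using Lp_cong[OF repm] i by auto
    have "lp_norm p (f m - abs_lfun F) powr p = (\<integral>t. cmod (rep_lfun (f m) t - F t) powr p \<partial>circ)"
      using p lp_norm_cong[OF repm, of p] by (auto simp: powr_powr integral_nonneg_AE)
    also have "\<dots> \<le> ((1/2) ^ j) powr p"
      using nn by (subst (asm) nn_integral_eq_integral[OF i]) auto
    finally have "lp_norm p (f m - abs_lfun F) \<le> (1/2) ^ j"
      using p by (meson lp_norm_nonneg not_le powr_less_mono2 zero_le_power zero_less_one less_le_trans
        half_gt_zero less_imp_le)
    with mem show ?thesis by simp
  qed
  have g: "abs_lfun F \<in> Lp p"
  proof -
    have "f (N 0) - (f (N 0) - abs_lfun F) \<in> Lp p"
      by (intro Lp_diff f p conjunct1[OF key[OF order_refl]])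
    then show ?thesis by simp
  qed
  have "(\<lambda>n. lp_norm p (f n - abs_lfun F)) \<longlonglongrightarrow> 0"
  proof (rule LIMSEQ_I)
    fix e :: real assume "e > 0"
    then obtain j where j: "(1/2) ^ j < e" using real_arch_pow_inv[of e "1/2"] by auto
    show "\<exists>no. \<forall>n\<ge>no. norm (lp_norm p (f n - abs_lfun F) - 0) < e"
      using key[of j] j by (intro exI[of _ "N j"]) fastforce
  qed
  with g show ?thesis by (rule that)
qed

section \<open>Mean values and uniqueness of Fourier coefficients\<close>

lemma cis_measurable [measurable]: "cis \<in> borel_measurable borel"
  by (intro borel_measurable_continuous_onI continuous_intros)

text \<open>Links the abstract measure with the integral over [0, 2 pi] in which contour integrals
  are parametrised.\<close>

lemma integral_circ:
  fixes G :: "complex \<Rightarrow> complex"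
  assumes [measurable]: "G \<in> borel_measurable borel" and cont: "continuous_on (sphere 0 1) G"
  shows "(\<integral>t. G t \<partial>circ) = integral {0..2*pi} (\<lambda>\<theta>. G (cis \<theta>)) /\<^sub>R (2 * pi)"
proof -
  have "cis \<in> measurable (uniform_measure lborel {0..2 * pi}) borel"
    by (simp cong: measurable_cong_sets)
  then have "(\<integral>t. G t \<partial>circ) = (\<integral>\<theta>. G (cis \<theta>) \<partial>uniform_measure lborel {0..2*pi})"
    unfolding circ_def by (rule integral_distr) measurable
  also have "uniform_measure lborel {0..2*pi} = density lborel (\<lambda>\<theta>. ennreal (indicator {0..2*pi} \<theta> / (2*pi)))"
    unfolding uniform_measure_def
  proof (intro density_cong AE_I2)
    show "indicator {0..2 * pi} x / emeasure lborel {0..2 * pi} = ennreal (indicator {0..2 * pi} x / (2 * pi))"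
      for x :: real
      by (cases "x \<in> {0..2*pi}") (simp_all add: divide_ennreal[symmetric])
  qed measurable
  also have "(\<integral>\<theta>. G (cis \<theta>) \<partial>\<dots>) = (\<integral>\<theta>. (indicator {0..2*pi} \<theta> / (2*pi)) *\<^sub>R G (cis \<theta>) \<partial>lborel)"
    by (rule integral_density) auto
  also have "\<dots> = (\<integral>\<theta>. (indicator {0..2*pi} \<theta> *\<^sub>R G (cis \<theta>)) /\<^sub>R (2*pi) \<partial>lborel)"
    by (rule Bochner_Integration.integral_cong[OF refl]) (simp only: scaleR_scaleR divide_inverse mult.commute)
  also have "\<dots> = (LINT \<theta>:{0..2*pi}|lborel. G (cis \<theta>)) /\<^sub>R (2*pi)"
    unfolding set_lebesgue_integral_def by (rule integral_scaleR_right)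
  also have "continuous_on {0..2*pi} (\<lambda>\<theta>. G (cis \<theta>))"
    by (rule continuous_on_compose2[OF cont]) (auto intro!: continuous_intros)
  then have "(LINT \<theta>:{0..2*pi}|lborel. G (cis \<theta>)) = integral {0..2*pi} (\<lambda>\<theta>. G (cis \<theta>))"
    by (intro set_borel_integral_eq_integral borel_integrable_atLeastAtMost')
  finally show ?thesis .
qed

text \<open>Cauchy's formula at the centre, as dt/(i t) is arc length. The explicit Fourier
  coefficients below are read off from this by exhibiting an analytic function with the right
  boundary values.\<close>

lemma circ_mean_value:
  assumes [measurable]: "G \<in> borel_measurable borel"
    and cont: "continuous_on (cball 0 1) G" and hol: "G holomorphic_on ball 0 1"
  shows "(\<integral>t. G t \<partial>circ) = G 0"
proof -
  have "((\<lambda>u. G u / (u - 0)) has_contour_integral (2 * of_real pi * \<i> * G 0)) (circlepath 0 1)"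
    by (rule Cauchy_integral_circlepath[OF cont hol]) auto
  then have "((\<lambda>\<theta>. G (0 + 1 * cis \<theta>) / (0 + 1 * cis \<theta> - 0) * 1 * \<i> * cis \<theta>) has_integral (2 * of_real pi * \<i> * G 0)) {0..2*pi}"
    unfolding circlepath_def by (subst (asm) has_contour_integral_part_circlepath_iff) auto
  then have I: "((\<lambda>\<theta>. - \<i> * (\<i> * G (cis \<theta>))) has_integral (- \<i> * (2 * of_real pi * \<i> * G 0))) {0..2*pi}"
    by (intro has_integral_mult_right) (simp add: mult_ac)
  have eq: "- \<i> * (2 * of_real pi * \<i> * G 0) = 2 * of_real pi * G 0" "- \<i> * (\<i> * z) = z" for z
    by (simp_all add: complex_eq_iff algebra_simps)
  have "integral {0..2*pi} (\<lambda>\<theta>. G (cis \<theta>)) = 2 * of_real pi * G 0"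
    using I unfolding eq by (rule integral_unique)
  moreover have "continuous_on (sphere 0 1) G"
    by (rule continuous_on_subset[OF cont]) auto
  ultimately show ?thesis
    by (simp add: integral_circ scaleR_conv_of_real)
qed

lemma cnj_eq_inverse: "cmod t = 1 \<Longrightarrow> cnj t = inverse t"
  by (metis complex_norm_square inverse_unique mult.commute of_real_1 one_power2)

lemma circ_mean_value_cnj:
  assumes [measurable]: "G \<in> borel_measurable borel" "F \<in> borel_measurable borel"
    and "continuous_on (cball 0 1) G" "G holomorphic_on ball 0 1"
    and "\<And>t. cmod t = 1 \<Longrightarrow> F t = cnj (G t)"
  shows "(\<integral>t. F t \<partial>circ) = cnj (G 0)"
proof -
  have "(\<integral>t. F t \<partial>circ) = (\<integral>t. cnj (G t) \<partial>circ)"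
    using AE_circ_norm by (intro integral_cong_AE) (auto elim!: eventually_mono simp: assms)
  then show ?thesis using circ_mean_value[of G] assms by simp
qed

lemma integral_circ_powi: "(\<integral>t. t powi n \<partial>circ) = (if n = 0 then 1 else 0)"
proof -
  have pos: "(\<integral>t. t ^ m \<partial>circ) = 0" if "m > 0" for m :: nat
    using that
    by (subst circ_mean_value) (auto intro!: continuous_intros holomorphic_intros simp: power_0_left)
  have neg: "(\<integral>t. inverse t ^ m \<partial>circ) = 0" if "m > 0" for m :: nat
    using that
    by (subst circ_mean_value_cnj[of "\<lambda>t. t ^ m" "\<lambda>t. inverse t ^ m"]) (auto intro!: continuous_intros holomorphic_intros simp: cnj_eq_inverse power_0_left)
  show ?thesis
    using pos[of "nat n"] neg[of "nat (- n)"] by (cases "n = 0"; cases "n \<ge> 0") (auto simp: power_int_def)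
qed

lemma lintegral_monomial: "lintegral (monomial n) = (if n = 0 then 1 else 0)"
  by (subst lintegral_cong[OF rep_lfun_monomial]) (auto simp: integral_circ_powi)

lemma fcoeff_monomial: "fcoeff (monomial k) n = (if n = k then 1 else 0)"
  by (simp add: fcoeff_def monomial_mult lintegral_monomial)

section \<open>Trigonometric polynomials, and measures determined by their moments\<close>

text \<open>Functions on the plane, not classes, so that they can be compared pointwise with the
  polynomials of Stone-Weierstrass. Products agree only for |t| = 1: at 0 the law for
  \<open>powi\<close> with mixed signs fails.\<close>

inductive trig_poly :: "(complex \<Rightarrow> complex) \<Rightarrow> bool" where
  trig_poly_monom: "trig_poly (\<lambda>t. c * t powi k)"
| trig_poly_add: "trig_poly f \<Longrightarrow> trig_poly g \<Longrightarrow> trig_poly (\<lambda>t. f t + g t)"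

lemma trig_poly_mult:
  assumes "trig_poly f" "trig_poly g"
  shows "\<exists>h. trig_poly h \<and> (\<forall>t. cmod t = 1 \<longrightarrow> h t = f t * g t)"
  using assms
proof (induction f)
  case (trig_poly_monom c k)
  from trig_poly_monom.prems show ?case
  proof (induction g)
    case (trig_poly_monom d l)
    have "\<forall>t. cmod t = 1 \<longrightarrow> c * d * t powi (k + l) = c * t powi k * (d * t powi l)"
      by (metis (no_types, opaque_lifting) mult.assoc mult.left_commute norm_zero power_int_add zero_neq_one)
    then show ?case using trig_poly.trig_poly_monom[of "c * d" "k + l"] by blast
  next
    case (trig_poly_add f g)
    then obtain h1 h2 where "trig_poly h1" "\<forall>t. cmod t = 1 \<longrightarrow> h1 t = c * t powi k * f t"
      "trig_poly h2" "\<forall>t. cmod t = 1 \<longrightarrow> h2 t = c * t powi k * g t" by auto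
    then show ?case
      by (intro exI[of _ "\<lambda>t. h1 t + h2 t"]) (auto intro: trig_poly.trig_poly_add simp: algebra_simps)
  qed
next
  case (trig_poly_add f1 f2)
  then obtain h1 h2 where "trig_poly h1" "\<forall>t. cmod t = 1 \<longrightarrow> h1 t = f1 t * g t"
    "trig_poly h2" "\<forall>t. cmod t = 1 \<longrightarrow> h2 t = f2 t * g t" by auto
  then show ?case
    by (intro exI[of _ "\<lambda>t. h1 t + h2 t"]) (auto intro: trig_poly.trig_poly_add simp: algebra_simps)
qed

lemma real_polynomial_trig_poly:
  fixes f :: "complex \<Rightarrow> real"
  assumes "real_polynomial_function f"
  shows "\<exists>h. trig_poly h \<and> (\<forall>t. cmod t = 1 \<longrightarrow> h t = of_real (f t))"
  using assms
proof (induction f)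
  case (linear f)
  interpret bounded_linear f by fact
  \<comment> \<open>A real linear form on the plane is A t + B cnj t with these coefficients, and
    cnj t = 1/t on the circle.\<close>
  define A where "A = (of_real (f 1) - \<i> * of_real (f \<i>)) / 2"
  define B where "B = (of_real (f 1) + \<i> * of_real (f \<i>)) / 2"
  have eq: "f t = Re t * f 1 + Im t * f \<i>" for t
  proof -
    have "f t = f (Re t *\<^sub>R 1 + Im t *\<^sub>R \<i>)"
      by (rule arg_cong[where f = f]) (simp add: complex_eq_iff)
    then show ?thesis by (simp only: add scaleR real_scaleR_def)
  qed
  have "of_real (f t) = A * t + B * cnj t" for t
    by (subst eq) (simp add: A_def B_def complex_eq_iff field_simps)
  then have "\<forall>t. cmod t = 1 \<longrightarrow> A * t powi 1 + B * t powi (-1) = of_real (f t)"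
    by (simp add: cnj_eq_inverse)
  then show ?case
    by (intro exI[of _ "\<lambda>t. A * t powi 1 + B * t powi (-1)"])
       (intro conjI trig_poly_add trig_poly_monom)
next
  case (const c)
  show ?case
    using trig_poly_monom[of "of_real c" 0] by auto
next
  case (add f g)
  then obtain h1 h2 where "trig_poly h1" "\<forall>t. cmod t = 1 \<longrightarrow> h1 t = of_real (f t)"
    "trig_poly h2" "\<forall>t. cmod t = 1 \<longrightarrow> h2 t = of_real (g t)" by auto
  then show ?case
    by (intro exI[of _ "\<lambda>t. h1 t + h2 t"]) (auto intro: trig_poly_add)
next
  case (mult f g)
  then obtain h1 h2 where h: "trig_poly h1" "\<forall>t. cmod t = 1 \<longrightarrow> h1 t = of_real (f t)"
    "trig_poly h2" "\<forall>t. cmod t = 1 \<longrightarrow> h2 t = of_real (g t)" by auto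
  from trig_poly_mult[OF h(1,3)] h(2,4) show ?case by auto
qed

lemma trig_poly_measurable: "trig_poly f \<Longrightarrow> f \<in> borel_measurable borel"
  by (induction f rule: trig_poly.induct) auto

lemma trig_poly_approx:
  fixes \<phi> :: "complex \<Rightarrow> real"
  assumes "continuous_on (sphere 0 1) \<phi>" "e > 0"
  obtains h where "trig_poly h" "\<And>t. cmod t = 1 \<Longrightarrow> cmod (of_real (\<phi> t) - h t) < e"
    "\<And>t. cmod t = 1 \<Longrightarrow> h t \<in> \<real>"
proof -
  obtain g where g: "real_polynomial_function g" "\<And>x. x \<in> sphere 0 1 \<Longrightarrow> \<bar>\<phi> x - g x\<bar> < e"
    using Stone_Weierstrass_real_polynomial_function[OF compact_sphere assms] by metis
  obtain h where h: "trig_poly h" "\<And>t. cmod t = 1 \<Longrightarrow> h t = of_real (g t)"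
    using real_polynomial_trig_poly[OF g(1)] by blast
  show ?thesis
    by (rule that[OF h(1)]) (use g(2) h(2) in \<open>auto simp: norm_of_real simp flip: of_real_diff\<close>)
qed

text \<open>Equal moments give equal integrals of trigonometric polynomials, hence of continuous
  functions by uniform approximation, hence equal masses of closed sets, which generate the Borel
  sets. Both the uniqueness of Fourier coefficients and the change of variables for the shift rest
  on it.\<close>

lemma measure_eqI_circle:
  assumes "finite_measure M" "finite_measure N" and sets: "sets M = sets borel" "sets N = sets borel"
    and AE: "AE t in M. cmod t = 1" "AE t in N. cmod t = 1"
    and eq: "\<And>n. (\<integral>t. t powi n \<partial>M) = (\<integral>t. t powi n \<partial>N)"
  shows "M = (N :: complex measure)"
proof -
  interpret M: finite_measure M by fact
  interpret N: finite_measure N by fact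
  have [measurable_cong]: "sets M = sets borel" "sets N = sets borel" by fact+
  have int: "integrable M f" "integrable N f"
    if [measurable]: "f \<in> borel_measurable borel" and "\<And>t. cmod t = 1 \<Longrightarrow> norm (f t) \<le> C"
    for f :: "complex \<Rightarrow> complex" and C
  proof -
    show "integrable M f"
      by (rule M.integrable_const_bound[of _ C]) (use AE that in \<open>auto elim!: eventually_mono\<close>)
    show "integrable N f"
      by (rule N.integrable_const_bound[of _ C]) (use AE that in \<open>auto elim!: eventually_mono\<close>)
  qed
  have int_powi: "integrable M (\<lambda>t. c * t powi k)" "integrable N (\<lambda>t. c * t powi k)" for c k
    by (rule int[where C = "cmod c"]; simp add: norm_mult norm_power_int)+
  have tp: "integrable M h \<and> integrable N h \<and> (\<integral>t. h t \<partial>M) = (\<integral>t. h t \<partial>N)" if "trig_poly h" for h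
    using that
  proof (induction h)
    case (trig_poly_monom c k)
    then show ?case using int_powi[of c k] eq[of k] by simp
  qed auto
  have cont: "(\<integral>t. \<phi> t \<partial>M) = (\<integral>t. \<phi> t \<partial>N)" if \<phi>: "continuous_on UNIV \<phi>" for \<phi> :: "complex \<Rightarrow> real"
  proof -
    have [measurable]: "\<phi> \<in> borel_measurable borel" using \<phi> by (intro borel_measurable_continuous_onI)
    have \<phi>s: "continuous_on (sphere 0 1) \<phi>" using \<phi> by (rule continuous_on_subset) auto
    obtain C where "\<forall>t\<in>sphere 0 1. \<bar>\<phi> t\<bar> \<le> C"
      using compact_imp_bounded[OF compact_continuous_image[OF \<phi>s compact_sphere]]
      by (auto simp: bounded_iff)
    then have C: "\<bar>\<phi> t\<bar> \<le> C" if "cmod t = 1" for t using that by simp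
    have i\<phi>: "integrable M (\<lambda>t. complex_of_real (\<phi> t))" "integrable N (\<lambda>t. complex_of_real (\<phi> t))"
      by (rule int[where C = C]; simp add: C)+
    define m where "m = measure M (space M) + measure N (space N)"
    have m: "m \<ge> 0" by (simp add: m_def)
    have "cmod ((\<integral>t. complex_of_real (\<phi> t) \<partial>M) - (\<integral>t. complex_of_real (\<phi> t) \<partial>N)) \<le> 0 + e" if "e > 0" for e
    proof -
      define d where "d = e / (m + 1)"
      have d: "d > 0" "d * m \<le> e" using \<open>e > 0\<close> m by (auto simp: d_def field_simps)
      obtain h where h: "trig_poly h" "\<And>t. cmod t = 1 \<Longrightarrow> cmod (of_real (\<phi> t) - h t) < d"
        using trig_poly_approx[OF \<phi>s d(1)] by metis
      have [measurable]: "h \<in> borel_measurable borel" by (rule trig_poly_measurable[OF h(1)])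
      note th = tp[OF h(1)]
      have "(\<integral>t. complex_of_real (\<phi> t) \<partial>M) - (\<integral>t. complex_of_real (\<phi> t) \<partial>N) =
          (\<integral>t. of_real (\<phi> t) - h t \<partial>M) - (\<integral>t. of_real (\<phi> t) - h t \<partial>N)"
        using th i\<phi> by simp
      also have "cmod \<dots> \<le> cmod (\<integral>t. of_real (\<phi> t) - h t \<partial>M) + cmod (\<integral>t. of_real (\<phi> t) - h t \<partial>N)"
        by (rule norm_triangle_ineq4)
      also have "cmod (\<integral>t. of_real (\<phi> t) - h t \<partial>M) \<le> (\<integral>t. d \<partial>M)"
      proof (rule order_trans[OF integral_norm_bound], rule integral_mono_AE)
        show "AE t in M. cmod (of_real (\<phi> t) - h t) \<le> d"
          using AE(1) by eventually_elim (rule less_imp_le, rule h(2))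
      qed (use th i\<phi> in auto)
      also have "cmod (\<integral>t. of_real (\<phi> t) - h t \<partial>N) \<le> (\<integral>t. d \<partial>N)"
      proof (rule order_trans[OF integral_norm_bound], rule integral_mono_AE)
        show "AE t in N. cmod (of_real (\<phi> t) - h t) \<le> d"
          using AE(2) by eventually_elim (rule less_imp_le, rule h(2))
      qed (use th i\<phi> in auto)
      finally show ?thesis using d(2) by (simp add: m_def algebra_simps)
    qed
    then have "cmod ((\<integral>t. complex_of_real (\<phi> t) \<partial>M) - (\<integral>t. complex_of_real (\<phi> t) \<partial>N)) \<le> 0"
      by (rule field_le_epsilon)
    then show ?thesis by simp
  qed
  have closed: "measure M C = measure N C" if C: "closed C" for C
  proof (cases "C = {}")
    case False
    \<comment> \<open>Continuous functions tending to the indicator of C: outside C they vanish once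
      n infdist t C exceeds 1.\<close>
    define \<phi> where "\<phi> n t = max 0 (1 - real n * infdist t C)" for n t
    have c\<phi>: "continuous_on UNIV (\<phi> n)" for n unfolding \<phi>_def by (intro continuous_intros)
    have [measurable]: "\<phi> n \<in> borel_measurable borel" for n
      using c\<phi> by (intro borel_measurable_continuous_onI)
    have [measurable]: "C \<in> sets borel" using C by auto
    have mb: "\<phi> n \<in> borel_measurable M" "\<phi> n \<in> borel_measurable N" for n by measurable
    have bnd: "\<bar>\<phi> n t\<bar> \<le> 1" for n t by (simp add: \<phi>_def infdist_nonneg)
    have lim: "(\<lambda>n. \<phi> n t) \<longlonglongrightarrow> indicator C t" for t
    proof (cases "t \<in> C")
      case True
      then show ?thesis by (simp add: \<phi>_def)
    next
      case F: False
      then have pos: "infdist t C > 0"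
        using in_closed_iff_infdist_zero[OF C False] infdist_nonneg[of t C] by (metis less_le)
      obtain N where N: "1 < real N * infdist t C"
        using reals_Archimedean3[OF pos] by blast
      have "\<forall>\<^sub>F n in sequentially. \<phi> n t = 0"
        using eventually_ge_at_top[of N]
      proof eventually_elim
        case (elim n)
        then have "real N * infdist t C \<le> real n * infdist t C"
          using pos by (intro mult_right_mono) auto
        with N show ?case by (simp add: \<phi>_def)
      qed
      with F show ?thesis by (simp add: tendsto_eventually)
    qed
    have "(\<lambda>n. \<integral>t. \<phi> n t \<partial>M) \<longlonglongrightarrow> (\<integral>t. indicator C t \<partial>M)"
      by (rule integral_dominated_convergence[where w = "\<lambda>_. 1"])
         (use lim bnd mb in auto)
    moreover have "(\<lambda>n. \<integral>t. \<phi> n t \<partial>N) \<longlonglongrightarrow> (\<integral>t. indicator C t \<partial>N)"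
      by (rule integral_dominated_convergence[where w = "\<lambda>_. 1"])
         (use lim bnd mb in auto)
    ultimately have "(\<integral>t. indicator C t \<partial>M) = (\<integral>t. indicator C t \<partial>N :: real)"
      unfolding cont[OF c\<phi>] by (rule LIMSEQ_unique)
    moreover have "space M = UNIV" "space N = UNIV"
      using sets_eq_imp_space_eq[OF sets(1)] sets_eq_imp_space_eq[OF sets(2)] by auto
    ultimately show ?thesis by simp
  qed simp
  show ?thesis
  proof (rule measure_eqI_generator_eq[where E = "Collect closed" and \<Omega> = UNIV and A = "\<lambda>_. UNIV"])
    show "Int_stable (Collect closed)" by (auto simp: Int_stable_def)
    show "sets M = sigma_sets UNIV (Collect closed)" "sets N = sigma_sets UNIV (Collect closed)"
      using sets by (simp_all add: borel_eq_closed)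
    show "emeasure M X = emeasure N X" if "X \<in> Collect closed" for X
      using closed[of X] that by (simp add: M.emeasure_eq_measure N.emeasure_eq_measure)
  qed auto
qed

text \<open>The positive and the negative part of f are densities of finite measures on the circle.
  Vanishing Fourier coefficients say that these have the same moments, so the measures, and then the
  densities, coincide.\<close>

lemma lfun_eq_0I_real:
  assumes f: "f \<in> Lp 1" "lcnj f = f" and coeff: "\<And>n. fcoeff f n = 0"
  shows "f = 0"
proof -
  define F where "F t = Re (rep_lfun f t)" for t
  have [measurable]: "F \<in> borel_measurable borel" unfolding F_def by measurable
  have AEF: "AE t in circ. rep_lfun f t = of_real (F t)"
    using rep_lfun_lcnj[of f] unfolding f(2)
    by eventually_elim (simp add: F_def complex_eq_iff)
  have iF: "integrable circ F"
    using f(1) unfolding Lp_1_iff F_def by (rule integrable_Re)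
  define P where "P t = max (F t) 0" for t
  define N where "N t = max (- F t) 0" for t
  have [measurable]: "P \<in> borel_measurable borel" "N \<in> borel_measurable borel"
    unfolding P_def N_def by measurable
  have iP: "integrable circ P" and iN: "integrable circ N"
    unfolding P_def N_def using iF by auto
  have fm: "finite_measure (density circ (\<lambda>t. ennreal (G t)))"
    if "integrable circ G" "\<And>t. G t \<ge> 0" for G
    by (rule finite_measureI)
       (use that in \<open>simp add: emeasure_density nn_integral_eq_integral borel_measurable_integrable\<close>)
  have "density circ (\<lambda>t. ennreal (P t)) = density circ (\<lambda>t. ennreal (N t))"
  proof (rule measure_eqI_circle)
    fix n
    have "(\<integral>t. P t *\<^sub>R (t powi n) \<partial>circ) - (\<integral>t. N t *\<^sub>R (t powi n) \<partial>circ) =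
        (\<integral>t. P t *\<^sub>R (t powi n) - N t *\<^sub>R (t powi n) \<partial>circ)"
    proof (rule Bochner_Integration.integral_diff[symmetric])
      show "integrable circ (\<lambda>t. P t *\<^sub>R (t powi n))"
        by (rule Bochner_Integration.integrable_bound[OF iP])
           (use AE_circ_norm in \<open>auto elim!: eventually_mono simp: norm_power_int\<close>)
      show "integrable circ (\<lambda>t. N t *\<^sub>R (t powi n))"
        by (rule Bochner_Integration.integrable_bound[OF iN])
           (use AE_circ_norm in \<open>auto elim!: eventually_mono simp: norm_power_int\<close>)
    qed
    also have "\<dots> = (\<integral>t. F t *\<^sub>R (t powi n) \<partial>circ)"
      by (intro Bochner_Integration.integral_cong refl)
         (auto simp: P_def N_def max_def scaleR_left_diff_distrib)
    also have "\<dots> = fcoeff f (- n)"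
      unfolding fcoeff_def
    proof (subst lintegral_cong[where F = "\<lambda>t. F t *\<^sub>R (t powi n)"])
      show "AE t in circ. rep_lfun (f * monomial (- (- n))) t = F t *\<^sub>R t powi n"
        using rep_lfun_times[of f "monomial n"] rep_lfun_monomial[of n] AEF
        by (simp, eventually_elim) (simp add: scaleR_conv_of_real)
    qed auto
    finally show "(\<integral>t. t powi n \<partial>density circ (\<lambda>t. ennreal (P t))) = (\<integral>t. t powi n \<partial>density circ (\<lambda>t. ennreal (N t)))"
      using coeff[of "-n"] by (simp add: integral_density P_def N_def)
  qed (use fm[OF iP] fm[OF iN] AE_circ_norm in \<open>auto simp: P_def N_def AE_density elim!: eventually_mono\<close>)
  then have "AE t in circ. ennreal (P t) = ennreal (N t)"
    by (subst (asm) circ.density_unique_iff) auto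
  then have "AE t in circ. F t = 0"
    by eventually_elim (auto simp: P_def N_def max_def split: if_splits)
  with AEF have "AE t in circ. rep_lfun f t = 0"
    by eventually_elim simp
  then show ?thesis by (rule lfun_eqI_AE[OF _ rep_lfun_zero])
qed

text \<open>The real case applies to f + cnj f and to i (f - cnj f).\<close>

lemma lfun_eq_0I:
  assumes f: "f \<in> Lp 1" and coeff: "\<And>n. fcoeff f n = 0"
  shows "f = 0"
proof -
  have 1: "f + lcnj f = 0"
    by (rule lfun_eq_0I_real) (auto simp: f Lp_add Lp_lcnj fcoeff_add fcoeff_lcnj coeff)
  have 2: "lscale \<i> (f - lcnj f) = 0"
    by (rule lfun_eq_0I_real)
       (auto simp: f Lp_diff Lp_lcnj Lp_lscale fcoeff_lscale fcoeff_diff fcoeff_lcnj coeff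
         lfun.scale_right_diff_distrib)
  then have "f - lcnj f = 0" by (metis complex_i_not_zero lfun.scale_eq_0_iff)
  with 1 have "f + f = 0" by simp
  then have "lscale 2 f = 0" by (metis lfun.scale_left_distrib lfun.scale_one one_add_one)
  then show ?thesis by (simp only: lfun.scale_eq_0_iff) simp
qed

lemma lfun_eqI_fcoeff:
  assumes "f \<in> Lp 1" "g \<in> Lp 1" "\<And>n. fcoeff f n = fcoeff g n"
  shows "f = g"
  using lfun_eq_0I[of "f - g"] assms by (simp add: Lp_diff fcoeff_diff)

section \<open>The Carleman shift\<close>

lemma rep_lfun_compose: "AE t in circ. rep_lfun (compose_alpha \<beta> f) t = rep_lfun f (alpha \<beta> t)"
proof -
  have [measurable]: "alpha \<beta> \<in> borel_measurable borel"
    unfolding alpha_def[abs_def] by measurable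
  show ?thesis
    unfolding compose_alpha_def using rep_abs_lfun[of "rep_lfun f \<circ> alpha \<beta>"] by (simp add: comp_def)
qed

lemma rep_lfun_chi: "AE t in circ. rep_lfun (chi \<beta>) t = (cnj \<beta> * t - 1) / lam \<beta>"
  unfolding chi_def by (intro rep_abs_lfun) measurable

locale carleman_shift =
  fixes \<beta> :: complex
  assumes \<beta>: "cmod \<beta> > 1"
begin

abbreviation J :: "lfun \<Rightarrow> lfun" where "J \<equiv> J_alpha \<beta>"
abbreviation \<A> :: "lfun \<Rightarrow> lfun" where "\<A> \<equiv> compose_alpha \<beta>"

lemma alpha_measurable [measurable]: "alpha \<beta> \<in> borel_measurable borel"
  unfolding alpha_def[abs_def] by measurable

lemma lam_nz: "lam \<beta> \<noteq> 0"
  using \<beta> by (auto simp: lam_def power2_eq_square) (smt (verit) mult_le_cancel_left1)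

lemma lam_sq: "lam \<beta> * lam \<beta> = - ((cmod \<beta>)\<^sup>2 - 1)"
proof -
  have "(cmod \<beta>)\<^sup>2 - 1 \<ge> 0" using \<beta> by simp
  then have "sqrt ((cmod \<beta>)\<^sup>2 - 1) * sqrt ((cmod \<beta>)\<^sup>2 - 1) = (cmod \<beta>)\<^sup>2 - 1" by simp
  then show ?thesis
    unfolding lam_def by (simp add: algebra_simps flip: of_real_mult)
qed

lemma cmod_lam_sq: "(cmod (lam \<beta>))\<^sup>2 = (cmod \<beta>)\<^sup>2 - 1"
proof -
  have "(cmod (lam \<beta>))\<^sup>2 = cmod (lam \<beta> * lam \<beta>)" by (simp add: norm_mult power2_eq_square)
  also have "\<dots> = \<bar>(cmod \<beta>)\<^sup>2 - 1\<bar>" unfolding lam_sq by (simp flip: of_real_diff of_real_power)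
  finally show ?thesis using \<beta> by simp
qed

lemma den_nz: "cmod t \<le> 1 \<Longrightarrow> t - \<beta> \<noteq> 0" and den_nz': "cmod t = 1 \<Longrightarrow> cnj \<beta> * t - 1 \<noteq> 0"
  using \<beta> by (auto simp: norm_mult dest: arg_cong[where f = cmod])

lemma norm_den: "cmod t = 1 \<Longrightarrow> cmod (cnj \<beta> * t - 1) = cmod (t - \<beta>)"
proof -
  assume t: "cmod t = 1"
  have "cnj t * (t - \<beta>) = 1 - \<beta> * cnj t"
    using t by (simp add: algebra_simps) (metis complex_norm_square mult.commute of_real_1 power_one)
  then have "cmod (cnj t * (t - \<beta>)) = cmod (cnj (1 - cnj \<beta> * t))" by simp
  then show ?thesis using t by (simp only: norm_mult complex_mod_cnj) (simp add: norm_minus_commute)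
qed

lemma cmod_alpha: "cmod t = 1 \<Longrightarrow> cmod (alpha \<beta> t) = 1"
  using den_nz[of t] by (simp add: alpha_def norm_divide norm_den)

lemma cnj_alpha: "cmod t = 1 \<Longrightarrow> cnj (alpha \<beta> t) = (cnj \<beta> * t - 1) / (t - \<beta>)"
  using cnj_eq_inverse[OF cmod_alpha, of t] by (simp add: alpha_def)

lemma alpha_den:
  assumes "cmod t = 1"
  shows "cnj \<beta> * alpha \<beta> t - 1 = lam \<beta> * lam \<beta> / (cnj \<beta> * t - 1)"
proof -
  have "\<beta> * cnj \<beta> = (cmod \<beta>)\<^sup>2" by (simp only: complex_norm_square)
  then show ?thesis
    using den_nz'[OF assms] unfolding lam_sq alpha_def by (simp add: field_simps)
qed

lemma alpha_alpha:
  assumes "cmod t = 1"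
  shows "alpha \<beta> (alpha \<beta> t) = t"
proof -
  have "\<beta> * cnj \<beta> = (cmod \<beta>)\<^sup>2" by (simp only: complex_norm_square)
  then have "alpha \<beta> t - \<beta> = lam \<beta> * lam \<beta> * t / (cnj \<beta> * t - 1)"
    using den_nz'[OF assms] unfolding lam_sq by (simp add: alpha_def field_simps)
  then show ?thesis
    unfolding alpha_def[of \<beta> "alpha \<beta> t"] alpha_den[OF assms] using lam_nz den_nz'[OF assms] by simp
qed

section \<open>The Jacobian of the shift and the change of variables\<close>

text \<open>On the circle this is |\<alpha>'(t)|. It is also |\<chi>(t)|^{-2} and the Poisson kernel
  of the point 1/cnj \<beta>, which is \<alpha> at infinity.\<close>

definition wgt :: "complex \<Rightarrow> real" where
  "wgt t = ((cmod \<beta>)\<^sup>2 - 1) / (cmod (cnj \<beta> * t - 1))\<^sup>2"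

lemma wgt_measurable [measurable]: "wgt \<in> borel_measurable borel"
  unfolding wgt_def[abs_def] by measurable

lemma wgt_nonneg: "wgt t \<ge> 0"
  using \<beta> by (auto simp: wgt_def)

lemma wgt_pos: "cmod t = 1 \<Longrightarrow> wgt t > 0"
  using \<beta> den_nz'[of t] by (auto simp: wgt_def intro!: divide_pos_pos one_less_power)

lemma wgt_eq: "wgt t = inverse ((cmod ((cnj \<beta> * t - 1) / lam \<beta>))\<^sup>2)"
  by (simp add: wgt_def norm_divide power_divide cmod_lam_sq)

lemma wgt_eq_complex:
  assumes "cmod t = 1"
  shows "complex_of_real (wgt t) = complex_of_real ((cmod \<beta>)\<^sup>2 - 1) * t / ((cnj \<beta> * t - 1) * (\<beta> - t))"
proof -
  have "complex_of_real ((cmod (cnj \<beta> * t - 1))\<^sup>2) = (cnj \<beta> * t - 1) * (\<beta> * inverse t - 1)"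
    using assms by (simp only: complex_norm_square) (simp add: cnj_eq_inverse)
  also have "\<dots> = (cnj \<beta> * t - 1) * (\<beta> - t) / t"
    using assms by (auto simp: field_simps)
  finally have *: "complex_of_real ((cmod (cnj \<beta> * t - 1))\<^sup>2) = (cnj \<beta> * t - 1) * (\<beta> - t) / t" .
  have "complex_of_real (wgt t) = complex_of_real ((cmod \<beta>)\<^sup>2 - 1) / complex_of_real ((cmod (cnj \<beta> * t - 1))\<^sup>2)"
    by (simp add: wgt_def)
  then show ?thesis unfolding * by simp
qed

text \<open>The right-hand side is analytic in the closed disc, its only pole being \<beta>, and
  vanishes at 0; so its mean over the circle is 0.\<close>

lemma wgt_alpha_negative_power:
  assumes t: "cmod t = 1"
  shows "wgt t *\<^sub>R cnj (alpha \<beta> t) ^ Suc m =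
      - (complex_of_real ((cmod \<beta>)\<^sup>2 - 1) * t * (cnj \<beta> * t - 1) ^ m / (t - \<beta>) ^ (m + 2))"
proof -
  have nz: "t - \<beta> \<noteq> 0" "cnj \<beta> * t - 1 \<noteq> 0" "\<beta> - t \<noteq> 0"
    using den_nz[of t] den_nz'[OF t] t by auto
  have "complex_of_real ((cmod \<beta>)\<^sup>2 - 1) * t / (Y * (\<beta> - t)) * (Y / X) ^ Suc m =
      - (complex_of_real ((cmod \<beta>)\<^sup>2 - 1) * t * Y ^ m / X ^ (m + 2))" if "X \<noteq> 0" "Y \<noteq> 0" "\<beta> - t = - X" for X Y
    unfolding that(3) using that(1,2) by (simp add: field_simps power_add power2_eq_square)
  from this[of "t - \<beta>" "cnj \<beta> * t - 1"] nz show ?thesis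
    unfolding scaleR_conv_of_real wgt_eq_complex[OF t] cnj_alpha[OF t] by simp
qed

text \<open>Displays the Poisson kernel as 1 + H + cnj H with H analytic and H(0) = 0, which shows
  that its mean is 1.\<close>

lemma wgt_eq_Poisson:
  assumes t: "cmod t = 1"
  shows "complex_of_real (wgt t) = 1 + t / (\<beta> - t) + cnj (t / (\<beta> - t))"
proof -
  have nz: "t \<noteq> 0" "\<beta> - t \<noteq> 0" "cnj \<beta> * t - 1 \<noteq> 0" using den_nz[of t] den_nz'[OF t] t by auto
  have bb: "complex_of_real ((cmod \<beta>)\<^sup>2 - 1) = \<beta> * cnj \<beta> - 1"
    by (simp only: of_real_diff complex_norm_square of_real_1)
  have "cnj (t / (\<beta> - t)) = inverse t / (cnj \<beta> - inverse t)"
    using t by (simp add: cnj_eq_inverse)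
  also have "\<dots> = 1 / (cnj \<beta> * t - 1)"
    using nz by (simp add: field_simps)
  finally have *: "cnj (t / (\<beta> - t)) = 1 / (cnj \<beta> * t - 1)" .
  have "(\<beta> * B - 1) * t / ((B * t - 1) * (\<beta> - t)) = 1 + t / (\<beta> - t) + 1 / (B * t - 1)"
    if "B * t - 1 \<noteq> 0" for B
    using nz that by (simp add: divide_simps) (simp add: algebra_simps)
  then show ?thesis
    unfolding wgt_eq_complex[OF t] * bb using nz by blast
qed

text \<open>The moments of the image under \<alpha> of the measure with density \<open>wgt\<close>.
  Nonzero moments vanish by analyticity, positive powers being conjugates of negative ones; the
  total mass comes from the Poisson form.\<close>

lemma integral_wgt_alpha: "(\<integral>t. wgt t *\<^sub>R (alpha \<beta> t) powi n \<partial>circ) = (\<integral>t. t powi n \<partial>circ)"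
proof -
  define G where "G m t = - (complex_of_real ((cmod \<beta>)\<^sup>2 - 1) * t * (cnj \<beta> * t - 1) ^ m / (t - \<beta>) ^ (m + 2))" for m t
  have [measurable]: "G m \<in> borel_measurable borel" for m
    unfolding G_def[abs_def] by measurable
  have G: "continuous_on (cball 0 1) (G m)" "G m holomorphic_on ball 0 1" for m
    unfolding G_def[abs_def] using den_nz \<beta> by (auto intro!: continuous_intros holomorphic_intros)
  have neg: "(\<integral>t. wgt t *\<^sub>R cnj (alpha \<beta> t) ^ Suc m \<partial>circ) = 0" for m
  proof -
    have "(\<integral>t. wgt t *\<^sub>R cnj (alpha \<beta> t) ^ Suc m \<partial>circ) = (\<integral>t. G m t \<partial>circ)"
    proof (rule integral_cong_AE)
      show "AE t in circ. wgt t *\<^sub>R cnj (alpha \<beta> t) ^ Suc m = G m t"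
        using AE_circ_norm by eventually_elim (unfold G_def, rule wgt_alpha_negative_power)
    qed measurable
    then show ?thesis using circ_mean_value[OF _ G, of m] by (simp add: G_def)
  qed
  have pos: "(\<integral>t. wgt t *\<^sub>R (alpha \<beta> t) ^ Suc m \<partial>circ) = 0" for m
  proof -
    have "(\<integral>t. wgt t *\<^sub>R (alpha \<beta> t) ^ Suc m \<partial>circ) = cnj (\<integral>t. wgt t *\<^sub>R cnj (alpha \<beta> t) ^ Suc m \<partial>circ)"
      by (subst Bochner_Integration.integral_cnj[symmetric]) simp
    then show ?thesis unfolding neg by simp
  qed
  have zero: "(\<integral>t. wgt t *\<^sub>R 1 \<partial>circ) = (1::complex)"
  proof -
    define H where "H t = t / (\<beta> - t)" for t
    have [measurable]: "H \<in> borel_measurable borel" unfolding H_def[abs_def] by measurable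
    have H: "continuous_on (cball 0 1) H" "H holomorphic_on ball 0 1"
      unfolding H_def[abs_def] using den_nz \<beta> by (auto intro!: continuous_intros holomorphic_intros)
    have i: "integrable circ H"
    proof (rule circ.integrable_const_bound[of _ "1 / (cmod \<beta> - 1)"])
      show "AE t in circ. cmod (H t) \<le> 1 / (cmod \<beta> - 1)"
        using AE_circ_norm
      proof eventually_elim
        case (elim t)
        have "cmod \<beta> - 1 \<le> cmod (\<beta> - t)" using norm_triangle_ineq2[of \<beta> t] elim by simp
        then show ?case using \<beta> elim by (simp add: H_def norm_divide frac_le)
      qed
    qed measurable
    have "(\<integral>t. wgt t *\<^sub>R 1 \<partial>circ) = (\<integral>t. 1 + H t + cnj (H t) \<partial>circ)"
    proof (rule integral_cong_AE)
      show "AE t in circ. wgt t *\<^sub>R 1 = 1 + H t + cnj (H t)"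
        using AE_circ_norm by eventually_elim (simp add: scaleR_conv_of_real wgt_eq_Poisson H_def)
    qed measurable
    also have "\<dots> = 1 + H 0 + cnj (H 0)"
      using i circ_mean_value[OF _ H] by (simp add: integral_cnj)
    finally show ?thesis by (simp add: H_def)
  qed
  consider (z) "n = 0" | (p) m where "n = int (Suc m)" | (n) m where "n = - int (Suc m)"
    by (metis int_cases3 not0_implies_Suc of_nat_0 of_nat_0_less_iff less_numeral_extra(3))
  then show ?thesis
  proof cases
    case z
    then show ?thesis using zero by (simp add: integral_circ_powi)
  next
    case p
    have "(\<integral>t. wgt t *\<^sub>R (alpha \<beta> t) powi n \<partial>circ) = (\<integral>t. wgt t *\<^sub>R (alpha \<beta> t) ^ Suc m \<partial>circ)"
      unfolding p by (simp only: power_int_of_nat)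
    then show ?thesis unfolding pos integral_circ_powi using p by simp
  next
    case n
    have "(\<integral>t. wgt t *\<^sub>R (alpha \<beta> t) powi n \<partial>circ) = (\<integral>t. wgt t *\<^sub>R cnj (alpha \<beta> t) ^ Suc m \<partial>circ)"
    proof (rule integral_cong_AE)
      show "AE t in circ. wgt t *\<^sub>R (alpha \<beta> t) powi n = wgt t *\<^sub>R cnj (alpha \<beta> t) ^ Suc m"
        using AE_circ_norm
        by eventually_elim
           (simp only: n power_int_minus power_int_of_nat cnj_eq_inverse[OF cmod_alpha] power_inverse)
    qed measurable
    then show ?thesis unfolding neg integral_circ_powi using n by simp
  qed
qed

text \<open>The substitution rule for \<alpha>, obtained from moments without parametrising the
  circle or treating \<alpha> as a diffeomorphism.\<close>

lemma distr_alpha: "distr (density circ (\<lambda>t. ennreal (wgt t))) borel (alpha \<beta>) = circ"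
proof (rule measure_eqI_circle)
  have m: "alpha \<beta> \<in> measurable (density circ (\<lambda>t. ennreal (wgt t))) borel" by simp
  show "finite_measure circ" by unfold_locales
  have "AE t in circ. wgt t \<le> ((cmod \<beta>)\<^sup>2 - 1) / (cmod \<beta> - 1)\<^sup>2"
    using AE_circ_norm
  proof eventually_elim
    case (elim t)
    have "cmod \<beta> - 1 \<le> cmod (cnj \<beta> * t - 1)" using norm_triangle_ineq2[of "cnj \<beta> * t" 1] elim by (simp add: norm_mult)
    then show ?case using \<beta> unfolding wgt_def by (intro frac_le power_mono) auto
  qed
  then have i: "integrable circ wgt"
    by (intro circ.integrable_const_bound) (auto simp: wgt_nonneg)
  interpret D: finite_measure "density circ (\<lambda>t. ennreal (wgt t))"
    by (rule finite_measureI) (simp add: emeasure_density nn_integral_eq_integral i wgt_nonneg)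
  show "finite_measure (distr (density circ (\<lambda>t. ennreal (wgt t))) borel (alpha \<beta>))"
    by (rule D.finite_measure_distr[OF m])
  show "AE t in distr (density circ (\<lambda>t. ennreal (wgt t))) borel (alpha \<beta>). cmod t = 1"
    by (subst AE_distr_iff[OF m])
       (use AE_circ_norm in \<open>auto simp: AE_density elim!: eventually_mono intro: cmod_alpha\<close>)
  show "(\<integral>t. t powi n \<partial>distr (density circ (\<lambda>t. ennreal (wgt t))) borel (alpha \<beta>)) = (\<integral>t. t powi n \<partial>circ)" for n
    by (subst integral_distr[OF m])
       (simp_all add: integral_density wgt_nonneg integral_wgt_alpha)
qed (use AE_circ_norm in auto)

text \<open>As \<open>wgt\<close> is positive on the circle, preimages of null sets are null. This
  makes composition with the shift well behaved on classes.\<close>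

lemma AE_alpha:
  assumes "AE t in circ. P t" shows "AE t in circ. P (alpha \<beta> t)"
proof -
  have "AE t in distr (density circ (\<lambda>t. ennreal (wgt t))) borel (alpha \<beta>). P t"
    unfolding distr_alpha by (rule assms)
  then have "AE t in density circ (\<lambda>t. ennreal (wgt t)). P (alpha \<beta> t)"
    by (rule AE_distrD[rotated]) simp
  then have "AE t in circ. 0 < wgt t \<longrightarrow> P (alpha \<beta> t)"
    by (simp add: AE_density)
  with AE_circ_norm show ?thesis by eventually_elim (auto intro: wgt_pos)
qed

lemma integral_alpha:
  fixes F :: "complex \<Rightarrow> 'a :: {banach, second_countable_topology}"
  assumes "F \<in> borel_measurable borel"
  shows "(\<integral>t. wgt t *\<^sub>R F (alpha \<beta> t) \<partial>circ) = (\<integral>t. F t \<partial>circ)"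
    "integrable circ F \<Longrightarrow> integrable circ (\<lambda>t. wgt t *\<^sub>R F (alpha \<beta> t))"
proof -
  note [measurable] = assms
  have m: "alpha \<beta> \<in> measurable (density circ (\<lambda>t. ennreal (wgt t))) borel" by simp
  have "(\<integral>t. F t \<partial>circ) = (\<integral>t. F t \<partial>distr (density circ (\<lambda>t. ennreal (wgt t))) borel (alpha \<beta>))"
    by (simp only: distr_alpha)
  also have "\<dots> = (\<integral>t. wgt t *\<^sub>R F (alpha \<beta> t) \<partial>circ)"
    by (subst integral_distr[OF m]) (simp_all add: integral_density wgt_nonneg)
  finally show "(\<integral>t. wgt t *\<^sub>R F (alpha \<beta> t) \<partial>circ) = (\<integral>t. F t \<partial>circ)" ..
  assume "integrable circ F"
  then have "integrable (distr (density circ (\<lambda>t. ennreal (wgt t))) borel (alpha \<beta>)) F"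
    by (simp only: distr_alpha)
  then have "integrable (density circ (\<lambda>t. ennreal (wgt t))) (\<lambda>t. F (alpha \<beta> t))"
    by (subst (asm) integrable_distr_eq[OF m]) auto
  then show "integrable circ (\<lambda>t. wgt t *\<^sub>R F (alpha \<beta> t))"
    by (subst (asm) integrable_density) (auto simp: wgt_nonneg)
qed

section \<open>Algebra of the composition operator and of \<open>J\<close>\<close>

lemma compose_times: "\<A> (f * g) = \<A> f * \<A> g"
proof (rule lfun_eqI_AE[where F = "\<lambda>t. rep_lfun f (alpha \<beta> t) * rep_lfun g (alpha \<beta> t)"])
  show "AE t in circ. rep_lfun (\<A> (f * g)) t = rep_lfun f (alpha \<beta> t) * rep_lfun g (alpha \<beta> t)"
    using rep_lfun_compose[of \<beta> "f * g"] AE_alpha[OF rep_lfun_times[of f g]] by eventually_elim simp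
  show "AE t in circ. rep_lfun (\<A> f * \<A> g) t = rep_lfun f (alpha \<beta> t) * rep_lfun g (alpha \<beta> t)"
    using rep_lfun_times[of "\<A> f" "\<A> g"] rep_lfun_compose[of \<beta> f] rep_lfun_compose[of \<beta> g]
    by eventually_elim simp
qed

lemma compose_add: "\<A> (f + g) = \<A> f + \<A> g"
proof (rule lfun_eqI_AE[where F = "\<lambda>t. rep_lfun f (alpha \<beta> t) + rep_lfun g (alpha \<beta> t)"])
  show "AE t in circ. rep_lfun (\<A> (f + g)) t = rep_lfun f (alpha \<beta> t) + rep_lfun g (alpha \<beta> t)"
    using rep_lfun_compose[of \<beta> "f + g"] AE_alpha[OF rep_lfun_add[of f g]] by eventually_elim simp
  show "AE t in circ. rep_lfun (\<A> f + \<A> g) t = rep_lfun f (alpha \<beta> t) + rep_lfun g (alpha \<beta> t)"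
    using rep_lfun_add[of "\<A> f" "\<A> g"] rep_lfun_compose[of \<beta> f] rep_lfun_compose[of \<beta> g]
    by eventually_elim simp
qed

lemma compose_lscale: "\<A> (lscale c f) = lscale c (\<A> f)"
proof (rule lfun_eqI_AE[where F = "\<lambda>t. c * rep_lfun f (alpha \<beta> t)"])
  show "AE t in circ. rep_lfun (\<A> (lscale c f)) t = c * rep_lfun f (alpha \<beta> t)"
    using rep_lfun_compose[of \<beta> "lscale c f"] AE_alpha[OF rep_lfun_lscale[of c f]] by eventually_elim simp
  show "AE t in circ. rep_lfun (lscale c (\<A> f)) t = c * rep_lfun f (alpha \<beta> t)"
    using rep_lfun_lscale[of c "\<A> f"] rep_lfun_compose[of \<beta> f] by eventually_elim simp
qed

lemma compose_inverse: "\<A> (inverse f) = inverse (\<A> f)"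
proof (rule lfun_eqI_AE[where F = "\<lambda>t. inverse (rep_lfun f (alpha \<beta> t))"])
  show "AE t in circ. rep_lfun (\<A> (inverse f)) t = inverse (rep_lfun f (alpha \<beta> t))"
    using rep_lfun_compose[of \<beta> "inverse f"] AE_alpha[OF rep_lfun_inverse[of f]] by eventually_elim simp
  show "AE t in circ. rep_lfun (inverse (\<A> f)) t = inverse (rep_lfun f (alpha \<beta> t))"
    using rep_lfun_inverse[of "\<A> f"] rep_lfun_compose[of \<beta> f] by eventually_elim simp
qed

lemma compose_lcnj: "\<A> (lcnj f) = lcnj (\<A> f)"
proof (rule lfun_eqI_AE[where F = "\<lambda>t. cnj (rep_lfun f (alpha \<beta> t))"])
  show "AE t in circ. rep_lfun (\<A> (lcnj f)) t = cnj (rep_lfun f (alpha \<beta> t))"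
    using rep_lfun_compose[of \<beta> "lcnj f"] AE_alpha[OF rep_lfun_lcnj[of f]] by eventually_elim simp
  show "AE t in circ. rep_lfun (lcnj (\<A> f)) t = cnj (rep_lfun f (alpha \<beta> t))"
    using rep_lfun_lcnj[of "\<A> f"] rep_lfun_compose[of \<beta> f] by eventually_elim simp
qed

lemma compose_one: "\<A> 1 = 1"
proof (rule lfun_eqI_AE[OF _ rep_lfun_one])
  show "AE t in circ. rep_lfun (\<A> 1) t = 1"
    using rep_lfun_compose[of \<beta> 1] AE_alpha[OF rep_lfun_one] by eventually_elim simp
qed

lemma compose_diff: "\<A> (f - g) = \<A> f - \<A> g"
  using compose_add[of f "lscale (-1) g"] compose_lscale[of "-1" g] by simp

lemma compose_zero: "\<A> 0 = 0"
  using compose_lscale[of 0 0] by simp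

lemma compose_power: "\<A> (f ^ n) = \<A> f ^ n"
  by (induction n) (simp_all add: compose_one compose_times)

lemma compose_compose: "\<A> (\<A> f) = f"
proof (rule lfun_eqI)
  show "AE t in circ. rep_lfun (\<A> (\<A> f)) t = rep_lfun f t"
    using rep_lfun_compose[of \<beta> "\<A> f"] AE_alpha[OF rep_lfun_compose[of \<beta> f]] AE_circ_norm
    by eventually_elim (simp add: alpha_alpha)
qed

lemma chi_inverse: "chi \<beta> * inverse (chi \<beta>) = 1"
proof (rule lfun_eqI_AE[OF _ rep_lfun_one])
  show "AE t in circ. rep_lfun (chi \<beta> * inverse (chi \<beta>)) t = 1"
    using rep_lfun_times[of "chi \<beta>" "inverse (chi \<beta>)"] rep_lfun_inverse[of "chi \<beta>"] rep_lfun_chi[of \<beta>] AE_circ_norm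
    by eventually_elim (use den_nz' lam_nz in auto)
qed

text \<open>The purpose of dividing by \<open>lam\<close>: cnj \<beta> \<alpha>(t) - 1 equals
  \<lambda>^2 / (cnj \<beta> t - 1), and splitting \<lambda>^2 evenly gives the reciprocal. It is
  what makes \<open>J\<close> an involution.\<close>

lemma compose_chi: "\<A> (chi \<beta>) = inverse (chi \<beta>)"
proof (rule lfun_eqI_AE[where F = "\<lambda>t. inverse ((cnj \<beta> * t - 1) / lam \<beta>)"])
  show "AE t in circ. rep_lfun (\<A> (chi \<beta>)) t = inverse ((cnj \<beta> * t - 1) / lam \<beta>)"
    using rep_lfun_compose[of \<beta> "chi \<beta>"] AE_alpha[OF rep_lfun_chi[of \<beta>]] AE_circ_norm
    by eventually_elim (use lam_nz in \<open>simp add: alpha_den\<close>)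
  show "AE t in circ. rep_lfun (inverse (chi \<beta>)) t = inverse ((cnj \<beta> * t - 1) / lam \<beta>)"
    using rep_lfun_inverse[of "chi \<beta>"] rep_lfun_chi[of \<beta>] by eventually_elim simp
qed

lemma chi_eq: "chi \<beta> = lscale (cnj \<beta> / lam \<beta>) (monomial 1) - lscale (1 / lam \<beta>) 1"
proof (rule lfun_eqI_AE[OF rep_lfun_chi])
  show "AE t in circ. rep_lfun (lscale (cnj \<beta> / lam \<beta>) (monomial 1) - lscale (1 / lam \<beta>) 1) t
      = (cnj \<beta> * t - 1) / lam \<beta>"
    using rep_lfun_minus[of "lscale (cnj \<beta> / lam \<beta>) (monomial 1)" "lscale (1 / lam \<beta>) 1"]
      rep_lfun_lscale[of "cnj \<beta> / lam \<beta>" "monomial 1"] rep_lfun_lscale[of "1 / lam \<beta>" 1]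
      rep_lfun_monomial[of 1] rep_lfun_one
    by eventually_elim (simp add: diff_divide_distrib)
qed

lemma Linf_chi: "chi \<beta> \<in> Linf"
  unfolding chi_eq using Linf_add[OF Linf_lscale Linf_lscale, of "monomial 1" 1 "cnj \<beta> / lam \<beta>" "- (1 / lam \<beta>)"]
  by simp

lemma Linf_compose: "a \<in> Linf \<Longrightarrow> \<A> a \<in> Linf"
proof -
  assume a: "a \<in> Linf"
  obtain C where C: "C \<ge> 0" "AE t in circ. cmod (rep_lfun a t) \<le> C" using Linf_bound[OF a] .
  show ?thesis by (rule Linf_I[OF rep_lfun_compose]) (use AE_alpha[OF C(2)] in auto)
qed

lemma Linf_inverse_chi: "inverse (chi \<beta>) \<in> Linf"
  using Linf_compose[OF Linf_chi] by (simp add: compose_chi)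

lemma J_J: "J (J f) = f"
  by (simp add: J_alpha_def compose_times compose_inverse compose_chi[symmetric] compose_compose
      mult.assoc[symmetric])
     (metis chi_inverse compose_chi mult.commute mult.left_neutral)

lemma J_times: "J (a * f) = \<A> a * J f"
  by (simp add: J_alpha_def compose_times mult_ac)

lemma J_add: "J (f + g) = J f + J g"
  by (simp add: J_alpha_def compose_add distrib_left)

lemma J_diff: "J (f - g) = J f - J g"
  by (simp add: J_alpha_def compose_diff right_diff_distrib)

lemma J_lscale: "J (lscale c f) = lscale c (J f)"
  by (simp add: J_alpha_def compose_lscale lscale_times_right)

lemma J_zero: "J 0 = 0"
  by (simp add: J_alpha_def compose_zero)

lemma compose_bounded:
  assumes p: "p > 0"
  obtains C where "C \<ge> 0"
    "\<And>f. f \<in> Lp p \<Longrightarrow> \<A> f \<in> Lp p \<and> lp_norm p (\<A> f) \<le> C * lp_norm p f"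
proof -
  \<comment> \<open>An upper bound of 1 / \<open>wgt\<close> on the circle, from |cnj \<beta> t - 1|
    \<le> |\<beta>| + 1.\<close>
  define K where "K = (cmod \<beta> + 1)\<^sup>2 / ((cmod \<beta>)\<^sup>2 - 1)"
  have \<beta>2: "(cmod \<beta>)\<^sup>2 - 1 > 0" using \<beta> by (simp add: one_less_power)
  have K: "K > 0" unfolding K_def using \<beta>2 \<beta> by (intro divide_pos_pos zero_less_power) auto
  have Kw: "1 \<le> K * wgt t" if "cmod t = 1" for t
  proof -
    have "cmod (cnj \<beta> * t - 1) \<le> cmod \<beta> + 1"
      using norm_triangle_ineq4[of "cnj \<beta> * t" 1] that by (simp add: norm_mult)
    moreover have "cmod (cnj \<beta> * t - 1) > 0" using den_nz'[OF that] by simp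
    ultimately have "1 \<le> (cmod \<beta> + 1)\<^sup>2 / (cmod (cnj \<beta> * t - 1))\<^sup>2"
      by (subst le_divide_eq_1_pos) auto
    also have "\<dots> = K * wgt t" using \<beta>2 by (simp add: K_def wgt_def)
    finally show ?thesis .
  qed
  show ?thesis
  proof (rule that[of "K powr (1/p)"])
    fix f assume f: "f \<in> Lp p"
    define F where "F t = cmod (rep_lfun f t) powr p" for t
    have [measurable]: "F \<in> borel_measurable borel" unfolding F_def[abs_def] by measurable
    have iF: "integrable circ F" using f by (simp add: Lp_iff F_def[abs_def])
    have i1: "integrable circ (\<lambda>t. K * (wgt t *\<^sub>R F (alpha \<beta> t)))"
      by (intro integrable_mult_right integral_alpha iF) auto
    have le: "AE t in circ. F (alpha \<beta> t) \<le> K * (wgt t *\<^sub>R F (alpha \<beta> t))"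
      using AE_circ_norm
    proof eventually_elim
      case (elim t)
      then show ?case using mult_right_mono[OF Kw, of t "F (alpha \<beta> t)"] by (simp add: F_def mult_ac)
    qed
    have i2: "integrable circ (\<lambda>t. F (alpha \<beta> t))"
      by (rule Bochner_Integration.integrable_bound[OF i1])
         (use le in \<open>auto elim!: eventually_mono simp: F_def\<close>)
    have mem: "\<A> f \<in> Lp p"
      using Lp_cong[OF rep_lfun_compose[of \<beta> f], of p] i2 by (simp add: F_def)
    have "(\<integral>t. F (alpha \<beta> t) \<partial>circ) \<le> (\<integral>t. K * (wgt t *\<^sub>R F (alpha \<beta> t)) \<partial>circ)"
      by (rule integral_mono_AE[OF i2 i1 le])
    also have "\<dots> = K * (\<integral>t. F t \<partial>circ)"
      using integral_alpha(1)[of F] by simp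
    finally have "(\<integral>t. F (alpha \<beta> t) \<partial>circ) powr (1/p) \<le> (K * (\<integral>t. F t \<partial>circ)) powr (1/p)"
      using p by (intro powr_mono2) (auto simp: F_def)
    also have "\<dots> = K powr (1/p) * lp_norm p f"
      using K by (subst powr_mult) (auto simp: lp_norm_eq F_def[abs_def])
    finally have "lp_norm p (\<A> f) \<le> K powr (1/p) * lp_norm p f"
      using lp_norm_cong[OF rep_lfun_compose[of \<beta> f], of p] by (simp add: F_def)
    with mem show "\<A> f \<in> Lp p \<and> lp_norm p (\<A> f) \<le> K powr (1/p) * lp_norm p f"
      by simp
  qed simp
qed

lemma J_bounded:
  assumes p: "p > 0"
  obtains C where "C \<ge> 0" "\<And>f. f \<in> Lp p \<Longrightarrow> J f \<in> Lp p \<and> lp_norm p (J f) \<le> C * lp_norm p f"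
proof -
  obtain C where C: "C \<ge> 0"
    "\<And>f. f \<in> Lp p \<Longrightarrow> \<A> f \<in> Lp p \<and> lp_norm p (\<A> f) \<le> C * lp_norm p f"
    using compose_bounded[OF p] by metis
  obtain D where D: "D \<ge> 0"
    "\<And>f. f \<in> Lp p \<Longrightarrow> inverse (chi \<beta>) * f \<in> Lp p \<and> lp_norm p (inverse (chi \<beta>) * f) \<le> D * lp_norm p f"
    using Linf_mult_Lp[OF Linf_inverse_chi p] by metis
  show ?thesis
  proof (rule that[of "D * C"])
    fix f assume "f \<in> Lp p"
    then show "J f \<in> Lp p \<and> lp_norm p (J f) \<le> D * C * lp_norm p f"
      unfolding J_alpha_def using C D mult_left_mono[of "lp_norm p (\<A> f)" "C * lp_norm p f" D]
      by (fastforce simp: mult.assoc)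
  qed (use C D in auto)
qed

lemma J_Lp: "p > 0 \<Longrightarrow> f \<in> Lp p \<Longrightarrow> J f \<in> Lp p"
  using J_bounded by metis

lemma compose_Lp: "p > 0 \<Longrightarrow> f \<in> Lp p \<Longrightarrow> \<A> f \<in> Lp p"
  using compose_bounded by metis

text \<open>Substituting \<alpha> turns \<chi>^{-1} into \<chi> and brings in the Jacobian
  |\<chi>|^{-2}; their product is 1 / cnj \<chi>, the factor of \<open>J\<close> on the other side
  of the pairing.\<close>

lemma pairing_J: "pairing (J f) g = pairing f (J g)"
proof -
  define h where "h = J f * lcnj g"
  have "lintegral h = (\<integral>t. wgt t *\<^sub>R rep_lfun h (alpha \<beta> t) \<partial>circ)"
    by (simp add: integral_alpha lintegral_eq)
  also have "\<dots> = lintegral (f * lcnj (J g))"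
    unfolding lintegral_eq
  proof (rule integral_cong_AE)
    have eq: "\<A> h = chi \<beta> * f * lcnj (\<A> g)"
      unfolding h_def J_alpha_def
      by (simp add: compose_times compose_inverse compose_lcnj compose_chi[symmetric] compose_compose)
    have eq2: "f * lcnj (J g) = f * inverse (lcnj (chi \<beta>)) * lcnj (\<A> g)"
      by (simp add: J_alpha_def mult_ac)
    have "AE t in circ. rep_lfun (f * lcnj (J g)) t =
        rep_lfun f t * inverse (cnj (rep_lfun (chi \<beta>) t)) * rep_lfun (lcnj (\<A> g)) t"
      unfolding eq2
      using rep_lfun_times[of "f * inverse (lcnj (chi \<beta>))" "lcnj (\<A> g)"]
        rep_lfun_times[of f "inverse (lcnj (chi \<beta>))"] rep_lfun_inverse[of "lcnj (chi \<beta>)"] rep_lfun_lcnj[of "chi \<beta>"]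
      by eventually_elim simp
    moreover have "AE t in circ. rep_lfun h (alpha \<beta> t) =
        rep_lfun (chi \<beta>) t * rep_lfun f t * rep_lfun (lcnj (\<A> g)) t"
      using rep_lfun_compose[of \<beta> h] rep_lfun_times[of "chi \<beta> * f" "lcnj (\<A> g)"] rep_lfun_times[of "chi \<beta>" f]
      unfolding eq by eventually_elim simp
    ultimately show "AE t in circ. wgt t *\<^sub>R rep_lfun h (alpha \<beta> t) = rep_lfun (f * lcnj (J g)) t"
      using rep_lfun_chi[of \<beta>] AE_circ_norm
    proof eventually_elim
      case (elim t)
      let ?x = "rep_lfun (chi \<beta>) t"
      have nz: "?x \<noteq> 0" using elim den_nz'[of t] lam_nz by auto
      have "complex_of_real (wgt t) = inverse (?x * cnj ?x)"
        unfolding elim(3)[symmetric] wgt_eq by (simp add: complex_norm_square[symmetric])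
      then show ?case
        unfolding elim(1,2) scaleR_conv_of_real using nz by (simp add: field_simps)
    qed
  qed measurable
  finally show ?thesis by (simp add: pairing_def h_def)
qed

section \<open>The action of the shift on monomials\<close>

text \<open>On the circle the integrand is the conjugate of an analytic function G. The factor t in
  G, which comes from \<chi>^{-1}, makes G(0) = 0 even for m = 0.\<close>

lemma fcoeff_J_monomial_nonneg:
  assumes "k \<ge> 0" "m \<ge> 0" shows "fcoeff (J (monomial k)) m = 0"
proof -
  define G where "G t = cnj (lam \<beta>) * t / (\<beta> - t) * ((cnj \<beta> * t - 1) / (t - \<beta>)) ^ nat k * t ^ nat m" for t
  have [measurable]: "G \<in> borel_measurable borel" unfolding G_def[abs_def] by measurable
  have G: "continuous_on (cball 0 1) G" "G holomorphic_on ball 0 1"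
    unfolding G_def[abs_def] using den_nz \<beta> by (auto intro!: continuous_intros holomorphic_intros)
  have "AE t in circ. rep_lfun (J (monomial k) * monomial (- m)) t = cnj (G t)"
    unfolding J_alpha_def
    using rep_lfun_times[of "inverse (chi \<beta>) * \<A> (monomial k)" "monomial (- m)"]
      rep_lfun_times[of "inverse (chi \<beta>)" "\<A> (monomial k)"] rep_lfun_inverse[of "chi \<beta>"]
      rep_lfun_chi[of \<beta>] rep_lfun_compose[of \<beta> "monomial k"] AE_alpha[OF rep_lfun_monomial[of k]]
      rep_lfun_monomial[of "- m"] AE_circ_norm
  proof eventually_elim
    case (elim t)
    have 1: "cnj (t ^ nat m) = t powi (- m)"
      using assms elim(8) by (simp add: cnj_eq_inverse power_int_minus power_int_def power_inverse)
    have 2: "cnj (((cnj \<beta> * t - 1) / (t - \<beta>)) ^ nat k) = alpha \<beta> t powi k"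
      using assms unfolding cnj_alpha[OF elim(8), symmetric] by (simp add: power_int_def)
    have nz: "t \<noteq> 0" "\<beta> - t \<noteq> 0" "cnj \<beta> * t - 1 \<noteq> 0" using den_nz[of t] den_nz'[of t] elim(8) by auto
    have "cnj (cnj (lam \<beta>) * t / (\<beta> - t)) = lam \<beta> * inverse t / (cnj \<beta> - inverse t)"
      using elim(8) by (simp add: cnj_eq_inverse)
    also have "\<dots> = lam \<beta> / (cnj \<beta> * t - 1)" using nz by (simp add: field_simps)
    finally have 3: "cnj (cnj (lam \<beta>) * t / (\<beta> - t)) = lam \<beta> / (cnj \<beta> * t - 1)" .
    have "cnj (G t) = lam \<beta> / (cnj \<beta> * t - 1) * alpha \<beta> t powi k * t powi (- m)"
      unfolding G_def complex_cnj_mult[of "_ * _"] 1 unfolding complex_cnj_mult[of "_ / _"] 2 3 ..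
    then show ?case using elim by simp
  qed
  then have "fcoeff (J (monomial k)) m = cnj (\<integral>t. G t \<partial>circ)"
    unfolding fcoeff_def by (subst lintegral_cong) (auto simp: integral_cnj)
  also have "(\<integral>t. G t \<partial>circ) = G 0" by (rule circ_mean_value[OF _ G]) measurable
  finally show ?thesis by (simp add: G_def)
qed

text \<open>The pole of \<chi>^{-1} at 1/cnj \<beta> is cancelled by one of the zeros of \<alpha>^k,
  k < 0, so the integrand is analytic in the disc; the factor t^{-m} supplies the zero at 0.\<close>

lemma fcoeff_J_monomial_neg:
  assumes "k < 0" "m < 0" shows "fcoeff (J (monomial k)) m = 0"
proof -
  define n where "n = nat (- k - 1)"
  have k: "k = - int (Suc n)" using assms by (simp add: n_def)
  define G where "G t = lam \<beta> * (cnj \<beta> * t - 1) ^ n / (t - \<beta>) ^ Suc n * t ^ nat (- m)" for t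
  have [measurable]: "G \<in> borel_measurable borel" unfolding G_def[abs_def] by measurable
  have G: "continuous_on (cball 0 1) G" "G holomorphic_on ball 0 1"
    unfolding G_def[abs_def] using den_nz \<beta> by (auto intro!: continuous_intros holomorphic_intros)
  have "AE t in circ. rep_lfun (J (monomial k) * monomial (- m)) t = G t"
    unfolding J_alpha_def
    using rep_lfun_times[of "inverse (chi \<beta>) * \<A> (monomial k)" "monomial (- m)"]
      rep_lfun_times[of "inverse (chi \<beta>)" "\<A> (monomial k)"] rep_lfun_inverse[of "chi \<beta>"]
      rep_lfun_chi[of \<beta>] rep_lfun_compose[of \<beta> "monomial k"] AE_alpha[OF rep_lfun_monomial[of k]]
      rep_lfun_monomial[of "- m"] AE_circ_norm
  proof eventually_elim
    case (elim t)
    have nz: "t - \<beta> \<noteq> 0" "cnj \<beta> * t - 1 \<noteq> 0" using den_nz[of t] den_nz'[of t] elim(8) by auto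
    have 1: "t powi (- m) = t ^ nat (- m)" using assms by (simp add: power_int_def)
    have 2: "alpha \<beta> t powi k = ((cnj \<beta> * t - 1) / (t - \<beta>)) ^ Suc n"
      unfolding k power_int_minus power_int_of_nat power_inverse[symmetric] by (simp add: alpha_def)
    have "inverse (Y / lam \<beta>) * (Y / X) ^ Suc n = lam \<beta> * Y ^ n / X ^ Suc n" if "X \<noteq> 0" "Y \<noteq> 0" for X Y
      using that lam_nz by (simp add: field_simps)
    from this[OF nz] show ?case using elim 1 2 by (simp add: G_def del: power_Suc)
  qed
  then have "fcoeff (J (monomial k)) m = (\<integral>t. G t \<partial>circ)"
    unfolding fcoeff_def by (subst lintegral_cong) auto
  also have "\<dots> = G 0" by (rule circ_mean_value[OF _ G]) measurable
  finally show ?thesis using assms by (simp add: G_def)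
qed

text \<open>The mean of an antianalytic function is its value at infinity, and \<alpha> takes the
  value 1/cnj \<beta> there.\<close>

lemma fcoeff_compose_monomial_0: "fcoeff (\<A> (monomial (int k))) 0 = (1 / cnj \<beta>) ^ k"
proof -
  define G where "G t = ((cnj \<beta> * t - 1) / (t - \<beta>)) ^ k" for t
  have [measurable]: "G \<in> borel_measurable borel" unfolding G_def[abs_def] by measurable
  have G: "continuous_on (cball 0 1) G" "G holomorphic_on ball 0 1"
    unfolding G_def[abs_def] using den_nz \<beta> by (auto intro!: continuous_intros holomorphic_intros)
  have "AE t in circ. rep_lfun (\<A> (monomial (int k))) t = cnj (G t)"
    using rep_lfun_compose[of \<beta> "monomial k"] AE_alpha[OF rep_lfun_monomial[of k]] AE_circ_norm
    by eventually_elim (simp add: G_def cnj_alpha[symmetric])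
  then have "fcoeff (\<A> (monomial (int k))) 0 = cnj (\<integral>t. G t \<partial>circ)"
    unfolding fcoeff_def by (simp, subst lintegral_cong) (auto simp: integral_cnj)
  also have "(\<integral>t. G t \<partial>circ) = G 0" by (rule circ_mean_value[OF _ G]) measurable
  finally show ?thesis by (simp add: G_def power_divide)
qed

end

section \<open>Nearest points and annihilators\<close>

lemma powr_le_cancel:
  fixes a b :: real
  assumes "a powr p \<le> b powr p" "p > 0" "b \<ge> 0"
  shows "a \<le> b"
  using assms powr_less_mono2[of p b a] by linarith

lemma powr_less_cancel_base:
  fixes a b :: real
  assumes "a powr p < b powr p" "p > 0" "a \<ge> 0" "b \<ge> 0"
  shows "a < b"
  using assms powr_mono2[of p b a] by linarith

text \<open>The mean value theorem on both halves of the interval; the derivative p x^{p-1} is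
  strictly increasing, so the right half has the larger increment.\<close>

lemma powr_strict_midpoint:
  fixes a b :: real
  assumes p: "p > 1" and ab: "0 \<le> a" "a < b"
  shows "((a + b) / 2) powr p < (a powr p + b powr p) / 2"
proof -
  define m where "m = (a + b) / 2"
  have m: "a < m" "m < b" using ab by (auto simp: m_def)
  have d: "((\<lambda>x. x powr p) has_real_derivative p * x powr (p - 1)) (at x)" if "x > 0" for x :: real
    using has_real_derivative_powr[OF that, of p] by simp
  have c: "continuous_on {u..v} (\<lambda>x. x powr p)" if "0 \<le> u" for u v :: real
    by (rule continuous_on_powr') (use that p in auto)
  have mvt: "\<exists>z. u < z \<and> z < v \<and> v powr p - u powr p = (v - u) * (p * z powr (p - 1))"
    if uv: "0 \<le> u" "u < v" for u v :: real
  proof -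
    have "\<exists>l z. u < z \<and> z < v \<and> ((\<lambda>x. x powr p) has_real_derivative l) (at z) \<and> v powr p - u powr p = (v - u) * l"
    proof (intro MVT c)
      show "(\<lambda>x. x powr p) differentiable (at x)" if "u < x" "x < v" for x
        using d[of x] that uv by (auto simp: real_differentiable_def)
    qed (use uv in auto)
    then obtain l z where z: "u < z" "z < v" "((\<lambda>x. x powr p) has_real_derivative l) (at z)"
      "v powr p - u powr p = (v - u) * l" by blast
    then have "l = p * z powr (p - 1)" using d[of z] uv by (intro DERIV_unique[OF z(3)]) auto
    with z show ?thesis by blast
  qed
  obtain x where x: "a < x" "x < m" "m powr p - a powr p = (m - a) * (p * x powr (p - 1))"
    using mvt[of a m] m ab by auto
  obtain y where y: "m < y" "y < b" "b powr p - m powr p = (b - m) * (p * y powr (p - 1))"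
    using mvt[of m b] m ab by auto
  have "x powr (p - 1) < y powr (p - 1)"
    using x y ab p by (intro powr_less_mono2) auto
  then have "(m - a) * (p * x powr (p - 1)) < (m - a) * (p * y powr (p - 1))"
    using m p by (intro mult_strict_left_mono) auto
  moreover have "b - m = m - a" by (simp add: m_def field_simps)
  ultimately have "m powr p - a powr p < b powr p - m powr p" using x y by simp
  then show ?thesis by (simp add: m_def)
qed

definition convex_gap :: "real \<Rightarrow> complex \<Rightarrow> complex \<Rightarrow> real" where
  "convex_gap p x y = (cmod x powr p + cmod y powr p) / 2 - cmod ((x + y) / 2) powr p"

lemma convex_gap_nonneg: "p \<ge> 1 \<Longrightarrow> convex_gap p x y \<ge> 0"
proof -
  assume p: "p \<ge> 1"
  have "cmod ((x + y) / 2) powr p \<le> ((1 - 1/2) * cmod x + 1/2 * cmod y) powr p"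
    using p norm_triangle_ineq[of x y] by (intro powr_mono2) (auto simp: norm_divide)
  also have "\<dots> \<le> (1 - 1/2) * cmod x powr p + 1/2 * cmod y powr p"
    by (rule powr_convex_ineq) (use p in auto)
  finally show ?thesis by (simp add: convex_gap_def)
qed

text \<open>Strict convexity of r^p on moduli forces |x| = |y|, then |x + y| = 2 |x|, and the
  parallelogram identity leaves |x - y| = 0.\<close>

lemma convex_gap_eq_0:
  assumes p: "p > 1" and "convex_gap p x y = 0"
  shows "x = y"
proof -
  have eq: "cmod ((x + y) / 2) powr p = (cmod x powr p + cmod y powr p) / 2"
    using assms by (simp add: convex_gap_def)
  have le: "cmod ((x + y) / 2) powr p \<le> ((cmod x + cmod y) / 2) powr p"
    using p norm_triangle_ineq[of x y] by (intro powr_mono2) (auto simp: norm_divide)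
  have xy: "cmod x = cmod y"
  proof (rule ccontr)
    assume "cmod x \<noteq> cmod y"
    then consider "cmod x < cmod y" | "cmod y < cmod x" by linarith
    then have "((cmod x + cmod y) / 2) powr p < (cmod x powr p + cmod y powr p) / 2"
      using powr_strict_midpoint[OF p, of "cmod x" "cmod y"] powr_strict_midpoint[OF p, of "cmod y" "cmod x"]
      by cases (auto simp: add.commute)
    with eq le show False by simp
  qed
  then have "cmod ((x + y) / 2) powr p = cmod x powr p" using eq by simp
  then have "cmod ((x + y) / 2) = cmod x"
    using p powr_le_cancel[of "cmod ((x + y) / 2)" p "cmod x"] powr_le_cancel[of "cmod x" p "cmod ((x + y) / 2)"]
    by simp
  then have cm: "cmod (x + y) = 2 * cmod x" by (simp add: norm_divide)
  have e1: "(Re x + Re y)\<^sup>2 + (Im x + Im y)\<^sup>2 = 4 * ((Re x)\<^sup>2 + (Im x)\<^sup>2)"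
    using arg_cong[OF cm, of "\<lambda>u. u\<^sup>2"] by (simp add: cmod_power2 power_mult_distrib)
  have e2: "(Re x)\<^sup>2 + (Im x)\<^sup>2 = (Re y)\<^sup>2 + (Im y)\<^sup>2"
    using arg_cong[OF xy, of "\<lambda>u. u\<^sup>2"] by (simp add: cmod_power2)
  have "(Re x - Re y)\<^sup>2 + (Im x - Im y)\<^sup>2 = 0"
    using e1 e2 by (simp add: power2_eq_square algebra_simps)
  then have "(cmod (x - y))\<^sup>2 = 0" by (simp only: cmod_power2 minus_complex.sel)
  then show ?thesis by simp
qed

lemma continuous_on_cmod_powr:
  "p > 0 \<Longrightarrow> continuous_on S f \<Longrightarrow> continuous_on S (\<lambda>x. cmod (f x) powr p)"
  by (rule continuous_on_powr') (auto intro: continuous_on_norm)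

text \<open>Uniform convexity in the form that can be integrated directly; by homogeneity and compactness it
  reduces to strict convexity.\<close>

lemma uniform_convexity:
  assumes p: "p > 1" and e: "e > 0"
  obtains K where "K \<ge> 0"
    "\<And>x y. cmod (x - y) powr p \<le> e * (cmod x powr p + cmod y powr p) + K * convex_gap p x y"
proof -
  \<comment> \<open>The unit sphere of the p-norm on pairs. On its compact part where |x - y|^p
    \<ge> e the gap is continuous and positive, hence bounded below by some m > 0.\<close>
  define S where "S = {z :: complex \<times> complex. cmod (fst z) powr p + cmod (snd z) powr p = 1}"
  define S' where "S' = {z. cmod (fst z - snd z) powr p \<ge> e} \<inter> S"
  have le1: "cmod x \<le> 1 \<and> cmod y \<le> 1" if "(x, y) \<in> S" for x y
  proof -
    have "cmod x powr p \<le> 1 powr p" "cmod y powr p \<le> 1 powr p"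
      using that by (simp_all add: S_def, smt (verit) powr_ge_zero, smt (verit) powr_ge_zero)
    then show ?thesis
      using p powr_le_cancel[of "cmod x" p 1] powr_le_cancel[of "cmod y" p 1] by simp
  qed
  have "closed S" unfolding S_def
    by (intro closed_Collect_eq continuous_intros continuous_on_cmod_powr) (use p in auto)
  moreover have "closed {z :: complex \<times> complex. cmod (fst z - snd z) powr p \<ge> e}"
    by (intro closed_Collect_le continuous_intros continuous_on_cmod_powr) (use p in auto)
  moreover have "bounded S"
  proof (rule bounded_subset)
    show "bounded (cball 0 1 \<times> cball (0::complex) 1 :: (complex \<times> complex) set)"
      by (intro bounded_Times bounded_cball)
    show "S \<subseteq> cball 0 1 \<times> cball 0 1" using le1 by auto
  qed
  ultimately have comp: "compact S'"
    unfolding S'_def by (intro closed_Int_compact) (auto simp: compact_eq_bounded_closed)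
  have cg: "continuous_on S' (\<lambda>z. convex_gap p (fst z) (snd z))"
    unfolding convex_gap_def by (intro continuous_intros continuous_on_cmod_powr) (use p in auto)
  have "\<exists>m>0. \<forall>z\<in>S'. m \<le> convex_gap p (fst z) (snd z)"
  proof (cases "S' = {}")
    case False
    obtain z where z: "z \<in> S'" "\<forall>w\<in>S'. convex_gap p (fst z) (snd z) \<le> convex_gap p (fst w) (snd w)"
      using continuous_attains_inf[OF comp False cg] by blast
    have "convex_gap p (fst z) (snd z) \<noteq> 0"
      using convex_gap_eq_0[OF p, of "fst z" "snd z"] z(1) e p by (auto simp: S'_def)
    moreover have "convex_gap p (fst z) (snd z) \<ge> 0" using p by (intro convex_gap_nonneg) auto
    ultimately show ?thesis using z by (intro exI[of _ "convex_gap p (fst z) (snd z)"]) auto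
  qed (auto intro: exI[of _ 1])
  then obtain m where m: "m > 0" "\<And>x y. (x, y) \<in> S' \<Longrightarrow> m \<le> convex_gap p x y" by fastforce
  \<comment> \<open>On the sphere |x - y|^p \<le> 2^p, so K times the gap, which is at least K m =
    2^p, pays for the pairs that are far apart.\<close>
  define K where "K = 2 powr p / m"
  have K: "K \<ge> 0" using m by (simp add: K_def)
  have onS: "cmod (x - y) powr p \<le> e + K * convex_gap p x y" if xy: "(x, y) \<in> S" for x y
  proof (cases "cmod (x - y) powr p < e")
    case True
    have "K * convex_gap p x y \<ge> 0" using K p by (intro mult_nonneg_nonneg convex_gap_nonneg) auto
    with True show ?thesis by linarith
  next
    case False
    then have "m \<le> convex_gap p x y" using xy by (intro m) (auto simp: S'_def)
    then have "K * m \<le> K * convex_gap p x y" using K by (intro mult_left_mono) auto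
    moreover have "K * m = 2 powr p" using m by (simp add: K_def)
    moreover have "cmod (x - y) powr p \<le> 2 powr p"
      using p le1[OF xy] norm_triangle_ineq4[of x y] by (intro powr_mono2) auto
    ultimately show ?thesis using e by linarith
  qed
  show ?thesis
  proof (rule that[OF K])
    fix x y
    show "cmod (x - y) powr p \<le> e * (cmod x powr p + cmod y powr p) + K * convex_gap p x y"
    proof (cases "x = 0 \<and> y = 0")
      case True
      then show ?thesis by (simp add: convex_gap_def)
    next
      case False
      define T where "T = cmod x powr p + cmod y powr p"
      have T: "T > 0" using False by (auto simp: T_def add_pos_nonneg add_nonneg_pos)
      define s where "s = T powr (1 / p)"
      have s: "s > 0" "s powr p = T" using T p by (auto simp: s_def powr_powr)
      have sc: "cmod (z / complex_of_real s) powr p = cmod z powr p / T" for z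
        using s by (simp add: norm_divide powr_divide)
      have "(x / s, y / s) \<in> S"
        using T by (simp add: S_def sc add_divide_distrib[symmetric]) (simp add: T_def)
      from onS[OF this] have "cmod ((x - y) / s) powr p \<le> e + K * convex_gap p (x / s) (y / s)"
        by (simp add: diff_divide_distrib)
      moreover have "convex_gap p (x / s) (y / s) = convex_gap p x y / T"
      proof -
        have "(x / s + y / s) / 2 = ((x + y) / 2) / s" by (simp add: add_divide_distrib mult.commute)
        then show ?thesis
          unfolding convex_gap_def sc by (simp only: sc) (simp add: add_divide_distrib diff_divide_distrib)
      qed
      ultimately have "cmod (x - y) powr p / T \<le> e + K * convex_gap p x y / T"
        unfolding sc by simp
      then show ?thesis using T unfolding T_def[symmetric] by (simp add: field_simps)
    qed
  qed
qed

definition closed_subspace :: "real \<Rightarrow> lfun set \<Rightarrow> bool" where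
  "closed_subspace p R \<longleftrightarrow> R \<subseteq> Lp p \<and> lfun.subspace R \<and>
     (\<forall>r y. (\<forall>n. r n \<in> R) \<and> y \<in> Lp p \<and> (\<lambda>n::nat. lp_norm p (r n - y)) \<longlonglongrightarrow> 0 \<longrightarrow> y \<in> R)"

lemma closed_subspaceD:
  assumes "closed_subspace p R"
  shows "R \<subseteq> Lp p" "lfun.subspace R" "0 \<in> R"
    "\<And>x y. x \<in> R \<Longrightarrow> y \<in> R \<Longrightarrow> x + y \<in> R" "\<And>x y. x \<in> R \<Longrightarrow> y \<in> R \<Longrightarrow> x - y \<in> R"
    "\<And>c x. x \<in> R \<Longrightarrow> lscale c x \<in> R"
    "\<And>r y. (\<And>n::nat. r n \<in> R) \<Longrightarrow> y \<in> Lp p \<Longrightarrow> (\<lambda>n. lp_norm p (r n - y)) \<longlonglongrightarrow> 0 \<Longrightarrow> y \<in> R"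
  using assms unfolding closed_subspace_def
  by (auto intro: lfun.subspace_0 lfun.subspace_add lfun.subspace_diff lfun.subspace_scale)

section \<open>The duality map and the Euler equation of nearest points\<close>

text \<open>The element of L^q that norms h; up to the factor p it is the derivative of the p-th
  power of the norm at h.\<close>

definition dual_elt :: "real \<Rightarrow> lfun \<Rightarrow> lfun" where
  "dual_elt p h = abs_lfun (\<lambda>t. of_real (cmod (rep_lfun h t) powr (p - 2)) * rep_lfun h t)"

lemma rep_dual_elt:
  "AE t in circ. rep_lfun (dual_elt p h) t = of_real (cmod (rep_lfun h t) powr (p - 2)) * rep_lfun h t"
  unfolding dual_elt_def by (rule rep_abs_lfun) measurable

lemma norm_dual: "cmod (of_real (cmod w powr (p - 2)) * w) = cmod w powr (p - 1)"
proof (cases "w = 0")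
  case False
  then have "cmod w powr (p - 1) = cmod w powr (p - 2) * cmod w powr 1"
    using powr_add[of "cmod w" "p - 2" 1] by simp
  with False show ?thesis by (simp add: norm_mult)
qed simp

lemma dual_elt:
  assumes p: "p > 1" and h: "h \<in> Lp p"
  shows "dual_elt p h \<in> Lp (conj_exp p)"
    "lp_norm (conj_exp p) (dual_elt p h) = lp_norm p h powr (p - 1)"
    "pairing h (dual_elt p h) = of_real (lp_norm p h powr p)"
proof -
  define q where "q = conj_exp p"
  have q: "q > 1" "(p - 1) * q = p" "1 / p + 1 / q = 1" "p / q = p - 1"
    using conj_exp[OF p] p by (auto simp: q_def conj_exp_def)
  have eq: "cmod (of_real (cmod w powr (p - 2)) * w) powr q = cmod w powr p" for w
    unfolding norm_dual by (simp add: powr_powr q)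
  show "dual_elt p h \<in> Lp (conj_exp p)"
    unfolding q_def[symmetric]
    using h by (subst Lp_cong[OF rep_dual_elt]) (auto simp: eq Lp_iff)
  have "lp_norm q (dual_elt p h) = (lp_norm p h powr p) powr (1 / q)"
    using p by (subst lp_norm_cong[OF rep_dual_elt]) (auto simp: eq lp_norm_powr)
  also have "\<dots> = lp_norm p h powr (p - 1)"
    by (simp add: powr_powr q(4))
  finally show "lp_norm (conj_exp p) (dual_elt p h) = lp_norm p h powr (p - 1)"
    by (simp add: q_def)
  have *: "w * cnj (of_real (cmod w powr (p - 2)) * w) = of_real (cmod w powr p)" for w
  proof (cases "w = 0")
    case False
    then have "cmod w powr p = cmod w powr (p - 2) * cmod w powr 2"
      using powr_add[of "cmod w" "p - 2" 2] by simp
    then have "complex_of_real (cmod w powr p) = of_real (cmod w powr (p - 2)) * (w * cnj w)"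
      using False by (simp add: complex_norm_square[symmetric])
    then show ?thesis by (simp add: mult_ac)
  qed simp
  have "AE t in circ. rep_lfun (h * lcnj (dual_elt p h)) t = of_real (cmod (rep_lfun h t) powr p)"
    using rep_lfun_times[of h "lcnj (dual_elt p h)"] rep_lfun_lcnj[of "dual_elt p h"] rep_dual_elt[of p h]
    by eventually_elim (simp add: * del: complex_cnj_mult)
  then have "pairing h (dual_elt p h) = (\<integral>t. complex_of_real (cmod (rep_lfun h t) powr p) \<partial>circ)"
    unfolding pairing_def by (intro lintegral_cong) auto
  then show "pairing h (dual_elt p h) = of_real (lp_norm p h powr p)"
    using p by (simp add: lp_norm_powr)
qed

text \<open>The supporting hyperplane of the convex function |.|^p at v. It comes from Young's
  inequality for |w| and |v|^{p-1}, so no differentiation of a complex power is involved.\<close>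

lemma powr_tangent:
  fixes v w :: complex
  assumes p: "p > 1"
  shows "cmod v powr p + p * Re (cnj (of_real (cmod v powr (p - 2)) * v) * (w - v)) \<le> cmod w powr p"
proof -
  define q where "q = conj_exp p"
  have q: "q > 1" "(p - 1) * q = p" "1 / p + 1 / q = 1" "p / q = p - 1"
    using conj_exp[OF p] p by (auto simp: q_def conj_exp_def)
  define z where "z = of_real (cmod v powr (p - 2)) * v"
  have zv: "cnj z * v = of_real (cmod v powr p)"
  proof (cases "v = 0")
    case False
    then have "cmod v powr p = cmod v powr (p - 2) * cmod v powr 2"
      using powr_add[of "cmod v" "p - 2" 2] by simp
    then have "complex_of_real (cmod v powr p) = of_real (cmod v powr (p - 2)) * (v * cnj v)"
      using False by (simp add: complex_norm_square[symmetric])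
    then show ?thesis by (simp add: z_def mult_ac)
  qed (simp add: z_def)
  have "Re (cnj z * w) \<le> cmod z * cmod w"
    using complex_Re_le_cmod[of "cnj z * w"] by (simp add: norm_mult)
  also have "\<dots> = cmod w * cmod v powr (p - 1)" unfolding z_def norm_dual by simp
  also have "\<dots> \<le> cmod w powr p / p + (cmod v powr (p - 1)) powr q / q"
    by (rule Youngs_inequality) (use p q in auto)
  also have "(cmod v powr (p - 1)) powr q = cmod v powr p" by (simp add: powr_powr q)
  finally have "p * Re (cnj z * w) \<le> p * (cmod w powr p / p + cmod v powr p / q)"
    using p by (intro mult_left_mono) auto
  also have "\<dots> = cmod w powr p + (p / q) * cmod v powr p" using p by (simp add: field_simps)
  finally have "p * Re (cnj z * w) \<le> cmod w powr p + (p - 1) * cmod v powr p" unfolding q(4) .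
  moreover have "Re (cnj z * (w - v)) = Re (cnj z * w) - cmod v powr p"
    using zv by (simp add: right_diff_distrib)
  ultimately show ?thesis unfolding z_def[symmetric] by (simp add: algebra_simps)
qed

text \<open>For p < 2 the factor |v|^{p-2} is singular at 0; there continuity is seen from the
  modulus |v|^{p-1} of the whole expression.\<close>

lemma dual_tendsto:
  fixes h :: complex
  assumes p: "p > 1" and v: "v \<longlonglongrightarrow> h"
  shows "(\<lambda>n. of_real (cmod (v n) powr (p - 2)) * v n) \<longlonglongrightarrow> of_real (cmod h powr (p - 2)) * h"
proof (cases "h = 0")
    case True
    have "(\<lambda>n. cmod (v n) powr (p - 1)) \<longlonglongrightarrow> cmod h powr (p - 1)"
      using p by (intro tendsto_powr2 tendsto_norm v tendsto_const) auto
    then have "(\<lambda>n. cmod (of_real (cmod (v n) powr (p - 2)) * v n)) \<longlonglongrightarrow> 0"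
      using True p by (simp only: norm_dual) simp
    then show ?thesis using True by (simp add: tendsto_norm_zero_cancel)
  next
    case False
    then have "(\<lambda>n. cmod (v n) powr (p - 2)) \<longlonglongrightarrow> cmod h powr (p - 2)"
      by (intro tendsto_powr tendsto_norm v tendsto_const) auto
    then show ?thesis by (intro tendsto_mult tendsto_of_real v)
qed

text \<open>A minimising sequence is Cauchy by uniform convexity, because midpoints stay in R and
  cannot come closer to y than the infimum.\<close>

lemma nearest_point_exists:
  assumes p: "p > 1" and R: "closed_subspace p R" and y: "y \<in> Lp p"
  obtains r0 where "r0 \<in> R" "\<And>r. r \<in> R \<Longrightarrow> lp_norm p (y - r0) \<le> lp_norm p (y - r)"
proof -
  note RD = closed_subspaceD[OF R]
  have p1: "p \<ge> 1" "p > 0" using p by auto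
  define I where "I f = lp_norm p f powr p" for f
  have I_eq: "I f = (\<integral>t. cmod (rep_lfun f t) powr p \<partial>circ)" for f
    using p by (simp add: I_def lp_norm_powr)
  define d where "d = (INF r\<in>R. I (y - r))"
  have bdd: "bdd_below ((\<lambda>r. I (y - r)) ` R)" by (rule bdd_belowI2[of _ 0]) (simp add: I_def)
  have d_le: "d \<le> I (y - r)" if "r \<in> R" for r
    unfolding d_def using that by (intro cINF_lower bdd)
  have d0: "d \<ge> 0" unfolding d_def using RD(3) by (intro cINF_greatest) (auto simp: I_def)
  have "\<exists>r\<in>R. I (y - r) < d + 1 / (real n + 1)" for n
  proof -
    have "Inf ((\<lambda>r. I (y - r)) ` R) < d + 1 / (real n + 1)" unfolding d_def by simp
    from cInf_lessD[OF _ this] RD(3) show ?thesis by auto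
  qed
  then obtain r where r: "\<And>n. r n \<in> R" "\<And>n. I (y - r n) < d + 1 / (real n + 1)" by metis
  have rL: "r n \<in> Lp p" for n using r RD(1) by auto
  have yr: "y - r n \<in> Lp p" for n using y rL p1 by (intro Lp_diff)
  have key: "I (r m - r n) \<le> e * (2 * (d + 1)) + K / (real N + 1)"
    if K: "K \<ge> 0" "\<And>x y. cmod (x - y) powr p \<le> e * (cmod x powr p + cmod y powr p) + K * convex_gap p x y"
      and e: "e > 0" and mn: "m \<ge> N" "n \<ge> N" for e K m n N
  proof -
    define u where "u = y - r n"
    define v where "v = y - r m"
    have uv: "u \<in> Lp p" "v \<in> Lp p" using yr by (auto simp: u_def v_def)
    \<comment> \<open>The distance vector of the midpoint. It is the mean of u and v, and its p-th
      power norm is at least d, so the integrated gap is at most 1/(N+1).\<close>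
    define w where "w = y - lscale (1/2) (r m + r n)"
    have w: "w \<in> Lp p" unfolding w_def using y rL p1 by (intro Lp_diff Lp_lscale Lp_add)
    have weq: "w = lscale (1/2) (u + v)"
    proof -
      have "lscale (1/2) y + lscale (1/2) y = y"
        by (simp only: lfun.scale_left_distrib[symmetric]) simp
      then have "w = (lscale (1/2) y + lscale (1/2) y) - lscale (1/2) (r m + r n)"
        by (simp only: w_def)
      also have "\<dots> = lscale (1/2) (u + v)"
        by (simp only: u_def v_def lfun.scale_right_distrib lfun.scale_right_diff_distrib) (simp add: algebra_simps)
      finally show ?thesis .
    qed
    have "I w \<ge> d" unfolding w_def by (intro d_le RD(4,6) r(1))
    have AEw: "AE t in circ. rep_lfun w t = (rep_lfun u t + rep_lfun v t) / 2"
      unfolding weq using rep_lfun_lscale[of "1/2" "u + v"] rep_lfun_add[of u v] by eventually_elim simp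
    have AEd: "AE t in circ. rep_lfun (u - v) t = rep_lfun u t - rep_lfun v t" by (rule rep_lfun_minus)
    have i: "integrable circ (\<lambda>t. cmod (rep_lfun f t) powr p)" if "f \<in> Lp p" for f using that by (simp add: Lp_iff)
    have "I (u - v) \<le> (\<integral>t. e * (cmod (rep_lfun u t) powr p + cmod (rep_lfun v t) powr p) +
        K * ((cmod (rep_lfun u t) powr p + cmod (rep_lfun v t) powr p) / 2 - cmod (rep_lfun w t) powr p) \<partial>circ)"
      unfolding I_eq
    proof (rule integral_mono_AE)
      show "AE t in circ. cmod (rep_lfun (u - v) t) powr p \<le> e * (cmod (rep_lfun u t) powr p + cmod (rep_lfun v t) powr p) +
        K * ((cmod (rep_lfun u t) powr p + cmod (rep_lfun v t) powr p) / 2 - cmod (rep_lfun w t) powr p)"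
        using AEw AEd
      proof eventually_elim
        case (elim t)
        show ?case using K(2)[of "rep_lfun u t" "rep_lfun v t"] unfolding elim convex_gap_def .
      qed
      show "integrable circ (\<lambda>t. cmod (rep_lfun (u - v) t) powr p)" by (intro i Lp_diff uv p1)
      show "integrable circ (\<lambda>t. e * (cmod (rep_lfun u t) powr p + cmod (rep_lfun v t) powr p) +
        K * ((cmod (rep_lfun u t) powr p + cmod (rep_lfun v t) powr p) / 2 - cmod (rep_lfun w t) powr p))"
        by (intro Bochner_Integration.integrable_add integrable_mult_right Bochner_Integration.integrable_diff
            integrable_divide i uv w)
    qed
    also have "\<dots> = e * (I u + I v) + K * ((I u + I v) / 2 - I w)"
      using i[OF uv(1)] i[OF uv(2)] i[OF w] by (simp add: I_eq)
    also have "\<dots> \<le> e * (2 * (d + 1)) + K * (1 / (real N + 1))"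
    proof (intro add_mono mult_left_mono)
      have 1: "1 / (real n + 1) \<le> 1 / (real N + 1)" "1 / (real m + 1) \<le> 1 / (real N + 1)"
        using mn by (auto intro!: divide_left_mono)
      have 2: "1 / (real N + 1) \<le> 1" by simp
      show "I u + I v \<le> 2 * (d + 1)" using r(2)[of n] r(2)[of m] 1 2 unfolding u_def v_def by argo
      show "(I u + I v) / 2 - I w \<le> 1 / (real N + 1)"
        using r(2)[of n] r(2)[of m] 1 \<open>I w \<ge> d\<close> unfolding u_def v_def by argo
    qed (use e K in auto)
    finally show ?thesis by (simp add: u_def v_def)
  qed
  have Cauchy: "\<exists>N. \<forall>m\<ge>N. \<forall>n\<ge>N. lp_norm p (r m - r n) < e'" if e': "e' > 0" for e'
  proof -
    \<comment> \<open>Chosen to make the first term of the estimate a quarter of e'^p; the second,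
      K/(N+1), is kept below a half by taking N large.\<close>
    define e where "e = e' powr p / (8 * (d + 1))"
    have e: "e > 0" "e * (2 * (d + 1)) = e' powr p / 4" using e' d0 by (auto simp: e_def field_simps)
    obtain K where K: "K \<ge> 0"
      "\<And>x y. cmod (x - y) powr p \<le> e * (cmod x powr p + cmod y powr p) + K * convex_gap p x y"
      using uniform_convexity[OF p e(1)] by metis
    obtain N :: nat where N: "4 * K / e' powr p < real N" using reals_Archimedean2 by blast
    have "K / (real N + 1) < e' powr p / 2"
    proof -
      have "4 * K < real N * e' powr p" using N e' by (simp add: field_simps)
      moreover have "0 < e' powr p" using e' by simp
      moreover have "K < (X + Y) / 2" if "4 * K < X" "0 < Y" for X Y using that K(1) by simp
      ultimately have "K < (real N * e' powr p + e' powr p) / 2" by blast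
      then have "K < (real N + 1) * (e' powr p / 2)" by (simp add: algebra_simps)
      then show ?thesis by (simp add: divide_less_eq mult.commute)
    qed
    moreover have "0 < e' powr p" using e' by simp
    ultimately have "I (r m - r n) < e' powr p" if "m \<ge> N" "n \<ge> N" for m n
      using key[OF K e(1) that] unfolding e(2) by linarith
    then show ?thesis
      using e' p1 unfolding I_def
      by (intro exI[of _ N] allI impI) (rule powr_less_cancel_base[of _ p]; simp)
  qed
  obtain r0 where r0: "r0 \<in> Lp p" "(\<lambda>n. lp_norm p (r n - r0)) \<longlonglongrightarrow> 0"
    using Lp_complete[OF rL p1(1) Cauchy] by blast
  have r0R: "r0 \<in> R" by (rule RD(7)[OF r(1) r0])
  have "(\<lambda>n. lp_norm p (y - r n)) \<longlonglongrightarrow> lp_norm p (y - r0)"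
  proof (rule LIMSEQ_offset[of _ 0], rule Lim_transform_bound[OF _ r0(2), THEN LIM_zero_cancel])
    show "\<forall>\<^sub>F n in sequentially. norm (lp_norm p (y - r (n + 0)) - lp_norm p (y - r0)) \<le> norm (lp_norm p (r n - r0))"
    proof (rule always_eventually, rule allI)
      fix n
      have d1: "y - r0 \<in> Lp p" "r n - r0 \<in> Lp p" using y rL r0 p1 by (auto intro: Lp_diff)
      have "lp_norm p (y - r n) \<le> lp_norm p (y - r0) + lp_norm p (r n - r0)"
        using lp_norm_triangle_diff[OF d1 p1(1)] by simp
      moreover have "lp_norm p (y - r0) \<le> lp_norm p (y - r n) + lp_norm p (r n - r0)"
        using lp_norm_triangle[OF yr[of n] d1(2) p1(1)] by simp
      ultimately show "norm (lp_norm p (y - r (n + 0)) - lp_norm p (y - r0)) \<le> norm (lp_norm p (r n - r0))" by simp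
    qed
  qed
  then have lim: "(\<lambda>n. I (y - r n)) \<longlonglongrightarrow> I (y - r0)"
    unfolding I_def using p1 by (intro tendsto_powr2 tendsto_const) auto
  have "(\<lambda>n. d + 1 / (real n + 1)) \<longlonglongrightarrow> d + 0"
    by (intro tendsto_add tendsto_const LIMSEQ_inverse_real_of_nat[unfolded inverse_eq_divide of_nat_Suc, simplified add.commute[of 1]])
  then have limd: "(\<lambda>n. d + 1 / (real n + 1)) \<longlonglongrightarrow> d" by simp
  have "\<exists>N. \<forall>n\<ge>N. I (y - r n) \<le> d + 1 / (real n + 1)"
    using r(2) by (blast intro: less_imp_le)
  then have "I (y - r0) \<le> d" by (rule LIMSEQ_le[OF lim limd])
  then have "I (y - r0) \<le> I (y - r)" if "r \<in> R" for r using d_le[OF that] by linarith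
  then have "lp_norm p (y - r0) \<le> lp_norm p (y - r)" if "r \<in> R" for r
    using that p1 powr_le_cancel[of "lp_norm p (y - r0)" p "lp_norm p (y - r)"] unfolding I_def by simp
  with r0R show ?thesis by (rule that)
qed

lemma pairing_L1:
  assumes "p > 1" "f \<in> Lp p" "g \<in> Lp (conj_exp p)"
  shows "f * lcnj g \<in> Lp 1" "cmod (pairing f g) \<le> lp_norm p f * lp_norm (conj_exp p) g"
proof -
  have g: "lcnj g \<in> Lp (conj_exp p)" using assms Lp_lcnj by auto
  show "f * lcnj g \<in> Lp 1" by (rule Holder(1)[OF assms(1,2) g])
  have "cmod (pairing f g) \<le> lp_norm 1 (f * lcnj g)" unfolding pairing_def by (rule norm_lintegral_le)
  also have "\<dots> \<le> lp_norm p f * lp_norm (conj_exp p) g"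
    using Holder(2)[OF assms(1,2) g] by (simp add: lp_norm_lcnj)
  finally show "cmod (pairing f g) \<le> lp_norm p f * lp_norm (conj_exp p) g" .
qed

lemma pairing_lscale: "pairing (lscale c f) g = c * pairing f g" "pairing f (lscale c g) = cnj c * pairing f g"
  by (simp_all add: pairing_def lscale_times_left lscale_times_right lintegral_lscale)

lemma pairing_0 [simp]: "pairing 0 g = 0" "pairing f 0 = 0"
  by (simp_all add: pairing_def)

lemma pairing_commute: "pairing g f = cnj (pairing f g)"
  using lintegral_lcnj[of "f * lcnj g"] by (simp add: pairing_def mult.commute)

lemma pairing_times: "pairing (a * f) g = pairing f (lcnj a * g)"
  by (simp add: pairing_def mult_ac)

lemma pairing_monomial: "pairing f (monomial n) = fcoeff f n" "pairing (monomial n) f = cnj (fcoeff f n)"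
proof -
  show "pairing f (monomial n) = fcoeff f n"
    by (simp add: pairing_def fcoeff_def)
  then show "pairing (monomial n) f = cnj (fcoeff f n)"
    by (metis pairing_commute)
qed

lemma pairing_add_left:
  assumes "p > 1" "f1 \<in> Lp p" "f2 \<in> Lp p" "g \<in> Lp (conj_exp p)"
  shows "pairing (f1 + f2) g = pairing f1 g + pairing f2 g" "pairing (f1 - f2) g = pairing f1 g - pairing f2 g"
  using pairing_L1(1)[OF assms(1,2,4)] pairing_L1(1)[OF assms(1,3,4)]
  by (simp_all add: pairing_def distrib_right left_diff_distrib lintegral_add lintegral_diff)

lemma pairing_add_right:
  assumes "p > 1" "f \<in> Lp p" "g1 \<in> Lp (conj_exp p)" "g2 \<in> Lp (conj_exp p)"
  shows "pairing f (g1 + g2) = pairing f g1 + pairing f g2" "pairing f (g1 - g2) = pairing f g1 - pairing f g2"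
  using pairing_L1(1)[OF assms(1,2,3)] pairing_L1(1)[OF assms(1,2,4)]
  by (simp_all add: pairing_def distrib_left right_diff_distrib lintegral_add lintegral_diff)

lemma powr_add_le:
  fixes a b :: real
  assumes "p \<ge> 1" "a \<ge> 0" "b \<ge> 0"
  shows "(a + b) powr p \<le> 2 powr p * (1/2 * a powr p + 1/2 * b powr p)"
proof -
  have "a + b = 2 * ((1 - 1/2) * a + 1/2 * b)" by simp
  also have "\<dots> powr p = 2 powr p * ((1 - 1/2) * a + 1/2 * b) powr p"
    using assms by (subst powr_mult) auto
  also have "\<dots> \<le> 2 powr p * ((1 - 1/2) * a powr p + 1/2 * b powr p)"
    by (intro mult_left_mono powr_convex_ineq) (use assms in auto)
  finally show ?thesis by simp
qed

text \<open>Dominated convergence: for |s n| \<le> 1 the integrand is bounded by (|h| +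
  |z|)^p.\<close>

lemma pairing_dual_elt_tendsto:
  assumes p: "p > 1" and h: "h \<in> Lp p" and z: "z \<in> Lp p" and s: "s \<longlonglongrightarrow> 0" "\<And>n. \<bar>s n\<bar> \<le> 1"
  shows "(\<lambda>n. pairing z (dual_elt p (h + lscale (of_real (s n)) z))) \<longlonglongrightarrow> pairing z (dual_elt p h)"
proof -
  define H where "H = rep_lfun h"
  define Z where "Z = rep_lfun z"
  define \<phi> where "\<phi> w = of_real (cmod w powr (p - 2)) * w" for w
  have [measurable]: "H \<in> borel_measurable borel" "Z \<in> borel_measurable borel" "\<phi> \<in> borel_measurable borel"
    unfolding H_def Z_def \<phi>_def[abs_def] by measurable
  have AEn: "AE t in circ. rep_lfun (z * lcnj (dual_elt p (h + lscale (of_real (s n)) z))) t =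
      Z t * cnj (\<phi> (H t + of_real (s n) * Z t))" for n
    using rep_lfun_times[of z "lcnj (dual_elt p (h + lscale (of_real (s n)) z))"]
      rep_lfun_lcnj[of "dual_elt p (h + lscale (of_real (s n)) z)"] rep_dual_elt[of p "h + lscale (of_real (s n)) z"]
      rep_lfun_add[of h "lscale (of_real (s n)) z"] rep_lfun_lscale[of "of_real (s n)" z]
    by eventually_elim (simp add: H_def Z_def \<phi>_def)
  have AE0: "AE t in circ. rep_lfun (z * lcnj (dual_elt p h)) t = Z t * cnj (\<phi> (H t))"
    using rep_lfun_times[of z "lcnj (dual_elt p h)"] rep_lfun_lcnj[of "dual_elt p h"] rep_dual_elt[of p h]
    by eventually_elim (simp add: H_def Z_def \<phi>_def)
  have eqn: "pairing z (dual_elt p (h + lscale (of_real (s n)) z)) = (\<integral>t. Z t * cnj (\<phi> (H t + of_real (s n) * Z t)) \<partial>circ)" for n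
    unfolding pairing_def by (rule lintegral_cong[OF AEn]) measurable
  have eq0: "pairing z (dual_elt p h) = (\<integral>t. Z t * cnj (\<phi> (H t)) \<partial>circ)"
    unfolding pairing_def by (rule lintegral_cong[OF AE0]) measurable
  show ?thesis
    unfolding eqn eq0
  proof (rule integral_dominated_convergence[where w = "\<lambda>t. 2 powr p * (1/2 * cmod (H t) powr p + 1/2 * cmod (Z t) powr p)"])
    show "integrable circ (\<lambda>t. 2 powr p * (1/2 * cmod (H t) powr p + 1/2 * cmod (Z t) powr p))"
      using h z by (auto simp: Lp_iff H_def Z_def)
    show "AE t in circ. (\<lambda>n. Z t * cnj (\<phi> (H t + of_real (s n) * Z t))) \<longlonglongrightarrow> Z t * cnj (\<phi> (H t))"
    proof (rule AE_I2)
      fix t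
      have "(\<lambda>n. H t + of_real (s n) * Z t) \<longlonglongrightarrow> H t + of_real 0 * Z t"
        by (intro tendsto_intros s)
      then have "(\<lambda>n. \<phi> (H t + of_real (s n) * Z t)) \<longlonglongrightarrow> \<phi> (H t)"
        unfolding \<phi>_def by (intro dual_tendsto[OF p]) simp
      then show "(\<lambda>n. Z t * cnj (\<phi> (H t + of_real (s n) * Z t))) \<longlonglongrightarrow> Z t * cnj (\<phi> (H t))"
        by (intro tendsto_intros)
    qed
    show "AE t in circ. norm (Z t * cnj (\<phi> (H t + of_real (s n) * Z t))) \<le>
        2 powr p * (1/2 * cmod (H t) powr p + 1/2 * cmod (Z t) powr p)" for n
    proof (rule AE_I2)
      fix t
      have le: "cmod (H t + of_real (s n) * Z t) \<le> cmod (H t) + cmod (Z t)"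
        using norm_triangle_ineq[of "H t" "of_real (s n) * Z t"] mult_right_mono[OF s(2)[of n] norm_ge_zero[of "Z t"]]
        by (simp add: norm_mult)
      have "norm (Z t * cnj (\<phi> (H t + of_real (s n) * Z t))) = cmod (H t + of_real (s n) * Z t) powr (p - 1) * cmod (Z t)"
        unfolding norm_mult complex_mod_cnj \<phi>_def norm_dual[unfolded norm_mult] by simp
      also have "\<dots> \<le> (cmod (H t) + cmod (Z t)) powr (p - 1) * (cmod (H t) + cmod (Z t)) powr 1"
        by (intro mult_mono powr_mono2) (use le p in auto)
      also have "\<dots> = (cmod (H t) + cmod (Z t)) powr p"
        by (subst powr_add[symmetric]) simp
      also have "\<dots> \<le> 2 powr p * (1/2 * cmod (H t) powr p + 1/2 * cmod (Z t) powr p)"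
        by (rule powr_add_le) (use p in auto)
      finally show "norm (Z t * cnj (\<phi> (H t + of_real (s n) * Z t))) \<le>
        2 powr p * (1/2 * cmod (H t) powr p + 1/2 * cmod (Z t) powr p)" .
    qed
  qed measurable
qed

text \<open>The tangent inequality is taken at the perturbed point, not at h. This bounds the
  increment from above, so minimality of h gives information on the pairing.\<close>

lemma lp_norm_tangent:
  assumes p: "p > 1" and h: "h \<in> Lp p" and z: "z \<in> Lp p"
  shows "lp_norm p (h + lscale (of_real s) z) powr p - lp_norm p h powr p
    \<le> p * s * Re (pairing z (dual_elt p (h + lscale (of_real s) z)))"
proof -
  define v where "v = h + lscale (of_real s) z"
  have v: "v \<in> Lp p" unfolding v_def using h z p by (intro Lp_add Lp_lscale) auto
  have L1: "z * lcnj (dual_elt p v) \<in> Lp 1" by (rule pairing_L1(1)[OF p z dual_elt(1)[OF p v]])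
  then have iR: "integrable circ (\<lambda>t. Re (rep_lfun (z * lcnj (dual_elt p v)) t))"
    unfolding Lp_1_iff by (rule integrable_Re)
  have "lp_norm p v powr p - lp_norm p h powr p = (\<integral>t. cmod (rep_lfun v t) powr p - cmod (rep_lfun h t) powr p \<partial>circ)"
    using p v h by (simp add: lp_norm_powr Lp_iff)
  also have "\<dots> \<le> (\<integral>t. p * s * Re (rep_lfun (z * lcnj (dual_elt p v)) t) \<partial>circ)"
  proof (rule integral_mono_AE)
    show "AE t in circ. cmod (rep_lfun v t) powr p - cmod (rep_lfun h t) powr p
        \<le> p * s * Re (rep_lfun (z * lcnj (dual_elt p v)) t)"
      using rep_lfun_times[of z "lcnj (dual_elt p v)"] rep_lfun_lcnj[of "dual_elt p v"] rep_dual_elt[of p v]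
        rep_lfun_add[of h "lscale (of_real s) z"] rep_lfun_lscale[of "of_real s" z]
    proof eventually_elim
      case (elim t)
      have v: "rep_lfun v t = rep_lfun h t + of_real s * rep_lfun z t" using elim by (simp add: v_def)
      have E: "p * Re (cnj w * (rep_lfun h t - rep_lfun v t)) = - (p * s * Re (rep_lfun z t * cnj w))" for w
        by (simp add: v algebra_simps)
      show ?case
        using powr_tangent[OF p, of "rep_lfun v t" "rep_lfun h t"] unfolding elim(1,2,3) E by linarith
    qed
  qed (use v h iR in \<open>auto simp: Lp_iff\<close>)
  also have "\<dots> = p * s * Re (pairing z (dual_elt p v))"
    using L1 unfolding pairing_def lintegral_eq Lp_1_iff by simp
  finally show ?thesis by (simp add: v_def)
qed

text \<open>Letting the perturbation shrink shows that the real part of the pairing is nonnegative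
  on R; applied to z, -z, i z and -i z it makes the pairing vanish.\<close>

lemma nearest_point:
  assumes p: "p > 1" and R: "closed_subspace p R" and y: "y \<in> Lp p"
  obtains r0 where "r0 \<in> R" "\<And>z. z \<in> R \<Longrightarrow> pairing z (dual_elt p (y - r0)) = 0"
proof -
  note RD = closed_subspaceD[OF R]
  obtain r0 where r0: "r0 \<in> R" "\<And>r. r \<in> R \<Longrightarrow> lp_norm p (y - r0) \<le> lp_norm p (y - r)"
    using nearest_point_exists[OF p R y] by metis
  define h where "h = y - r0"
  have h: "h \<in> Lp p" unfolding h_def using y r0 RD(1) p by (intro Lp_diff) auto
  have Re: "Re (pairing z (dual_elt p h)) \<ge> 0" if z: "z \<in> R" for z
  proof -
    have zL: "z \<in> Lp p" using z RD(1) by auto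
    define s where "s n = 1 / real (Suc n)" for n
    have s: "s \<longlonglongrightarrow> 0" "\<bar>s n\<bar> \<le> 1" "s n > 0" for n
      using LIMSEQ_inverse_real_of_nat by (auto simp: s_def[abs_def] inverse_eq_divide)
    have "0 \<le> Re (pairing z (dual_elt p (h + lscale (of_real (s n)) z)))" for n
    proof -
      have "lp_norm p h \<le> lp_norm p (y - (r0 - lscale (of_real (s n)) z))"
        unfolding h_def by (intro r0 RD(5,6) z)
      then have "lp_norm p h powr p \<le> lp_norm p (h + lscale (of_real (s n)) z) powr p"
        using p by (intro powr_mono2) (auto simp: h_def algebra_simps)
      then have "0 \<le> p * s n * Re (pairing z (dual_elt p (h + lscale (of_real (s n)) z)))"
        using lp_norm_tangent[OF p h zL, of "s n"] by linarith
      moreover have "p * s n > 0" using p s(3)[of n] by simp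
      ultimately show ?thesis by (metis zero_le_mult_iff less_le_not_le)
    qed
    then show ?thesis
      by (intro LIMSEQ_le_const[OF tendsto_Re[OF pairing_dual_elt_tendsto[OF p h zL s(1,2)]]]) auto
  qed
  have "pairing z (dual_elt p h) = 0" if z: "z \<in> R" for z
    using Re[OF z] Re[OF RD(6)[OF z, of "-1"]] Re[OF RD(6)[OF z, of "\<i>"]] Re[OF RD(6)[OF z, of "-\<i>"]]
    unfolding pairing_lscale by (simp add: complex_eq_iff)
  with r0(1) show ?thesis unfolding h_def by (rule that)
qed

lemma annihilator:
  assumes p: "p > 1" and R: "closed_subspace p R" and y: "y \<in> Lp p" "y \<notin> R"
  obtains g where "g \<in> Lp (conj_exp p)" "\<And>z. z \<in> R \<Longrightarrow> pairing z g = 0" "pairing y g \<noteq> 0"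
proof -
  note RD = closed_subspaceD[OF R]
  obtain r0 where r0: "r0 \<in> R" "\<And>z. z \<in> R \<Longrightarrow> pairing z (dual_elt p (y - r0)) = 0"
    using nearest_point[OF p R y(1)] by metis
  define h where "h = y - r0"
  have r0L: "r0 \<in> Lp p" using r0 RD(1) by auto
  have h: "h \<in> Lp p" unfolding h_def using y r0L p by (intro Lp_diff) auto
  have "h \<noteq> 0" using y r0 by (auto simp: h_def)
  then have "lp_norm p h powr p \<noteq> 0" using lp_norm_eq_0_iff[OF h] p by simp
  then have "pairing h (dual_elt p h) \<noteq> 0" by (simp add: dual_elt(3)[OF p h])
  \<comment> \<open>As r0 lies in R and is annihilated, y pairs like h, and h pairs with its dual
    element to the p-th power of its norm.\<close>
  moreover have "pairing y (dual_elt p h) = pairing h (dual_elt p h) + pairing r0 (dual_elt p h)"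
    using pairing_add_left(1)[OF p h r0L dual_elt(1)[OF p h]] by (simp add: h_def)
  ultimately have "pairing y (dual_elt p h) \<noteq> 0" using r0 by (simp add: h_def)
  with dual_elt(1)[OF p h] r0(2) show ?thesis unfolding h_def by (intro that)
qed

definition Lclosure :: "real \<Rightarrow> lfun set \<Rightarrow> lfun set" where
  "Lclosure p V = {f \<in> Lp p. \<forall>e>0. \<exists>g\<in>V. lp_norm p (f - g) < e}"

lemma subset_Lclosure: "V \<subseteq> Lp p \<Longrightarrow> V \<subseteq> Lclosure p V"
  unfolding Lclosure_def by (auto intro!: bexI)

lemma closed_subspace_Lclosure:
  assumes p: "p \<ge> 1" and V: "V \<subseteq> Lp p" "lfun.subspace V"
  shows "closed_subspace p (Lclosure p V)"
  unfolding closed_subspace_def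
proof (intro conjI allI impI)
  show "Lclosure p V \<subseteq> Lp p" by (auto simp: Lclosure_def)
  show "lfun.subspace (Lclosure p V)"
  proof (rule lfun.subspaceI)
    show "0 \<in> Lclosure p V"
      using subset_Lclosure[OF V(1)] lfun.subspace_0[OF V(2)] by auto
  next
    fix x y assume xy: "x \<in> Lclosure p V" "y \<in> Lclosure p V"
    have "\<exists>g\<in>V. lp_norm p (x + y - g) < e" if "e > 0" for e
    proof -
      obtain g h where gh: "g \<in> V" "lp_norm p (x - g) < e / 2" "h \<in> V" "lp_norm p (y - h) < e / 2"
        using xy \<open>e > 0\<close> by (fastforce simp: Lclosure_def dest: spec[of _ "e / 2"])
      have "lp_norm p ((x - g) + (y - h)) \<le> lp_norm p (x - g) + lp_norm p (y - h)"
        by (rule lp_norm_triangle) (use xy gh V p in \<open>auto simp: Lclosure_def intro!: Lp_diff\<close>)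
      then have "lp_norm p (x + y - (g + h)) < e" using gh by (simp add: algebra_simps)
      then show ?thesis using gh lfun.subspace_add[OF V(2)] by blast
    qed
    then show "x + y \<in> Lclosure p V" using xy p by (auto simp: Lclosure_def intro: Lp_add)
  next
    fix c x assume x: "x \<in> Lclosure p V"
    have "\<exists>g\<in>V. lp_norm p (lscale c x - g) < e" if "e > 0" for e
    proof -
      have "e / (cmod c + 1) > 0" using that by (intro divide_pos_pos add_nonneg_pos) auto
      then obtain g where g: "g \<in> V" "lp_norm p (x - g) < e / (cmod c + 1)"
        using x by (auto simp: Lclosure_def)
      have "lp_norm p (lscale c x - lscale c g) = cmod c * lp_norm p (x - g)"
        using p by (simp add: lfun.scale_right_diff_distrib[symmetric] lp_norm_lscale)
      also have "\<dots> \<le> (cmod c + 1) * lp_norm p (x - g)" by (intro mult_right_mono) auto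
      also have "\<dots> < e"
      proof -
        have "cmod c + 1 > 0" by (simp add: add_nonneg_pos)
        then show ?thesis using g(2) by (simp add: pos_less_divide_eq mult.commute)
      qed
      finally show ?thesis using g lfun.subspace_scale[OF V(2)] by blast
    qed
    then show "lscale c x \<in> Lclosure p V" using x by (auto simp: Lclosure_def intro: Lp_lscale)
  qed
next
  fix r y assume *: "(\<forall>n. r n \<in> Lclosure p V) \<and> y \<in> Lp p \<and> (\<lambda>n::nat. lp_norm p (r n - y)) \<longlonglongrightarrow> 0"
  have "\<exists>g\<in>V. lp_norm p (y - g) < e" if "e > 0" for e
  proof -
    have "\<exists>n. lp_norm p (r n - y) < e / 2"
      using LIMSEQ_D[of _ 0 "e / 2"] * \<open>e > 0\<close> by fastforce
    then obtain n where n: "lp_norm p (r n - y) < e / 2" ..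
    obtain g where g: "g \<in> V" "lp_norm p (r n - g) < e / 2"
      using * \<open>e > 0\<close> by (fastforce simp: Lclosure_def dest: spec[of _ "e / 2"])
    have "lp_norm p ((r n - g) - (r n - y)) \<le> lp_norm p (r n - g) + lp_norm p (r n - y)"
      by (rule lp_norm_triangle_diff) (use * g V p in \<open>auto simp: Lclosure_def intro!: Lp_diff\<close>)
    then show ?thesis using n g by (intro bexI[of _ g]) auto
  qed
  then show "y \<in> Lclosure p V" using * by (auto simp: Lclosure_def)
qed

definition trig :: "lfun set" where "trig = lfun.span (range monomial)"

lemma subspace_trig: "lfun.subspace trig"
  by (simp add: trig_def)

lemma trig_Linf: "f \<in> trig \<Longrightarrow> f \<in> Linf"
  unfolding trig_def
  by (induction rule: lfun.span_induct_alt) (auto intro!: Linf_add Linf_lscale)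

lemma trig_Lp: "f \<in> trig \<Longrightarrow> p > 0 \<Longrightarrow> f \<in> Lp p"
  by (intro Linf_imp_Lp trig_Linf)

lemma monomial_trig: "monomial n \<in> trig"
  by (auto simp: trig_def intro: lfun.span_base)

text \<open>An element annihilating all monomials has vanishing Fourier coefficients, hence is 0, so
  the closure of \<open>trig\<close> is everything.\<close>

lemma trig_dense:
  assumes p: "p > 1" and f: "f \<in> Lp p" and e: "e > 0"
  obtains g where "g \<in> trig" "lp_norm p (f - g) < e"
proof -
  have V: "trig \<subseteq> Lp p" using p trig_Lp by auto
  have "f \<in> Lclosure p trig"
  proof (rule ccontr)
    assume "f \<notin> Lclosure p trig"
    then obtain g where g: "g \<in> Lp (conj_exp p)" "\<And>z. z \<in> Lclosure p trig \<Longrightarrow> pairing z g = 0" "pairing f g \<noteq> 0"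
      using annihilator[OF p closed_subspace_Lclosure[OF _ V subspace_trig] f] p by (metis less_imp_le)
    have "fcoeff g n = 0" for n
      using g(2)[of "monomial n"] subset_Lclosure[OF V] monomial_trig[of n] by (auto simp: pairing_monomial)
    then have "g = 0" using g(1) conj_exp[OF p] by (intro lfun_eq_0I Lp_imp_L1[of g]) auto
    with g(3) show False by simp
  qed
  then show ?thesis using e that by (auto simp: Lclosure_def)
qed

section \<open>The bounded inverse theorem\<close>

lemma Metric_space_closed_subspace:
  assumes p: "p \<ge> 1" and H: "closed_subspace p H"
  shows "Metric_space H (\<lambda>f g. lp_norm p (f - g))"
proof
  note HD = closed_subspaceD[OF H]
  have p0: "p > 0" using p by simp
  have HL: "f \<in> Lp p" if "f \<in> H" for f using HD(1) that by auto
  fix x y z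
  show "lp_norm p (x - y) = lp_norm p (y - x)" using p0 by (intro lp_norm_minus_commute)
  assume xy: "x \<in> H" "y \<in> H"
  then show "(lp_norm p (x - y) = 0) = (x = y)"
    using lp_norm_eq_0_iff[of "x - y" p] p0 HL HD(5) by auto
  assume z: "z \<in> H"
  have "lp_norm p ((x - y) + (y - z)) \<le> lp_norm p (x - y) + lp_norm p (y - z)"
    by (intro lp_norm_triangle HL HD(5) xy z p)
  then show "lp_norm p (x - z) \<le> lp_norm p (x - y) + lp_norm p (y - z)" by simp
qed simp

text \<open>The open mapping argument: Baire's theorem gives a ball in which images of bounded sets
  are dense, scaling gives approximate solutions with control, and iterating on the residual gives
  exact ones. The metric lives on the carrier H because the norm depends on the exponent.\<close>

lemma bounded_inverse:
  assumes p: "p > 1" and H: "closed_subspace p H"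
    and T: "\<And>f. f \<in> H \<Longrightarrow> T f \<in> H" "\<And>f g. f \<in> H \<Longrightarrow> g \<in> H \<Longrightarrow> T (f + g) = T f + T g"
      "\<And>c f. f \<in> H \<Longrightarrow> T (lscale c f) = lscale c (T f)"
      "\<And>f. f \<in> H \<Longrightarrow> lp_norm p (T f) \<le> C * lp_norm p f"
    and inj: "\<And>f. f \<in> H \<Longrightarrow> T f = 0 \<Longrightarrow> f = 0"
    and surj: "\<And>f. f \<in> H \<Longrightarrow> \<exists>g\<in>H. T g = f"
  obtains K where "K \<ge> 0" "\<And>f. f \<in> H \<Longrightarrow> lp_norm p f \<le> K * lp_norm p (T f)"
proof -
  note HD = closed_subspaceD[OF H]
  have p1: "p \<ge> 1" "p > 0" using p by auto
  have HL: "f \<in> Lp p" if "f \<in> H" for f using HD(1) that by auto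
  have Td: "T (f - g) = T f - T g" if "f \<in> H" "g \<in> H" for f g
    using T(2)[of f "lscale (-1) g"] T(3)[OF that(2), of "-1"] HD(6)[OF that(2), of "-1"] that by simp
  interpret M: Metric_space H "\<lambda>f g. lp_norm p (f - g)"
    by (rule Metric_space_closed_subspace[OF p1(1) H])
  have complete: "M.mcomplete"
    unfolding M.mcomplete_def
  proof (intro allI impI)
    fix \<sigma> assume \<sigma>: "M.MCauchy \<sigma>"
    then have m: "\<sigma> n \<in> H" for n by (auto simp: M.MCauchy_def)
    obtain g where g: "g \<in> Lp p" "(\<lambda>n. lp_norm p (\<sigma> n - g)) \<longlonglongrightarrow> 0"
      using Lp_complete[of \<sigma> p] HL[OF m] p1 \<sigma> unfolding M.MCauchy_def by metis
    have "g \<in> H" by (rule HD(7)[OF m g])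
    moreover have "\<exists>N. \<forall>n\<ge>N. lp_norm p (\<sigma> n - g) < e" if "e > 0" for e
      using LIMSEQ_D[OF g(2) that] by simp
    ultimately show "\<exists>x. limitin M.mtopology \<sigma> x sequentially"
      using m by (intro exI[of _ g]) (auto simp: M.limit_metric_sequentially)
  qed
  define E where "E n = T ` {x \<in> H. lp_norm p x \<le> real n}" for n
  have EH: "E n \<subseteq> H" for n using T(1) by (auto simp: E_def)
  have un: "(\<Union>n. M.mtopology closure_of E n) = H"
  proof
    show "(\<Union>n. M.mtopology closure_of E n) \<subseteq> H"
      by (auto simp: M.metric_closure_of)
    show "H \<subseteq> (\<Union>n. M.mtopology closure_of E n)"
    proof
      fix y assume "y \<in> H"
      then obtain x where x: "x \<in> H" "T x = y" using surj by blast
      obtain n where "lp_norm p x \<le> real n" using real_arch_simple by blast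
      then have "y \<in> E n" using x by (auto simp: E_def)
      then have "y \<in> M.mtopology closure_of E n"
        using closure_of_subset[of "E n" M.mtopology] EH by auto
      then show "y \<in> (\<Union>n. M.mtopology closure_of E n)" by blast
    qed
  qed
  have "\<exists>n. M.mtopology interior_of (M.mtopology closure_of E n) \<noteq> {}"
  proof (rule ccontr)
    assume "\<not> ?thesis"
    then have "M.mtopology interior_of \<Union>(range (\<lambda>n. M.mtopology closure_of E n)) = {}"
      by (intro M.metric_Baire_category_alt complete) auto
    then have "M.mtopology interior_of H = {}" using un by simp
    then show False using HD(3) interior_of_topspace[of M.mtopology] by auto
  qed
  then obtain n y0 where "y0 \<in> M.mtopology interior_of (M.mtopology closure_of E n)" by blast
  then obtain r where y0: "y0 \<in> H" and r: "r > 0" "M.mball y0 r \<subseteq> M.mtopology closure_of E n"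
    by (auto simp: M.in_interior_of_mball)
  have near: "\<exists>x\<in>H. lp_norm p x \<le> real n \<and> lp_norm p (y - T x) < d"
    if "y \<in> H" "lp_norm p (y0 - y) < r" "d > 0" for y d
  proof -
    have "y \<in> M.mtopology closure_of E n" using r(2) that y0 by (auto simp: M.in_mball)
    then show ?thesis using that by (auto simp: M.metric_closure_of E_def M.in_mball)
  qed
  \<comment> \<open>Subtracting the approximations of y0 - z and of y0 moves the ball to the origin,
    at the cost of doubling the bound n.\<close>
  have A: "\<exists>x\<in>H. lp_norm p x \<le> 2 * real n \<and> lp_norm p (z - T x) < d"
    if z: "z \<in> H" "lp_norm p z < r" and d: "d > 0" for z d
  proof -
    obtain x1 where x1: "x1 \<in> H" "lp_norm p x1 \<le> real n" "lp_norm p (y0 - z - T x1) < d / 2"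
      using near[of "y0 - z" "d / 2"] z d y0 HD(5) by auto
    obtain x2 where x2: "x2 \<in> H" "lp_norm p x2 \<le> real n" "lp_norm p (y0 - T x2) < d / 2"
      using near[of y0 "d / 2"] d y0 r by auto
    have "lp_norm p ((y0 - T x2) - (y0 - z - T x1)) \<le> lp_norm p (y0 - T x2) + lp_norm p (y0 - z - T x1)"
      by (intro lp_norm_triangle_diff HL HD(5) y0 z x1 x2 T p1)
    then have "lp_norm p (z - T (x2 - x1)) < d"
      using x1 x2 by (simp add: Td algebra_simps)
    moreover have "lp_norm p (x2 - x1) \<le> 2 * real n"
      using lp_norm_triangle_diff[OF HL[OF x2(1)] HL[OF x1(1)] p1(1)] x1 x2 by simp
    ultimately show ?thesis using HD(5)[OF x2(1) x1(1)] by blast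
  qed
  \<comment> \<open>Scaling z to norm r/2, solving there with bound 2 n and scaling back produces
    this factor.\<close>
  define K where "K = 4 * real n / r"
  have K: "K \<ge> 0" using r by (simp add: K_def)
  have B: "\<exists>x\<in>H. lp_norm p x \<le> K * lp_norm p z \<and> lp_norm p (z - T x) \<le> lp_norm p z / 2" if z: "z \<in> H" for z
  proof (cases "z = 0")
    case True
    then show ?thesis using T(3)[OF HD(3), of 0] HD(3) by (intro bexI[of _ 0]) auto
  next
    case False
    then have nz: "lp_norm p z > 0" using lp_norm_eq_0_iff[OF HL[OF z] p1(2)] lp_norm_nonneg[of p z] by (auto simp: less_le)
    define c where "c = r / (2 * lp_norm p z)"
    have c: "c > 0" using nz r by (simp add: c_def)
    have "lp_norm p (lscale (of_real c) z) = c * lp_norm p z"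
      using c p1 by (simp add: lp_norm_lscale)
    also have "c * lp_norm p z = r / 2" using nz by (simp add: c_def)
    finally have "lp_norm p (lscale (of_real c) z) = r / 2" .
    then obtain x where x: "x \<in> H" "lp_norm p x \<le> 2 * real n" "lp_norm p (lscale (of_real c) z - T x) < c * (lp_norm p z / 2)"
      using A[of "lscale (of_real c) z" "c * (lp_norm p z / 2)"] HD(6)[OF z] r c nz by auto
    define x' where "x' = lscale (of_real (1 / c)) x"
    have "z - T x' = lscale (of_real (1 / c)) (lscale (of_real c) z - T x)"
      using c x by (simp add: x'_def T(3) lfun.scale_right_diff_distrib)
    then have "lp_norm p (z - T x') = lp_norm p (lscale (of_real c) z - T x) / c"
      using c p1 by (simp add: lp_norm_lscale norm_divide)
    then have "lp_norm p (z - T x') \<le> lp_norm p z / 2" using x(3) c by (simp add: pos_divide_le_eq mult.commute less_imp_le)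
    moreover have "lp_norm p x' = lp_norm p x / c" using c p1 by (simp add: x'_def lp_norm_lscale norm_divide)
    then have "lp_norm p x' \<le> 2 * real n / c" using x c by (simp add: divide_right_mono)
    moreover have "2 * real n / c = K * lp_norm p z" using nz r by (simp add: c_def K_def)
    ultimately show ?thesis using HD(6)[OF x(1)] by (auto simp: x'_def)
  qed
  then obtain W where W: "\<And>z. z \<in> H \<Longrightarrow> W z \<in> H" "\<And>z. z \<in> H \<Longrightarrow> lp_norm p (W z) \<le> K * lp_norm p z"
    "\<And>z. z \<in> H \<Longrightarrow> lp_norm p (z - T (W z)) \<le> lp_norm p z / 2" by metis
  have main: "\<exists>x\<in>H. T x = z \<and> lp_norm p x \<le> 2 * K * lp_norm p z" if z: "z \<in> H" for z
  proof -
    \<comment> \<open>The residuals, each at most half of the preceding one; the corrections W (Z k)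
      then sum to an exact solution with the geometric factor 2.\<close>
    define Z where "Z = rec_nat z (\<lambda>_ u. u - T (W u))"
    have Z0: "Z 0 = z" and ZS: "Z (Suc k) = Z k - T (W (Z k))" for k by (simp_all add: Z_def)
    have ZH: "Z k \<in> H" for k by (induction k) (auto simp: Z0 ZS z intro!: HD(5) T W)
    have Zn: "lp_norm p (Z k) \<le> lp_norm p z * (1/2) ^ k" for k
      by (induction k) (use W(3)[OF ZH] in \<open>auto simp: Z0 ZS intro: order_trans\<close>)
    define x where "x m = (\<Sum>k<m. W (Z k))" for m
    have subH: "sum f I \<in> H" if "\<And>i. i \<in> I \<Longrightarrow> f i \<in> H" for f and I :: "nat set"
      using that HD(2) by (intro lfun.subspace_sum) auto
    have xH: "x m \<in> H" for m unfolding x_def by (intro subH W ZH)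
    have Wn: "lp_norm p (W (Z k)) \<le> K * lp_norm p z * (1/2) ^ k" for k
      using W(2)[OF ZH, of k] mult_left_mono[OF Zn[of k] K] by (simp add: mult.assoc)
    have Tx: "T (x m) = z - Z m" for m
    proof (induction m)
      case 0
      show ?case using T(3)[OF HD(3), of 0] by (simp add: x_def Z0)
    next
      case (Suc m)
      have "T (x (Suc m)) = T (x m) + T (W (Z m))"
        using T(2)[OF xH[of m] W(1)[OF ZH[of m]]] by (simp add: x_def)
      then show ?case using Suc by (simp add: ZS)
    qed
    have geo: "(\<Sum>k\<in>{m..<m'}. (1/2::real) ^ k) \<le> 2 * (1/2) ^ m" for m m'
    proof (cases "m \<le> m'")
      case True
      then have "(\<Sum>k\<in>{m..<m'}. (1/2::real) ^ k) = 2 * (1/2) ^ m - 2 * (1/2) ^ m'"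
        by (induction rule: dec_induct) (auto simp: sum.atLeastLessThan_Suc)
      then show ?thesis by simp
    qed simp
    have diff: "lp_norm p (x m' - x m) \<le> 2 * (K * lp_norm p z) * (1/2) ^ m" if "m \<le> m'" for m m'
    proof -
      have "x m' - x m = (\<Sum>k\<in>{m..<m'}. W (Z k))"
        unfolding x_def using that by (simp add: lessThan_atLeast0 sum_diff_nat_ivl)
      also have "lp_norm p \<dots> \<le> (\<Sum>k\<in>{m..<m'}. lp_norm p (W (Z k)))"
        by (rule lp_norm_sum_le) (auto intro: HL W ZH p1)
      also have "\<dots> \<le> (\<Sum>k\<in>{m..<m'}. K * lp_norm p z * (1/2) ^ k)" by (intro sum_mono Wn)
      also have "\<dots> = K * lp_norm p z * (\<Sum>k\<in>{m..<m'}. (1/2) ^ k)" by (rule sum_distrib_left[symmetric])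
      also have "\<dots> \<le> K * lp_norm p z * (2 * (1/2) ^ m)" using K by (intro mult_left_mono geo) auto
      finally show ?thesis by simp
    qed
    have pow0: "(\<lambda>m. c * (1/2) ^ m) \<longlonglongrightarrow> 0" for c :: real
      by (intro tendsto_mult_right_zero LIMSEQ_realpow_zero) auto
    obtain g where g: "g \<in> Lp p" "(\<lambda>m. lp_norm p (x m - g)) \<longlonglongrightarrow> 0"
    proof (rule Lp_complete[of x p])
      fix e :: real assume "e > 0"
      then obtain N where N: "\<And>m. m \<ge> N \<Longrightarrow> \<bar>2 * (K * lp_norm p z) * (1/2) ^ m\<bar> < e"
        using LIMSEQ_D[OF pow0, of e "2 * (K * lp_norm p z)"] by auto
      have "lp_norm p (x m - x k) < e" if "m \<ge> N" "k \<ge> N" for m k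
      proof (cases "m \<le> k")
        case True
        then show ?thesis using diff[OF True] N[OF that(1)] lp_norm_minus_commute[OF p1(2), of "x m" "x k"] by linarith
      next
        case False
        then show ?thesis using diff[of k m] N[OF that(2)] by linarith
      qed
      then show "\<exists>N. \<forall>m\<ge>N. \<forall>n\<ge>N. lp_norm p (x m - x n) < e" by blast
    qed (auto intro: HL xH p1)
    have gH: "g \<in> H" by (rule HD(7)[OF xH g])
    have xg: "x m - g \<in> H" for m by (intro HD(5) xH gH)
    have "lp_norm p (T g - z) \<le> C * lp_norm p (x m - g) + lp_norm p z * (1/2) ^ m" for m
    proof -
      have "T g - z = (T (x m) - z) - (T (x m) - T g)" by simp
      also have "\<dots> = (- Z m) - T (x m - g)" unfolding Tx[of m, symmetric] by (simp add: Td xH gH Tx)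
      also have "lp_norm p \<dots> \<le> lp_norm p (- Z m) + lp_norm p (T (x m - g))"
        by (intro lp_norm_triangle_diff Lp_uminus HL ZH T xg p1)
      also have "\<dots> \<le> lp_norm p z * (1/2) ^ m + C * lp_norm p (x m - g)"
        using Zn[of m] T(4)[OF xg[of m]] p1 by (simp add: lp_norm_uminus add_mono)
      finally show ?thesis by simp
    qed
    moreover have "(\<lambda>m. C * lp_norm p (x m - g) + lp_norm p z * (1/2) ^ m) \<longlonglongrightarrow> C * 0 + 0"
      by (intro tendsto_add tendsto_mult tendsto_const g(2) pow0)
    ultimately have "lp_norm p (T g - z) \<le> 0"
      by (intro LIMSEQ_le_const[of _ 0]) auto
    then have Tg: "T g = z"
      using lp_norm_eq_0_iff[of "T g - z" p] lp_norm_nonneg[of p "T g - z"] HL[OF HD(5)[OF T(1)[OF gH] z]] p1 by auto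
    have "lp_norm p g \<le> 2 * K * lp_norm p z + lp_norm p (x m - g)" for m
    proof -
      have "lp_norm p (x m - (x m - g)) \<le> lp_norm p (x m) + lp_norm p (x m - g)"
        by (intro lp_norm_triangle_diff HL xH xg p1)
      moreover have "lp_norm p (x m) \<le> 2 * K * lp_norm p z" using diff[of 0 m] by (simp add: x_def)
      ultimately show ?thesis by simp
    qed
    moreover have "(\<lambda>m. 2 * K * lp_norm p z + lp_norm p (x m - g)) \<longlonglongrightarrow> 2 * K * lp_norm p z + 0"
      by (intro tendsto_add tendsto_const g(2))
    ultimately have "lp_norm p g \<le> 2 * K * lp_norm p z"
      by (intro LIMSEQ_le_const[of _ "2 * K * lp_norm p z"]) auto
    with gH Tg show ?thesis by blast
  qed
  show ?thesis
  proof (rule that[of "2 * K"])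
    fix f assume f: "f \<in> H"
    obtain x where x: "x \<in> H" "T x = T f" "lp_norm p x \<le> 2 * K * lp_norm p (T f)"
      using main[OF T(1)[OF f]] by blast
    have "T (x - f) = 0" using x f by (simp add: Td)
    then have "x = f" using inj[OF HD(5)[OF x(1) f]] by simp
    with x show "lp_norm p f \<le> 2 * K * lp_norm p (T f)" by simp
  qed (use K in simp)
qed

section \<open>The Riesz projection\<close>

lemma Riesz_P_eqI:
  assumes "h \<in> Lp 1" "\<And>n. fcoeff h n = (if n \<ge> 0 then fcoeff f n else 0)"
  shows "Riesz_P f = h"
  unfolding Riesz_P_def
proof (rule the_equality)
  fix g assume "g \<in> Lp 1 \<and> (\<forall>n. fcoeff g n = (if n \<ge> 0 then fcoeff f n else 0))"
  then show "g = h" using assms by (intro lfun_eqI_fcoeff) auto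
qed (use assms in auto)

lemma Lp_monomial: "p > 0 \<Longrightarrow> monomial n \<in> Lp p"
  by (rule Linf_imp_Lp) auto

lemma Lp_const: "p > 0 \<Longrightarrow> lscale c 1 \<in> Lp p"
  by (rule Linf_imp_Lp) (auto intro: Linf_lscale)

lemma fcoeff_one: "fcoeff 1 n = (if n = 0 then 1 else 0)"
  using fcoeff_monomial[of 0 n] by simp

lemma finite_fcoeff_trig:
  assumes "f \<in> trig" shows "finite {k. fcoeff f k \<noteq> 0}"
proof -
  have "f \<in> Lp 1 \<and> finite {k. fcoeff f k \<noteq> 0}"
    using assms unfolding trig_def
  proof (induction rule: lfun.span_induct_alt)
    case (step c x y)
    then obtain m where m: "x = monomial m" by auto
    have "{k. fcoeff (lscale c x + y) k \<noteq> 0} \<subseteq> insert m {k. fcoeff y k \<noteq> 0}"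
      using step by (auto simp: m fcoeff_add Lp_lscale Lp_monomial fcoeff_lscale fcoeff_monomial split: if_splits)
    then show ?case using step m finite_subset by (auto intro!: Lp_add Lp_lscale Lp_monomial)
  qed auto
  then show ?thesis ..
qed

lemma trig_expand:
  assumes "f \<in> trig" "finite S" "{k. fcoeff f k \<noteq> 0} \<subseteq> S"
  shows "f = (\<Sum>k\<in>S. lscale (fcoeff f k) (monomial k))"
proof (rule lfun_eqI_fcoeff)
  show "f \<in> Lp 1" using assms by (intro trig_Lp) auto
  show "(\<Sum>k\<in>S. lscale (fcoeff f k) (monomial k)) \<in> Lp 1"
    by (intro Lp_sum Lp_lscale Lp_monomial) auto
  fix n
  have "fcoeff (\<Sum>k\<in>S. lscale (fcoeff f k) (monomial k)) n = (\<Sum>k\<in>S. if n = k then fcoeff f k else 0)"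
    by (subst fcoeff_sum) (auto intro!: Lp_lscale Lp_monomial sum.cong simp: fcoeff_lscale fcoeff_monomial)
  also have "\<dots> = fcoeff f n" using assms by (auto simp: sum.delta')
  finally show "fcoeff f n = fcoeff (\<Sum>k\<in>S. lscale (fcoeff f k) (monomial k)) n" ..
qed

lemma trig_sum: "(\<And>i. i \<in> I \<Longrightarrow> f i \<in> trig) \<Longrightarrow> sum f I \<in> trig"
  using subspace_trig by (intro lfun.subspace_sum) auto

lemma Riesz_P_trig:
  assumes "f \<in> trig"
  shows "Riesz_P f \<in> trig" "fcoeff (Riesz_P f) n = (if n \<ge> 0 then fcoeff f n else 0)"
proof -
  define S where "S = {k. fcoeff f k \<noteq> 0}"
  have S: "finite S" unfolding S_def by (rule finite_fcoeff_trig[OF assms])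
  define h where "h = (\<Sum>k\<in>S \<inter> {0..}. lscale (fcoeff f k) (monomial k))"
  have h: "h \<in> trig" unfolding h_def
    by (intro trig_sum lfun.subspace_scale[OF subspace_trig] monomial_trig)
  have coeff: "fcoeff h n = (if n \<ge> 0 then fcoeff f n else 0)" for n
  proof -
    have "fcoeff h n = (\<Sum>k\<in>S \<inter> {0..}. if n = k then fcoeff f k else 0)"
      unfolding h_def
      by (subst fcoeff_sum) (auto intro!: Lp_lscale Lp_monomial sum.cong simp: fcoeff_lscale fcoeff_monomial)
    also have "\<dots> = (if n \<ge> 0 then fcoeff f n else 0)" using S by (auto simp: sum.delta' S_def)
    finally show ?thesis .
  qed
  have "Riesz_P f = h" using h coeff by (intro Riesz_P_eqI trig_Lp) auto
  with h coeff show "Riesz_P f \<in> trig" "fcoeff (Riesz_P f) n = (if n \<ge> 0 then fcoeff f n else 0)" by auto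
qed

lemma pairing_trig:
  assumes f: "f \<in> trig" and g: "g \<in> Lp 1" and S: "finite S" "{k. fcoeff f k \<noteq> 0} \<subseteq> S"
  shows "pairing f g = (\<Sum>k\<in>S. fcoeff f k * cnj (fcoeff g k))"
proof -
  have L1: "lscale c (monomial k) * lcnj g \<in> Lp 1" for c k
    using Lp_monomial_times[OF _ Lp_lcnj[OF g], of k] by (simp add: lscale_times_left Lp_lscale)
  have *: "sum h I * lcnj g \<in> Lp 1 \<and> pairing (sum h I) g = (\<Sum>k\<in>I. pairing (h k) g)"
    if "\<And>k. k \<in> I \<Longrightarrow> h k * lcnj g \<in> Lp 1" "finite I" for h and I :: "int set"
    using that(2,1) by (induction I) (auto simp: pairing_def distrib_right lintegral_add Lp_add)
  have "pairing f g = (\<Sum>k\<in>S. pairing (lscale (fcoeff f k) (monomial k)) g)"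
    by (subst trig_expand[OF f S]) (use *[of S "\<lambda>k. lscale (fcoeff f k) (monomial k)"] L1 S in simp)
  then show ?thesis by (simp add: pairing_lscale pairing_monomial)
qed

text \<open>The element h stands for the projection of g. It is a hypothesis because at this stage
  the projection is controlled on trigonometric polynomials only.\<close>

lemma pairing_Riesz_trig:
  assumes f: "f \<in> trig" and g: "g \<in> Lp 1" and h: "h \<in> Lp 1" "\<And>n. fcoeff h n = (if n \<ge> 0 then fcoeff g n else 0)"
  shows "pairing (Riesz_P f) g = pairing f h"
proof -
  define S where "S = {k. fcoeff f k \<noteq> 0}"
  have S: "finite S" unfolding S_def by (rule finite_fcoeff_trig[OF f])
  have "pairing (Riesz_P f) g = (\<Sum>k\<in>S. fcoeff (Riesz_P f) k * cnj (fcoeff g k))"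
    by (rule pairing_trig) (use Riesz_P_trig[OF f] g S in \<open>auto simp: S_def split: if_splits\<close>)
  also have "\<dots> = (\<Sum>k\<in>S. fcoeff f k * cnj (fcoeff h k))"
    by (intro sum.cong refl) (auto simp: Riesz_P_trig[OF f] h)
  also have "\<dots> = pairing f h"
    by (rule pairing_trig[symmetric]) (use f h S in \<open>auto simp: S_def\<close>)
  finally show ?thesis .
qed

section \<open>Boundedness of the Riesz projection\<close>

lemma lp_norm_2_pairing: "of_real ((lp_norm 2 f)\<^sup>2) = pairing f f"
proof -
  have "AE t in circ. rep_lfun (f * lcnj f) t = of_real (cmod (rep_lfun f t) powr 2)"
    using rep_lfun_times[of f "lcnj f"] rep_lfun_lcnj[of f]
    by eventually_elim (simp add: complex_norm_square[symmetric])
  then have "pairing f f = (\<integral>t. complex_of_real (cmod (rep_lfun f t) powr 2) \<partial>circ)"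
    unfolding pairing_def by (intro lintegral_cong) auto
  also have "\<dots> = of_real (lp_norm 2 f powr 2)"
    unfolding integral_complex_of_real by (subst lp_norm_powr) auto
  finally show ?thesis by simp
qed

lemma lp_norm_2_Riesz_P:
  assumes f: "f \<in> trig"
  shows "lp_norm 2 (Riesz_P f) \<le> lp_norm 2 f"
proof -
  define g where "g = Riesz_P f"
  define h where "h = f - g"
  have g: "g \<in> trig" using Riesz_P_trig[OF f] by (simp add: g_def)
  have h: "h \<in> trig" unfolding h_def by (intro lfun.subspace_diff[OF subspace_trig] f g)
  have L: "f \<in> Lp 1" "g \<in> Lp 1" "h \<in> Lp 1" "f \<in> Lp 2" "g \<in> Lp 2" "h \<in> Lp 2"
    using f g h trig_Lp by auto
  have gh: "pairing g h = 0"
  proof -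
    have "pairing g h = (\<Sum>k\<in>{k. fcoeff g k \<noteq> 0}. fcoeff g k * cnj (fcoeff h k))"
      by (rule pairing_trig) (use g L finite_fcoeff_trig[OF g] in auto)
    also have "\<dots> = 0"
    proof (intro sum.neutral ballI)
      fix k
      have "fcoeff h k = fcoeff f k - fcoeff g k" by (simp add: h_def fcoeff_diff L)
      then show "fcoeff g k * cnj (fcoeff h k) = 0" by (simp add: g_def Riesz_P_trig[OF f])
    qed
    finally show ?thesis .
  qed
  then have hg: "pairing h g = 0" using pairing_commute[of h g] by simp
  have two: "conj_exp 2 = (2::real)" by (simp add: conj_exp_def)
  have "pairing f f = pairing (g + h) g + pairing (g + h) h"
    using pairing_add_right(1)[of 2 "g + h" g h] L by (simp add: two h_def)
  also have "\<dots> = pairing g g + pairing h h"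
    using pairing_add_left(1)[of 2 g h g] pairing_add_left(1)[of 2 g h h] L gh hg by (simp add: two)
  finally have "complex_of_real ((lp_norm 2 f)\<^sup>2) = of_real ((lp_norm 2 g)\<^sup>2 + (lp_norm 2 h)\<^sup>2)"
    by (simp add: lp_norm_2_pairing[symmetric])
  then have "(lp_norm 2 f)\<^sup>2 = (lp_norm 2 g)\<^sup>2 + (lp_norm 2 h)\<^sup>2" by (simp only: of_real_eq_iff)
  then have "(lp_norm 2 g)\<^sup>2 \<le> (lp_norm 2 f)\<^sup>2" by simp
  then show ?thesis unfolding g_def by (rule power2_le_imp_le) simp
qed

text \<open>The pointwise inequality behind Riesz' theorem: it bounds \<open>\<bar>F\<bar>\<^sup>p\<close> for an analytic function \<open>F\<close>
  with positive real part by \<open>(Re F)\<^sup>p\<close> up to a multiple of \<open>Re F\<^sup>p\<close>, whose mean is known.\<close>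

lemma Riesz_pointwise:
  fixes p :: real
  assumes p: "1 < p" "p \<le> 2"
  obtains A B where "A \<ge> 0" "B \<ge> 0"
    "\<And>z. Re z > 0 \<Longrightarrow> cmod z powr p \<le> A * Re z powr p - B * Re (z powr of_real p)"
proof -
  \<comment> \<open>The value for which p \<gamma> is the midpoint of pi/2 and p pi/2: it is above
    pi/2, where the cosine is negative, and below pi because p \<le> 2.\<close>
  define \<gamma> where "\<gamma> = pi * (p + 1) / (4 * p)"
  have pg: "p * \<gamma> = pi * (p + 1) / 4" using p by (simp add: \<gamma>_def)
  have g: "0 < \<gamma>" "\<gamma> < pi / 2" using p by (auto simp: \<gamma>_def field_simps intro: add_pos_pos)
  have pgb: "pi / 2 < p * \<gamma>" "p * \<gamma> < pi" unfolding pg using p by (auto simp: field_simps)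
  define \<eta> where "\<eta> = - cos (p * \<gamma>)"
  have eta: "\<eta> > 0"
    using cos_monotone_0_pi[of "pi / 2" "p * \<gamma>"] pgb by (simp add: \<eta>_def)
  have cg: "cos \<gamma> > 0" using g by (intro cos_gt_zero) auto
  \<comment> \<open>For angles from \<gamma> to pi/2 the term with B alone contributes at least 1.
    For smaller angles cos \<theta> \<ge> cos \<gamma>, and A is made to outweigh 1 + B.\<close>
  define B where "B = 1 / \<eta>"
  define A where "A = (1 + B) / cos \<gamma> powr p"
  have B: "B > 0" and A: "A > 0" using eta cg by (auto simp: A_def B_def add_pos_pos)
  have key: "1 \<le> A * cos \<theta> powr p - B * cos (p * \<theta>)" if th: "0 \<le> \<theta>" "\<theta> \<le> pi / 2" for \<theta>
  proof (cases "\<theta> \<ge> \<gamma>")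
    case True
    have "p * \<theta> \<le> 2 * (pi / 2)" using p th by (intro mult_mono) auto
    then have "cos (p * \<theta>) \<le> cos (p * \<gamma>)"
      using True p g by (intro cos_monotone_0_pi_le mult_left_mono) auto
    then have "B * cos (p * \<theta>) \<le> B * (- \<eta>)" using B by (intro mult_left_mono) (auto simp: \<eta>_def)
    also have "B * (- \<eta>) = - 1" using eta by (simp add: B_def)
    finally show ?thesis using A by (smt (verit) mult_nonneg_nonneg powr_ge_zero)
  next
    case False
    have "cos \<gamma> \<le> cos \<theta>" using False th g by (intro cos_monotone_0_pi_le) auto
    then have "cos \<gamma> powr p \<le> cos \<theta> powr p" using cg p by (intro powr_mono2) auto
    then have "A * cos \<gamma> powr p \<le> A * cos \<theta> powr p" using A by (intro mult_left_mono) auto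
    moreover have "A * cos \<gamma> powr p = 1 + B" using cg by (simp add: A_def)
    moreover have "B * cos (p * \<theta>) \<le> B * 1" using B by (intro mult_left_mono) auto
    ultimately show ?thesis by linarith
  qed
  show ?thesis
  proof (rule that[of A B])
    fix z :: complex assume z: "Re z > 0"
    then have nz: "z \<noteq> 0" by auto
    define r where "r = cmod z"
    define \<theta> where "\<theta> = \<bar>Im (Ln z)\<bar>"
    have r: "r > 0" using nz by (simp add: r_def)
    have th: "0 \<le> \<theta>" "\<theta> \<le> pi / 2" using Re_Ln_pos_lt[OF nz] z by (auto simp: \<theta>_def)
    have rez: "Re z = r * cos \<theta>"
    proof -
      have "Re z = Re (exp (Ln z))" using nz by simp
      also have "\<dots> = r * cos \<theta>" using nz unfolding Re_exp \<theta>_def r_def by simp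
      finally show ?thesis .
    qed
    have "Re (z powr of_real p) = Re (exp (of_real p * Ln z))" using nz by (simp add: powr_def)
    also have "\<dots> = exp (p * ln r) * cos (p * Im (Ln z))" using nz by (simp add: Re_exp r_def)
    also have "exp (p * ln r) = r powr p" using r by (simp add: powr_def)
    also have "cos (p * Im (Ln z)) = cos (p * \<theta>)" by (simp add: \<theta>_def abs_if)
    finally have rep: "Re (z powr of_real p) = r powr p * cos (p * \<theta>)" .
    have "cos \<theta> \<ge> 0" using th by (intro cos_ge_zero) auto
    then have rp: "Re z powr p = r powr p * cos \<theta> powr p" unfolding rez using r by (simp add: powr_mult)
    have "r powr p * 1 \<le> r powr p * (A * cos \<theta> powr p - B * cos (p * \<theta>))"
      using key[OF th] by (intro mult_left_mono) auto
    then show "cmod z powr p \<le> A * Re z powr p - B * Re (z powr of_real p)"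
      unfolding rp rep r_def[symmetric] by (simp add: algebra_simps)
  qed (use A B in auto)
qed

text \<open>For functions like a principal power that are well behaved on the closed disc only:
  cutting off by the indicator makes them Borel on the plane without changing them on the
  circle.\<close>

lemma circ_mean_value_cball:
  assumes cont: "continuous_on (cball 0 1) G" and hol: "G holomorphic_on ball 0 1"
  shows "(\<integral>t. indicator (cball 0 1) t *\<^sub>R G t \<partial>circ) = G 0"
proof -
  have "(\<lambda>t. indicator (cball 0 1) t *\<^sub>R G t) \<in> borel_measurable borel"
    by (rule borel_measurable_continuous_on_indicator) (use cont in auto)
  moreover have "continuous_on (cball 0 1) (\<lambda>t. indicator (cball 0 1) t *\<^sub>R G t)"
    by (rule continuous_on_eq[OF cont]) simp
  moreover have "(\<lambda>t. indicator (cball 0 1) t *\<^sub>R G t) holomorphic_on ball 0 1"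
    by (rule holomorphic_transform[OF hol]) simp
  ultimately show ?thesis using circ_mean_value by fastforce
qed

text \<open>The maximum principle spreads Re F > 0 from the circle to the disc, so F^p is analytic
  there with mean F(0)^p. As F(0) is real and positive, this mean enters with a favourable sign and
  is dropped.\<close>

lemma Riesz_analytic:
  fixes p :: real
  assumes p: "1 < p" "p \<le> 2"
  obtains A where "A \<ge> 0"
    "\<And>F. F holomorphic_on UNIV \<Longrightarrow> F 0 \<in> \<real> \<Longrightarrow> (\<And>t. cmod t = 1 \<Longrightarrow> Re (F t) > 0) \<Longrightarrow>
      (\<integral>t. cmod (F t) powr p \<partial>circ) \<le> A * (\<integral>t. Re (F t) powr p \<partial>circ)"
proof -
  obtain A B where AB: "A \<ge> 0" "B \<ge> 0"
    "\<And>z. Re z > 0 \<Longrightarrow> cmod z powr p \<le> A * Re z powr p - B * Re (z powr of_real p)"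
    using Riesz_pointwise[OF p] by metis
  show ?thesis
  proof (rule that[OF AB(1)])
    fix F assume hol: "F holomorphic_on UNIV" and F0: "F 0 \<in> \<real>" and pos: "\<And>t. cmod t = 1 \<Longrightarrow> Re (F t) > 0"
    have cont: "continuous_on S F" for S
      using holomorphic_on_imp_continuous_on[OF hol] continuous_on_subset by blast
    have [measurable]: "F \<in> borel_measurable borel" by (intro borel_measurable_continuous_onI cont)
    have "continuous_on (sphere 0 1) (\<lambda>t. Re (F t))" by (intro continuous_intros cont)
    then obtain t0 where t0: "t0 \<in> sphere 0 1" "\<And>t. t \<in> sphere 0 1 \<Longrightarrow> Re (F t0) \<le> Re (F t)"
      using continuous_attains_inf[OF compact_sphere, of 0 1 "\<lambda>t. Re (F t)"] by auto
    define m where "m = Re (F t0)"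
    have m: "m > 0" using pos t0 by (simp add: m_def)
    have posc: "Re (F z) > 0" if "z \<in> cball 0 1" for z
    proof -
      have "Re (- F z) \<le> - m"
      proof (rule maximum_real_frontier[where S = "cball 0 1" and f = "\<lambda>z. - F z"])
        show "(\<lambda>z. - F z) holomorphic_on interior (cball 0 1)"
          using hol holomorphic_on_subset by (auto intro!: holomorphic_intros)
        show "continuous_on (closure (cball 0 1)) (\<lambda>z. - F z)" by (intro continuous_intros cont)
        show "Re (- F w) \<le> - m" if "w \<in> frontier (cball 0 1)" for w
          using that t0(2)[of w] by (auto simp: m_def)
      qed (use that in auto)
      then show ?thesis using m by simp
    qed
    define G where "G z = F z powr of_real p" for z
    have nn: "F z \<notin> \<real>\<^sub>\<le>\<^sub>0" if "z \<in> cball 0 1" for z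
      using posc[OF that] by (auto simp: complex_nonpos_Reals_iff)
    have Gc: "continuous_on (cball 0 1) G"
      unfolding G_def by (intro continuous_on_powr_complex cont continuous_on_const) (use nn posc in force)+
    have Gh: "G holomorphic_on ball 0 1"
      unfolding G_def using nn hol holomorphic_on_subset by (intro holomorphic_intros) (auto intro: holomorphic_on_subset)
    define H where "H t = indicator (cball 0 1) t *\<^sub>R G t" for t
    have [measurable]: "H \<in> borel_measurable borel"
      unfolding H_def[abs_def] by (rule borel_measurable_continuous_on_indicator) (use Gc in auto)
    have IH: "(\<integral>t. H t \<partial>circ) = G 0"
      unfolding H_def by (rule circ_mean_value_cball[OF Gc Gh])
    have "Re (G 0) \<ge> 0"
    proof -
      obtain x where x: "F 0 = of_real x" using F0 by (auto elim: Reals_cases)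
      have "x > 0" using posc[of 0] x by simp
      then have "G 0 = of_real (x powr p)" by (simp add: G_def x powr_of_real)
      then show ?thesis by simp
    qed
    obtain M where "\<forall>z\<in>cball 0 1. cmod (F z) \<le> M"
      using compact_imp_bounded[OF compact_continuous_image[OF cont compact_cball, of 0 1]] by (auto simp: bounded_iff)
    then have M: "cmod (F t) \<le> M" if "cmod t = 1" for t using that by simp
    have i1: "integrable circ (\<lambda>t. cmod (F t) powr p)"
    proof (rule circ.integrable_const_bound[of _ "M powr p"])
      show "AE t in circ. norm (cmod (F t) powr p) \<le> M powr p"
        using AE_circ_norm by eventually_elim (use M p in \<open>auto intro!: powr_mono2\<close>)
    qed measurable
    have i2: "integrable circ (\<lambda>t. Re (F t) powr p)"
    proof (rule circ.integrable_const_bound[of _ "M powr p"])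
      show "AE t in circ. norm (Re (F t) powr p) \<le> M powr p"
        using AE_circ_norm
      proof eventually_elim
        case (elim t)
        have "Re (F t) \<le> M" using M[OF elim] complex_Re_le_cmod[of "F t"] by linarith
        then show ?case using pos[OF elim] p by (auto intro!: powr_mono2)
      qed
    qed measurable
    obtain M' where "\<forall>z\<in>cball 0 1. cmod (G z) \<le> M'"
      using compact_imp_bounded[OF compact_continuous_image[OF Gc compact_cball]] by (auto simp: bounded_iff)
    then have i3: "integrable circ H"
      using AE_circ_norm by (intro circ.integrable_const_bound[of _ M']) (auto simp: H_def elim!: eventually_mono)
    have "(\<integral>t. cmod (F t) powr p \<partial>circ) \<le> (\<integral>t. A * Re (F t) powr p - B * Re (H t) \<partial>circ)"
    proof (rule integral_mono_AE)
      show "AE t in circ. cmod (F t) powr p \<le> A * Re (F t) powr p - B * Re (H t)"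
        using AE_circ_norm
      proof eventually_elim
        case (elim t)
        then show ?case using AB(3)[OF pos[OF elim]] by (simp add: H_def G_def)
      qed
    qed (use i1 i2 i3 in auto)
    also have "\<dots> = A * (\<integral>t. Re (F t) powr p \<partial>circ) - B * Re (G 0)"
      using i2 i3 by (simp add: IH)
    also have "\<dots> \<le> A * (\<integral>t. Re (F t) powr p \<partial>circ)" using AB \<open>Re (G 0) \<ge> 0\<close> by simp
    finally show "(\<integral>t. cmod (F t) powr p \<partial>circ) \<le> A * (\<integral>t. Re (F t) powr p \<partial>circ)" .
  qed
qed

lemma trig_poly_expansion:
  assumes "trig_poly h"
  shows "\<exists>c N0. \<forall>N\<ge>N0. \<forall>t. h t = (\<Sum>k\<in>{-int N..int N}. c k * t powi k)"
  using assms
proof induction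
  case (trig_poly_monom c k)
  show ?case
  proof (intro exI allI impI)
    fix N t assume "N \<ge> nat \<bar>k\<bar>"
    then have "(\<Sum>j\<in>{-int N..int N}. (if j = k then c else 0) * t powi j) = (\<Sum>j\<in>{-int N..int N}. if j = k then c * t powi k else 0)"
      by (intro sum.cong) auto
    also have "\<dots> = (if k \<in> {-int N..int N} then c * t powi k else 0)" by (rule sum.delta) simp
    also have "\<dots> = c * t powi k" using \<open>N \<ge> nat \<bar>k\<bar>\<close> by auto
    finally show "c * t powi k = (\<Sum>j\<in>{-int N..int N}. (if j = k then c else 0) * t powi j)" ..
  qed
next
  case (trig_poly_add f g)
  then obtain c1 N1 c2 N2 where
    "\<And>N t. N \<ge> N1 \<Longrightarrow> f t = (\<Sum>k\<in>{-int N..int N}. c1 k * t powi k)"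
    "\<And>N t. N \<ge> N2 \<Longrightarrow> g t = (\<Sum>k\<in>{-int N..int N}. c2 k * t powi k)" by metis
  then show ?case
    by (intro exI[of _ "\<lambda>k. c1 k + c2 k"] exI[of _ "max N1 N2"]) (auto simp: distrib_right sum.distrib)
qed

lemma abs_lfun_trig_poly:
  assumes "trig_poly h" shows "abs_lfun h \<in> trig"
  using assms
proof induction
  case (trig_poly_monom c k)
  have "abs_lfun (\<lambda>t. c * t powi k) = lscale c (monomial k)"
    by (rule abs_lfun_eqI)
       (use rep_lfun_lscale[of c "monomial k"] rep_lfun_monomial[of k] in \<open>auto elim: eventually_elim2\<close>)
  then show ?case by (auto intro: lfun.subspace_scale[OF subspace_trig] monomial_trig)
next
  case (trig_poly_add f g)
  have m: "f \<in> borel_measurable borel" "g \<in> borel_measurable borel"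
    using trig_poly_add.hyps by (auto intro: trig_poly_measurable)
  have "abs_lfun (\<lambda>t. f t + g t) = abs_lfun f + abs_lfun g"
  proof (rule abs_lfun_eqI)
    show "AE t in circ. rep_lfun (abs_lfun f + abs_lfun g) t = f t + g t"
      using rep_lfun_add[of "abs_lfun f" "abs_lfun g"] rep_abs_lfun[OF m(1)] rep_abs_lfun[OF m(2)]
      by eventually_elim simp
  qed (use m in measurable)
  then show ?case using trig_poly_add lfun.subspace_add[OF subspace_trig] by simp
qed

lemma trig_poly_rep:
  assumes "f \<in> trig"
  shows "\<exists>h. trig_poly h \<and> (AE t in circ. rep_lfun f t = h t)"
  using assms unfolding trig_def
proof (induction rule: lfun.span_induct_alt)
  case base
  show ?case using trig_poly_monom[of 0 0] rep_lfun_zero by (intro exI[of _ "\<lambda>t. 0 * t powi 0"]) auto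
next
  case (step c x y)
  then obtain k h where x: "x = monomial k" and h: "trig_poly h" "AE t in circ. rep_lfun y t = h t" by auto
  have "AE t in circ. rep_lfun (lscale c x + y) t = c * t powi k + h t"
    using rep_lfun_add[of "lscale c x" y] rep_lfun_lscale[of c x] rep_lfun_monomial[of k] h(2)
    by eventually_elim (simp add: x)
  then show ?case using trig_poly_add[OF trig_poly_monom h(1)] by blast
qed

text \<open>A positive h is the real part of F = 2 P h - c 0, an analytic polynomial, so the
  preceding estimate bounds F. Then P h = F/2 + c 0/2 together with |c 0| \<le> norm of h gives the
  constant.\<close>

lemma Riesz_positive:
  fixes p :: real
  assumes p: "1 < p" "p \<le> 2"
  obtains C where "C \<ge> 0"
    "\<And>h. trig_poly h \<Longrightarrow> (\<And>t. cmod t = 1 \<Longrightarrow> h t \<in> \<real> \<and> Re (h t) > 0) \<Longrightarrow>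
      lp_norm p (Riesz_P (abs_lfun h)) \<le> C * lp_norm p (abs_lfun h)"
proof -
  obtain A where A: "A \<ge> 0"
    "\<And>F. F holomorphic_on UNIV \<Longrightarrow> F 0 \<in> \<real> \<Longrightarrow> (\<And>t. cmod t = 1 \<Longrightarrow> Re (F t) > 0) \<Longrightarrow>
      (\<integral>t. cmod (F t) powr p \<partial>circ) \<le> A * (\<integral>t. Re (F t) powr p \<partial>circ)"
    using Riesz_analytic[OF p] by metis
  show ?thesis
  proof (rule that[of "1/2 * (A powr (1/p)) + 1/2"])
    fix h assume h: "trig_poly h" and pos: "\<And>t. cmod t = 1 \<Longrightarrow> h t \<in> \<real> \<and> Re (h t) > 0"
    have [measurable]: "h \<in> borel_measurable borel" by (rule trig_poly_measurable[OF h])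
    define u where "u = abs_lfun h"
    have u: "u \<in> trig" unfolding u_def by (rule abs_lfun_trig_poly[OF h])
    have repu: "AE t in circ. rep_lfun u t = h t" unfolding u_def by (rule rep_abs_lfun) measurable
    have "lcnj u = u"
    proof (rule lfun_eqI_AE[OF _ repu])
      show "AE t in circ. rep_lfun (lcnj u) t = h t"
        using rep_lfun_lcnj[of u] repu AE_circ_norm by eventually_elim (use pos in \<open>auto simp: Reals_cnj_iff\<close>)
    qed
    then have herm: "fcoeff u (- k) = cnj (fcoeff u k)" for k
      using fcoeff_lcnj[of u "-k"] by simp
    obtain c N where hc: "\<And>t. h t = (\<Sum>k\<in>{-int N..int N}. c k * t powi k)"
      using trig_poly_expansion[OF h] by blast
    have usum: "u = (\<Sum>k\<in>{-int N..int N}. lscale (c k) (monomial k))"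
    proof (rule lfun_eqI_AE[OF repu])
      have "AE t in circ. rep_lfun (\<Sum>k\<in>I. lscale (c k) (monomial k)) t = (\<Sum>k\<in>I. c k * t powi k)" if "finite I" for I
        using that
      proof (induction I)
        case empty
        show ?case using rep_lfun_zero by simp
      next
        case (insert j I)
        show ?case
          using insert.IH rep_lfun_add[of "lscale (c j) (monomial j)" "\<Sum>k\<in>I. lscale (c k) (monomial k)"]
            rep_lfun_lscale[of "c j" "monomial j"] rep_lfun_monomial[of j]
          by eventually_elim (use insert.hyps in simp)
      qed
      from this[of "{-int N..int N}"]
      show "AE t in circ. rep_lfun (\<Sum>k\<in>{-int N..int N}. lscale (c k) (monomial k)) t = h t"
        unfolding hc by simp
    qed
    then have cu: "fcoeff u k = (if k \<in> {-int N..int N} then c k else 0)" for k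
    proof -
      have "fcoeff (\<Sum>k\<in>{-int N..int N}. lscale (c k) (monomial k)) k = (\<Sum>j\<in>{-int N..int N}. if k = j then c j else 0)"
        by (subst fcoeff_sum, blast intro: Lp_lscale Lp_monomial zero_less_one)
           (intro sum.cong refl, simp add: fcoeff_lscale fcoeff_monomial)
      also have "\<dots> = (if k \<in> {-int N..int N} then c k else 0)" by (rule sum.delta') simp
      finally show ?thesis using usum by simp
    qed
    have c: "c (- k) = cnj (c k)" if "k \<in> {-int N..int N}" for k
      using herm[of k] that by (simp add: cu)
    have c0: "c 0 \<in> \<real>" using c[of 0] by (simp add: Reals_cnj_iff)
    \<comment> \<open>Doubling the positive frequencies compensates for the dropped negative ones,
      whose coefficients are the conjugates.\<close>
    define F where "F z = c 0 + 2 * (\<Sum>k\<in>{1..N}. c (int k) * z ^ k)" for z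
    have hF: "Re (F t) = Re (h t)" if t: "cmod t = 1" for t
    proof -
      have split: "{-int N..int N} = {0} \<union> (int ` {1..N} \<union> (\<lambda>k. - int k) ` {1..N})"
      proof (rule set_eqI, rule iffI)
        fix x assume x: "x \<in> {-int N..int N}"
        have "x \<in> int ` {1..N}" if "x > 0"
          using that x by (intro image_eqI[of _ _ "nat x"]) auto
        moreover have "x \<in> (\<lambda>k. - int k) ` {1..N}" if "x < 0"
          using that x by (intro image_eqI[of _ _ "nat (- x)"]) auto
        ultimately show "x \<in> {0} \<union> (int ` {1..N} \<union> (\<lambda>k. - int k) ` {1..N})" by force
      qed auto
      have "h t = c 0 + ((\<Sum>k\<in>{1..N}. c (int k) * t powi int k) + (\<Sum>k\<in>{1..N}. c (- int k) * t powi (- int k)))"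
        unfolding hc split
        by (subst sum.union_disjoint; (subst sum.union_disjoint)?) (auto simp: sum.reindex inj_on_def)
      also have "(\<Sum>k\<in>{1..N}. c (- int k) * t powi (- int k)) = (\<Sum>k\<in>{1..N}. cnj (c (int k) * t ^ k))"
      proof (intro sum.cong refl)
        fix k assume "k \<in> {1..N}"
        then have "c (- int k) = cnj (c (int k))" by (intro c) auto
        moreover have "t powi (- int k) = cnj (t ^ k)"
          using t by (simp add: cnj_eq_inverse power_int_minus power_inverse)
        ultimately show "c (- int k) * t powi (- int k) = cnj (c (int k) * t ^ k)" by simp
      qed
      also have "\<dots> = cnj (\<Sum>k\<in>{1..N}. c (int k) * t ^ k)" by (rule cnj_sum[symmetric])
      also have "(\<Sum>k\<in>{1..N}. c (int k) * t powi int k) = (\<Sum>k\<in>{1..N}. c (int k) * t ^ k)" by simp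
      finally have hS: "h t = c 0 + ((\<Sum>k\<in>{1..N}. c (int k) * t ^ k) + cnj (\<Sum>k\<in>{1..N}. c (int k) * t ^ k))" .
      have "Re (c 0 + 2 * S) = Re (c 0 + (S + cnj S))" for S by simp
      then show ?thesis unfolding hS F_def .
    qed
    have Fh: "F holomorphic_on UNIV" unfolding F_def by (intro holomorphic_intros)
    have [measurable]: "F \<in> borel_measurable borel"
      by (intro borel_measurable_continuous_onI holomorphic_on_imp_continuous_on Fh)
    have F0: "F 0 = c 0" by (simp add: F_def power_0_left)
    have "(\<integral>t. cmod (F t) powr p \<partial>circ) \<le> A * (\<integral>t. Re (F t) powr p \<partial>circ)"
      by (rule A(2)[OF Fh]) (use c0 pos in \<open>auto simp: F0 hF\<close>)
    also have "(\<integral>t. Re (F t) powr p \<partial>circ) = (\<integral>t. cmod (h t) powr p \<partial>circ)"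
    proof (rule integral_cong_AE)
      show "AE t in circ. Re (F t) powr p = cmod (h t) powr p"
        using AE_circ_norm
      proof eventually_elim
        case (elim t)
        then have "cmod (h t) = Re (h t)" using pos[OF elim] by (auto elim!: Reals_cases)
        then show ?case using hF[OF elim] by simp
      qed
    qed measurable
    finally have "(\<integral>t. cmod (F t) powr p \<partial>circ) powr (1/p) \<le> (A * (\<integral>t. cmod (h t) powr p \<partial>circ)) powr (1/p)"
      using p by (intro powr_mono2) auto
    also have "\<dots> = A powr (1/p) * lp_norm p u"
      using A(1) by (subst powr_mult) (auto simp: lp_norm_cong[OF repu])
    finally have Fn: "lp_norm p (abs_lfun F) \<le> A powr (1/p) * lp_norm p u"
      using lp_norm_cong[OF rep_abs_lfun[of F], of p] by simp
    have Pu: "Riesz_P u = lscale (1/2) (abs_lfun F) + lscale (c 0 / 2) 1"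
    proof (rule Riesz_P_eqI)
      have tpF: "abs_lfun F = lscale (c 0) 1 + (\<Sum>k\<in>{1..N}. lscale (2 * c (int k)) (monomial (int k)))"
      proof (rule abs_lfun_eqI)
        have "AE t in circ. rep_lfun (\<Sum>k\<in>I. lscale (2 * c (int k)) (monomial (int k))) t = (\<Sum>k\<in>I. 2 * c (int k) * t ^ k)"
          if "finite I" for I
          using that
        proof (induction I)
          case empty
          show ?case using rep_lfun_zero by simp
        next
          case (insert j I)
          show ?case
            using insert.IH rep_lfun_add[of "lscale (2 * c (int j)) (monomial (int j))" "\<Sum>k\<in>I. lscale (2 * c (int k)) (monomial (int k))"]
              rep_lfun_lscale[of "2 * c (int j)" "monomial (int j)"] rep_lfun_monomial[of "int j"]
            by eventually_elim (use insert.hyps in simp)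
        qed
        from this[OF finite_atLeastAtMost, of 1 N] rep_lfun_add[of "lscale (c 0) 1" "\<Sum>k\<in>{1..N}. lscale (2 * c (int k)) (monomial (int k))"]
          rep_lfun_lscale[of "c 0" 1] rep_lfun_one
        show "AE t in circ. rep_lfun (lscale (c 0) 1 + (\<Sum>k\<in>{1..N}. lscale (2 * c (int k)) (monomial (int k)))) t = F t"
          by eventually_elim (simp add: F_def sum_distrib_left mult.assoc)
      qed measurable
      have L: "lscale x 1 \<in> Lp 1" "lscale x (monomial k) \<in> Lp 1" for x k by (rule Lp_const Lp_lscale Lp_monomial; simp add: Lp_monomial)+
      then show "lscale (1/2) (abs_lfun F) + lscale (c 0 / 2) 1 \<in> Lp 1"
        unfolding tpF by (intro Lp_add Lp_lscale[of "_ + _"] Lp_sum) auto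
      fix n
      have "fcoeff (\<Sum>k\<in>{1..N}. lscale (2 * c (int k)) (monomial (int k))) n = (\<Sum>k\<in>{1..N}. if n = int k then 2 * c n else 0)"
        using L by (subst fcoeff_sum) (auto intro!: sum.cong simp: fcoeff_lscale fcoeff_monomial)
      also have "\<dots> = (if 1 \<le> n \<and> n \<le> int N then 2 * c n else 0)"
      proof (cases "n \<ge> 0")
        case True
        then have "(\<Sum>k\<in>{1..N}. if n = int k then 2 * c n else 0) = (\<Sum>k\<in>{1..N}. if nat n = k then 2 * c n else 0)"
          by (intro sum.cong) auto
        then show ?thesis using True by (auto simp: sum.delta')
      qed (auto intro!: sum.neutral)
      finally have s: "fcoeff (\<Sum>k\<in>{1..N}. lscale (2 * c (int k)) (monomial (int k))) n = (if 1 \<le> n \<and> n \<le> int N then 2 * c n else 0)" .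
      have "fcoeff (abs_lfun F) n = (if n = 0 then c 0 else if 1 \<le> n \<and> n \<le> int N then 2 * c n else 0)"
        unfolding tpF using L
        by (subst fcoeff_add) (auto intro!: Lp_sum simp: s[simplified] fcoeff_lscale fcoeff_one)
      moreover have "abs_lfun F \<in> Lp 1" unfolding tpF using L by (intro Lp_add Lp_sum) auto
      ultimately show "fcoeff (lscale (1/2) (abs_lfun F) + lscale (c 0 / 2) 1) n = (if n \<ge> 0 then fcoeff u n else 0)"
        using L by (subst fcoeff_add) (auto intro!: Lp_lscale simp: fcoeff_lscale fcoeff_one cu)
    qed
    have FL: "abs_lfun F \<in> Lp p"
    proof -
      have "lscale (1/2) (abs_lfun F) = Riesz_P u - lscale (c 0 / 2) 1" using Pu by simp
      then have "lscale 2 (lscale (1/2) (abs_lfun F)) = lscale 2 (Riesz_P u - lscale (c 0 / 2) 1)" by (rule arg_cong)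
      then have "abs_lfun F = lscale 2 (Riesz_P u - lscale (c 0 / 2) 1)"
        by (simp only: lfun.scale_scale) simp
      moreover have "lscale 2 (Riesz_P u - lscale (c 0 / 2) 1) \<in> Lp p"
        using Riesz_P_trig(1)[OF u] p by (intro Lp_lscale Lp_diff Lp_const trig_Lp) auto
      ultimately show ?thesis by metis
    qed
    have one: "lp_norm p 1 = 1" using p by (subst lp_norm_cong[OF rep_lfun_one]) auto
    have "lp_norm p (Riesz_P u) \<le> lp_norm p (lscale (1/2) (abs_lfun F)) + lp_norm p (lscale (c 0 / 2) 1)"
      unfolding Pu using p FL by (intro lp_norm_triangle Lp_lscale Lp_const) (auto intro: Linf_imp_Lp)
    also have "\<dots> = 1/2 * lp_norm p (abs_lfun F) + 1/2 * cmod (c 0)"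
      using p by (simp add: lp_norm_lscale one norm_divide)
    also have "\<dots> \<le> 1/2 * (A powr (1/p) * lp_norm p u) + 1/2 * lp_norm p u"
    proof (intro add_mono mult_left_mono Fn)
      show "cmod (c 0) \<le> lp_norm p u"
        using norm_fcoeff_le'[of u p 0] trig_Lp[OF u, of p] p by (simp add: cu)
    qed auto
    finally show "lp_norm p (Riesz_P (abs_lfun h)) \<le> (1/2 * (A powr (1/p)) + 1/2) * lp_norm p (abs_lfun h)"
      by (simp add: u_def algebra_simps)
  qed simp
qed

lemma Riesz_P_trig_add: "f \<in> trig \<Longrightarrow> g \<in> trig \<Longrightarrow> Riesz_P (f + g) = Riesz_P f + Riesz_P g"
  by (rule Riesz_P_eqI) (auto simp: Riesz_P_trig fcoeff_add trig_Lp intro!: Lp_add)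

lemma Riesz_P_trig_diff: "f \<in> trig \<Longrightarrow> g \<in> trig \<Longrightarrow> Riesz_P (f - g) = Riesz_P f - Riesz_P g"
  by (rule Riesz_P_eqI) (auto simp: Riesz_P_trig fcoeff_diff trig_Lp intro!: Lp_diff)

lemma Riesz_P_trig_lscale: "f \<in> trig \<Longrightarrow> Riesz_P (lscale c f) = lscale c (Riesz_P f)"
  by (rule Riesz_P_eqI) (auto simp: Riesz_P_trig fcoeff_lscale trig_Lp intro!: Lp_lscale)

lemma lp_norm_const_bound:
  assumes p: "p > 0" and e: "e \<ge> 0" "AE t in circ. cmod (rep_lfun f t) \<le> e"
  shows "lp_norm p f \<le> e"
proof -
  have one: "lp_norm p 1 = 1" "1 \<in> Lp p"
    using p by (auto simp: lp_norm_cong[OF rep_lfun_one] intro: Linf_imp_Lp)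
  have "AE t in circ. cmod (rep_lfun f t) \<le> e * cmod (rep_lfun 1 t)"
    using e(2) rep_lfun_one by eventually_elim simp
  from lp_norm_mono_AE[OF one(2) p e(1) this] one show ?thesis by simp
qed

lemma trig_poly_continuous:
  assumes "trig_poly h" shows "continuous_on (sphere 0 1) h"
  using assms
proof induction
  case (trig_poly_monom c k)
  have "continuous_on (sphere 0 1) (\<lambda>t::complex. t powi k)"
    by (intro continuous_on_power_int continuous_on_id) auto
  then show ?case by (intro continuous_on_mult continuous_on_const)
qed (auto intro!: continuous_intros)

text \<open>Approximating a nonnegative function by positive trigonometric polynomials makes an error that is
  small uniformly; \<open>P\<close> controls it in \<open>L\<^sup>2\<close>, hence in \<open>L\<^sup>p\<close> for \<open>p \<le> 2\<close>.\<close>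

lemma Riesz_trig_le2:
  fixes p :: real
  assumes p: "1 < p" "p \<le> 2"
  obtains C where "C \<ge> 0" "\<And>f. f \<in> trig \<Longrightarrow> lp_norm p (Riesz_P f) \<le> C * lp_norm p f"
proof -
  have p1: "p \<ge> 1" "p > 0" using p by auto
  obtain C where C: "C \<ge> 0"
    "\<And>h. trig_poly h \<Longrightarrow> (\<And>t. cmod t = 1 \<Longrightarrow> h t \<in> \<real> \<and> Re (h t) > 0) \<Longrightarrow>
      lp_norm p (Riesz_P (abs_lfun h)) \<le> C * lp_norm p (abs_lfun h)"
    using Riesz_positive[OF p] by metis
  show ?thesis
  proof (rule that[of "4 * C"])
    fix f assume f: "f \<in> trig"
    obtain h where h: "trig_poly h" "AE t in circ. rep_lfun f t = h t" using trig_poly_rep[OF f] by blast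
    note hc = trig_poly_continuous[OF h(1)]
    \<comment> \<open>Produces a strictly positive trigonometric polynomial uniformly within 3 e of
      \<phi>, to which the positive case applies; its norm exceeds that of f by at most 3 e because
      \<phi> \<le> |h|.\<close>
    have approx: "\<exists>u\<in>trig. lp_norm p (Riesz_P u) \<le> C * (lp_norm p f + 3 * e) \<and>
        (AE t in circ. cmod (rep_lfun u t - of_real (\<phi> t)) \<le> 3 * e)"
      if e: "e > 0" and \<phi>: "continuous_on (sphere 0 1) \<phi>" "\<And>t. 0 \<le> \<phi> t \<and> \<phi> t \<le> cmod (h t)" for e \<phi>
    proof -
      obtain g where g: "trig_poly g" "\<And>t. cmod t = 1 \<Longrightarrow> cmod (of_real (\<phi> t) - g t) < e"
        "\<And>t. cmod t = 1 \<Longrightarrow> g t \<in> \<real>"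
        using trig_poly_approx[OF \<phi>(1) e] by metis
      \<comment> \<open>The shift by 2 e makes the approximant positive: g > \<phi> - e \<ge> -e.
        The factor \<open>t powi 0\<close> casts the constant as a monomial.\<close>
      define k where "k t = g t + of_real (2 * e) * t powi 0" for t
      have k: "trig_poly k" unfolding k_def by (intro trig_poly_add trig_poly_monom g)
      have [measurable]: "k \<in> borel_measurable borel" by (rule trig_poly_measurable[OF k])
      have kb: "cmod (k t - of_real (\<phi> t)) \<le> 3 * e" if t: "cmod t = 1" for t
      proof -
        have "cmod (of_real (2 * e) - (of_real (\<phi> t) - g t)) \<le> cmod (of_real (2 * e)) + cmod (of_real (\<phi> t) - g t)"
          by (rule norm_triangle_ineq4)
        also have "\<dots> \<le> 2 * e + e" using g(2)[OF t] e by (intro add_mono) auto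
        finally show ?thesis by (simp add: k_def algebra_simps)
      qed
      have kpos: "k t \<in> \<real> \<and> Re (k t) > 0" if t: "cmod t = 1" for t
      proof
        show "k t \<in> \<real>" using g(3)[OF t] by (simp add: k_def)
        have "\<phi> t - Re (g t) \<le> cmod (of_real (\<phi> t) - g t)"
          using complex_Re_le_cmod[of "of_real (\<phi> t) - g t"] by simp
        then show "Re (k t) > 0" using g(2)[OF t] \<phi>(2)[of t] e by (simp add: k_def)
      qed
      define u where "u = abs_lfun k"
      have repu: "AE t in circ. rep_lfun u t = k t" unfolding u_def by (rule rep_abs_lfun) measurable
      have u: "u \<in> trig" unfolding u_def by (rule abs_lfun_trig_poly[OF k])
      define m where "m = abs_lfun (\<lambda>t. of_real (cmod (rep_lfun f t)))"
      have repm: "AE t in circ. rep_lfun m t = of_real (cmod (rep_lfun f t))"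
        unfolding m_def by (rule rep_abs_lfun) measurable
      have m: "m \<in> Lp p" "lp_norm p m = lp_norm p f"
        using trig_Lp[OF f p1(2)]
        by (subst Lp_cong[OF repm], simp_all add: Lp_iff) (subst lp_norm_cong[OF repm], simp_all add: lp_norm_eq)
      have "AE t in circ. cmod (rep_lfun u t) \<le> 1 * cmod (rep_lfun (m + lscale (of_real (3 * e)) 1) t)"
        using repu repm h(2) rep_lfun_add[of m "lscale (of_real (3 * e)) 1"] rep_lfun_lscale[of "of_real (3 * e)" 1]
          rep_lfun_one AE_circ_norm
      proof eventually_elim
        case (elim t)
        have "cmod (k t) \<le> cmod (k t - of_real (\<phi> t)) + cmod (of_real (\<phi> t))"
          using norm_triangle_ineq[of "k t - of_real (\<phi> t)" "of_real (\<phi> t)"] by simp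
        also have "\<dots> \<le> 3 * e + cmod (h t)" using kb[OF elim(7)] \<phi>(2)[of t] by simp
        finally have "cmod (k t) \<le> cmod (h t) + 3 * e" by simp
        also have "\<dots> = cmod (of_real (cmod (h t) + 3 * e))" using e by (simp only: norm_of_real) simp
        finally show ?case using elim by simp
      qed
      then have "lp_norm p u \<le> 1 * lp_norm p (m + lscale (of_real (3 * e)) 1)"
        by (intro lp_norm_mono_AE) (use m p1 in \<open>auto intro!: Lp_add Lp_const\<close>)
      also have "lp_norm p (m + lscale (of_real (3 * e)) 1) \<le> lp_norm p m + lp_norm p (lscale (of_real (3 * e)) 1)"
        by (intro lp_norm_triangle m p1 Lp_const)
      also have "lp_norm p (lscale (of_real (3 * e)) 1) \<le> 3 * e"
        by (rule lp_norm_const_bound)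
           (use p1 e rep_lfun_lscale[of "of_real (3 * e)" 1] rep_lfun_one in \<open>auto elim!: eventually_elim2\<close>)
      finally have "lp_norm p u \<le> lp_norm p f + 3 * e" by (simp add: m)
      then have "C * lp_norm p u \<le> C * (lp_norm p f + 3 * e)" using C(1) by (intro mult_left_mono)
      moreover have "lp_norm p (Riesz_P u) \<le> C * lp_norm p u" unfolding u_def by (rule C(2)[OF k kpos])
      moreover have "AE t in circ. cmod (rep_lfun u t - of_real (\<phi> t)) \<le> 3 * e"
        using repu AE_circ_norm by eventually_elim (simp add: kb)
      ultimately show ?thesis using u by (intro bexI[of _ u]) auto
    qed
    \<comment> \<open>The positive and negative parts of real and imaginary part are continuous but
      not trigonometric, hence the approximation. Four errors of 3 e account for 12 e in the
      remainder, four bounds with C for 12 C e.\<close>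
    have main: "lp_norm p (Riesz_P f) \<le> 4 * C * lp_norm p f + (12 * C + 12) * e" if e: "e > 0" for e
    proof -
      have cs: "continuous_on (sphere 0 1) (\<lambda>t. max 0 (Re (h t)))" "continuous_on (sphere 0 1) (\<lambda>t. max 0 (- Re (h t)))"
        "continuous_on (sphere 0 1) (\<lambda>t. max 0 (Im (h t)))" "continuous_on (sphere 0 1) (\<lambda>t. max 0 (- Im (h t)))"
        by (intro continuous_intros hc)+
      have bs: "0 \<le> max 0 (Re z) \<and> max 0 (Re z) \<le> cmod z" "0 \<le> max 0 (- Re z) \<and> max 0 (- Re z) \<le> cmod z"
        "0 \<le> max 0 (Im z) \<and> max 0 (Im z) \<le> cmod z" "0 \<le> max 0 (- Im z) \<and> max 0 (- Im z) \<le> cmod z" for z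
        using abs_Re_le_cmod[of z] abs_Im_le_cmod[of z] by auto
      let ?B = "C * (lp_norm p f + 3 * e)"
      obtain u1 where u1: "u1 \<in> trig" "lp_norm p (Riesz_P u1) \<le> ?B"
        "AE t in circ. cmod (rep_lfun u1 t - of_real (max 0 (Re (h t)))) \<le> 3 * e"
        using approx[OF e cs(1) bs(1)] by blast
      obtain u2 where u2: "u2 \<in> trig" "lp_norm p (Riesz_P u2) \<le> ?B"
        "AE t in circ. cmod (rep_lfun u2 t - of_real (max 0 (- Re (h t)))) \<le> 3 * e"
        using approx[OF e cs(2) bs(2)] by blast
      obtain u3 where u3: "u3 \<in> trig" "lp_norm p (Riesz_P u3) \<le> ?B"
        "AE t in circ. cmod (rep_lfun u3 t - of_real (max 0 (Im (h t)))) \<le> 3 * e"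
        using approx[OF e cs(3) bs(3)] by blast
      obtain u4 where u4: "u4 \<in> trig" "lp_norm p (Riesz_P u4) \<le> ?B"
        "AE t in circ. cmod (rep_lfun u4 t - of_real (max 0 (- Im (h t)))) \<le> 3 * e"
        using approx[OF e cs(4) bs(4)] by blast
      note st = lfun.subspace_diff[OF subspace_trig] lfun.subspace_add[OF subspace_trig] lfun.subspace_scale[OF subspace_trig]
      define v where "v = lscale \<i> (u3 - u4)"
      define g where "g = (u1 - u2) + v"
      have v: "v \<in> trig" unfolding v_def by (intro st u3 u4)
      have g: "g \<in> trig" unfolding g_def by (intro st u1 u2 v)
      define r where "r = f - g"
      have r: "r \<in> trig" unfolding r_def by (intro st f g)
      have PL: "Riesz_P w \<in> Lp p" if "w \<in> trig" for w using Riesz_P_trig(1)[OF that] p1 by (intro trig_Lp)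
      have "AE t in circ. cmod (rep_lfun r t) \<le> 12 * e"
        using h(2) u1(3) u2(3) u3(3) u4(3) rep_lfun_minus[of f g] rep_lfun_add[of "u1 - u2" v] rep_lfun_minus[of u1 u2]
          rep_lfun_lscale[of \<i> "u3 - u4"] rep_lfun_minus[of u3 u4]
      proof eventually_elim
        case (elim t)
        let ?d1 = "rep_lfun u1 t - of_real (max 0 (Re (h t)))" and ?d2 = "rep_lfun u2 t - of_real (max 0 (- Re (h t)))"
        let ?d3 = "rep_lfun u3 t - of_real (max 0 (Im (h t)))" and ?d4 = "rep_lfun u4 t - of_real (max 0 (- Im (h t)))"
        have "h t = of_real (max 0 (Re (h t))) - of_real (max 0 (- Re (h t))) +
            \<i> * (of_real (max 0 (Im (h t))) - of_real (max 0 (- Im (h t))))"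
          by (auto simp: complex_eq_iff)
        moreover have "x - ((y1 - y2) + \<i> * (y3 - y4)) = ((y2 - b) - (y1 - a)) + \<i> * ((y4 - d) - (y3 - c))"
          if "x = a - b + \<i> * (c - d)" for x y1 y2 y3 y4 a b c d :: complex
          unfolding that by (simp add: algebra_simps)
        moreover have "rep_lfun r t = h t - ((rep_lfun u1 t - rep_lfun u2 t) + \<i> * (rep_lfun u3 t - rep_lfun u4 t))"
          unfolding r_def elim(6) elim(1) unfolding g_def elim(7) elim(8) unfolding v_def elim(9) elim(10) ..
        ultimately have "rep_lfun r t = (?d2 - ?d1) + \<i> * (?d4 - ?d3)" by metis
        also have "cmod \<dots> \<le> (cmod ?d2 + cmod ?d1) + (cmod ?d4 + cmod ?d3)"
          by (intro norm_triangle_le add_mono norm_triangle_ineq4) (simp add: norm_mult norm_triangle_ineq4)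
        finally show ?case using elim by linarith
      qed
      then have "lp_norm 2 r \<le> 12 * e" using e by (intro lp_norm_const_bound) auto
      moreover have "lp_norm p (Riesz_P r) \<le> lp_norm 2 (Riesz_P r)"
        using p by (intro Lp_exponent_mono(2) trig_Lp Riesz_P_trig(1) r) auto
      ultimately have Pr: "lp_norm p (Riesz_P r) \<le> 12 * e" using lp_norm_2_Riesz_P[OF r] by linarith
      have "lp_norm p (Riesz_P v) = lp_norm p (Riesz_P (u3 - u4))"
        using p1 by (simp add: v_def Riesz_P_trig_lscale st u3 u4 lp_norm_lscale)
      also have "\<dots> \<le> lp_norm p (Riesz_P u3) + lp_norm p (Riesz_P u4)"
        unfolding Riesz_P_trig_diff[OF u3(1) u4(1)] by (intro lp_norm_triangle_diff PL u3 u4 p1)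
      finally have Pv: "lp_norm p (Riesz_P v) \<le> 2 * ?B" using u3(2) u4(2) by linarith
      have "lp_norm p (Riesz_P (u1 - u2)) \<le> lp_norm p (Riesz_P u1) + lp_norm p (Riesz_P u2)"
        unfolding Riesz_P_trig_diff[OF u1(1) u2(1)] by (intro lp_norm_triangle_diff PL u1 u2 p1)
      moreover have "lp_norm p (Riesz_P g) \<le> lp_norm p (Riesz_P (u1 - u2)) + lp_norm p (Riesz_P v)"
        unfolding g_def Riesz_P_trig_add[OF st(1)[OF u1(1) u2(1)] v] by (intro lp_norm_triangle PL st u1 u2 v p1)
      ultimately have Pg: "lp_norm p (Riesz_P g) \<le> 4 * ?B" using Pv u1(2) u2(2) by linarith
      have "f = g + r" by (simp add: r_def)
      then have "lp_norm p (Riesz_P f) \<le> lp_norm p (Riesz_P g) + lp_norm p (Riesz_P r)"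
        using Riesz_P_trig_add[OF g r] lp_norm_triangle[OF PL[OF g] PL[OF r] p1(1)] by simp
      then show ?thesis using Pg Pr by (simp add: algebra_simps)
    qed
    show "lp_norm p (Riesz_P f) \<le> 4 * C * lp_norm p f"
    proof (rule field_le_epsilon)
      fix e :: real assume e: "e > 0"
      have "12 * C + 12 > 0" using C(1) by simp
      then show "lp_norm p (Riesz_P f) \<le> 4 * C * lp_norm p f + e"
        using main[of "e / (12 * C + 12)"] e by simp
    qed
  qed (use C in simp)
qed

text \<open>Extension by density. The bound on \<open>trig\<close> is a hypothesis because the
  extension for q \<le> 2 is needed to obtain the bound for p > 2.\<close>

lemma Riesz_extend:
  assumes p: "p > 1" and C: "C \<ge> 0" "\<And>f. f \<in> trig \<Longrightarrow> lp_norm p (Riesz_P f) \<le> C * lp_norm p f" and f: "f \<in> Lp p"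
  shows "Riesz_P f \<in> Lp p" "lp_norm p (Riesz_P f) \<le> C * lp_norm p f"
    "fcoeff (Riesz_P f) n = (if n \<ge> 0 then fcoeff f n else 0)"
proof -
  have p1: "p \<ge> 1" "p > 0" using p by auto
  have "\<exists>g\<in>trig. lp_norm p (f - g) < 1 / (real n + 1)" for n
    using trig_dense[OF p f, of "1 / (real n + 1)"] by fastforce
  then obtain g where g: "\<And>n. g n \<in> trig" "\<And>n. lp_norm p (f - g n) < 1 / (real n + 1)" by metis
  have gL: "g n \<in> Lp p" for n using g p1 by (intro trig_Lp)
  have PL: "Riesz_P (g n) \<in> Lp p" for n using Riesz_P_trig(1)[OF g(1)] p1 by (intro trig_Lp)
  have inv: "(\<lambda>n. 1 / (real n + 1)) \<longlonglongrightarrow> 0"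
    using LIMSEQ_inverse_real_of_nat by (simp add: inverse_eq_divide add.commute)
  have g0: "(\<lambda>n. lp_norm p (f - g n)) \<longlonglongrightarrow> 0"
    by (rule tendsto_sandwich[OF _ _ tendsto_const inv]) (use g(2) in \<open>auto intro!: always_eventually less_imp_le\<close>)
  have dP: "lp_norm p (Riesz_P (g m) - Riesz_P (g n)) \<le> C * (1 / (real m + 1) + 1 / (real n + 1))" for m n
  proof -
    have "lp_norm p ((f - g n) - (f - g m)) \<le> lp_norm p (f - g n) + lp_norm p (f - g m)"
      by (intro lp_norm_triangle_diff Lp_diff f gL p1)
    then have "lp_norm p (g m - g n) \<le> 1 / (real m + 1) + 1 / (real n + 1)"
      using g(2)[of m] g(2)[of n] by simp
    then have "C * lp_norm p (g m - g n) \<le> C * (1 / (real m + 1) + 1 / (real n + 1))"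
      using C(1) by (intro mult_left_mono)
    moreover have "lp_norm p (Riesz_P (g m - g n)) \<le> C * lp_norm p (g m - g n)"
      by (intro C(2) lfun.subspace_diff[OF subspace_trig] g)
    ultimately show ?thesis by (simp add: Riesz_P_trig_diff g)
  qed
  obtain h where h: "h \<in> Lp p" "(\<lambda>n. lp_norm p (Riesz_P (g n) - h)) \<longlonglongrightarrow> 0"
  proof (rule Lp_complete[of "\<lambda>n. Riesz_P (g n)" p])
    fix e :: real assume e: "e > 0"
    have "(\<lambda>n. C * (1 / (real n + 1))) \<longlonglongrightarrow> 0" by (intro tendsto_mult_right_zero inv)
    then obtain N where "\<forall>n\<ge>N. norm (C * (1 / (real n + 1)) - 0) < e / 2"
      using LIMSEQ_D[of _ 0 "e / 2"] e by (meson half_gt_zero)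
    then have N: "C * (1 / (real n + 1)) < e / 2" if "n \<ge> N" for n
      using that abs_ge_self[of "C * (1 / (real n + 1))"] by fastforce
    have "lp_norm p (Riesz_P (g m) - Riesz_P (g n)) < e" if "m \<ge> N" "n \<ge> N" for m n
      using dP[of m n] N[OF that(1)] N[OF that(2)] unfolding distrib_left by linarith
    then show "\<exists>N. \<forall>m\<ge>N. \<forall>n\<ge>N. lp_norm p (Riesz_P (g m) - Riesz_P (g n)) < e" by blast
  qed (auto intro: PL p1)
  have coeff: "fcoeff h k = (if k \<ge> 0 then fcoeff f k else 0)" for k
  proof -
    have "cmod (fcoeff h k - (if k \<ge> 0 then fcoeff f k else 0)) \<le> lp_norm p (Riesz_P (g n) - h) + lp_norm p (f - g n)" for n
    proof -
      have 1: "cmod (fcoeff (Riesz_P (g n)) k - fcoeff h k) \<le> lp_norm p (Riesz_P (g n) - h)"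
        using norm_fcoeff_le'[of "Riesz_P (g n) - h" p k] PL[of n] h(1) p1
        by (simp add: Lp_diff fcoeff_diff Lp_imp_L1)
      have 2: "cmod (fcoeff f k - fcoeff (g n) k) \<le> lp_norm p (f - g n)"
        using norm_fcoeff_le'[of "f - g n" p k] gL[of n] f p1
        by (simp add: Lp_diff fcoeff_diff Lp_imp_L1)
      show ?thesis
      proof (cases "k \<ge> 0")
        case True
        have "fcoeff h k - fcoeff f k = - ((fcoeff (g n) k - fcoeff h k) + (fcoeff f k - fcoeff (g n) k))" by simp
        also have "cmod \<dots> \<le> cmod (fcoeff (g n) k - fcoeff h k) + cmod (fcoeff f k - fcoeff (g n) k)"
          unfolding norm_minus_cancel by (rule norm_triangle_ineq)
        finally show ?thesis using 1 2 True by (simp add: Riesz_P_trig g)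
      next
        case False
        then show ?thesis using 1 by (simp add: Riesz_P_trig g add_increasing2)
      qed
    qed
    moreover have "(\<lambda>n. lp_norm p (Riesz_P (g n) - h) + lp_norm p (f - g n)) \<longlonglongrightarrow> 0 + 0"
      by (intro tendsto_add h(2) g0)
    ultimately have "cmod (fcoeff h k - (if k \<ge> 0 then fcoeff f k else 0)) \<le> 0"
      by (intro LIMSEQ_le_const[of _ 0]) auto
    then show ?thesis by simp
  qed
  have Ph: "Riesz_P f = h" by (rule Riesz_P_eqI[OF Lp_imp_L1[OF h(1) p1(1)] coeff])
  show "Riesz_P f \<in> Lp p" "fcoeff (Riesz_P f) n = (if n \<ge> 0 then fcoeff f n else 0)"
    using h coeff by (auto simp: Ph)
  have "lp_norm p h \<le> lp_norm p (Riesz_P (g n) - h) + C * (lp_norm p f + lp_norm p (f - g n))" for n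
  proof -
    have "lp_norm p (Riesz_P (g n) - (Riesz_P (g n) - h)) \<le> lp_norm p (Riesz_P (g n)) + lp_norm p (Riesz_P (g n) - h)"
      by (intro lp_norm_triangle_diff Lp_diff PL h p1)
    moreover have "lp_norm p (f - (f - g n)) \<le> lp_norm p f + lp_norm p (f - g n)"
      by (intro lp_norm_triangle_diff Lp_diff f gL p1)
    then have "C * lp_norm p (g n) \<le> C * (lp_norm p f + lp_norm p (f - g n))" using C(1) by (intro mult_left_mono) auto
    ultimately show ?thesis using C(2)[OF g(1)[of n]] by simp
  qed
  moreover have "(\<lambda>n. lp_norm p (Riesz_P (g n) - h) + C * (lp_norm p f + lp_norm p (f - g n))) \<longlonglongrightarrow> 0 + C * (lp_norm p f + 0)"
    by (intro tendsto_add tendsto_mult tendsto_const h(2) g0)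
  ultimately show "lp_norm p (Riesz_P f) \<le> C * lp_norm p f"
    unfolding Ph by (intro LIMSEQ_le_const[of _ "C * lp_norm p f"]) auto
qed

text \<open>For p > 2 by duality: P f is tested against its own dual element in L^q, where q < 2,
  and the projection is moved onto that element.\<close>

lemma Riesz_trig:
  assumes p: "p > 1"
  obtains C where "C \<ge> 0" "\<And>f. f \<in> trig \<Longrightarrow> lp_norm p (Riesz_P f) \<le> C * lp_norm p f"
proof (cases "p \<le> 2")
  case True
  then show ?thesis using Riesz_trig_le2[OF p True] that by metis
next
  case False
  define q where "q = conj_exp p"
  have q: "q > 1" "conj_exp q = p" using conj_exp[OF p] by (auto simp: q_def)
  have "q \<le> 2" using False by (simp add: q_def conj_exp_def field_simps)
  then obtain C where C: "C \<ge> 0" "\<And>f. f \<in> trig \<Longrightarrow> lp_norm q (Riesz_P f) \<le> C * lp_norm q f"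
    using Riesz_trig_le2[OF q(1)] by metis
  show ?thesis
  proof (rule that[OF C(1)])
    fix f assume f: "f \<in> trig"
    define h where "h = Riesz_P f"
    have hL: "h \<in> Lp p" "f \<in> Lp p" using Riesz_P_trig(1)[OF f] f p by (auto simp: h_def intro: trig_Lp)
    define k where "k = dual_elt p h"
    have k: "k \<in> Lp q" "lp_norm q k = lp_norm p h powr (p - 1)" "pairing h k = of_real (lp_norm p h powr p)"
      using dual_elt[OF p hL(1)] by (auto simp: k_def q_def)
    note R = Riesz_extend[OF q(1) C k(1)]
    have "pairing h k = pairing f (Riesz_P k)"
      unfolding h_def using R q k by (intro pairing_Riesz_trig f) (auto intro: Lp_imp_L1)
    then have "lp_norm p h powr p = cmod (pairing f (Riesz_P k))"
      using k(3) by (metis norm_of_real abs_of_nonneg powr_ge_zero)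
    also have "\<dots> \<le> lp_norm p f * lp_norm q (Riesz_P k)"
      using pairing_L1(2)[OF p hL(2)] R(1) by (simp add: q_def)
    also have "\<dots> \<le> lp_norm p f * (C * lp_norm p h powr (p - 1))"
      using R(2) by (intro mult_left_mono) (auto simp: k)
    finally have le: "lp_norm p h powr p \<le> C * lp_norm p f * lp_norm p h powr (p - 1)" by (simp add: mult_ac)
    show "lp_norm p (Riesz_P f) \<le> C * lp_norm p f"
    proof (cases "lp_norm p h = 0")
      case True
      then show ?thesis using C by (simp add: h_def)
    next
      case nz: False
      then have pos: "lp_norm p h > 0" using lp_norm_nonneg[of p h] by linarith
      have "lp_norm p h powr p = lp_norm p h * lp_norm p h powr (p - 1)"
        using powr_add[of "lp_norm p h" 1 "p - 1"] pos by simp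
      with le pos show ?thesis by (simp add: h_def)
    qed
  qed
qed

lemma Riesz_P_bounded:
  assumes p: "p > 1"
  obtains C where "C \<ge> 0" "\<And>f. f \<in> Lp p \<Longrightarrow> lp_norm p (Riesz_P f) \<le> C * lp_norm p f"
  using Riesz_trig[OF p] Riesz_extend(2)[OF p] by metis

lemma Riesz_P_Lp:
  assumes p: "p > 1" and f: "f \<in> Lp p"
  shows "Riesz_P f \<in> Lp p" "fcoeff (Riesz_P f) n = (if n \<ge> 0 then fcoeff f n else 0)"
  using Riesz_trig[OF p] Riesz_extend(1,3)[OF p _ _ f] by metis+

section \<open>Hardy spaces\<close>

text \<open>The range of Q on L^p. In contrast to \<open>Hardy_bar\<close> the constants are
  excluded; this is what separates it from \<open>Hardy\<close>.\<close>

definition Hneg :: "real \<Rightarrow> lfun set" where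
  "Hneg p = {f \<in> Lp p. \<forall>n\<ge>0. fcoeff f n = 0}"

lemma Hardy_Lp: "f \<in> Hardy p \<Longrightarrow> f \<in> Lp p" by (simp add: Hardy_def)
lemma Hneg_Lp: "f \<in> Hneg p \<Longrightarrow> f \<in> Lp p" by (simp add: Hneg_def)
lemma Hardy_bar_Lp: "f \<in> Hardy_bar p \<Longrightarrow> f \<in> Lp p" by (simp add: Hardy_bar_def)

lemma lcnj_Hardy [simp]: "lcnj f \<in> Hardy p \<longleftrightarrow> f \<in> Hardy_bar p"
proof -
  have "(\<forall>n<0. fcoeff f (- n) = 0) \<longleftrightarrow> (\<forall>n>0. fcoeff f n = 0)"
    by (metis minus_minus neg_0_less_iff_less neg_less_0_iff_less)
  moreover have "lcnj f \<in> Lp p \<longleftrightarrow> f \<in> Lp p" using Lp_lcnj[of f p] Lp_lcnj[of "lcnj f" p] by auto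
  ultimately show ?thesis by (auto simp: Hardy_def Hardy_bar_def fcoeff_lcnj)
qed

lemma lcnj_Hardy_bar [simp]: "lcnj f \<in> Hardy_bar p \<longleftrightarrow> f \<in> Hardy p"
  using lcnj_Hardy[of "lcnj f" p] by simp

lemma Hneg_Hardy_bar: "f \<in> Hneg p \<Longrightarrow> f \<in> Hardy_bar p"
  by (auto simp: Hneg_def Hardy_bar_def)

lemma Riesz_P_Hardy: "p > 1 \<Longrightarrow> f \<in> Lp p \<Longrightarrow> Riesz_P f \<in> Hardy p"
  by (auto simp: Hardy_def Riesz_P_Lp)

lemma Riesz_Q_Hneg: "p > 1 \<Longrightarrow> f \<in> Lp p \<Longrightarrow> Riesz_Q f \<in> Hneg p"
  using Riesz_P_Lp[of p f] by (auto simp: Hneg_def Riesz_Q_def fcoeff_diff Lp_imp_L1 intro: Lp_diff)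

lemma Riesz_P_id: "p \<ge> 1 \<Longrightarrow> f \<in> Hardy p \<Longrightarrow> Riesz_P f = f"
  by (rule Riesz_P_eqI) (auto simp: Hardy_def intro: Lp_imp_L1)

lemma Riesz_P_Hneg: "f \<in> Hneg p \<Longrightarrow> Riesz_P f = 0"
  by (rule Riesz_P_eqI) (auto simp: Hneg_def)

lemma Riesz_P_0 [simp]: "Riesz_P 0 = 0"
  by (rule Riesz_P_eqI) auto

lemma Riesz_P_eq_0_iff: "p > 1 \<Longrightarrow> f \<in> Lp p \<Longrightarrow> Riesz_P f = 0 \<longleftrightarrow> f \<in> Hneg p"
  using Riesz_Q_Hneg[of p f] Riesz_P_Hneg[of f p] by (auto simp: Riesz_Q_def)

lemma Riesz_P_add:
  assumes "p > 1" "f \<in> Lp p" "g \<in> Lp p" shows "Riesz_P (f + g) = Riesz_P f + Riesz_P g"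
  by (rule Riesz_P_eqI)
     (use assms Riesz_P_Lp[of p f] Riesz_P_Lp[of p g] in \<open>auto simp: fcoeff_add Lp_imp_L1 intro!: Lp_add\<close>)

lemma Riesz_P_lscale:
  assumes "p > 1" "f \<in> Lp p" shows "Riesz_P (lscale c f) = lscale c (Riesz_P f)"
  by (rule Riesz_P_eqI)
     (use assms Riesz_P_Lp[of p f] in \<open>auto simp: fcoeff_lscale Lp_imp_L1 intro!: Lp_lscale\<close>)

lemma Riesz_P_diff:
  assumes "p > 1" "f \<in> Lp p" "g \<in> Lp p" shows "Riesz_P (f - g) = Riesz_P f - Riesz_P g"
  using Riesz_P_add[OF assms(1,2) Lp_lscale[OF assms(3)], of "-1"] Riesz_P_lscale[OF assms(1,3), of "-1"] by simp

lemma closed_subspace_Hardy: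
  assumes p: "p > 1" shows "closed_subspace p (Hardy p)"
  unfolding closed_subspace_def
proof (intro conjI allI impI)
  show "lfun.subspace (Hardy p)"
    using p by (auto simp: lfun.subspace_def Hardy_def fcoeff_add fcoeff_lscale Lp_imp_L1 intro: Lp_add Lp_lscale)
  fix r y assume *: "(\<forall>n. r n \<in> Hardy p) \<and> y \<in> Lp p \<and> (\<lambda>n::nat. lp_norm p (r n - y)) \<longlonglongrightarrow> 0"
  have "fcoeff y k = 0" if "k < 0" for k
  proof -
    have "cmod (fcoeff y k) \<le> lp_norm p (r n - y)" for n
    proof -
      have "r n \<in> Lp p" "y \<in> Lp p" "fcoeff (r n) k = 0" using * that by (auto simp: Hardy_def)
      then show ?thesis using norm_fcoeff_le'[of "r n - y" p k] p by (simp add: Lp_diff fcoeff_diff Lp_imp_L1)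
    qed
    then have "cmod (fcoeff y k) \<le> 0" using * by (intro LIMSEQ_le_const[of _ 0]) auto
    then show ?thesis by simp
  qed
  then show "y \<in> Hardy p" using * by (auto simp: Hardy_def)
qed (auto simp: Hardy_def)

lemmas Hardy_add = closed_subspaceD(4)[OF closed_subspace_Hardy]
  and Hardy_diff = closed_subspaceD(5)[OF closed_subspace_Hardy]
  and Hardy_lscale = closed_subspaceD(6)[OF closed_subspace_Hardy]
  and Hardy_0 = closed_subspaceD(3)[OF closed_subspace_Hardy]
  and Hardy_subspace = closed_subspaceD(2)[OF closed_subspace_Hardy]

lemma Hneg_subspace: "p > 1 \<Longrightarrow> lfun.subspace (Hneg p)"
  by (auto simp: lfun.subspace_def Hneg_def fcoeff_add fcoeff_lscale Lp_imp_L1 intro: Lp_add Lp_lscale)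

lemma Hardy_dense:
  assumes p: "p > 1" and f: "f \<in> Hardy p" and e: "e > 0"
  obtains g where "g \<in> trig" "g \<in> Hardy p" "lp_norm p (f - g) < e"
proof -
  obtain C where C: "C \<ge> 0" "\<And>f. f \<in> Lp p \<Longrightarrow> lp_norm p (Riesz_P f) \<le> C * lp_norm p f"
    using Riesz_P_bounded[OF p] by metis
  have "e / (C + 1) > 0" using e C by simp
  then obtain g where g: "g \<in> trig" "lp_norm p (f - g) < e / (C + 1)"
    using trig_dense[OF p Hardy_Lp[OF f]] by metis
  have gL: "g \<in> Lp p" using g p by (intro trig_Lp) auto
  have "f - Riesz_P g = Riesz_P (f - g)"
    using Riesz_P_diff[OF p Hardy_Lp[OF f] gL] Riesz_P_id[OF _ f] p by simp
  then have "lp_norm p (f - Riesz_P g) \<le> C * lp_norm p (f - g)"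
    using C(2)[of "f - g"] Lp_diff[OF Hardy_Lp[OF f] gL] p by simp
  also have "\<dots> \<le> C * (e / (C + 1))" using g C by (intro mult_left_mono) auto
  also have "\<dots> < e" using e C by (simp add: field_simps)
  finally show ?thesis using that Riesz_P_trig(1)[OF g(1)] Riesz_P_Hardy[OF p gL] by blast
qed

text \<open>True for trigonometric f by comparing finite sums; both sides depend boundedly on f,
  with D collecting the two bounds.\<close>

lemma pairing_Riesz:
  assumes p: "p > 1" and f: "f \<in> Lp p" and g: "g \<in> Lp (conj_exp p)"
  shows "pairing (Riesz_P f) g = pairing f (Riesz_P g)"
proof -
  define q where "q = conj_exp p"
  have q: "q > 1" using conj_exp[OF p] by (simp add: q_def)
  have Pg: "Riesz_P g \<in> Lp q" using Riesz_P_Lp(1)[OF q] g by (simp add: q_def)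
  obtain C where C: "C \<ge> 0" "\<And>f. f \<in> Lp p \<Longrightarrow> lp_norm p (Riesz_P f) \<le> C * lp_norm p f"
    using Riesz_P_bounded[OF p] by metis
  define D where "D = C * lp_norm q g + lp_norm q (Riesz_P g)"
  have D: "D \<ge> 0" using C by (simp add: D_def)
  have "cmod (pairing (Riesz_P f) g - pairing f (Riesz_P g)) \<le> 0 + e" if e: "e > 0" for e
  proof -
    obtain h where h: "h \<in> trig" "lp_norm p (f - h) < e / (D + 1)"
      using trig_dense[OF p f, of "e / (D + 1)"] e D by (metis add_nonneg_pos divide_pos_pos zero_less_one)
    have hL: "h \<in> Lp p" using h p by (intro trig_Lp) auto
    have d: "f - h \<in> Lp p" using f hL p by (intro Lp_diff) auto
    have "pairing (Riesz_P h) g = pairing h (Riesz_P g)"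
      using g Pg Riesz_P_Lp[OF q, of g] q by (intro pairing_Riesz_trig h) (auto simp: q_def intro: Lp_imp_L1)
    moreover have "pairing (Riesz_P f) g = pairing (Riesz_P h) g + pairing (Riesz_P (f - h)) g"
      using pairing_add_left(1)[OF p Riesz_P_Lp(1)[OF p hL] Riesz_P_Lp(1)[OF p d] g] Riesz_P_add[OF p hL d] by simp
    moreover have "pairing f (Riesz_P g) = pairing h (Riesz_P g) + pairing (f - h) (Riesz_P g)"
      using pairing_add_left(1)[OF p hL d] Pg by (simp add: q_def)
    ultimately have "pairing (Riesz_P f) g - pairing f (Riesz_P g) = pairing (Riesz_P (f - h)) g - pairing (f - h) (Riesz_P g)"
      by simp
    also have "cmod \<dots> \<le> cmod (pairing (Riesz_P (f - h)) g) + cmod (pairing (f - h) (Riesz_P g))"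
      by (rule norm_triangle_ineq4)
    also have "\<dots> \<le> (C * lp_norm p (f - h)) * lp_norm q g + lp_norm p (f - h) * lp_norm q (Riesz_P g)"
    proof (intro add_mono)
      have "cmod (pairing (Riesz_P (f - h)) g) \<le> lp_norm p (Riesz_P (f - h)) * lp_norm q g"
        using pairing_L1(2)[OF p Riesz_P_Lp(1)[OF p d] g] by (simp add: q_def)
      also have "\<dots> \<le> (C * lp_norm p (f - h)) * lp_norm q g" using C(2)[OF d] by (intro mult_right_mono) auto
      finally show "cmod (pairing (Riesz_P (f - h)) g) \<le> (C * lp_norm p (f - h)) * lp_norm q g" .
      show "cmod (pairing (f - h) (Riesz_P g)) \<le> lp_norm p (f - h) * lp_norm q (Riesz_P g)"
        using pairing_L1(2)[OF p d] Pg by (simp add: q_def)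
    qed
    also have "\<dots> = lp_norm p (f - h) * D" by (simp add: D_def algebra_simps)
    also have "\<dots> \<le> (e / (D + 1)) * D" using h D by (intro mult_right_mono) auto
    also have "\<dots> \<le> e" using e D by (simp add: field_simps)
    finally show ?thesis by simp
  qed
  then have "cmod (pairing (Riesz_P f) g - pairing f (Riesz_P g)) \<le> 0" by (rule field_le_epsilon)
  then show ?thesis by simp
qed

lemma pairing_Hardy_Hneg:
  assumes p: "p > 1" and f: "f \<in> Hardy p" and g: "g \<in> Hneg (conj_exp p)"
  shows "pairing f g = 0" "pairing g f = 0"
proof -
  have "pairing f g = pairing (Riesz_P f) g" using Riesz_P_id[OF _ f] p by simp
  also have "\<dots> = pairing f (Riesz_P g)" by (rule pairing_Riesz[OF p Hardy_Lp[OF f] Hneg_Lp[OF g]])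
  finally show "pairing f g = 0" by (simp add: Riesz_P_Hneg[OF g])
  then show "pairing g f = 0" using pairing_commute[of g f] by simp
qed

lemma pairing_Hneg_Hardy:
  assumes p: "p > 1" and f: "f \<in> Hneg p" and g: "g \<in> Hardy (conj_exp p)"
  shows "pairing f g = 0"
  using pairing_Hardy_Hneg(2)[of "conj_exp p" g f] conj_exp[OF p] f g by simp

lemma fcoeff_times_eq_pairing: "fcoeff (f * g) n = pairing f (monomial n * lcnj g)"
  by (simp add: fcoeff_def pairing_def mult_ac)

text \<open>The n-th coefficient of f g is the pairing of f with t^n cnj g, which lies in
  \<open>Hneg\<close> for n < 0. For n = 0 only the constant term of cnj g survives.\<close>

lemma Hardy_times:
  assumes p: "p > 1" and f: "f \<in> Hardy p" and g: "g \<in> Hardy (conj_exp p)"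
  shows "f * g \<in> Hardy 1" "fcoeff (f * g) 0 = fcoeff f 0 * fcoeff g 0"
proof -
  define q where "q = conj_exp p"
  have q: "q > 1" using conj_exp[OF p] by (simp add: q_def)
  have gq: "g \<in> Lp q" "lcnj g \<in> Lp q" using g Lp_lcnj by (auto simp: q_def Hardy_Lp)
  have "fcoeff (f * g) n = 0" if "n < 0" for n
  proof -
    have "monomial n * lcnj g \<in> Hneg q"
      using that g q gq by (auto simp: Hneg_def fcoeff_monomial_times fcoeff_lcnj q_def Hardy_def intro: Lp_monomial_times)
    then show ?thesis
      unfolding fcoeff_times_eq_pairing using pairing_Hardy_Hneg(1)[OF p f] by (simp add: q_def)
  qed
  moreover have "f * g \<in> Lp 1" using Holder(1)[OF p Hardy_Lp[OF f] Hardy_Lp[OF g]] .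
  ultimately show "f * g \<in> Hardy 1" by (auto simp: Hardy_def)
  have n: "lcnj g - lscale (cnj (fcoeff g 0)) 1 \<in> Hneg q"
    using g q gq by (auto simp: Hneg_def fcoeff_diff Lp_imp_L1 Lp_const fcoeff_lscale fcoeff_one fcoeff_lcnj q_def Hardy_def
        intro!: Lp_diff)
  have "fcoeff (f * g) 0 = pairing f (lcnj g)" unfolding fcoeff_times_eq_pairing by simp
  also have "\<dots> = pairing f (lscale (cnj (fcoeff g 0)) 1) + pairing f (lcnj g - lscale (cnj (fcoeff g 0)) 1)"
    using pairing_add_right(1)[OF p Hardy_Lp[OF f], of "lscale (cnj (fcoeff g 0)) 1" "lcnj g - lscale (cnj (fcoeff g 0)) 1"]
      n q by (simp add: Hneg_Lp Lp_const q_def)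
  also have "\<dots> = fcoeff g 0 * pairing f 1"
    using pairing_Hardy_Hneg(1)[OF p f] n by (simp add: q_def pairing_lscale)
  also have "pairing f 1 = fcoeff f 0" using pairing_monomial(1)[of f 0] by simp
  finally show "fcoeff (f * g) 0 = fcoeff f 0 * fcoeff g 0" by simp
qed

lemma Hardy_bar_times:
  assumes p: "p > 1" and f: "f \<in> Hardy_bar p" and g: "g \<in> Hardy_bar (conj_exp p)"
  shows "f * g \<in> Hardy_bar 1" "fcoeff (f * g) 0 = fcoeff f 0 * fcoeff g 0"
  using Hardy_times[OF p, of "lcnj f" "lcnj g"] f g
  by (simp_all add: lcnj_simps(4)[symmetric] fcoeff_lcnj del: lcnj_simps(4))
     (metis complex_cnj_cancel_iff complex_cnj_mult)

lemma Hardy_1_times_Hneg: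
  assumes p: "p > 1" and f: "f \<in> Hardy_bar p" and g: "g \<in> Hneg (conj_exp p)"
  shows "f * g \<in> Hneg 1"
  using Hardy_bar_times[OF p f Hneg_Hardy_bar[OF g]] g
  by (auto simp: Hneg_def Hardy_bar_def order_le_less)

lemma lfun_const:
  assumes "F \<in> Hardy 1" "F \<in> Hardy_bar 1" shows "F = lscale (fcoeff F 0) 1"
proof (rule lfun_eqI_fcoeff)
  show "fcoeff F n = fcoeff (lscale (fcoeff F 0) 1) n" for n
    using assms by (cases n "0::int" rule: linorder_cases) (auto simp: Hardy_def Hardy_bar_def fcoeff_lscale fcoeff_one)
qed (use assms in \<open>auto simp: Hardy_def intro: Lp_const\<close>)

lemma Hardy_Hneg_0: "F \<in> Hardy 1 \<Longrightarrow> F \<in> Hneg 1 \<Longrightarrow> F = 0"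
  by (rule lfun_eq_0I) (auto simp: Hardy_def Hneg_def, metis not_le)

lemma Hardy_mono: "f \<in> Hardy p \<Longrightarrow> 1 \<le> r \<Longrightarrow> r \<le> p \<Longrightarrow> f \<in> Hardy r"
  by (auto simp: Hardy_def Lp_exponent_mono)

lemma monomial_times_Hardy: "p > 0 \<Longrightarrow> f \<in> Hardy p \<Longrightarrow> k \<ge> 0 \<Longrightarrow> monomial k * f \<in> Hardy p"
  by (auto simp: Hardy_def fcoeff_monomial_times intro: Lp_monomial_times)

lemma monomial_times_Hneg: "p > 0 \<Longrightarrow> f \<in> Hneg p \<Longrightarrow> k \<le> 0 \<Longrightarrow> monomial k * f \<in> Hneg p"
  by (auto simp: Hneg_def fcoeff_monomial_times intro: Lp_monomial_times)

lemma monomial_Hardy: "p > 0 \<Longrightarrow> k \<ge> 0 \<Longrightarrow> monomial k \<in> Hardy p"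
  by (auto simp: Hardy_def fcoeff_monomial intro: Lp_monomial)

text \<open>An element of \<open>H\<^sup>2\<close> that vanishes on a set of positive measure is zero.  The idea is Helson's: if
  \<open>f\<^sub>0 \<noteq> 0\<close>, the difference of \<open>f\<close> and its projection to the closed span of \<open>tf, t\<^sup>2f, \<dots>\<close> has constant
  modulus, is not zero, and vanishes where \<open>f\<close> does.\<close>

lemma Hardy_2_zero_divisor_aux:
  assumes f: "f \<in> Hardy 2" "fcoeff f 0 \<noteq> 0" and fh: "f * h = 0"
  shows "h = 0"
proof -
  have two: "conj_exp 2 = (2::real)" by (simp add: conj_exp_def)
  have fL: "f \<in> Lp 2" using f by (simp add: Hardy_Lp)
  \<comment> \<open>The indicator of the set where h does not vanish; it is bounded, so
    multiplication by it is continuous and f e = 0 passes to the closed span.\<close>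
  define e where "e = abs_lfun (\<lambda>t. if rep_lfun h t = 0 then 0 else 1)"
  have repe: "AE t in circ. rep_lfun e t = (if rep_lfun h t = 0 then 0 else 1)"
    unfolding e_def by (rule rep_abs_lfun) measurable
  have eL: "e \<in> Linf" by (rule Linf_I[OF repe, where C = 1]) auto
  have fe: "f * e = 0"
  proof (rule lfun_eqI_AE[OF _ rep_lfun_zero])
    show "AE t in circ. rep_lfun (f * e) t = 0"
      using rep_lfun_times[of f e] rep_lfun_times[of f h] repe rep_lfun_zero unfolding fh by eventually_elim auto
  qed
  define V where "V = lfun.span ((\<lambda>k. monomial (int (Suc k)) * f) ` UNIV)"
  have sV: "lfun.subspace V" by (simp add: V_def)
  have "v \<in> Lp 2 \<and> fcoeff v 0 = 0 \<and> v * e = 0 \<and> monomial (int k) * v \<in> V" if "v \<in> V" for v k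
    using that unfolding V_def
  proof (induction rule: lfun.span_induct_alt)
    case base
    show ?case by (simp add: lfun.span_zero)
  next
    case (step c x y)
    then obtain j where x: "x = monomial (int (Suc j)) * f" by auto
    have xL: "x \<in> Lp 2" unfolding x using fL by (intro Lp_monomial_times) auto
    have "fcoeff x 0 = 0" using f(1) by (simp add: x fcoeff_monomial_times Hardy_def)
    moreover have "x * e = 0" using fe by (simp add: x mult.assoc)
    moreover have "monomial (int k) * x = monomial (int (Suc (k + j))) * f"
      by (simp add: x mult.assoc[symmetric] monomial_mult add_ac)
    then have "monomial (int k) * x \<in> lfun.span ((\<lambda>k. monomial (int (Suc k)) * f) ` UNIV)"
      by (intro lfun.span_base) blast
    ultimately show ?case
      using step xL by (auto simp: fcoeff_add Lp_imp_L1 Lp_lscale fcoeff_lscale distrib_right distrib_left lscale_times_left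
          lscale_times_right intro!: Lp_add lfun.span_add lfun.span_scale)
  qed
  then have V: "v \<in> Lp 2" "fcoeff v 0 = 0" "v * e = 0" "monomial (int k) * v \<in> V" if "v \<in> V" for v k using that by auto
  define R where "R = Lclosure 2 V"
  have VL: "V \<subseteq> Lp 2" using V(1) by auto
  have R: "closed_subspace 2 R" unfolding R_def by (intro closed_subspace_Lclosure VL sV) auto
  have VR: "V \<subseteq> R" unfolding R_def by (rule subset_Lclosure[OF VL])
  have RL: "r \<in> Lp 2" if "r \<in> R" for r using that by (simp add: R_def Lclosure_def)
  have near: "\<exists>v\<in>V. lp_norm 2 (r - v) < d" if "r \<in> R" "d > 0" for r d using that by (simp add: R_def Lclosure_def)
  have R0: "fcoeff r 0 = 0" if r: "r \<in> R" for r
  proof -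
    have "cmod (fcoeff r 0) \<le> 0 + d" if d: "d > 0" for d
    proof -
      obtain v where v: "v \<in> V" "lp_norm 2 (r - v) < d" using near[OF r d] by blast
      have "cmod (fcoeff (r - v) 0) \<le> lp_norm 2 (r - v)"
        using RL[OF r] V(1)[OF v(1)] by (intro norm_fcoeff_le' Lp_diff) auto
      then show ?thesis using v V(2)[OF v(1)] RL[OF r] V(1)[OF v(1)] by (simp add: fcoeff_diff Lp_imp_L1[of _ 2])
    qed
    then have "cmod (fcoeff r 0) \<le> 0" by (rule field_le_epsilon)
    then show ?thesis by simp
  qed
  obtain C where C: "C \<ge> 0" "\<And>g. g \<in> Lp 2 \<Longrightarrow> e * g \<in> Lp 2 \<and> lp_norm 2 (e * g) \<le> C * lp_norm 2 g"
    using Linf_mult_Lp[OF eL, of 2] by auto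
  have Re: "r * e = 0" if r: "r \<in> R" for r
  proof -
    have "lp_norm 2 (e * r) \<le> 0 + d" if d: "d > 0" for d
    proof -
      have "d / (C + 1) > 0" using d C by simp
      then obtain v where v: "v \<in> V" "lp_norm 2 (r - v) < d / (C + 1)" using near[OF r] by blast
      have "e * r = e * (r - v)" using V(3)[OF v(1)] by (simp add: right_diff_distrib mult.commute)
      then have "lp_norm 2 (e * r) \<le> C * lp_norm 2 (r - v)"
        using C(2)[of "r - v"] RL[OF r] V(1)[OF v(1)] by (simp add: Lp_diff)
      also have "\<dots> \<le> C * (d / (C + 1))" using v C by (intro mult_left_mono) auto
      also have "\<dots> \<le> d" using d C by (simp add: field_simps)
      finally show ?thesis by simp
    qed
    then have "lp_norm 2 (e * r) \<le> 0" by (rule field_le_epsilon)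
    then have "e * r = 0" using lp_norm_eq_0_iff[of "e * r" 2] C(2)[OF RL[OF r]] lp_norm_nonneg[of 2 "e * r"] by simp
    then show ?thesis by (simp add: mult.commute)
  qed
  have Rmono: "monomial (int k) * r \<in> R" if r: "r \<in> R" for r k
  proof -
    have "\<exists>v\<in>V. lp_norm 2 (monomial (int k) * r - v) < d" if d: "d > 0" for d
    proof -
      obtain v where v: "v \<in> V" "lp_norm 2 (r - v) < d" using near[OF r d] by blast
      have "lp_norm 2 (monomial (int k) * (r - v)) \<le> lp_norm 2 (r - v)"
        using RL[OF r] V(1)[OF v(1)] by (intro lp_norm_monomial_times Lp_diff) auto
      then have "lp_norm 2 (monomial (int k) * r - monomial (int k) * v) < d" using v by (simp add: right_diff_distrib)
      then show ?thesis using V(4)[OF v(1)] by blast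
    qed
    then show ?thesis using RL[OF r] by (auto simp: R_def Lclosure_def intro: Lp_monomial_times)
  qed
  obtain r0 where r0: "r0 \<in> R" "\<And>z. z \<in> R \<Longrightarrow> pairing z (dual_elt 2 (f - r0)) = 0"
    using nearest_point[OF _ R fL] by auto
  define m where "m = f - r0"
  have mL: "m \<in> Lp 2" unfolding m_def using fL RL[OF r0(1)] by (intro Lp_diff) auto
  \<comment> \<open>At exponent 2 the duality map is the identity, so the nearest point is the
    orthogonal projection.\<close>
  have dual: "dual_elt 2 m = m"
  proof (rule lfun_eqI)
    show "AE t in circ. rep_lfun (dual_elt 2 m) t = rep_lfun m t"
      using rep_dual_elt[of 2 m] by eventually_elim (auto simp: powr_zero_eq_one)
  qed
  have "fcoeff m 0 \<noteq> 0" using f R0[OF r0(1)] fL RL[OF r0(1)] by (simp add: m_def fcoeff_diff Lp_imp_L1[of _ 2])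
  then have m0: "m \<noteq> 0" by auto
  have me: "m * e = 0" unfolding m_def using fe Re[OF r0(1)] by (simp add: left_diff_distrib)
  \<comment> \<open>For k > 0 the function t^k m lies in R, as t^k f does and R is stable under t^k,
    while m is orthogonal to R. So |m|^2 has only its constant coefficient, and this is not
    0.\<close>
  define M where "M = m * lcnj m"
  have MLp: "M \<in> Lp 1" unfolding M_def using pairing_L1(1)[of 2 m m] mL by (simp add: two)
  have Mneg: "fcoeff M (- int (Suc k)) = 0" for k
  proof -
    have "monomial (int (Suc k)) * f \<in> R" using VR by (auto simp: V_def intro: lfun.span_base)
    then have "monomial (int (Suc k)) * m \<in> R"
      unfolding m_def right_diff_distrib by (rule closed_subspaceD(5)[OF R _ Rmono[OF r0(1)]])
    then have "pairing (monomial (int (Suc k)) * m) m = 0" using r0(2) dual by (simp add: m_def)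
    then show ?thesis by (simp add: M_def fcoeff_def pairing_def mult_ac add_ac)
  qed
  have Msym: "lcnj M = M" by (simp add: M_def mult.commute)
  have Mpos: "fcoeff M (int (Suc k)) = 0" for k
    using Mneg[of k] fcoeff_lcnj[of M "int (Suc k)"] Msym by simp
  have "M = lscale (fcoeff M 0) 1"
  proof (rule lfun_eqI_fcoeff[OF MLp])
    fix n :: int
    consider (z) "n = 0" | (p) k where "n = int (Suc k)" | (n) k where "n = - int (Suc k)"
      by (metis int_cases3 not0_implies_Suc less_numeral_extra(3))
    then show "fcoeff M n = fcoeff (lscale (fcoeff M 0) 1) n"
      by cases (simp_all only: Mneg Mpos fcoeff_lscale fcoeff_one, simp_all)
  qed (auto intro: Lp_const)
  moreover have "M * e = 0" using me by (simp add: M_def mult_ac) (metis mult.commute mult_zero_right mult.assoc)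
  ultimately have "lscale (fcoeff M 0) e = 0" by (metis lfun_one_scale)
  moreover have "fcoeff M 0 = pairing m m" by (simp add: M_def fcoeff_def pairing_def)
  then have "fcoeff M 0 = of_real ((lp_norm 2 m)\<^sup>2)" by (simp only: lp_norm_2_pairing)
  then have "fcoeff M 0 \<noteq> 0" using m0 lp_norm_eq_0_iff[OF mL] by simp
  ultimately have "e = 0" by (simp add: lfun.scale_eq_0_iff)
  then have "AE t in circ. rep_lfun h t = 0"
    using repe rep_lfun_zero by (auto elim!: eventually_elim2 split: if_splits)
  then show ?thesis by (rule lfun_eqI_AE[OF _ rep_lfun_zero])
qed

lemma Hardy_first_coeff:
  assumes "f \<in> Hardy p" "p \<ge> 1" "f \<noteq> 0"
  obtains n :: nat where "fcoeff f (int n) \<noteq> 0" "\<And>m. m < int n \<Longrightarrow> fcoeff f m = 0"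
proof -
  have "\<exists>n::nat. fcoeff f (int n) \<noteq> 0"
  proof (rule ccontr)
    assume "\<not> ?thesis"
    then have "fcoeff f m = 0" for m
      using assms(1) by (cases "m < 0") (auto simp: Hardy_def dest: spec[of _ "nat m"])
    then show False using lfun_eq_0I[of f] assms Lp_imp_L1[OF Hardy_Lp[OF assms(1)]] by auto
  qed
  then obtain n :: nat where n: "fcoeff f (int n) \<noteq> 0" "\<And>k::nat. k < n \<Longrightarrow> fcoeff f (int k) = 0"
    using exists_least_iff[of "\<lambda>n. fcoeff f (int n) \<noteq> 0"] by auto
  have "fcoeff f m = 0" if "m < int n" for m
    using n(2)[of "nat m"] assms(1) that by (cases "m < 0") (auto simp: Hardy_def)
  with n(1) show ?thesis by (rule that)
qed

lemma Hardy_2_zero_divisor: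
  assumes f: "f \<in> Hardy 2" "f \<noteq> 0" and fh: "f * h = 0"
  shows "h = 0"
proof -
  obtain n :: nat where n: "fcoeff f (int n) \<noteq> 0" "\<And>m. m < int n \<Longrightarrow> fcoeff f m = 0"
    using Hardy_first_coeff[OF f(1) _ f(2)] by auto
  show ?thesis
  proof (rule Hardy_2_zero_divisor_aux)
    show "monomial (- int n) * f \<in> Hardy 2"
      using f(1) n(2) by (auto simp: Hardy_def fcoeff_monomial_times intro: Lp_monomial_times)
    show "fcoeff (monomial (- int n) * f) 0 \<noteq> 0" using n(1) by (simp add: fcoeff_monomial_times)
    show "monomial (- int n) * f * h = 0" using fh by (simp add: mult.assoc)
  qed
qed

text \<open>One of two conjugate exponents is at least 2, so one of the factors lies in H^2 and
  cannot divide zero.\<close>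

lemma Hardy_zero_divisor:
  assumes p: "p > 1" and f: "f \<in> Hardy p" and g: "g \<in> Hardy (conj_exp p)" and fg: "f * lcnj g = 0"
  shows "f = 0 \<or> g = 0"
proof (cases "p \<ge> 2")
  case True
  then have "f \<in> Hardy 2" using Hardy_mono[OF f, of 2] by simp
  then have "f = 0 \<or> lcnj g = 0" using Hardy_2_zero_divisor[of f "lcnj g"] fg by auto
  then show ?thesis by (metis lcnj_simps(7,8))
next
  case False
  then have "conj_exp p \<ge> 2" using p by (simp add: conj_exp_def field_simps)
  then have "g \<in> Hardy 2" using Hardy_mono[OF g, of 2] by simp
  moreover have "g * lcnj f = lcnj (f * lcnj g)" by (simp add: mult.commute)
  ultimately have "g = 0 \<or> lcnj f = 0" using Hardy_2_zero_divisor[of g "lcnj f"] fg by auto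
  then show ?thesis by (metis lcnj_simps(7,8))
qed

section \<open>The shift on Hardy spaces\<close>

context carleman_shift
begin

text \<open>Self-adjointness moves \<open>J\<close> onto a monomial, whose image is known explicitly
  and is orthogonal to f. No density argument is required.\<close>

lemma J_Hardy:
  assumes p: "p > 1" and f: "f \<in> Hardy p" shows "J f \<in> Hneg p"
proof -
  define q where "q = conj_exp p"
  have q: "q > 1" using conj_exp[OF p] by (simp add: q_def)
  have "fcoeff (J f) m = 0" if "m \<ge> 0" for m
  proof -
    have "J (monomial m) \<in> Hneg q"
      using fcoeff_J_monomial_nonneg[OF that] J_Lp[OF _ Lp_monomial] q by (auto simp: Hneg_def)
    then have "pairing f (J (monomial m)) = 0"
      using pairing_Hardy_Hneg(1)[OF p f] by (simp add: q_def)
    then show ?thesis by (simp add: pairing_monomial(1)[symmetric] pairing_J)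
  qed
  then show ?thesis using J_Lp[OF _ Hardy_Lp[OF f]] p by (auto simp: Hneg_def)
qed

lemma J_Hneg:
  assumes p: "p > 1" and f: "f \<in> Hneg p" shows "J f \<in> Hardy p"
proof -
  define q where "q = conj_exp p"
  have q: "q > 1" using conj_exp[OF p] by (simp add: q_def)
  have "fcoeff (J f) m = 0" if "m < 0" for m
  proof -
    have "J (monomial m) \<in> Hardy q"
      using fcoeff_J_monomial_neg[OF that] J_Lp[OF _ Lp_monomial] q
      by (auto simp: Hardy_def intro: fcoeff_J_monomial_neg[OF that])
    then have "pairing f (J (monomial m)) = 0"
      using pairing_Hneg_Hardy[OF p f] by (simp add: q_def)
    then show ?thesis by (simp add: pairing_monomial(1)[symmetric] pairing_J)
  qed
  then show ?thesis using J_Lp[OF _ Hneg_Lp[OF f]] p by (auto simp: Hardy_def)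
qed

lemma fcoeff_chi_times:
  assumes "f \<in> Lp 1"
  shows "fcoeff (chi \<beta> * f) n = cnj \<beta> / lam \<beta> * fcoeff f (n - 1) - 1 / lam \<beta> * fcoeff f n"
proof -
  have "chi \<beta> * f = lscale (cnj \<beta> / lam \<beta>) (monomial 1 * f) - lscale (1 / lam \<beta>) f"
    by (simp add: chi_eq left_diff_distrib lscale_times_left)
  then show ?thesis
    using assms by (simp add: fcoeff_diff Lp_lscale Lp_monomial_times fcoeff_lscale fcoeff_monomial_times)
qed

lemma chi_times_Hardy: "p \<ge> 1 \<Longrightarrow> f \<in> Hardy p \<Longrightarrow> chi \<beta> * f \<in> Hardy p"
  using Linf_times_Lp[OF Linf_chi, of p f] by (auto simp: Hardy_def fcoeff_chi_times Lp_imp_L1)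

lemma chi_power_times_Hardy: "p \<ge> 1 \<Longrightarrow> f \<in> Hardy p \<Longrightarrow> chi \<beta> ^ n * f \<in> Hardy p"
  by (induction n) (auto simp: mult.assoc intro: chi_times_Hardy)

lemma compose_eq_J: "\<A> f = chi \<beta> * J f"
  using chi_inverse by (simp add: J_alpha_def mult.assoc[symmetric])

text \<open>Composition is \<chi> times \<open>J\<close>, and multiplication by \<chi> raises
  frequencies by at most one, so negative frequencies become nonpositive ones.\<close>

lemma compose_Hardy:
  assumes p: "p > 1" and f: "f \<in> Hardy p" shows "\<A> f \<in> Hardy_bar p"
proof -
  have J: "J f \<in> Hneg p" by (rule J_Hardy[OF p f])
  then have "fcoeff (chi \<beta> * J f) n = 0" if "n > 0" for n
    using that p by (subst fcoeff_chi_times) (auto simp: Hneg_def Lp_imp_L1)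
  then show ?thesis
    using Linf_times_Lp[OF Linf_chi, of p "J f"] J p by (auto simp: Hardy_bar_def compose_eq_J Hneg_def)
qed

lemma compose_Hardy_bar:
  assumes p: "p > 1" and f: "f \<in> Hardy_bar p" shows "\<A> f \<in> Hardy p"
proof -
  have p1: "p \<ge> 1" "p > 0" using p by auto
  define c where "c = fcoeff f 0"
  have fL: "f \<in> Lp p" using f by (simp add: Hardy_bar_Lp)
  have g: "f - lscale c 1 \<in> Hneg p"
    using f fL p1 by (auto simp: Hneg_def c_def fcoeff_diff Lp_imp_L1 Lp_const fcoeff_lscale fcoeff_one Hardy_bar_def
        intro!: Lp_diff)
  have "\<A> (f - lscale c 1) \<in> Hardy p"
    unfolding compose_eq_J by (intro chi_times_Hardy p1 J_Hneg[OF p g])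
  moreover have "lscale c 1 \<in> Hardy p"
    using p monomial_Hardy[of p 0] by (intro Hardy_lscale) auto
  ultimately have "\<A> (f - lscale c 1) + lscale c 1 \<in> Hardy p" by (intro Hardy_add p)
  then show ?thesis by (simp add: compose_diff compose_lscale compose_one)
qed

lemma disc_value_summable:
  assumes "f \<in> Lp p" "p \<ge> 1" "cmod z < 1"
  shows "summable (\<lambda>n. fcoeff f (int n) * z ^ n)" "cmod (disc_value f z) \<le> lp_norm p f / (1 - cmod z)"
proof -
  have le: "cmod (fcoeff f (int n) * z ^ n) \<le> lp_norm p f * cmod z ^ n" for n
    using norm_fcoeff_le'[OF assms(1,2)] by (auto simp: norm_mult norm_power intro: mult_right_mono)
  have s: "summable (\<lambda>n. lp_norm p f * cmod z ^ n)" using assms by (intro summable_mult summable_geometric) auto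
  have sn: "summable (\<lambda>n. cmod (fcoeff f (int n) * z ^ n))"
    by (rule summable_comparison_test'[OF s, of 0]) (use le in auto)
  then show "summable (\<lambda>n. fcoeff f (int n) * z ^ n)" by (rule summable_norm_cancel)
  have "cmod (disc_value f z) \<le> (\<Sum>n. cmod (fcoeff f (int n) * z ^ n))"
    unfolding disc_value_def by (rule summable_norm[OF sn])
  also have "\<dots> \<le> (\<Sum>n. lp_norm p f * cmod z ^ n)" by (rule suminf_le[OF le sn s])
  also have "\<dots> = lp_norm p f / (1 - cmod z)"
    using assms by (subst suminf_mult) (auto simp: suminf_geometric summable_geometric)
  finally show "cmod (disc_value f z) \<le> lp_norm p f / (1 - cmod z)" .
qed

text \<open>The composition is antianalytic and takes at infinity the value of f at
  \<alpha>(infinity) = 1/cnj \<beta>. This holds for polynomials by linearity and extends because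
  both sides are bounded in the norm of f.\<close>

lemma fcoeff_compose_0:
  assumes p: "p > 1" and f: "f \<in> Hardy p"
  shows "fcoeff (\<A> f) 0 = disc_value f (1 / cnj \<beta>)"
proof -
  define z where "z = 1 / cnj \<beta>"
  have z: "cmod z < 1" using \<beta> by (simp add: z_def norm_divide divide_less_eq)
  have p1: "p \<ge> 1" "p > 0" using p by auto
  obtain C where C: "C \<ge> 0"
    "\<And>f. f \<in> Lp p \<Longrightarrow> \<A> f \<in> Lp p \<and> lp_norm p (\<A> f) \<le> C * lp_norm p f"
    using compose_bounded[OF p1(2)] by metis
  have fL: "f \<in> Lp p" using f by (simp add: Hardy_Lp)
  have trig: "fcoeff (\<A> g) 0 = disc_value g z" if g: "g \<in> trig" "g \<in> Hardy p" for g
  proof -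
    define S where "S = {k. fcoeff g k \<noteq> 0}"
    have S: "finite S" unfolding S_def by (rule finite_fcoeff_trig[OF g(1)])
    define T where "T = {n::nat. fcoeff g (int n) \<noteq> 0}"
    have T: "finite T" using finite_vimageI[OF S, of int] by (simp add: T_def S_def vimage_def)
    have "S \<subseteq> int ` T"
    proof
      fix k assume k: "k \<in> S"
      then have "k \<ge> 0" using g(2) by (auto simp: S_def Hardy_def not_less[symmetric])
      then show "k \<in> int ` T" using k by (intro image_eqI[of _ _ "nat k"]) (auto simp: S_def T_def)
    qed
    then have "g = (\<Sum>k\<in>int ` T. lscale (fcoeff g k) (monomial k))"
      using T by (intro trig_expand g) (auto simp: S_def)
    also have "\<dots> = (\<Sum>n\<in>T. lscale (fcoeff g (int n)) (monomial (int n)))"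
      by (subst sum.reindex) (auto simp: inj_on_def)
    finally have gs: "g = (\<Sum>n\<in>T. lscale (fcoeff g (int n)) (monomial (int n)))" .
    have csum: "\<A> (sum u I) = (\<Sum>n\<in>I. \<A> (u n))" if "finite I" for u and I :: "nat set"
      using that by (induction I) (auto simp: compose_add compose_zero)
    have "fcoeff (\<A> g) 0 = fcoeff (\<Sum>n\<in>T. lscale (fcoeff g (int n)) (\<A> (monomial (int n)))) 0"
      by (subst gs) (simp add: csum[OF T] compose_lscale)
    also have "\<dots> = (\<Sum>n\<in>T. fcoeff g (int n) * z ^ n)"
      by (subst fcoeff_sum)
         (auto simp: fcoeff_lscale fcoeff_compose_monomial_0 z_def intro!: Lp_lscale compose_Lp Lp_monomial)
    also have "\<dots> = disc_value g z"
      unfolding disc_value_def by (rule suminf_finite[symmetric]) (use T in \<open>auto simp: T_def\<close>)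
    finally show ?thesis .
  qed
  define D where "D = C + 1 / (1 - cmod z)"
  have D: "D \<ge> 0" using C z by (simp add: D_def)
  have "cmod (fcoeff (\<A> f) 0 - disc_value f z) \<le> 0 + e" if e: "e > 0" for e
  proof -
    have "e / (D + 1) > 0" using e D by simp
    then obtain g where g: "g \<in> trig" "g \<in> Hardy p" "lp_norm p (f - g) < e / (D + 1)"
      using Hardy_dense[OF p f] by metis
    have gL: "g \<in> Lp p" using g by (simp add: Hardy_Lp)
    have d: "f - g \<in> Lp p" using fL gL p1 by (intro Lp_diff)
    have "disc_value f z - disc_value g z = disc_value (f - g) z"
      unfolding disc_value_def using fL gL p1 z
      by (subst suminf_diff) (auto simp: disc_value_summable fcoeff_diff Lp_imp_L1[of _ p] left_diff_distrib)
    moreover have "fcoeff (\<A> f) 0 - fcoeff (\<A> g) 0 = fcoeff (\<A> (f - g)) 0"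
      using C(2)[OF fL] C(2)[OF gL] p1 by (simp add: compose_diff fcoeff_diff Lp_imp_L1[of _ p])
    ultimately have "fcoeff (\<A> f) 0 - disc_value f z = fcoeff (\<A> (f - g)) 0 - disc_value (f - g) z"
      using trig[OF g(1,2)] by (simp add: algebra_simps)
    also have "cmod \<dots> \<le> cmod (fcoeff (\<A> (f - g)) 0) + cmod (disc_value (f - g) z)"
      by (rule norm_triangle_ineq4)
    also have "\<dots> \<le> C * lp_norm p (f - g) + lp_norm p (f - g) / (1 - cmod z)"
      using C(2)[OF d] norm_fcoeff_le'[of "\<A> (f - g)" p 0] p1 disc_value_summable(2)[OF d p1(1) z]
      by (intro add_mono) auto
    also have "\<dots> = lp_norm p (f - g) * D" by (simp add: D_def algebra_simps)
    also have "\<dots> \<le> (e / (D + 1)) * D" using g D by (intro mult_right_mono) auto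
    also have "\<dots> \<le> e" using e D by (simp add: field_simps)
    finally show ?thesis by simp
  qed
  then have "cmod (fcoeff (\<A> f) 0 - disc_value f z) \<le> 0" by (rule field_le_epsilon)
  then show ?thesis by (simp add: z_def)
qed

end

section \<open>Toeplitz operators\<close>

lemma toeplitz_Hardy: "p > 1 \<Longrightarrow> g \<in> Linf \<Longrightarrow> f \<in> Lp p \<Longrightarrow> toeplitz g f \<in> Hardy p"
  unfolding toeplitz_def by (intro Riesz_P_Hardy Linf_times_Lp) auto

lemma toeplitz_add: "p > 1 \<Longrightarrow> g \<in> Linf \<Longrightarrow> f1 \<in> Lp p \<Longrightarrow> f2 \<in> Lp p \<Longrightarrow> toeplitz g (f1 + f2) = toeplitz g f1 + toeplitz g f2"
  unfolding toeplitz_def distrib_left by (intro Riesz_P_add[of p] Linf_times_Lp) auto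

lemma toeplitz_diff: "p > 1 \<Longrightarrow> g \<in> Linf \<Longrightarrow> f1 \<in> Lp p \<Longrightarrow> f2 \<in> Lp p \<Longrightarrow> toeplitz g (f1 - f2) = toeplitz g f1 - toeplitz g f2"
  unfolding toeplitz_def right_diff_distrib by (intro Riesz_P_diff[of p] Linf_times_Lp) auto

lemma toeplitz_lscale: "p > 1 \<Longrightarrow> g \<in> Linf \<Longrightarrow> f \<in> Lp p \<Longrightarrow> toeplitz g (lscale c f) = lscale c (toeplitz g f)"
  unfolding toeplitz_def lscale_times_right by (intro Riesz_P_lscale[of p] Linf_times_Lp) auto

lemma toeplitz_0 [simp]: "toeplitz g 0 = 0"
  by (simp add: toeplitz_def)

lemma pairing_Hardy_right:
  assumes p: "p > 1" and f: "f \<in> Hardy p" and k: "k \<in> Lp (conj_exp p)"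
  shows "pairing f (Riesz_P k) = pairing f k"
  using pairing_Riesz[OF p Hardy_Lp[OF f] k] Riesz_P_id[OF _ f] p by simp

lemma pairing_Hardy_left:
  assumes p: "p > 1" and f: "f \<in> Lp p" and k: "k \<in> Hardy (conj_exp p)"
  shows "pairing (Riesz_P f) k = pairing f k"
  using pairing_Riesz[OF p f Hardy_Lp[OF k]] Riesz_P_id[OF _ k] conj_exp[OF p] by simp

lemma pairing_toeplitz:
  assumes p: "p > 1" and g: "g \<in> Linf" and f: "f \<in> Hardy p" and k: "k \<in> Hardy (conj_exp p)"
  shows "pairing (toeplitz g f) k = pairing f (toeplitz (lcnj g) k)"
proof -
  have q: "conj_exp p > 1" using conj_exp[OF p] by simp
  have "pairing (toeplitz g f) k = pairing (g * f) k"
    unfolding toeplitz_def using p by (intro pairing_Hardy_left[OF p _ k] Linf_times_Lp[OF g _ Hardy_Lp[OF f]]) auto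
  also have "\<dots> = pairing f (lcnj g * k)" by (rule pairing_times)
  also have "\<dots> = pairing f (toeplitz (lcnj g) k)"
    unfolding toeplitz_def using q
    by (intro pairing_Hardy_right[OF p f, symmetric] Linf_times_Lp[OF Linf_lcnj[OF g] _ Hardy_Lp[OF k]]) auto
  finally show ?thesis .
qed

lemma Hardy_eqI_pairing:
  assumes p: "p > 1" and k: "k1 \<in> Hardy (conj_exp p)" "k2 \<in> Hardy (conj_exp p)"
    and eq: "\<And>f. f \<in> Hardy p \<Longrightarrow> pairing f k1 = pairing f k2"
  shows "k1 = k2"
proof (rule lfun_eqI_fcoeff)
  have q: "conj_exp p \<ge> 1" using conj_exp[OF p] by simp
  then show "k1 \<in> Lp 1" "k2 \<in> Lp 1" using k Hardy_Lp Lp_imp_L1 by blast+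
  show "fcoeff k1 n = fcoeff k2 n" for n
  proof (cases "n \<ge> 0")
    case True
    then have "cnj (fcoeff k1 n) = cnj (fcoeff k2 n)"
      using eq[of "monomial n"] monomial_Hardy[of p n] p by (simp add: pairing_monomial)
    then show ?thesis by simp
  next
    case False
    then show ?thesis using k by (simp add: Hardy_def)
  qed
qed

lemma adjoint_op_eqI:
  assumes p: "p > 1" and h: "h \<in> Hardy (conj_exp p)" "\<And>f. f \<in> Hardy p \<Longrightarrow> pairing (A f) k = pairing f h"
  shows "adjoint_op p A k = h"
  unfolding adjoint_op_def
proof (rule the_equality)
  fix h' assume "h' \<in> Hardy (conj_exp p) \<and> (\<forall>f\<in>Hardy p. pairing (A f) k = pairing f h')"
  then show "h' = h" using h by (intro Hardy_eqI_pairing[OF p]) auto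
qed (use h in auto)

text \<open>Any operator of H^q into itself that satisfies the duality relation may serve as the
  adjoint, because elements of H^q are determined by their pairings with H^p.\<close>

lemma coker_eqI:
  assumes p: "p > 1" and B: "\<And>k. k \<in> Hardy (conj_exp p) \<Longrightarrow> B k \<in> Hardy (conj_exp p)"
    "\<And>f k. f \<in> Hardy p \<Longrightarrow> k \<in> Hardy (conj_exp p) \<Longrightarrow> pairing (A f) k = pairing f (B k)"
  shows "coker p A = ker (conj_exp p) B"
  unfolding coker_def ker_def using adjoint_op_eqI[OF p B(1), of _ A] B(2) by auto

lemma coker_toeplitz:
  assumes p: "p > 1" and g: "g \<in> Linf"
  shows "coker p (toeplitz g) = ker (conj_exp p) (toeplitz (lcnj g))"
  using conj_exp[OF p]
  by (intro coker_eqI[OF p] toeplitz_Hardy Linf_lcnj g pairing_toeplitz[OF p g]) (auto simp: Hardy_Lp)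

lemma ker_toeplitz:
  assumes p: "p > 1" and g: "g \<in> Linf"
  shows "f \<in> ker p (toeplitz g) \<longleftrightarrow> f \<in> Hardy p \<and> g * f \<in> Hneg p"
  using Riesz_P_eq_0_iff[OF p, of "g * f"] Linf_times_Lp[OF g, of p f] p
  by (auto simp: ker_def toeplitz_def Hardy_Lp)

lemma ker_toeplitz_subspace:
  assumes p: "p > 1" and g: "g \<in> Linf"
  shows "lfun.subspace (ker p (toeplitz g))"
  unfolding lfun.subspace_def ker_def using p g
  by (auto simp: Hardy_0 Hardy_add Hardy_lscale toeplitz_add[of p] toeplitz_lscale[of p] Hardy_Lp)

text \<open>The product cnj k g f has only negative frequencies, and so has its conjugate; therefore
  it is 0. Invertibility of g leaves f cnj k = 0, where one factor must vanish.\<close>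

lemma Coburn:
  assumes p: "p > 1" and g: "g \<in> Linf" "g * g' = 1"
    and f: "f \<in> ker p (toeplitz g)" and k: "k \<in> ker (conj_exp p) (toeplitz (lcnj g))"
  shows "f = 0 \<or> k = 0"
proof -
  define q where "q = conj_exp p"
  have q: "q > 1" "conj_exp q = p" using conj_exp[OF p] by (auto simp: q_def)
  have f: "f \<in> Hardy p" "g * f \<in> Hneg p" using f ker_toeplitz[OF p g(1)] by auto
  have k: "k \<in> Hardy q" "lcnj g * k \<in> Hneg q"
    using k ker_toeplitz[OF q(1) Linf_lcnj[OF g(1)]] by (auto simp: q_def)
  have 1: "lcnj k * (g * f) \<in> Hneg 1"
    using k f by (intro Hardy_1_times_Hneg[OF q(1)]) (auto simp: q)
  have 2: "lcnj f * (lcnj g * k) \<in> Hneg 1"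
    using k f by (intro Hardy_1_times_Hneg[OF p]) (auto simp: q_def[symmetric])
  have "lcnj f * (lcnj g * k) = lcnj (lcnj k * (g * f))" by (simp add: mult_ac)
  with 2 have "lcnj (lcnj k * (g * f)) \<in> Hardy_bar 1" using Hneg_Hardy_bar by metis
  then have "lcnj k * (g * f) \<in> Hardy 1" by (simp only: lcnj_Hardy_bar)
  then have "lcnj k * (g * f) = 0" using 1 by (rule Hardy_Hneg_0)
  then have "g' * (lcnj k * (g * f)) = 0" by simp
  then have "(g * g') * (f * lcnj k) = 0" by (simp add: mult_ac)
  then have "f * lcnj k = 0" by (simp only: g(2) mult_1_left)
  then show ?thesis using Hardy_zero_divisor[OF p f(1)] k(1) by (simp add: q_def)
qed

lemma Hardy_annihilator:
  assumes p: "p > 1" and R: "closed_subspace p R" "R \<subseteq> Hardy p" and y: "y \<in> Hardy p" "y \<notin> R"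
  obtains k where "k \<in> Hardy (conj_exp p)" "\<And>z. z \<in> R \<Longrightarrow> pairing z k = 0" "pairing y k \<noteq> 0"
proof -
  obtain k where k: "k \<in> Lp (conj_exp p)" "\<And>z. z \<in> R \<Longrightarrow> pairing z k = 0" "pairing y k \<noteq> 0"
    using annihilator[OF p R(1) Hardy_Lp[OF y(1)] y(2)] by metis
  have "pairing z (Riesz_P k) = pairing z k" if "z \<in> Hardy p" for z
    by (rule pairing_Hardy_right[OF p that k(1)])
  note * = this
  show ?thesis
  proof (rule that)
    show "Riesz_P k \<in> Hardy (conj_exp p)" using conj_exp[OF p] k(1) by (intro Riesz_P_Hardy) auto
    show "pairing z (Riesz_P k) = 0" if "z \<in> R" for z using *[of z] k(2)[OF that] R(2) that by auto
    show "pairing y (Riesz_P k) \<noteq> 0" using *[OF y(1)] k(3) by simp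
  qed
qed

lemma toeplitz_image_subspace:
  assumes p: "p > 1" and g: "g \<in> Linf"
  shows "lfun.subspace (toeplitz g ` Hardy p)"
  unfolding lfun.subspace_def
proof (intro conjI allI ballI)
  show "0 \<in> toeplitz g ` Hardy p" using Hardy_0[OF p] by (intro image_eqI[of _ _ 0]) auto
  fix x y assume "x \<in> toeplitz g ` Hardy p" "y \<in> toeplitz g ` Hardy p"
  then obtain u v where "u \<in> Hardy p" "x = toeplitz g u" "v \<in> Hardy p" "y = toeplitz g v" by auto
  then show "x + y \<in> toeplitz g ` Hardy p"
    using p g Hardy_add[OF p] by (intro image_eqI[of _ _ "u + v"]) (auto simp: toeplitz_add[of p] Hardy_Lp)
next
  fix c x assume "x \<in> toeplitz g ` Hardy p"
  then obtain u where "u \<in> Hardy p" "x = toeplitz g u" by auto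
  then show "lscale c x \<in> toeplitz g ` Hardy p"
    using p g Hardy_lscale[OF p] by (intro image_eqI[of _ _ "lscale c u"]) (auto simp: toeplitz_lscale[of p] Hardy_Lp)
qed

text \<open>Here the closedness of the range enters: a vector outside it would be separated from it
  by an element of H^q, and that element lies in the kernel of the adjoint.\<close>

lemma fredholm_range:
  assumes p: "p > 1" and g: "g \<in> Linf" and F: "fredholm p (toeplitz g)"
    and y: "y \<in> Hardy p" "\<And>k. k \<in> ker (conj_exp p) (toeplitz (lcnj g)) \<Longrightarrow> pairing y k = 0"
  obtains f where "f \<in> Hardy p" "toeplitz g f = y"
proof -
  interpret M: Metric_space "Hardy p" "\<lambda>f g. lp_norm p (f - g)"
    by (rule Metric_space_closed_subspace[OF _ closed_subspace_Hardy[OF p]]) (use p in simp)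
  define R where "R = toeplitz g ` Hardy p"
  have sub: "R \<subseteq> Hardy p" unfolding R_def using toeplitz_Hardy[OF p g] Hardy_Lp by auto
  have "closedin M.mtopology R" using F by (simp add: fredholm_def R_def)
  then have seq: "\<And>\<sigma> l. range \<sigma> \<subseteq> R \<Longrightarrow> limitin M.mtopology \<sigma> l sequentially \<Longrightarrow> l \<in> R"
    unfolding M.metric_closedin_iff_sequentially_closed by blast
  have "closed_subspace p R"
    unfolding closed_subspace_def
  proof (intro conjI allI impI)
    show "R \<subseteq> Lp p" using sub Hardy_Lp by auto
    show "lfun.subspace R" unfolding R_def by (rule toeplitz_image_subspace[OF p g])
    fix r z assume *: "(\<forall>n. r n \<in> R) \<and> z \<in> Lp p \<and> (\<lambda>n::nat. lp_norm p (r n - z)) \<longlonglongrightarrow> 0"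
    have zH: "z \<in> Hardy p" by (rule closed_subspaceD(7)[OF closed_subspace_Hardy[OF p], of r]) (use * sub in auto)
    have "\<exists>N. \<forall>n\<ge>N. r n \<in> Hardy p \<and> lp_norm p (r n - z) < e" if "e > 0" for e
    proof -
      obtain N where "\<forall>n\<ge>N. norm (lp_norm p (r n - z) - 0) < e" using * LIMSEQ_D[of "\<lambda>n. lp_norm p (r n - z)" 0 e] \<open>e > 0\<close> by blast
      then show ?thesis using * sub by (intro exI[of _ N]) auto
    qed
    then have "limitin M.mtopology r z sequentially" using zH by (simp add: M.limit_metric_sequentially)
    then show "z \<in> R" using * by (intro seq[of r]) auto
  qed
  then have "y \<in> R"
  proof (rule contrapos_pp)
    assume "y \<notin> R"
    show "\<not> closed_subspace p R"
    proof
      assume cl: "closed_subspace p R"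
      obtain k where k: "k \<in> Hardy (conj_exp p)" "\<And>z. z \<in> R \<Longrightarrow> pairing z k = 0" "pairing y k \<noteq> 0"
        using Hardy_annihilator[OF p cl sub y(1) \<open>y \<notin> R\<close>] by metis
      have q: "conj_exp p > 1" using conj_exp[OF p] by simp
      have "toeplitz (lcnj g) k = 0"
      proof (rule Hardy_eqI_pairing[OF p toeplitz_Hardy[OF q Linf_lcnj[OF g] Hardy_Lp[OF k(1)]]])
        show "0 \<in> Hardy (conj_exp p)" by (rule Hardy_0[OF q])
        show "pairing f (toeplitz (lcnj g) k) = pairing f 0" if "f \<in> Hardy p" for f
          using k(2)[of "toeplitz g f"] pairing_toeplitz[OF p g that k(1)] that by (auto simp: R_def)
      qed
      then show False using y(2)[of k] k by (simp add: ker_def)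
    qed
  qed
  then show ?thesis using that by (auto simp: R_def)
qed

text \<open>The lowest nonzero coefficient of t^j f sits at position m + j, so the coefficients form
  a triangular system.\<close>

lemma independent_shifts:
  assumes p: "p \<ge> 1" and f: "f \<in> Hardy p" "f \<noteq> 0"
  shows "inj (\<lambda>j::nat. monomial (int j) * f)" "lfun.independent ((\<lambda>j::nat. monomial (int j) * f) ` {..n})"
proof -
  obtain m :: nat where m: "fcoeff f (int m) \<noteq> 0" "\<And>k. k < int m \<Longrightarrow> fcoeff f k = 0"
    using Hardy_first_coeff[OF f(1) p f(2)] by blast
  show inj: "inj (\<lambda>j::nat. monomial (int j) * f)"
  proof (rule injI)
    fix i j :: nat assume eq: "monomial (int i) * f = monomial (int j) * f"
    have "fcoeff f (int m + int i - int j) \<noteq> 0" "fcoeff f (int m + int j - int i) \<noteq> 0"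
      using m(1) arg_cong[OF eq, of "\<lambda>h. fcoeff h (int m + int i)"] arg_cong[OF eq, of "\<lambda>h. fcoeff h (int m + int j)"]
      by (auto simp: fcoeff_monomial_times)
    then have "\<not> int m + int i - int j < int m" "\<not> int m + int j - int i < int m" using m(2) by blast+
    then show "i = j" by simp
  qed
  have fL: "lscale c (monomial k * f) \<in> Lp 1" for c k
    using Lp_imp_L1[OF Hardy_Lp[OF f(1)] p] by (intro Lp_lscale Lp_monomial_times) auto
  show "lfun.independent ((\<lambda>j::nat. monomial (int j) * f) ` {..n})"
  proof (rule lfun.independent_if_scalars_zero)
    fix u x assume s: "(\<Sum>x\<in>(\<lambda>j::nat. monomial (int j) * f) ` {..n}. lscale (u x) x) = 0"
      and x: "x \<in> (\<lambda>j::nat. monomial (int j) * f) ` {..n}"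
    define v where "v j = u (monomial (int j) * f)" for j :: nat
    have s': "(\<Sum>j\<le>n. lscale (v j) (monomial (int j) * f)) = 0"
      using s by (subst (asm) sum.reindex) (auto intro: inj_on_subset[OF inj] simp: v_def)
    have "v j = 0" if "j \<le> n" for j
      using that
    proof (induction j rule: less_induct)
      case (less j)
      have "0 = fcoeff (\<Sum>i\<le>n. lscale (v i) (monomial (int i) * f)) (int m + int j)" unfolding s' by simp
      also have "\<dots> = (\<Sum>i\<le>n. v i * fcoeff f (int m + int j - int i))"
        by (subst fcoeff_sum) (auto intro: fL simp: fcoeff_lscale fcoeff_monomial_times)
      also have "\<dots> = (\<Sum>i\<le>n. if i = j then v j * fcoeff f (int m) else 0)"
      proof (rule sum.cong[OF refl])
        fix i assume "i \<in> {..n}"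
        then show "v i * fcoeff f (int m + int j - int i) = (if i = j then v j * fcoeff f (int m) else 0)"
          using less.IH[of i] m(2)[of "int m + int j - int i"] by (cases i j rule: linorder_cases) auto
      qed
      also have "\<dots> = v j * fcoeff f (int m)" using less.prems by simp
      finally show ?case using m(1) by simp
    qed
    then show "u x = 0" using x by (auto simp: v_def)
  qed simp
qed

lemma fin_dim_basis:
  assumes "fin_dim V" "lfun.subspace V"
  obtains B where "finite B" "B \<subseteq> V" "lfun.independent B" "lfun.span B = V" "card B = lfun.dim V"
proof -
  obtain B where B: "B \<subseteq> V" "lfun.independent B" "V \<subseteq> lfun.span B" "card B = lfun.dim V"
    using lfun.basis_exists by blast
  obtain S where S: "finite S" "V \<subseteq> lfun.span S" using assms by (auto simp: fin_dim_def)
  have "finite B" using lfun.independent_span_bound[OF S(1) B(2)] B(1) S(2) by auto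
  moreover have "lfun.span B = V" using B lfun.span_minimal[OF B(1) assms(2)] by auto
  ultimately show ?thesis using B that by blast
qed

lemma dim_zero [simp]: "lfun.dim {0} = 0"
  using lfun.dim_eq_card[of "{}" "{0}"] lfun.span_insert_0[of "{}"] by (simp add: lfun.independent_empty)

section \<open>From Fredholm Toeplitz operators to bijective ones\<close>

text \<open>If the first n coefficients of v vanish, dividing by powers of t stays analytic and
  stays in the kernel, so t^{-n} v, ..., t^{-1} v, v would be n + 1 independent elements of a space
  of dimension n.\<close>

lemma ker_toeplitz_first_coeffs:
  assumes p: "p > 1" and g: "g \<in> Linf" and fd: "fin_dim (ker p (toeplitz g))"
    and v: "v \<in> ker p (toeplitz g)" "\<And>i. i < lfun.dim (ker p (toeplitz g)) \<Longrightarrow> fcoeff v (int i) = 0"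
  shows "v = 0"
proof (rule ccontr)
  assume v0: "v \<noteq> 0"
  define n where "n = lfun.dim (ker p (toeplitz g))"
  have p1: "p \<ge> 1" "p > 0" using p by auto
  have vH: "v \<in> Hardy p" "g * v \<in> Hneg p" using v(1) ker_toeplitz[OF p g] by auto
  define f where "f = monomial (- int n) * v"
  have vz: "fcoeff v k = 0" if "k < int n" for k
    using v(2)[of "nat k"] vH(1) that by (cases "k < 0") (auto simp: n_def Hardy_def)
  have fH: "f \<in> Hardy p" unfolding f_def using vH(1) vz p1
    by (auto simp: Hardy_def fcoeff_monomial_times intro: Lp_monomial_times)
  have "monomial (int n) * f = v" by (simp add: f_def mult.assoc[symmetric])
  then have f0: "f \<noteq> 0" using v0 by auto
  have "(\<lambda>j::nat. monomial (int j) * f) ` {..n} \<subseteq> ker p (toeplitz g)"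
  proof
    fix x assume "x \<in> (\<lambda>j::nat. monomial (int j) * f) ` {..n}"
    then obtain j where j: "j \<le> n" "x = monomial (int j) * f" by auto
    have "g * x = monomial (int j - int n) * (g * v)"
      unfolding j f_def by (simp add: mult_ac monomial_mult[symmetric, of "int j" "- int n", simplified])
    then have "g * x \<in> Hneg p" using monomial_times_Hneg[OF p1(2) vH(2), of "int j - int n"] j(1) by simp
    moreover have "x \<in> Hardy p" unfolding j by (intro monomial_times_Hardy p1 fH) auto
    ultimately show "x \<in> ker p (toeplitz g)" using ker_toeplitz[OF p g] by auto
  qed
  moreover obtain B where B: "finite B" "lfun.span B = ker p (toeplitz g)" "card B = n"
    using fin_dim_basis[OF fd ker_toeplitz_subspace[OF p g]] n_def by metis
  ultimately have "card ((\<lambda>j::nat. monomial (int j) * f) ` {..n}) \<le> card B"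
    using lfun.independent_span_bound[OF B(1) independent_shifts(2)[OF p1(1) fH f0]] by auto
  moreover have "card ((\<lambda>j::nat. monomial (int j) * f) ` {..n}) = Suc n"
    by (subst card_image) (auto intro: inj_on_subset[OF independent_shifts(1)[OF p1(1) fH f0]])
  ultimately show False using B(3) by simp
qed

text \<open>The first n coefficients are n functionals, injective on a space of dimension n, hence a
  coordinate system. The map \<pi> realises it as truncation to polynomials of degree below
  n.\<close>

lemma dual_basis:
  assumes V: "V \<subseteq> Lp 1" "lfun.subspace V" "fin_dim V"
    and inj: "\<And>v. v \<in> V \<Longrightarrow> (\<And>i. i < lfun.dim V \<Longrightarrow> fcoeff v (int i) = 0) \<Longrightarrow> v = 0"
  shows "\<exists>k. (\<forall>j<lfun.dim V. k j \<in> V) \<and>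
    (\<forall>i<lfun.dim V. \<forall>j<lfun.dim V. fcoeff (k j) (int i) = (if i = j then 1 else 0)) \<and>
    (\<forall>v\<in>V. v = (\<Sum>j<lfun.dim V. lscale (fcoeff v (int j)) (k j)))"
proof -
  define n where "n = lfun.dim V"
  obtain B where B: "finite B" "B \<subseteq> V" "lfun.independent B" "lfun.span B = V" "card B = n"
    using fin_dim_basis[OF V(3,2)] n_def by metis
  define \<pi> where "\<pi> v = (\<Sum>i<n. lscale (fcoeff v (int i)) (monomial (int i)))" for v
  have c\<pi>: "fcoeff (\<pi> v) (int i) = fcoeff v (int i)" if "i < n" for v i
  proof -
    have "fcoeff (\<pi> v) (int i) = (\<Sum>j<n. if i = j then fcoeff v (int j) else 0)"
      unfolding \<pi>_def
      by (subst fcoeff_sum, blast intro: Lp_lscale Lp_monomial zero_less_one)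
         (intro sum.cong refl, simp add: fcoeff_lscale fcoeff_monomial)
    then show ?thesis using that by simp
  qed
  have VL: "lscale c v \<in> Lp 1" if "v \<in> V" for c v using V(1) that by (auto intro: Lp_lscale)
  have \<pi>_sum: "\<pi> (\<Sum>b\<in>B. lscale (u b) b) = (\<Sum>b\<in>B. lscale (u b) (\<pi> b))" for u
  proof -
    have "\<pi> (\<Sum>b\<in>B. lscale (u b) b) = (\<Sum>i<n. lscale (\<Sum>b\<in>B. u b * fcoeff b (int i)) (monomial (int i)))"
      unfolding \<pi>_def using B(2) by (intro sum.cong refl) (subst fcoeff_sum, auto intro: VL simp: fcoeff_lscale)
    also have "\<dots> = (\<Sum>i<n. \<Sum>b\<in>B. lscale (u b) (lscale (fcoeff b (int i)) (monomial (int i))))"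
      by (simp add: lfun.scale_sum_left)
    also have "\<dots> = (\<Sum>b\<in>B. \<Sum>i<n. lscale (u b) (lscale (fcoeff b (int i)) (monomial (int i))))"
      by (rule sum.swap)
    also have "\<dots> = (\<Sum>b\<in>B. lscale (u b) (\<pi> b))" by (simp only: \<pi>_def lfun.scale_sum_right)
    finally show ?thesis .
  qed
  have inV: "(\<Sum>b\<in>B. lscale (u b) b) \<in> V" for u
    using B(2) by (intro lfun.subspace_sum[OF V(2)] lfun.subspace_scale[OF V(2)]) auto
  have \<pi>0: "v = 0" if "v \<in> V" "\<pi> v = 0" for v
    using inj[OF that(1)] c\<pi>[of _ v] that(2) by (simp add: n_def)
  have zero: "u b = 0" if "(\<Sum>b\<in>B. lscale (u b) (\<pi> b)) = 0" "b \<in> B" for u b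
  proof -
    have "(\<Sum>b\<in>B. lscale (u b) b) = 0" using \<pi>0[OF inV] \<pi>_sum that(1) by simp
    then show ?thesis using lfun.independentD[OF B(3) B(1) order_refl, of u b] that(2) by simp
  qed
  have inj\<pi>: "inj_on \<pi> B"
  proof (rule inj_onI)
    fix b c assume bc: "b \<in> B" "c \<in> B" "\<pi> b = \<pi> c"
    have "b - c = 0"
    proof (rule inj)
      show "b - c \<in> V" using bc B(2) lfun.subspace_diff[OF V(2)] by auto
      show "fcoeff (b - c) (int i) = 0" if "i < lfun.dim V" for i
        using c\<pi>[of i b] c\<pi>[of i c] bc that B(2) V(1) by (subst fcoeff_diff) (auto simp: n_def)
    qed
    then show "b = c" by simp
  qed
  have ind: "lfun.independent (\<pi> ` B)"
  proof (rule lfun.independent_if_scalars_zero)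
    fix u x assume "(\<Sum>x\<in>\<pi> ` B. lscale (u x) x) = 0" and x: "x \<in> \<pi> ` B"
    then have "(\<Sum>b\<in>B. lscale (u (\<pi> b)) (\<pi> b)) = 0" by (subst (asm) sum.reindex[OF inj\<pi>]) simp
    then show "u x = 0" using zero[of "\<lambda>b. u (\<pi> b)"] x by auto
  qed (use B(1) in simp)
  have \<pi>span: "\<pi> v \<in> lfun.span ((\<lambda>i. monomial (int i)) ` {..<n})" for v
    unfolding \<pi>_def by (intro lfun.span_sum lfun.span_scale lfun.span_base) auto
  have "\<exists>v\<in>V. \<pi> v = monomial (int j)" if j: "j < n" for j
  proof -
    have "monomial (int j) \<in> lfun.span (\<pi> ` B)"
    proof (rule ccontr)
      assume nin: "monomial (int j) \<notin> lfun.span (\<pi> ` B)"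
      have "lfun.independent (insert (monomial (int j)) (\<pi> ` B))" by (rule lfun.independent_insertI[OF nin ind])
      moreover have "insert (monomial (int j)) (\<pi> ` B) \<subseteq> lfun.span ((\<lambda>i. monomial (int i)) ` {..<n})"
        using \<pi>span j by (auto intro: lfun.span_base)
      ultimately have "card (insert (monomial (int j)) (\<pi> ` B)) \<le> card ((\<lambda>i. monomial (int i)) ` {..<n})"
        using lfun.independent_span_bound[of "(\<lambda>i. monomial (int i)) ` {..<n}"] by blast
      also have "\<dots> \<le> n" using card_image_le[of "{..<n}"] by simp
      finally have "card (insert (monomial (int j)) (\<pi> ` B)) \<le> n" .
      moreover have "monomial (int j) \<notin> \<pi> ` B" using nin lfun.span_base[of "monomial (int j)" "\<pi> ` B"] by blast
      ultimately show False using B(1,5) card_image[OF inj\<pi>] by simp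
    qed
    then obtain u where "monomial (int j) = (\<Sum>x\<in>\<pi> ` B. lscale (u x) x)"
      using lfun.span_finite[OF finite_imageI[OF B(1)]] by auto
    also have "\<dots> = (\<Sum>b\<in>B. lscale (u (\<pi> b)) (\<pi> b))" by (subst sum.reindex[OF inj\<pi>]) simp
    also have "\<dots> = \<pi> (\<Sum>b\<in>B. lscale (u (\<pi> b)) b)" by (rule \<pi>_sum[symmetric])
    finally show ?thesis using inV by metis
  qed
  then obtain k where k: "\<And>j. j < n \<Longrightarrow> k j \<in> V" "\<And>j. j < n \<Longrightarrow> \<pi> (k j) = monomial (int j)" by metis
  have kc: "fcoeff (k j) (int i) = (if i = j then 1 else 0)" if "i < n" "j < n" for i j
    using c\<pi>[OF that(1), of "k j"] k(2)[OF that(2)] by (simp add: fcoeff_monomial)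
  have "v = (\<Sum>j<n. lscale (fcoeff v (int j)) (k j))" if v: "v \<in> V" for v
  proof -
    have sV: "(\<Sum>j<n. lscale (fcoeff v (int j)) (k j)) \<in> V"
      using k(1) by (intro lfun.subspace_sum[OF V(2)] lfun.subspace_scale[OF V(2)]) auto
    have "v - (\<Sum>j<n. lscale (fcoeff v (int j)) (k j)) = 0"
    proof (rule inj)
      show "v - (\<Sum>j<n. lscale (fcoeff v (int j)) (k j)) \<in> V" by (rule lfun.subspace_diff[OF V(2) v sV])
      fix i assume "i < lfun.dim V"
      then have i: "i < n" by (simp add: n_def)
      have "fcoeff (\<Sum>j<n. lscale (fcoeff v (int j)) (k j)) (int i) = (\<Sum>j<n. fcoeff v (int j) * fcoeff (k j) (int i))"
        using k(1) by (subst fcoeff_sum) (auto intro: VL simp: fcoeff_lscale)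
      also have "\<dots> = (\<Sum>j<n. if i = j then fcoeff v (int j) else 0)"
        using kc[OF i] by (intro sum.cong) auto
      also have "\<dots> = fcoeff v (int i)" using i by simp
      finally show "fcoeff (v - (\<Sum>j<n. lscale (fcoeff v (int j)) (k j))) (int i) = 0"
        using V(1) v sV by (subst fcoeff_diff) auto
    qed
    then show ?thesis by simp
  qed
  with k(1) kc show ?thesis unfolding n_def by blast
qed

text \<open>Bijectivity alone; boundedness of the inverse follows separately. This is the form in
  which the index is used later, since it passes to the conjugate exponent by adjoints.\<close>

definition toeplitz_bij :: "real \<Rightarrow> lfun \<Rightarrow> bool" where
  "toeplitz_bij p h \<longleftrightarrow> h \<in> Linf \<and> (\<forall>f\<in>Hardy p. toeplitz h f = 0 \<longrightarrow> f = 0) \<and>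
     (\<forall>y\<in>Hardy p. \<exists>f\<in>Hardy p. toeplitz h f = y)"

lemma fredholm_index_toeplitz:
  assumes "p > 1" "g \<in> Linf"
  shows "fredholm_index p (toeplitz g) =
    int (lfun.dim (ker p (toeplitz g))) - int (lfun.dim (ker (conj_exp p) (toeplitz (lcnj g))))"
    "fredholm_index (conj_exp p) (toeplitz (lcnj g)) = - fredholm_index p (toeplitz g)"
  using coker_toeplitz[OF assms] coker_toeplitz[of "conj_exp p" "lcnj g"] conj_exp[OF assms(1)] Linf_lcnj[OF assms(2)]
  by (simp_all add: fredholm_index_def)

lemma fin_dim_ker:
  assumes "p > 1" "g \<in> Linf" "fredholm p (toeplitz g)"
  shows "fin_dim (ker p (toeplitz g))" "fin_dim (ker (conj_exp p) (toeplitz (lcnj g)))"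
  using assms coker_toeplitz[OF assms(1,2)] by (auto simp: fredholm_def)

lemma dim_eq_0:
  assumes "fin_dim V" "lfun.subspace V" "lfun.dim V = 0" shows "V = {0}"
proof -
  obtain B where "finite B" "B \<subseteq> V" "lfun.independent B" "lfun.span B = V" "card B = 0"
    using fin_dim_basis[OF assms(1,2)] assms(3) by metis
  then show ?thesis by auto
qed

text \<open>By Coburn's lemma one of the two kernels is zero, and the sign of the index tells which;
  at index 0 both vanish.\<close>

lemma ker_trivial:
  assumes p: "p > 1" and g: "g \<in> Linf" "g * g' = 1" and F: "fredholm p (toeplitz g)"
  shows "fredholm_index p (toeplitz g) \<le> 0 \<Longrightarrow> ker p (toeplitz g) = {0}"
    "fredholm_index p (toeplitz g) \<ge> 0 \<Longrightarrow> ker (conj_exp p) (toeplitz (lcnj g)) = {0}"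
proof -
  let ?V = "ker p (toeplitz g)" and ?W = "ker (conj_exp p) (toeplitz (lcnj g))"
  have q: "conj_exp p > 1" using conj_exp[OF p] by simp
  have sV: "lfun.subspace ?V" and sW: "lfun.subspace ?W"
    using ker_toeplitz_subspace[OF p g(1)] ker_toeplitz_subspace[OF q Linf_lcnj[OF g(1)]] by auto
  note fd = fin_dim_ker[OF p g(1) F]
  have alt: "?V = {0} \<or> ?W = {0}"
    using Coburn[OF p g] lfun.subspace_0[OF sV] lfun.subspace_0[OF sW] by blast
  show "?V = {0}" if le: "fredholm_index p (toeplitz g) \<le> 0"
    using alt
  proof
    assume "?W = {0}"
    then have "lfun.dim ?W = 0" by (simp only: dim_zero)
    then have "lfun.dim ?V = 0" using le unfolding fredholm_index_toeplitz(1)[OF p g(1)] by linarith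
    then show ?thesis by (rule dim_eq_0[OF fd(1) sV])
  qed
  show "?W = {0}" if ge: "fredholm_index p (toeplitz g) \<ge> 0"
    using alt
  proof
    assume "?V = {0}"
    then have "lfun.dim ?V = 0" by (simp only: dim_zero)
    then have "lfun.dim ?W = 0" using ge unfolding fredholm_index_toeplitz(1)[OF p g(1)] by linarith
    then show ?thesis by (rule dim_eq_0[OF fd(2) sW])
  qed
qed

text \<open>For index n \<ge> 0 a solution of T(g) x = y is corrected by a kernel element until it
  is divisible by t^n. For index -n < 0 it is t^n y that is corrected, by a polynomial of degree
  below n, to lie in the range.\<close>

lemma toeplitz_bij_index:
  assumes p: "p > 1" and g: "g \<in> Linf" "g * g' = 1" and F: "fredholm p (toeplitz g)"
  shows "toeplitz_bij p (g * monomial (fredholm_index p (toeplitz g)))"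
proof -
  define \<kappa> where "\<kappa> = fredholm_index p (toeplitz g)"
  define V where "V = ker p (toeplitz g)"
  define q where "q = conj_exp p"
  define W where "W = ker q (toeplitz (lcnj g))"
  have q: "q > 1" "conj_exp q = p" using conj_exp[OF p] by (auto simp: q_def)
  have p1: "p \<ge> 1" "p > 0" and q1: "q \<ge> 1" "q > 0" using p q by auto
  have gk: "g * monomial \<kappa> \<in> Linf" by (intro Linf_times g) simp
  have lg: "lcnj g \<in> Linf" by (intro Linf_lcnj g)
  have fdV: "fin_dim V" and fdW: "fin_dim W" using fin_dim_ker[OF p g(1) F] by (auto simp: V_def W_def q_def)
  have sV: "lfun.subspace V" and sW: "lfun.subspace W"
    using ker_toeplitz_subspace[OF p g(1)] ker_toeplitz_subspace[OF q(1) lg] by (auto simp: V_def W_def)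
  have VH: "V \<subseteq> Hardy p" and WH: "W \<subseteq> Hardy q" by (auto simp: V_def W_def ker_def)
  have VL: "V \<subseteq> Lp 1" and WL: "W \<subseteq> Lp 1"
    using VH WH Hardy_Lp Lp_imp_L1[OF _ p1(1)] Lp_imp_L1[OF _ q1(1)] by blast+
  have ker: "f \<in> V \<longleftrightarrow> f \<in> Hardy p \<and> g * f \<in> Hneg p" for f
    unfolding V_def by (rule ker_toeplitz[OF p g(1)])
  have kerk: "toeplitz (g * monomial \<kappa>) f = 0 \<longleftrightarrow> g * (monomial \<kappa> * f) \<in> Hneg p" if "f \<in> Hardy p" for f
    using ker_toeplitz[OF p gk, of f] that by (simp add: ker_def mult.assoc)
  have idx: "\<kappa> = int (lfun.dim V) - int (lfun.dim W)"
    unfolding \<kappa>_def V_def W_def q_def by (rule fredholm_index_toeplitz(1)[OF p g(1)])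
  have "(\<forall>f\<in>Hardy p. toeplitz (g * monomial \<kappa>) f = 0 \<longrightarrow> f = 0) \<and>
     (\<forall>y\<in>Hardy p. \<exists>f\<in>Hardy p. toeplitz (g * monomial \<kappa>) f = y)"
  proof (cases "\<kappa> \<ge> 0")
    case True
    define n where "n = lfun.dim V"
    have W0: "W = {0}" using ker_trivial(2)[OF p g F] True by (simp add: W_def q_def \<kappa>_def)
    have \<kappa>: "\<kappa> = int n" using idx W0 by (simp add: n_def)
    have first: "v = 0" if "v \<in> V" "\<And>i. i < n \<Longrightarrow> fcoeff v (int i) = 0" for v
      using ker_toeplitz_first_coeffs[OF p g(1), of v] fdV that by (simp add: V_def n_def)
    obtain k where k: "\<And>j. j < n \<Longrightarrow> k j \<in> V"
      "\<And>i j. i < n \<Longrightarrow> j < n \<Longrightarrow> fcoeff (k j) (int i) = (if i = j then 1 else 0)"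
      "\<And>v. v \<in> V \<Longrightarrow> v = (\<Sum>j<n. lscale (fcoeff v (int j)) (k j))"
      using dual_basis[OF VL sV fdV first[unfolded n_def], folded n_def] by blast
    show ?thesis
    proof (intro conjI ballI impI)
      fix f assume f: "f \<in> Hardy p" "toeplitz (g * monomial \<kappa>) f = 0"
      have "monomial \<kappa> * f \<in> V"
        unfolding ker using f kerk[OF f(1)] \<kappa> by (auto intro: monomial_times_Hardy[OF p1(2)])
      then have "monomial \<kappa> * f = 0"
        using f(1) by (intro first) (auto simp: fcoeff_monomial_times \<kappa> Hardy_def)
      then have "monomial (- \<kappa>) * (monomial \<kappa> * f) = 0" by simp
      then show "f = 0" by (simp add: mult.assoc[symmetric])
    next
      fix y assume y: "y \<in> Hardy p"
      obtain x where x: "x \<in> Hardy p" "toeplitz g x = y"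
        using fredholm_range[OF p g(1) F y] W0 by (auto simp: W_def q_def)
      \<comment> \<open>Removing the kernel element with the same first n coefficients leaves a
        solution divisible by t^n.\<close>
      define x' where "x' = x - (\<Sum>j<n. lscale (fcoeff x (int j)) (k j))"
      have sV': "(\<Sum>j<n. lscale (fcoeff x (int j)) (k j)) \<in> V"
        using k(1) by (intro lfun.subspace_sum[OF sV] lfun.subspace_scale[OF sV]) auto
      have x'H: "x' \<in> Hardy p" unfolding x'_def using sV' VH by (intro Hardy_diff p x) auto
      have x'i: "fcoeff x' (int i) = 0" if i: "i < n" for i
      proof -
        have "fcoeff (\<Sum>j<n. lscale (fcoeff x (int j)) (k j)) (int i) = (\<Sum>j<n. fcoeff x (int j) * fcoeff (k j) (int i))"
          using k(1) VL by (subst fcoeff_sum) (auto intro: Lp_lscale simp: fcoeff_lscale)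
        also have "\<dots> = (\<Sum>j<n. if i = j then fcoeff x (int j) else 0)"
          using k(2)[OF i] by (intro sum.cong) auto
        also have "\<dots> = fcoeff x (int i)" using i by simp
        finally show ?thesis
          unfolding x'_def using VL sV' Lp_imp_L1[OF Hardy_Lp[OF x(1)] p1(1)] by (subst fcoeff_diff) auto
      qed
      have x'z: "fcoeff x' m = 0" if "m < int n" for m
        using that x'H x'i[of "nat m"] by (cases "m < 0") (auto simp: Hardy_def)
      define f where "f = monomial (- \<kappa>) * x'"
      have f: "f \<in> Hardy p" unfolding f_def using x'H x'z p1
        by (auto simp: Hardy_def fcoeff_monomial_times \<kappa> intro: Lp_monomial_times)
      have "toeplitz (g * monomial \<kappa>) f = toeplitz g x'"
        by (simp add: toeplitz_def f_def mult.assoc) (simp add: mult.assoc[symmetric])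
      also have "\<dots> = toeplitz g x - toeplitz g (\<Sum>j<n. lscale (fcoeff x (int j)) (k j))"
        unfolding x'_def using sV' VH by (intro toeplitz_diff[OF p g(1)] Hardy_Lp x) auto
      also have "toeplitz g (\<Sum>j<n. lscale (fcoeff x (int j)) (k j)) = 0" using sV' by (simp add: V_def ker_def)
      finally show "\<exists>f\<in>Hardy p. toeplitz (g * monomial \<kappa>) f = y" using f x(2) by auto
    qed
  next
    case False
    define n where "n = lfun.dim W"
    have V0: "V = {0}" using ker_trivial(1)[OF p g F] False by (simp add: V_def \<kappa>_def)
    have \<kappa>: "\<kappa> = - int n" using idx V0 by (simp add: n_def)
    have first: "v = 0" if "v \<in> W" "\<And>i. i < n \<Longrightarrow> fcoeff v (int i) = 0" for v
      using ker_toeplitz_first_coeffs[OF q(1) lg, of v] fdW that by (simp add: W_def n_def)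
    obtain k where k: "\<And>j. j < n \<Longrightarrow> k j \<in> W"
      "\<And>i j. i < n \<Longrightarrow> j < n \<Longrightarrow> fcoeff (k j) (int i) = (if i = j then 1 else 0)"
      "\<And>v. v \<in> W \<Longrightarrow> v = (\<Sum>j<n. lscale (fcoeff v (int j)) (k j))"
      using dual_basis[OF WL sW fdW first[unfolded n_def], folded n_def] by blast
    have kH: "k j \<in> Hardy q" if "j < n" for j using k(1)[OF that] WH by auto
    have psum: "pairing (sum u I) w = (\<Sum>j\<in>I. pairing (u j) w)"
      if "finite I" "\<And>j. j \<in> I \<Longrightarrow> u j \<in> Lp p" "w \<in> Lp q" for u w and I :: "nat set"
      using that(1,2)
    proof (induction I)
      case (insert i I)
      then show ?case
        using pairing_add_left(1)[OF p, of "u i" "sum u I" w] that(3) Lp_sum[of I u p] p1 by (simp add: q_def)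
    qed simp
    have psum2: "pairing w (sum u I) = (\<Sum>j\<in>I. pairing w (u j))"
      if "finite I" "\<And>j. j \<in> I \<Longrightarrow> u j \<in> Lp q" "w \<in> Lp p" for u w and I :: "nat set"
      using that(1,2)
    proof (induction I)
      case (insert i I)
      then show ?case
        using pairing_add_right(1)[OF p, of w "u i" "sum u I"] that(3) Lp_sum[of I u q] q1 by (simp add: q_def)
    qed simp
    have poly: "pairing (\<Sum>j<n. lscale (u j) (monomial (int j))) (k i) = u i" if i: "i < n" for u i
    proof -
      have "pairing (\<Sum>j<n. lscale (u j) (monomial (int j))) (k i) = (\<Sum>j<n. pairing (lscale (u j) (monomial (int j))) (k i))"
        by (intro psum Lp_lscale Lp_monomial Hardy_Lp[OF kH[OF i]] p1) auto
      also have "\<dots> = (\<Sum>j<n. if i = j then u j else 0)"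
        using k(2)[OF _ i] by (intro sum.cong) (auto simp: pairing_lscale pairing_monomial)
      finally show ?thesis using i by simp
    qed
    show ?thesis
    proof (intro conjI ballI impI)
      fix f assume f: "f \<in> Hardy p" "toeplitz (g * monomial \<kappa>) f = 0"
      \<comment> \<open>A polynomial of degree below n, because t^{-n} g f has only negative
        frequencies. Its coefficients are its pairings with the dual basis of the cokernel, and
        elements of the range pair to 0 with these.\<close>
      define r where "r = toeplitz g f"
      have gf: "g * f \<in> Lp p" using f by (intro Linf_times_Lp g p1 Hardy_Lp)
      have "monomial \<kappa> * (g * f) \<in> Hneg p" using kerk[OF f(1)] f(2) by (simp add: mult_ac)
      then have gfz: "fcoeff (g * f) m = 0" if "m \<ge> int n" for m
        using that by (auto simp: Hneg_def fcoeff_monomial_times \<kappa> dest: spec[of _ "m - int n"])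
      have rc: "fcoeff r m = (if m \<ge> 0 then fcoeff (g * f) m else 0)" for m
        unfolding r_def toeplitz_def by (rule Riesz_P_Lp(2)[OF p gf])
      have rL: "r \<in> Lp p" unfolding r_def toeplitz_def by (rule Riesz_P_Lp(1)[OF p gf])
      have r: "r = (\<Sum>j<n. lscale (fcoeff r (int j)) (monomial (int j)))"
      proof (rule lfun_eqI_fcoeff)
        fix m
        have "fcoeff (\<Sum>j<n. lscale (fcoeff r (int j)) (monomial (int j))) m = (\<Sum>j<n. if m = int j then fcoeff r m else 0)"
          by (subst fcoeff_sum, blast intro: Lp_lscale Lp_monomial zero_less_one)
             (intro sum.cong refl, simp add: fcoeff_lscale fcoeff_monomial)
        also have "\<dots> = fcoeff r m"
        proof (cases "m \<ge> 0 \<and> m < int n")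
          case True
          then have "(\<Sum>j<n. if m = int j then fcoeff r m else 0) = (\<Sum>j<n. if nat m = j then fcoeff r m else 0)"
            by (intro sum.cong) auto
          then show ?thesis using True by auto
        next
          case False
          then have "fcoeff r m = 0" using rc[of m] gfz[of m] by auto
          then show ?thesis by (auto intro!: sum.neutral)
        qed
        finally show "fcoeff r m = fcoeff (\<Sum>j<n. lscale (fcoeff r (int j)) (monomial (int j))) m" ..
      qed (auto intro!: Lp_sum Lp_lscale Lp_monomial Lp_imp_L1[OF rL p1(1)])
      have "fcoeff r (int i) = 0" if i: "i < n" for i
      proof -
        have "fcoeff r (int i) = pairing r (k i)" using poly[OF i, of "\<lambda>j. fcoeff r (int j)"] r by simp
        also have "\<dots> = pairing f (toeplitz (lcnj g) (k i))"
          unfolding r_def using kH[OF i] by (intro pairing_toeplitz[OF p g(1) f(1)]) (simp add: q_def)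
        also have "\<dots> = 0" using k(1)[OF i] by (simp add: W_def ker_def)
        finally show ?thesis .
      qed
      then have "r = 0" by (subst r) simp
      then have "f \<in> V" using f by (simp add: V_def ker_def r_def)
      then show "f = 0" using V0 by simp
    next
      fix y assume y: "y \<in> Hardy p"
      \<comment> \<open>The polynomial with the same pairings as t^n y. Subtracting it lands in the
        range of T(g), and after multiplication by t^{-n} it has only negative frequencies, so P
        removes it again.\<close>
      define s where "s = (\<Sum>j<n. lscale (pairing (monomial (int n) * y) (k j)) (monomial (int j)))"
      define z where "z = monomial (int n) * y - s"
      have myH: "monomial (int n) * y \<in> Hardy p" by (intro monomial_times_Hardy p1 y) simp
      have sH: "s \<in> Hardy p" unfolding s_def
        by (intro lfun.subspace_sum[OF Hardy_subspace[OF p]] Hardy_lscale p monomial_Hardy p1) auto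
      have zH: "z \<in> Hardy p" unfolding z_def by (intro Hardy_diff p myH sH)
      have zk: "pairing z (k i) = 0" if i: "i < n" for i
      proof -
        have "pairing z (k i) = pairing (monomial (int n) * y) (k i) - pairing s (k i)"
          unfolding z_def using Hardy_Lp[OF kH[OF i]] by (intro pairing_add_left(2)[OF p Hardy_Lp[OF myH] Hardy_Lp[OF sH]]) (simp add: q_def)
        then show ?thesis using poly[OF i] by (simp add: s_def)
      qed
      have "pairing z w = 0" if w: "w \<in> W" for w
      proof -
        have "pairing z w = pairing z (\<Sum>j<n. lscale (fcoeff w (int j)) (k j))" using k(3)[OF w] by simp
        also have "\<dots> = (\<Sum>j<n. pairing z (lscale (fcoeff w (int j)) (k j)))"
          by (intro psum2 Lp_lscale Hardy_Lp[OF zH] Hardy_Lp[OF kH]) auto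
        also have "\<dots> = 0" using zk by (simp add: pairing_lscale)
        finally show ?thesis .
      qed
      then obtain f where f: "f \<in> Hardy p" "toeplitz g f = z"
        using fredholm_range[OF p g(1) F zH] by (auto simp: W_def q_def)
      have gf: "g * f \<in> Lp p" using f by (intro Linf_times_Lp g p1 Hardy_Lp)
      have Q: "Riesz_Q (g * f) \<in> Hneg p" by (rule Riesz_Q_Hneg[OF p gf])
      have ms: "monomial \<kappa> * s \<in> Hneg p"
      proof -
        have "monomial \<kappa> * s = (\<Sum>j<n. lscale (pairing (monomial (int n) * y) (k j)) (monomial (\<kappa> + int j)))"
          unfolding s_def by (simp add: sum_distrib_left lscale_times_right monomial_mult)
        also have "\<dots> \<in> Hneg p"
          by (intro lfun.subspace_sum[OF Hneg_subspace[OF p]] lfun.subspace_scale[OF Hneg_subspace[OF p]])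
             (auto simp: Hneg_def fcoeff_monomial \<kappa> intro: Lp_monomial p1)
        finally show ?thesis .
      qed
      have "g * monomial \<kappa> * f = monomial \<kappa> * (z + Riesz_Q (g * f))"
        using f(2) by (simp add: Riesz_Q_def toeplitz_def mult_ac)
      also have "\<dots> = y + (monomial \<kappa> * Riesz_Q (g * f) - monomial \<kappa> * s)"
        by (simp add: z_def \<kappa> distrib_left right_diff_distrib mult.assoc[symmetric])
      finally have eq: "g * monomial \<kappa> * f = y + (monomial \<kappa> * Riesz_Q (g * f) - monomial \<kappa> * s)" .
      have "monomial \<kappa> * Riesz_Q (g * f) - monomial \<kappa> * s \<in> Hneg p"
        using \<kappa> by (intro lfun.subspace_diff[OF Hneg_subspace[OF p]] ms monomial_times_Hneg[OF p1(2) Q]) auto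
      then have "toeplitz (g * monomial \<kappa>) f = y"
        unfolding toeplitz_def eq
        using Riesz_P_add[OF p Hardy_Lp[OF y] Hneg_Lp] Riesz_P_id[OF p1(1) y] Riesz_P_Hneg by (metis add.right_neutral)
      then show "\<exists>f\<in>Hardy p. toeplitz (g * monomial \<kappa>) f = y" using f(1) by blast
    qed
  qed
  then show ?thesis using gk by (simp add: toeplitz_bij_def \<kappa>_def)
qed

section \<open>Bounded linear maps and bounded inverses\<close>

definition blin :: "real \<Rightarrow> lfun set \<Rightarrow> lfun set \<Rightarrow> (lfun \<Rightarrow> lfun) \<Rightarrow> bool" where
  "blin p X Y T \<longleftrightarrow> (\<forall>f\<in>X. T f \<in> Y) \<and> (\<forall>f\<in>X. \<forall>g\<in>X. T (f + g) = T f + T g) \<and>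
     (\<forall>c. \<forall>f\<in>X. T (lscale c f) = lscale c (T f)) \<and>
     (\<exists>C\<ge>0. \<forall>f\<in>X. lp_norm p (T f) \<le> C * lp_norm p f)"

lemma blinI:
  assumes "\<And>f. f \<in> X \<Longrightarrow> T f \<in> Y" "\<And>f g. f \<in> X \<Longrightarrow> g \<in> X \<Longrightarrow> T (f + g) = T f + T g"
    "\<And>c f. f \<in> X \<Longrightarrow> T (lscale c f) = lscale c (T f)"
    "C \<ge> 0" "\<And>f. f \<in> X \<Longrightarrow> lp_norm p (T f) \<le> C * lp_norm p f"
  shows "blin p X Y T"
  using assms unfolding blin_def by blast

lemma blinD:
  assumes "blin p X Y T"
  shows "\<And>f. f \<in> X \<Longrightarrow> T f \<in> Y" "\<And>f g. f \<in> X \<Longrightarrow> g \<in> X \<Longrightarrow> T (f + g) = T f + T g"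
    "\<And>c f. f \<in> X \<Longrightarrow> T (lscale c f) = lscale c (T f)"
  using assms unfolding blin_def by blast+

lemma blin_bound:
  assumes "blin p X Y T"
  obtains C where "C \<ge> 0" "\<And>f. f \<in> X \<Longrightarrow> lp_norm p (T f) \<le> C * lp_norm p f"
  using assms unfolding blin_def by blast

lemma blin_imp_bounded_op: "blin p (Hardy p) (Hardy p) T \<Longrightarrow> bounded_op p T"
  unfolding blin_def bounded_op_def by blast

lemma blin_cong: "blin p X Y T \<Longrightarrow> (\<And>f. f \<in> X \<Longrightarrow> S f = T f) \<Longrightarrow> lfun.subspace X \<Longrightarrow> blin p X Y S"
  unfolding blin_def by (auto simp: lfun.subspace_add lfun.subspace_scale)

lemma blin_mono: "blin p X Y T \<Longrightarrow> X' \<subseteq> X \<Longrightarrow> Y \<subseteq> Y' \<Longrightarrow> blin p X' Y' T"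
  unfolding blin_def by (meson subset_iff)

lemma blin_comp:
  assumes S: "blin p X Y S" and T: "blin p Y Z T"
  shows "blin p X Z (\<lambda>f. T (S f))"
proof -
  obtain C where C: "C \<ge> 0" "\<And>f. f \<in> X \<Longrightarrow> lp_norm p (S f) \<le> C * lp_norm p f" using blin_bound[OF S] by blast
  obtain D where D: "D \<ge> 0" "\<And>f. f \<in> Y \<Longrightarrow> lp_norm p (T f) \<le> D * lp_norm p f" using blin_bound[OF T] by blast
  show ?thesis
  proof (rule blinI[where C = "D * C"])
    fix f assume f: "f \<in> X"
    have "lp_norm p (T (S f)) \<le> D * lp_norm p (S f)" by (rule D(2)[OF blinD(1)[OF S f]])
    also have "\<dots> \<le> D * (C * lp_norm p f)" by (rule mult_left_mono[OF C(2)[OF f] D(1)])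
    finally show "lp_norm p (T (S f)) \<le> D * C * lp_norm p f" by simp
  qed (use C D blinD[OF S] blinD[OF T] in auto)
qed

lemma blin_lscale:
  assumes "blin p X (Lp p) T" "p > 0" shows "blin p X (Lp p) (\<lambda>f. lscale c (T f))"
proof -
  obtain C where C: "C \<ge> 0" "\<And>f. f \<in> X \<Longrightarrow> lp_norm p (T f) \<le> C * lp_norm p f" using blin_bound[OF assms(1)] by blast
  show ?thesis
  proof (rule blinI[where C = "cmod c * C"])
    show "lp_norm p (lscale c (T f)) \<le> cmod c * C * lp_norm p f" if "f \<in> X" for f
      using mult_left_mono[OF C(2)[OF that], of "cmod c"] assms(2) by (simp add: lp_norm_lscale mult.assoc)
  qed (use C assms blinD[OF assms(1)] in \<open>auto simp: lfun.scale_right_distrib mult.commute intro: Lp_lscale\<close>)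
qed

lemma blin_add:
  assumes S: "blin p X (Lp p) S" and T: "blin p X (Lp p) T" and p: "p \<ge> 1"
  shows "blin p X (Lp p) (\<lambda>f. S f + T f)"
proof -
  obtain C where C: "C \<ge> 0" "\<And>f. f \<in> X \<Longrightarrow> lp_norm p (S f) \<le> C * lp_norm p f" using blin_bound[OF S] by blast
  obtain D where D: "D \<ge> 0" "\<And>f. f \<in> X \<Longrightarrow> lp_norm p (T f) \<le> D * lp_norm p f" using blin_bound[OF T] by blast
  show ?thesis
  proof (rule blinI[where C = "C + D"])
    fix f assume f: "f \<in> X"
    show "lp_norm p (S f + T f) \<le> (C + D) * lp_norm p f"
      using lp_norm_triangle[OF blinD(1)[OF S f] blinD(1)[OF T f] p] C(2)[OF f] D(2)[OF f] by (simp add: distrib_right)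
  qed (use C D p blinD[OF S] blinD[OF T] in \<open>auto simp: lfun.scale_right_distrib intro: Lp_add\<close>)
qed

lemma blin_diff:
  assumes S: "blin p X (Lp p) S" and T: "blin p X (Lp p) T" and p: "p \<ge> 1"
  shows "blin p X (Lp p) (\<lambda>f. S f - T f)"
proof -
  have "blin p X (Lp p) (\<lambda>f. lscale (- 1) (T f))" using p by (intro blin_lscale T) simp
  from blin_add[OF S this p] show ?thesis by simp
qed

lemma blin_id: "X \<subseteq> Lp p \<Longrightarrow> blin p X (Lp p) (\<lambda>f. f)"
  by (rule blinI[where C = 1]) auto

lemma blin_times: "a \<in> Linf \<Longrightarrow> p > 0 \<Longrightarrow> blin p (Lp p) (Lp p) (\<lambda>f. a * f)"
proof -
  assume a: "a \<in> Linf" and p: "p > 0"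
  obtain C where "C \<ge> 0" "\<And>f. f \<in> Lp p \<Longrightarrow> a * f \<in> Lp p \<and> lp_norm p (a * f) \<le> C * lp_norm p f"
    using Linf_mult_Lp[OF a p] by metis
  then show ?thesis by (intro blinI[where C = C]) (auto simp: distrib_left lscale_times_right)
qed

lemma blin_Riesz_P: "p > 1 \<Longrightarrow> blin p (Lp p) (Hardy p) Riesz_P"
proof -
  assume p: "p > 1"
  obtain C where "C \<ge> 0" "\<And>f. f \<in> Lp p \<Longrightarrow> lp_norm p (Riesz_P f) \<le> C * lp_norm p f"
    using Riesz_P_bounded[OF p] by metis
  then show ?thesis
    by (intro blinI[where C = C]) (use p in \<open>auto simp: Riesz_P_add[of p] Riesz_P_lscale[of p] Riesz_P_Hardy\<close>)
qed

lemma Hardy_subset_Lp: "Hardy p \<subseteq> Lp p" by (auto simp: Hardy_def)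

lemma blin_Riesz_P': "p > 1 \<Longrightarrow> blin p (Lp p) (Lp p) Riesz_P"
  by (rule blin_mono[OF blin_Riesz_P]) (auto simp: Hardy_Lp)

lemma Lp_subspace: "p \<ge> 1 \<Longrightarrow> lfun.subspace (Lp p)"
  by (auto simp: lfun.subspace_def intro: Lp_add Lp_lscale)

lemma blin_Riesz_Q: "p > 1 \<Longrightarrow> blin p (Lp p) (Lp p) Riesz_Q"
  by (rule blin_cong[OF blin_diff[OF blin_id blin_Riesz_P']]) (auto simp: Riesz_Q_def intro!: Lp_subspace)

lemma blin_toeplitz: "p > 1 \<Longrightarrow> a \<in> Linf \<Longrightarrow> blin p (Lp p) (Hardy p) (toeplitz a)"
  unfolding toeplitz_def by (rule blin_comp[OF blin_times blin_Riesz_P]) auto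

lemma toeplitz_bij_inverse:
  assumes p: "p > 1" and h: "toeplitz_bij p h"
  defines "S \<equiv> the_inv_into (Hardy p) (toeplitz h)"
  shows "\<And>f. f \<in> Hardy p \<Longrightarrow> S (toeplitz h f) = f" "\<And>y. y \<in> Hardy p \<Longrightarrow> toeplitz h (S y) = y"
    "blin p (Hardy p) (Hardy p) S"
proof -
  have hL: "h \<in> Linf" and inj0: "\<And>f. f \<in> Hardy p \<Longrightarrow> toeplitz h f = 0 \<Longrightarrow> f = 0"
    and surj: "\<And>y. y \<in> Hardy p \<Longrightarrow> \<exists>f\<in>Hardy p. toeplitz h f = y"
    using h by (auto simp: toeplitz_bij_def)
  have inj: "inj_on (toeplitz h) (Hardy p)"
  proof (rule inj_onI)
    fix f g assume fg: "f \<in> Hardy p" "g \<in> Hardy p" "toeplitz h f = toeplitz h g"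
    then have "toeplitz h (f - g) = 0" using toeplitz_diff[OF p hL] by (simp add: Hardy_Lp)
    then have "f - g = 0" by (rule inj0[OF Hardy_diff[OF p fg(1,2)]])
    then show "f = g" by simp
  qed
  show S1: "S (toeplitz h f) = f" if "f \<in> Hardy p" for f
    unfolding S_def by (rule the_inv_into_f_f[OF inj that])
  show S2: "toeplitz h (S y) = y" if "y \<in> Hardy p" for y
    using surj[OF that] S1 by auto
  have SH: "S y \<in> Hardy p" if "y \<in> Hardy p" for y using surj[OF that] S1 by auto
  note T = blin_mono[OF blin_toeplitz[OF p hL] Hardy_subset_Lp order_refl]
  obtain C where C: "\<And>f. f \<in> Hardy p \<Longrightarrow> lp_norm p (toeplitz h f) \<le> C * lp_norm p f"
    using blin_bound[OF T] by metis
  obtain K where K: "K \<ge> 0" "\<And>f. f \<in> Hardy p \<Longrightarrow> lp_norm p f \<le> K * lp_norm p (toeplitz h f)"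
    using bounded_inverse[OF p closed_subspace_Hardy[OF p] blinD[OF T] C inj0 surj] by metis
  show "blin p (Hardy p) (Hardy p) S"
  proof (rule blinI[where C = K])
    fix f g assume fg: "f \<in> Hardy p" "g \<in> Hardy p"
    have "S (toeplitz h (S f + S g)) = S f + S g" by (rule S1[OF Hardy_add[OF p SH[OF fg(1)] SH[OF fg(2)]]])
    then show "S (f + g) = S f + S g" by (simp add: blinD(2)[OF T] SH fg S2)
  next
    fix c f assume f: "f \<in> Hardy p"
    have "S (toeplitz h (lscale c (S f))) = lscale c (S f)" by (rule S1[OF Hardy_lscale[OF p SH[OF f]]])
    then show "S (lscale c f) = lscale c (S f)" by (simp add: blinD(3)[OF T] SH f S2)
  next
    fix f assume f: "f \<in> Hardy p"
    show "lp_norm p (S f) \<le> K * lp_norm p f" using K(2)[OF SH[OF f]] by (simp add: S2 f)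
  qed (use K SH in auto)
qed

text \<open>The bound for the inverse makes the adjoint bounded below, hence injective with closed
  range. An element of H^p annihilating that range lies in the kernel of T(h), which is zero, so the
  range is all of H^q.\<close>

lemma toeplitz_bij_adjoint:
  assumes p: "p > 1" and h: "toeplitz_bij p h"
  shows "toeplitz_bij (conj_exp p) (lcnj h)"
proof -
  define q where "q = conj_exp p"
  have q: "q > 1" "conj_exp q = p" using conj_exp[OF p] by (auto simp: q_def)
  have q1: "q \<ge> 1" "q > 0" using q by auto
  have hL: "h \<in> Linf" and inj: "\<And>f. f \<in> Hardy p \<Longrightarrow> toeplitz h f = 0 \<Longrightarrow> f = 0"
    and surj: "\<And>y. y \<in> Hardy p \<Longrightarrow> \<exists>f\<in>Hardy p. toeplitz h f = y"
    using h by (auto simp: toeplitz_bij_def)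
  have lh: "lcnj h \<in> Linf" by (rule Linf_lcnj[OF hL])
  have adj: "pairing (toeplitz (lcnj h) k) x = pairing k (toeplitz h x)" if "k \<in> Hardy q" "x \<in> Hardy p" for k x
    using pairing_toeplitz[OF q(1) lh that(1), of x] that(2) by (simp add: q)
  define S where "S = the_inv_into (Hardy p) (toeplitz h)"
  note S = toeplitz_bij_inverse[OF p h, folded S_def]
  obtain K where K: "K \<ge> 0" "\<And>f. f \<in> Hardy p \<Longrightarrow> lp_norm p (S f) \<le> K * lp_norm p f"
    using blin_bound[OF S(3)] by blast
  obtain C where C: "C \<ge> 0" "\<And>f. f \<in> Lp p \<Longrightarrow> lp_norm p (Riesz_P f) \<le> C * lp_norm p f"
    using Riesz_P_bounded[OF p] by metis
  note T = blin_mono[OF blin_toeplitz[OF q(1) lh] Hardy_subset_Lp order_refl]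
  have below: "lp_norm q k \<le> (K * C) * lp_norm q (toeplitz (lcnj h) k)" if k: "k \<in> Hardy q" for k
  proof (cases "lp_norm q k = 0")
    case True
    then show ?thesis using K C by simp
  next
    case False
    then have pos: "lp_norm q k > 0" using lp_norm_nonneg[of q k] by linarith
    \<comment> \<open>The norming element of k, projected to H^p and pulled back by S, is the test
      element that reveals the norm of the adjoint at k.\<close>
    define x0 where "x0 = dual_elt q k"
    have x0: "x0 \<in> Lp p" "lp_norm p x0 = lp_norm q k powr (q - 1)" "pairing k x0 = of_real (lp_norm q k powr q)"
      using dual_elt[OF q(1) Hardy_Lp[OF k]] by (auto simp: x0_def q)
    have PH: "Riesz_P x0 \<in> Hardy p" by (rule Riesz_P_Hardy[OF p x0(1)])
    have SH: "S (Riesz_P x0) \<in> Hardy p" by (rule blinD(1)[OF S(3) PH])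
    have "pairing k x0 = pairing k (toeplitz h (S (Riesz_P x0)))"
      using pairing_Hardy_right[OF q(1) k, of x0] x0(1) by (simp add: S(2)[OF PH] q)
    also have "\<dots> = pairing (toeplitz (lcnj h) k) (S (Riesz_P x0))" by (rule adj[OF k SH, symmetric])
    finally have "lp_norm q k powr q = cmod (pairing (toeplitz (lcnj h) k) (S (Riesz_P x0)))"
      using x0(3) by (metis norm_of_real abs_of_nonneg powr_ge_zero)
    also have "\<dots> \<le> lp_norm q (toeplitz (lcnj h) k) * lp_norm p (S (Riesz_P x0))"
      using pairing_L1(2)[OF q(1) Hardy_Lp[OF blinD(1)[OF T k]], of "S (Riesz_P x0)"] Hardy_Lp[OF SH] by (simp add: q)
    also have "\<dots> \<le> lp_norm q (toeplitz (lcnj h) k) * (K * (C * lp_norm p x0))"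
      by (intro mult_left_mono order_trans[OF K(2)[OF PH]] C(2)[OF x0(1)] K(1)) auto
    finally have le: "lp_norm q k powr q \<le> (K * C) * lp_norm q (toeplitz (lcnj h) k) * lp_norm q k powr (q - 1)"
      by (simp add: x0(2) mult_ac)
    have "lp_norm q k powr q = lp_norm q k * lp_norm q k powr (q - 1)"
      using powr_add[of "lp_norm q k" 1 "q - 1"] pos by simp
    with le pos show ?thesis by simp
  qed
  have injq: "k = 0" if "k \<in> Hardy q" "toeplitz (lcnj h) k = 0" for k
    using below[OF that(1)] that(2) lp_norm_eq_0_iff[OF Hardy_Lp[OF that(1)] q1(2)] lp_norm_nonneg[of q k] by simp
  have surjq: "\<exists>k\<in>Hardy q. toeplitz (lcnj h) k = y" if y: "y \<in> Hardy q" for y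
  proof (rule ccontr)
    assume nex: "\<not> ?thesis"
    define R where "R = toeplitz (lcnj h) ` Hardy q"
    have RH: "R \<subseteq> Hardy q" unfolding R_def using blinD(1)[OF T] by auto
    have "closed_subspace q R"
      unfolding closed_subspace_def
    proof (intro conjI allI impI)
      show "R \<subseteq> Lp q" using RH Hardy_subset_Lp by blast
      show "lfun.subspace R" unfolding R_def by (rule toeplitz_image_subspace[OF q(1) lh])
      fix r z assume *: "(\<forall>n. r n \<in> R) \<and> z \<in> Lp q \<and> (\<lambda>n::nat. lp_norm q (r n - z)) \<longlonglongrightarrow> 0"
      then have "\<forall>n. \<exists>k\<in>Hardy q. r n = toeplitz (lcnj h) k" by (auto simp: R_def)
      then obtain k where k: "\<And>n. k n \<in> Hardy q" "\<And>n. r n = toeplitz (lcnj h) (k n)" by metis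
      have rL: "r n \<in> Lp q" for n using * RH Hardy_subset_Lp by blast
      define M where "M = K * C + 1"
      have M: "M > 0" using K C by (simp add: M_def add_nonneg_pos)
      have below': "lp_norm q u \<le> M * lp_norm q (toeplitz (lcnj h) u)" if "u \<in> Hardy q" for u
        using below[OF that] by (simp add: M_def distrib_right add_increasing2)
      have dk: "lp_norm q (k m - k n) \<le> M * (lp_norm q (r m - z) + lp_norm q (r n - z))" for m n
      proof -
        have "lp_norm q (k m - k n) \<le> M * lp_norm q (toeplitz (lcnj h) (k m - k n))"
          by (intro below' Hardy_diff q k)
        also have "toeplitz (lcnj h) (k m - k n) = (r m - z) - (r n - z)"
          using toeplitz_diff[OF q(1) lh Hardy_Lp[OF k(1)] Hardy_Lp[OF k(1)]] k(2) by simp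
        also have "lp_norm q \<dots> \<le> lp_norm q (r m - z) + lp_norm q (r n - z)"
          using * by (intro lp_norm_triangle_diff Lp_diff rL q1) auto
        finally show ?thesis using M by (simp add: mult_left_mono)
      qed
      obtain l where l: "l \<in> Lp q" "(\<lambda>n. lp_norm q (k n - l)) \<longlonglongrightarrow> 0"
      proof (rule Lp_complete[of k q])
        fix e :: real assume e: "e > 0"
        then have "e / (2 * M) > 0" using M by simp
        then obtain N where N: "\<forall>n\<ge>N. norm (lp_norm q (r n - z) - 0) < e / (2 * M)"
          using * LIMSEQ_D[of "\<lambda>n. lp_norm q (r n - z)" 0] by blast
        have "lp_norm q (k m - k n) < e" if "m \<ge> N" "n \<ge> N" for m n
        proof -
          have "lp_norm q (r m - z) + lp_norm q (r n - z) < e / (2 * M) + e / (2 * M)"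
            using N that by (intro add_strict_mono) auto
          then have "M * (lp_norm q (r m - z) + lp_norm q (r n - z)) < M * (e / (2 * M) + e / (2 * M))"
            using M by (intro mult_strict_left_mono)
          also have "\<dots> = e" using M by (simp add: field_simps)
          finally show ?thesis using dk[of m n] by linarith
        qed
        then show "\<exists>N. \<forall>m\<ge>N. \<forall>n\<ge>N. lp_norm q (k m - k n) < e" by blast
      qed (use k Hardy_Lp q1 in auto)
      have lH: "l \<in> Hardy q" by (rule closed_subspaceD(7)[OF closed_subspace_Hardy[OF q(1)] k(1) l])
      obtain D where D: "D \<ge> 0" "\<And>f. f \<in> Hardy q \<Longrightarrow> lp_norm q (toeplitz (lcnj h) f) \<le> D * lp_norm q f"
        using blin_bound[OF T] by blast
      have TH: "toeplitz (lcnj h) l \<in> Hardy q" by (rule blinD(1)[OF T lH])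
      have "lp_norm q (toeplitz (lcnj h) l - z) \<le> D * lp_norm q (k n - l) + lp_norm q (r n - z)" for n
      proof -
        have eq: "toeplitz (lcnj h) l - z = (r n - z) - toeplitz (lcnj h) (k n - l)"
          using toeplitz_diff[OF q(1) lh Hardy_Lp[OF k(1)] Hardy_Lp[OF lH]] k(2) by simp
        have klH: "k n - l \<in> Hardy q" by (intro Hardy_diff q k lH)
        have "lp_norm q (toeplitz (lcnj h) l - z) \<le> lp_norm q (r n - z) + lp_norm q (toeplitz (lcnj h) (k n - l))"
          unfolding eq using * by (intro lp_norm_triangle_diff Lp_diff rL q1 Hardy_Lp[OF blinD(1)[OF T klH]]) auto
        then show ?thesis using D(2)[OF klH] by linarith
      qed
      moreover have "(\<lambda>n. D * lp_norm q (k n - l) + lp_norm q (r n - z)) \<longlonglongrightarrow> D * 0 + 0"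
        using * by (intro tendsto_add tendsto_mult tendsto_const l(2)) auto
      ultimately have "lp_norm q (toeplitz (lcnj h) l - z) \<le> 0"
        by (intro LIMSEQ_le_const[of _ 0]) auto
      moreover have "toeplitz (lcnj h) l - z \<in> Lp q" using * by (intro Lp_diff Hardy_Lp[OF TH] q1) auto
      ultimately have "toeplitz (lcnj h) l = z"
        using lp_norm_eq_0_iff[of "toeplitz (lcnj h) l - z" q] lp_norm_nonneg[of q "toeplitz (lcnj h) l - z"] q1 by simp
      then show "z \<in> R" using lH by (auto simp: R_def)
    qed
    moreover have "y \<notin> R" using nex by (auto simp: R_def)
    ultimately obtain x where x: "x \<in> Hardy p" "\<And>z. z \<in> R \<Longrightarrow> pairing z x = 0" "pairing y x \<noteq> 0"
      using Hardy_annihilator[OF q(1) _ RH y] q(2) by metis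
    have "toeplitz h x = 0"
    proof (rule Hardy_eqI_pairing[OF q(1)])
      show "toeplitz h x \<in> Hardy (conj_exp q)" using toeplitz_Hardy[OF p hL Hardy_Lp[OF x(1)]] by (simp add: q)
      show "0 \<in> Hardy (conj_exp q)" using Hardy_0[OF p] by (simp add: q)
      show "pairing k (toeplitz h x) = pairing k 0" if "k \<in> Hardy q" for k
        using adj[OF that x(1)] x(2)[of "toeplitz (lcnj h) k"] that by (auto simp: R_def)
    qed
    then have "x = 0" by (rule inj[OF x(1)])
    then show False using x(3) by simp
  qed
  show ?thesis
    using lh injq surjq by (auto simp: toeplitz_bij_def q_def)
qed

text \<open>An antianalytic factor may be taken out on the left of a Toeplitz operator. Taking out
  t^{-\<kappa>} for \<kappa> \<ge> 0 gives the right inverse; taking out t^\<kappa> for \<kappa>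
  \<le> 0 shows that the same formula is a left inverse.\<close>

lemma toeplitz_right_inv:
  assumes p: "p > 1" and g: "g \<in> Linf" and \<kappa>: "\<kappa> = fredholm_index p (toeplitz g)"
    and bij: "toeplitz_bij p (g * monomial \<kappa>)"
  shows "blin p (Hardy p) (Hardy p) (toeplitz_right_inv p g)"
    "\<And>y. \<kappa> \<ge> 0 \<Longrightarrow> y \<in> Hardy p \<Longrightarrow> toeplitz g (toeplitz_right_inv p g y) = y"
    "\<And>f. \<kappa> \<le> 0 \<Longrightarrow> f \<in> Hardy p \<Longrightarrow> toeplitz_right_inv p g (toeplitz g f) = f"
proof -
  have p1: "p \<ge> 1" "p > 0" using p by auto
  define S where "S = the_inv_into (Hardy p) (toeplitz (g * monomial \<kappa>))"
  note S = toeplitz_bij_inverse[OF p bij, folded S_def]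
  have R: "toeplitz_right_inv p g f = S (toeplitz (monomial \<kappa>) f)" for f
    by (simp add: toeplitz_right_inv_def S_def \<kappa> Let_def)
  have m: "blin p (Hardy p) (Hardy p) (toeplitz (monomial \<kappa>))"
    by (rule blin_mono[OF blin_toeplitz[OF p Linf_monomial] Hardy_subset_Lp order_refl])
  have "blin p (Hardy p) (Hardy p) (\<lambda>f. S (toeplitz (monomial \<kappa>) f))" by (rule blin_comp[OF m S(3)])
  then show "blin p (Hardy p) (Hardy p) (toeplitz_right_inv p g)" by (simp add: R[abs_def])
  show "toeplitz g (toeplitz_right_inv p g y) = y" if k: "\<kappa> \<ge> 0" and y: "y \<in> Hardy p" for y
  proof -
    have my: "toeplitz (monomial \<kappa>) y = monomial \<kappa> * y"
      unfolding toeplitz_def by (rule Riesz_P_id[OF p1(1) monomial_times_Hardy[OF p1(2) y k]])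
    have myH: "monomial \<kappa> * y \<in> Hardy p" by (rule monomial_times_Hardy[OF p1(2) y k])
    define x where "x = S (monomial \<kappa> * y)"
    have x: "x \<in> Hardy p" unfolding x_def by (rule blinD(1)[OF S(3) myH])
    have gx: "g * monomial \<kappa> * x \<in> Lp p" using g x by (intro Linf_times_Lp Linf_times p1 Hardy_Lp) auto
    have "toeplitz (g * monomial \<kappa>) x = monomial \<kappa> * y" unfolding x_def by (rule S(2)[OF myH])
    then have "monomial \<kappa> * y + Riesz_Q (g * monomial \<kappa> * x) = monomial \<kappa> * (g * x)"
      by (simp add: toeplitz_def Riesz_Q_def mult_ac)
    then have "monomial (-\<kappa>) * (monomial \<kappa> * y + Riesz_Q (g * monomial \<kappa> * x)) = monomial (-\<kappa>) * (monomial \<kappa> * (g * x))"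
      by simp
    then have eq: "g * x = y + monomial (-\<kappa>) * Riesz_Q (g * monomial \<kappa> * x)"
      by (simp only: distrib_left mult.assoc[symmetric] monomial_cancel mult_1_left)
    have N: "monomial (-\<kappa>) * Riesz_Q (g * monomial \<kappa> * x) \<in> Hneg p"
      using k by (intro monomial_times_Hneg p1 Riesz_Q_Hneg[OF p gx]) auto
    have "toeplitz g x = Riesz_P y + Riesz_P (monomial (-\<kappa>) * Riesz_Q (g * monomial \<kappa> * x))"
      unfolding toeplitz_def eq by (rule Riesz_P_add[OF p Hardy_Lp[OF y] Hneg_Lp[OF N]])
    also have "\<dots> = y" by (simp add: Riesz_P_id[OF p1(1) y] Riesz_P_Hneg[OF N])
    finally show ?thesis by (simp add: R my x_def)
  qed
  show "toeplitz_right_inv p g (toeplitz g f) = f" if k: "\<kappa> \<le> 0" and f: "f \<in> Hardy p" for f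
  proof -
    have gf: "g * f \<in> Lp p" by (intro Linf_times_Lp g p1 Hardy_Lp f)
    have N: "monomial \<kappa> * Riesz_Q (g * f) \<in> Hneg p" by (intro monomial_times_Hneg p1 Riesz_Q_Hneg[OF p gf] k)
    have "g * monomial \<kappa> * f = monomial \<kappa> * Riesz_P (g * f) + monomial \<kappa> * Riesz_Q (g * f)"
      by (simp add: Riesz_Q_def distrib_left[symmetric] mult_ac)
    then have "toeplitz (g * monomial \<kappa>) f = Riesz_P (monomial \<kappa> * Riesz_P (g * f)) + Riesz_P (monomial \<kappa> * Riesz_Q (g * f))"
      unfolding toeplitz_def
      using Riesz_P_add[OF p Lp_monomial_times[OF p1(2) Riesz_P_Lp(1)[OF p gf]] Hneg_Lp[OF N]] by simp
    then have "toeplitz (monomial \<kappa>) (toeplitz g f) = toeplitz (g * monomial \<kappa>) f"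
      by (simp add: toeplitz_def Riesz_P_Hneg[OF N])
    then show ?thesis using S(1)[OF f] by (simp add: R)
  qed
qed

section \<open>Wiener--Hopf factorization\<close>

lemma lfun_inverse_unique: "a * b = 1 \<Longrightarrow> inverse a = (b :: lfun)"
proof (rule lfun_eqI)
  assume ab: "a * b = 1"
  show "AE t in circ. rep_lfun (inverse a) t = rep_lfun b t"
    using rep_lfun_times[of a b] rep_lfun_one rep_lfun_inverse[of a] unfolding ab
    by eventually_elim (metis inverse_unique)
qed

lemma lfun_mult_cancel:
  fixes a :: lfun
  assumes "a * a' = 1" "a * x = a * y" shows "x = y"
proof -
  have "(a * a') * x = (a * a') * y" using assms(2) by (metis mult.assoc mult.commute)
  then show ?thesis by (simp add: assms(1))
qed

text \<open>The quotient of the minus factors equals the reverse quotient of the plus factors, so it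
  is analytic and antianalytic, hence constant; the normalisation at infinity makes the constant
  1.\<close>

lemma wiener_hopf_unique:
  assumes p: "p > 1" and 1: "wiener_hopf p g gm gp" and 2: "wiener_hopf p g gm' gp'"
  shows "gp = gp'"
proof -
  define q where "q = conj_exp p"
  have q: "q > 1" "conj_exp q = p" using conj_exp[OF p] by (auto simp: q_def)
  define n where "n = fredholm_index p (toeplitz g)"
  have W: "g = gm * monomial (- n) * gp" "fcoeff gm 0 = 1" "gp * inverse gp = 1" "gm * inverse gm = 1"
    "gp \<in> Hardy q" "inverse gp \<in> Hardy p" "gm \<in> Hardy_bar p" "inverse gm \<in> Hardy_bar q"
    using 1 by (auto simp: wiener_hopf_def n_def q_def)
  have W': "g = gm' * monomial (- n) * gp'" "fcoeff gm' 0 = 1" "gp' * inverse gp' = 1" "gm' * inverse gm' = 1"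
    "gp' \<in> Hardy q" "inverse gp' \<in> Hardy p" "gm' \<in> Hardy_bar p" "inverse gm' \<in> Hardy_bar q"
    using 2 by (auto simp: wiener_hopf_def n_def q_def)
  have "monomial n * (gm * monomial (- n) * gp) = monomial n * (gm' * monomial (- n) * gp')"
    using W(1) W'(1) by simp
  then have "(monomial n * monomial (- n)) * (gm * gp) = (monomial n * monomial (- n)) * (gm' * gp')" by (simp only: mult_ac)
  then have "gm * gp = gm' * gp'" by simp
  then have "gm * gp * (inverse gm' * inverse gp) = gm' * gp' * (inverse gm' * inverse gp)" by simp
  then have "(gm * inverse gm') * (gp * inverse gp) = (gm' * inverse gm') * (gp' * inverse gp)" by (simp only: mult_ac)
  then have eq: "gm * inverse gm' = gp' * inverse gp" using W W' by simp
  have hb: "gm * inverse gm' \<in> Hardy_bar 1" "fcoeff (gm * inverse gm') 0 = fcoeff (inverse gm') 0"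
    using Hardy_bar_times[OF p W(7), of "inverse gm'"] W(2) W'(8) by (auto simp: q_def)
  have h1: "gp' * inverse gp \<in> Hardy 1"
    using Hardy_times[OF q(1) W'(5), of "inverse gp"] W(6) by (auto simp: q)
  have "fcoeff (gm' * inverse gm') 0 = fcoeff (inverse gm') 0"
    using Hardy_bar_times[OF p W'(7), of "inverse gm'"] W'(2,8) by (auto simp: q_def)
  then have c1: "fcoeff (inverse gm') 0 = 1" using W'(4) by (simp add: fcoeff_one)
  have "gp' * inverse gp = lscale (fcoeff (gp' * inverse gp) 0) 1"
    using h1 hb(1) eq by (intro lfun_const) auto
  also have "\<dots> = 1" using hb(2) c1 eq by simp
  finally have "inverse gp * gp' = inverse gp * gp" using W(3) by (simp add: mult.commute)
  then show ?thesis using W(3) by (metis lfun_mult_cancel mult.commute)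
qed

lemma wh_plus_eq: "p > 1 \<Longrightarrow> wiener_hopf p g gm gp \<Longrightarrow> wh_plus p g = gp"
  unfolding wh_plus_def using wiener_hopf_unique by blast

text \<open>The factors are read off from x = T(h)^{-1} 1 and y = T(cnj h)^{-1} 1, where h = g t^n:
  h x is the minus factor and x the inverse of the plus factor. The product x h cnj y is analytic
  and antianalytic, so it is a constant k, and it supplies both remaining inverses.\<close>

lemma wiener_hopf_exists:
  assumes p: "p > 1" and g: "g \<in> Linf" "g * g' = 1" and F: "fredholm p (toeplitz g)"
  obtains gm gp where "wiener_hopf p g gm gp"
proof -
  define q where "q = conj_exp p"
  have q: "q > 1" "conj_exp q = p" using conj_exp[OF p] by (auto simp: q_def)
  have p1: "p \<ge> 1" "p > 0" and q1: "q \<ge> 1" "q > 0" using p q by auto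
  define n where "n = fredholm_index p (toeplitz g)"
  define h where "h = g * monomial n"
  have bij: "toeplitz_bij p h" unfolding h_def n_def by (rule toeplitz_bij_index[OF p g F])
  have bijq: "toeplitz_bij q (lcnj h)" unfolding q_def by (rule toeplitz_bij_adjoint[OF p bij])
  have hL: "h \<in> Linf" "lcnj h \<in> Linf" using bij bijq by (auto simp: toeplitz_bij_def)
  define S where "S = the_inv_into (Hardy p) (toeplitz h)"
  note S = toeplitz_bij_inverse[OF p bij, folded S_def]
  have one: "1 \<in> Hardy p" "1 \<in> Hardy q" using monomial_Hardy[of p 0] monomial_Hardy[of q 0] p1 q1 by auto
  define x where "x = S 1"
  have x: "x \<in> Hardy p" "toeplitz h x = 1" unfolding x_def using blinD(1)[OF S(3) one(1)] S(2)[OF one(1)] by auto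
  obtain y where y: "y \<in> Hardy q" "toeplitz (lcnj h) y = 1" using bijq one(2) by (auto simp: toeplitz_bij_def)
  define gm where "gm = h * x"
  define r where "r = h * lcnj y"
  have hx: "h * x \<in> Lp p" and hy: "lcnj h * y \<in> Lp q" using hL x y p1 q1 by (auto intro: Linf_times_Lp Hardy_Lp)
  have cgm: "fcoeff gm k = (if k = 0 then 1 else 0)" if "k \<ge> 0" for k
    using Riesz_P_Lp(2)[OF p hx, of k] x(2) that by (simp add: gm_def toeplitz_def fcoeff_one)
  have gm: "gm \<in> Hardy_bar p" using hx cgm by (auto simp: Hardy_bar_def gm_def)
  have cy: "fcoeff (lcnj h * y) k = (if k = 0 then 1 else 0)" if "k \<ge> 0" for k
    using Riesz_P_Lp(2)[OF q(1) hy, of k] y(2) that by (simp add: toeplitz_def fcoeff_one)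
  have "lcnj h * y \<in> Hardy_bar q" using hy cy by (auto simp: Hardy_bar_def)
  moreover have "r = lcnj (lcnj h * y)" by (simp add: r_def)
  ultimately have r: "r \<in> Hardy q" "fcoeff r 0 = 1"
    using cy[of 0] by (simp_all only: lcnj_Hardy fcoeff_lcnj) simp
  have ly: "lcnj y \<in> Hardy_bar q" using y by simp
  define k where "k = fcoeff x 0"
  have xr: "x * r = gm * lcnj y" by (simp add: r_def gm_def mult_ac)
  have h1: "x * r \<in> Hardy 1" "fcoeff (x * r) 0 = k"
    using Hardy_times[OF p x(1), of r] r by (auto simp: q_def k_def)
  have "gm * lcnj y \<in> Hardy_bar 1" using Hardy_bar_times[OF p gm, of "lcnj y"] ly by (auto simp: q_def)
  then have xrk: "x * r = lscale k 1" using lfun_const[of "x * r"] h1 xr by simp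
  \<comment> \<open>Otherwise x cnj y = 0, which is impossible for nonzero analytic x and y.\<close>
  have k0: "k \<noteq> 0"
  proof
    assume "k = 0"
    then have "h * (x * lcnj y) = 0" using xrk by (simp add: r_def mult_ac)
    then have "(g' * monomial (- n)) * (h * (x * lcnj y)) = 0" by simp
    then have "(g * g') * (monomial n * monomial (- n)) * (x * lcnj y) = 0" unfolding h_def by (simp only: mult_ac)
    then have "x * lcnj y = 0" using g(2) by simp
    then have "x = 0 \<or> y = 0" using Hardy_zero_divisor[OF p x(1)] y(1) by (simp add: q_def)
    then show False using x(2) y(2) by auto
  qed
  define gp where "gp = lscale (1 / k) r"
  define igm where "igm = lscale (1 / k) (lcnj y)"
  have xgp: "x * gp = 1" using xrk k0 by (simp add: gp_def lscale_times_right)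
  have igp: "inverse gp = x" using xgp by (intro lfun_inverse_unique) (simp add: mult.commute)
  have gi: "gm * igm = 1" using xrk xr k0 by (simp add: igm_def lscale_times_right)
  have igm: "inverse gm = igm" by (rule lfun_inverse_unique[OF gi])
  have igmH: "igm \<in> Hardy_bar q"
  proof -
    have "lcnj igm \<in> Hardy q" unfolding igm_def by (simp add: Hardy_lscale[OF q(1)] y)
    then show ?thesis by simp
  qed
  have gpH: "gp \<in> Hardy q" unfolding gp_def by (rule Hardy_lscale[OF q(1) r(1)])
  have fact: "g = gm * monomial (- n) * gp"
  proof -
    have "gm * monomial (- n) * gp = g * (monomial n * monomial (- n)) * (x * gp)" by (simp only: gm_def h_def mult_ac)
    then show ?thesis by (simp add: xgp)
  qed
  \<comment> \<open>The bounded extension is the inverse of T(h) itself. As the inverse minus factor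
    is antianalytic, its product with t^j has no frequency above j, so its projection v is a
    polynomial and x v stays in H^p.\<close>
  have B: "S (monomial (int j)) = x * Riesz_P (igm * monomial (int j))" for j :: nat
  proof -
    define w where "w = igm * monomial (int j)"
    have wL: "w \<in> Lp q" unfolding w_def
      using Lp_monomial_times[OF q1(2) Hardy_bar_Lp[OF igmH]] by (simp add: mult.commute)
    have wc: "fcoeff w m = 0" if "m > int j" for m
      using igmH that by (simp add: w_def mult.commute[of igm] fcoeff_monomial_times Hardy_bar_def)
    define v where "v = Riesz_P w"
    have v: "v = (\<Sum>i\<in>{0..int j}. lscale (fcoeff w i) (monomial i))"
      unfolding v_def
    proof (rule Riesz_P_eqI)
      fix m
      have "fcoeff (\<Sum>i\<in>{0..int j}. lscale (fcoeff w i) (monomial i)) m = (\<Sum>i\<in>{0..int j}. if m = i then fcoeff w i else 0)"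
        by (subst fcoeff_sum, blast intro: Lp_lscale Lp_monomial zero_less_one)
           (intro sum.cong refl, simp add: fcoeff_lscale fcoeff_monomial)
      also have "\<dots> = (if m \<in> {0..int j} then fcoeff w m else 0)" by (rule sum.delta') simp
      finally show "fcoeff (\<Sum>i\<in>{0..int j}. lscale (fcoeff w i) (monomial i)) m = (if m \<ge> 0 then fcoeff w m else 0)"
        using wc[of m] by auto
    qed (auto intro!: Lp_sum Lp_lscale Lp_monomial)
    have "x * v = (\<Sum>i\<in>{0..int j}. lscale (fcoeff w i) (monomial i * x))"
      unfolding v by (simp add: sum_distrib_left lscale_times_right mult.commute)
    also have "\<dots> \<in> Hardy p"
      by (intro lfun.subspace_sum[OF Hardy_subspace[OF p]] Hardy_lscale p monomial_times_Hardy p1 x) auto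
    finally have xv: "x * v \<in> Hardy p" .
    have QN: "gm * Riesz_Q w \<in> Hneg 1"
      using Hardy_1_times_Hneg[OF p gm, of "Riesz_Q w"] Riesz_Q_Hneg[OF q(1) wL] by (simp add: q_def)
    have "h * (x * v) = gm * (w - Riesz_Q w)" by (simp add: gm_def v_def Riesz_Q_def mult.assoc)
    also have "\<dots> = (gm * igm) * monomial (int j) - gm * Riesz_Q w" by (simp add: w_def right_diff_distrib mult.assoc)
    finally have eq: "h * (x * v) = monomial (int j) - gm * Riesz_Q w" by (simp add: gi)
    have "toeplitz h (x * v) = monomial (int j)"
      unfolding toeplitz_def eq
      by (rule Riesz_P_eqI) (use QN in \<open>auto simp: Hneg_def fcoeff_diff Lp_monomial fcoeff_monomial\<close>)
    then show ?thesis using S(1)[OF xv] by (simp add: v_def w_def)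
  qed
  have "wiener_hopf p g gm gp"
    unfolding wiener_hopf_def n_def[symmetric] q_def[symmetric] igp igm
    using fact cgm[of 0] xgp gi gpH x(1) gm igmH B blin_imp_bounded_op[OF S(3)]
    by (auto simp: mult.commute)
  then show ?thesis by (rule that)
qed

section \<open>The spaces \<open>im P\<^sub>\<alpha>\<^sup>\<plusminus>(g)\<close>\<close>

context carleman_shift
begin

lemma blin_J: "p > 0 \<Longrightarrow> blin p (Lp p) (Lp p) (J)"
proof -
  assume p: "p > 0"
  obtain C where "C \<ge> 0" "\<And>f. f \<in> Lp p \<Longrightarrow> J f \<in> Lp p \<and> lp_norm p (J f) \<le> C * lp_norm p f"
    using J_bounded[OF p] by metis
  then show ?thesis by (intro blinI[where C = C]) (auto simp: J_add J_lscale)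
qed

text \<open>The image of the projection with sign s, written as an eigenspace. Membership in the
  kernel of T(g) is implied, and neither P nor Q occurs, so equations for its elements are plain
  algebra.\<close>

definition Eig :: "real \<Rightarrow> complex \<Rightarrow> lfun \<Rightarrow> lfun set" where
  "Eig p s g = {h \<in> Hardy p. J (g * h) = lscale s h}"

lemma Eig_ker:
  assumes p: "p > 1" and g: "g \<in> Linf" and h: "h \<in> Eig p s g"
  shows "h \<in> ker p (toeplitz g)"
proof -
  have hH: "h \<in> Hardy p" and J: "J (g * h) = lscale s h" using h by (auto simp: Eig_def)
  have "g * h = J (lscale s h)" using J J_J[of "g * h"] by simp
  also have "\<dots> \<in> Hneg p" by (intro J_Hardy[OF p] Hardy_lscale p hH)
  finally show ?thesis using hH ker_toeplitz[OF p g] by simp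
qed

lemma Eig_subspace:
  assumes p: "p > 1"
  shows "lfun.subspace (Eig p s g)"
  unfolding lfun.subspace_def Eig_def
  by (auto simp: Hardy_0[OF p] Hardy_add[OF p] Hardy_lscale[OF p] distrib_left J_add J_zero
      lscale_times_right J_lscale lfun.scale_right_distrib mult.commute)

text \<open>On the kernel of T(g) the inner P and Q act as identities, so the projection averages f
  with the involution that sends f to \<open>J (g * f)\<close>; it is an involution because g times
  its composition with \<alpha> is 1.\<close>

lemma im_proj_eq_Eig:
  assumes p: "p > 1" and g: "g \<in> Linf" "g * \<A> g = 1" and s: "s * s = 1"
  shows "im_proj p \<beta> s g = Eig p s g"
proof -
  have p1: "p \<ge> 1" using p by simp
  have proj: "proj_alpha \<beta> s g f = lscale (1/2) (f + lscale s (J (g * f)))" if f: "f \<in> ker p (toeplitz g)" for f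
  proof -
    have "f \<in> Hardy p" "g * f \<in> Hneg p" using f ker_toeplitz[OF p g(1)] by auto
    then have "Riesz_P f = f" "Riesz_Q (g * f) = g * f" using Riesz_P_id[OF p1] Riesz_P_Hneg by (auto simp: Riesz_Q_def)
    then show ?thesis by (simp add: proj_alpha_def)
  qed
  have JJ: "J (g * J (g * f)) = f" for f
  proof -
    have "J (g * J (g * f)) = (g * \<A> g) * f"

      unfolding J_times[of g "J (g * f)"] J_J[of "g * f"] by (simp only: mult_ac)
    then show ?thesis by (simp only: g(2) mult_1)
  qed
  show ?thesis
  proof
    show "im_proj p \<beta> s g \<subseteq> Eig p s g"
    proof
      fix h assume "h \<in> im_proj p \<beta> s g"
      then obtain f where f: "f \<in> ker p (toeplitz g)" "h = proj_alpha \<beta> s g f" by (auto simp: im_proj_def)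
      then have h: "h = lscale (1/2) (f + lscale s (J (g * f)))" using proj by simp
      have fH: "f \<in> Hardy p" "g * f \<in> Hneg p" using f ker_toeplitz[OF p g(1)] by auto
      have "h \<in> Hardy p" unfolding h by (intro Hardy_lscale[OF p] Hardy_add[OF p] fH J_Hneg[OF p])
      moreover have "J (g * h) = lscale (1/2) (J (g * f) + lscale s f)"
        unfolding h by (simp add: lscale_times_right distrib_left J_lscale J_add JJ)
      then have "J (g * h) = lscale s h"
        unfolding h using s by (simp add: lfun.scale_right_distrib mult.commute add.commute)
      ultimately show "h \<in> Eig p s g" by (simp add: Eig_def)
    qed
    show "Eig p s g \<subseteq> im_proj p \<beta> s g"
    proof
      fix h assume h: "h \<in> Eig p s g"
      have k: "h \<in> ker p (toeplitz g)" by (rule Eig_ker[OF p g(1) h])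
      have "proj_alpha \<beta> s g h = lscale (1/2) (h + lscale s (lscale s h))" using proj[OF k] h by (simp add: Eig_def)
      also have "\<dots> = lscale (1/2) (lscale 2 h)"
        using s lfun.scale_left_distrib[of 1 1 h] by simp
      also have "\<dots> = h" by simp
      finally show "h \<in> im_proj p \<beta> s g" unfolding im_proj_def using k by (intro image_eqI[of _ _ h]) auto
    qed
  qed
qed

text \<open>Independence concerns sets, so a family needs injectivity as well; the coefficient
  hypothesis yields it through the relation b k - b l = 0.\<close>

lemma family_independent:
  assumes K: "finite K" and z: "\<And>v. (\<Sum>k\<in>K. lscale (v k) (b k)) = 0 \<Longrightarrow> \<forall>k\<in>K. v k = 0"
  shows "inj_on b K" "lfun.independent (b ` K)"
proof -
  show inj: "inj_on b K"
  proof (rule inj_onI, rule ccontr)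
    fix k l assume kl: "k \<in> K" "l \<in> K" "b k = b l" "k \<noteq> l"
    define v where "v j = (if j = k then 1 else if j = l then - 1 else 0 :: complex)" for j
    have "(\<Sum>j\<in>K. lscale (v j) (b j)) = (\<Sum>j\<in>K. (if j = k then b k else 0) - (if j = l then b l else 0))"
      using kl(4) by (intro sum.cong) (auto simp: v_def)
    also have "\<dots> = b k - b l" using K kl by (simp add: sum_subtractf)
    finally have "v k = 0" using z kl by auto
    then show False by (simp add: v_def)
  qed
  show "lfun.independent (b ` K)"
  proof (rule lfun.independent_if_scalars_zero)
    fix u x assume "(\<Sum>x\<in>b ` K. lscale (u x) x) = 0" "x \<in> b ` K"
    then show "u x = 0" using z[of "\<lambda>k. u (b k)"] by (auto simp: sum.reindex[OF inj])
  qed (use K in simp)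
qed

text \<open>Covers both parities: the pairs of indices are mutually disjoint, and only in the odd
  case can a pair degenerate to a single index, where the vector is (1 + c) e and the factor must
  not vanish.\<close>

lemma family_pairs:
  fixes n :: nat
  assumes E: "\<And>u. (\<Sum>j<n. lscale (u j) (e j)) = 0 \<Longrightarrow> \<forall>j<n. u j = 0"
    and K: "finite K" "\<And>k. k \<in> K \<Longrightarrow> i k < n" "\<And>k. k \<in> K \<Longrightarrow> i' k < n" "inj_on i K"
    and dist: "\<And>k l. k \<in> K \<Longrightarrow> l \<in> K \<Longrightarrow> k \<noteq> l \<Longrightarrow> i' l \<noteq> i k"
    and same: "\<And>k. k \<in> K \<Longrightarrow> i' k = i k \<Longrightarrow> 1 + c \<noteq> 0"
    and 0: "(\<Sum>k\<in>K. lscale (v k) (e (i k) + lscale c (e (i' k)))) = 0"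
  shows "\<forall>k\<in>K. v k = 0"
proof
  \<comment> \<open>The total coefficient of e j after expanding the pairs. At j = i k only the
    summand k contributes.\<close>
  define U where "U j = (\<Sum>k\<in>K. v k * ((if j = i k then 1 else 0) + c * (if j = i' k then 1 else 0)))" for j
  have delta: "lscale (v k) (e (i k) + lscale c (e (i' k))) =
      (\<Sum>j<n. lscale (v k * ((if j = i k then 1 else 0) + c * (if j = i' k then 1 else 0))) (e j))" if "k \<in> K" for k
  proof -
    have "(\<Sum>j<n. lscale (v k * ((if j = i k then 1 else 0) + c * (if j = i' k then 1 else 0))) (e j)) =
        (\<Sum>j<n. (if j = i k then lscale (v k) (e (i k)) else 0) + (if j = i' k then lscale (v k * c) (e (i' k)) else 0))"
      by (intro sum.cong refl) (auto simp: distrib_left lfun.scale_left_distrib)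
    also have "\<dots> = lscale (v k) (e (i k)) + lscale (v k * c) (e (i' k))"
      using K(2,3)[OF that] unfolding sum.distrib by simp
    finally show ?thesis by (simp add: lfun.scale_right_distrib)
  qed
  have "(\<Sum>j<n. lscale (U j) (e j)) = (\<Sum>k\<in>K. lscale (v k) (e (i k) + lscale c (e (i' k))))"
    unfolding U_def lfun.scale_sum_left
    by (subst sum.swap) (rule sum.cong[OF refl delta[symmetric]])
  then have U0: "\<forall>j<n. U j = 0" using 0 E by simp
  fix k assume k: "k \<in> K"
  have "U (i k) = (\<Sum>l\<in>K. if l = k then v k * (1 + c * (if i k = i' k then 1 else 0)) else 0)"
    unfolding U_def
  proof (rule sum.cong[OF refl])
    fix l assume l: "l \<in> K"
    show "v l * ((if i k = i l then 1 else 0) + c * (if i k = i' l then 1 else 0)) =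
      (if l = k then v k * (1 + c * (if i k = i' k then 1 else 0)) else 0)"
      using inj_onD[OF K(4) _ k l] dist[OF k l] by auto
  qed
  also have "\<dots> = v k * (1 + c * (if i k = i' k then 1 else 0))" using K(1) k by simp
  finally have "v k * (1 + c * (if i k = i' k then 1 else 0)) = 0" using U0 K(2)[OF k] by simp
  moreover have "1 + c * (if i k = i' k then 1 else 0) \<noteq> 0" using same[OF k] by auto
  ultimately show "v k = 0" by simp
qed

section \<open>Powers of \<chi>, the signature and explicit bases\<close>

lemma fcoeff_chi_power:
  "fcoeff (chi \<beta> ^ j) (int j) = (cnj \<beta> / lam \<beta>) ^ j" "m > int j \<Longrightarrow> fcoeff (chi \<beta> ^ j) m = 0"
proof -
  have L: "chi \<beta> ^ j \<in> Lp 1" for j by (intro Linf_imp_Lp Linf_power Linf_chi) simp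
  have "fcoeff (chi \<beta> ^ j) (int j) = (cnj \<beta> / lam \<beta>) ^ j \<and> (\<forall>m>int j. fcoeff (chi \<beta> ^ j) m = 0)"
  proof (induction j)
    case 0
    show ?case by (simp add: fcoeff_one)
  next
    case (Suc j)
    then show ?case using L[of j] by (auto simp: fcoeff_chi_times)
  qed
  then show "fcoeff (chi \<beta> ^ j) (int j) = (cnj \<beta> / lam \<beta>) ^ j" "m > int j \<Longrightarrow> fcoeff (chi \<beta> ^ j) m = 0" by auto
qed

lemma chi_power_family:
  assumes 0: "(\<Sum>j<n. lscale (u j) (chi \<beta> ^ j)) = 0"
  shows "\<forall>j<n. u j = 0"
proof (rule ccontr)
  assume "\<not> ?thesis"
  then have ne: "{j. j < n \<and> u j \<noteq> 0} \<noteq> {}" by auto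
  define M where "M = Max {j. j < n \<and> u j \<noteq> 0}"
  have M: "M < n" "u M \<noteq> 0" using Max_in[OF _ ne] by (auto simp: M_def)
  have big: "u j = 0" if "M < j" "j < n" for j
  proof (rule ccontr)
    assume "u j \<noteq> 0"
    then have "j \<le> M" unfolding M_def using that by (intro Max_ge) auto
    then show False using that by simp
  qed
  have L: "lscale c (chi \<beta> ^ j) \<in> Lp 1" for c j by (intro Linf_imp_Lp Linf_lscale Linf_power Linf_chi) simp
  have "0 = fcoeff (\<Sum>j<n. lscale (u j) (chi \<beta> ^ j)) (int M)" using 0 by simp
  also have "\<dots> = (\<Sum>j<n. u j * fcoeff (chi \<beta> ^ j) (int M))"
    by (subst fcoeff_sum) (auto intro: L simp: fcoeff_lscale)
  also have "\<dots> = (\<Sum>j<n. if j = M then u M * (cnj \<beta> / lam \<beta>) ^ M else 0)"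
  proof (rule sum.cong[OF refl])
    fix j assume "j \<in> {..<n}"
    then show "u j * fcoeff (chi \<beta> ^ j) (int M) = (if j = M then u M * (cnj \<beta> / lam \<beta>) ^ M else 0)"
      using big[of j] fcoeff_chi_power by (cases j M rule: linorder_cases) auto
  qed
  also have "\<dots> = u M * (cnj \<beta> / lam \<beta>) ^ M" using M by simp
  finally show False using M(2) lam_nz \<beta> by auto
qed

text \<open>The factor \<chi>/t is antianalytic with value cnj \<beta> / \<lambda> at infinity, and
  values at infinity multiply.\<close>

lemma Hardy_bar_times_power:
  assumes "F \<in> Hardy_bar 1"
  shows "(monomial (- 1) * chi \<beta>) ^ n * F \<in> Hardy_bar 1"
    "fcoeff ((monomial (- 1) * chi \<beta>) ^ n * F) 0 = (cnj \<beta> / lam \<beta>) ^ n * fcoeff F 0"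
proof -
  have step: "(monomial (- 1) * chi \<beta>) * G \<in> Hardy_bar 1 \<and> fcoeff ((monomial (- 1) * chi \<beta>) * G) 0 = cnj \<beta> / lam \<beta> * fcoeff G 0"
    if G: "G \<in> Hardy_bar 1" for G
  proof -
    have GL: "G \<in> Lp 1" using G by (simp add: Hardy_bar_def)
    have "fcoeff ((monomial (- 1) * chi \<beta>) * G) n = cnj \<beta> / lam \<beta> * fcoeff G n - 1 / lam \<beta> * fcoeff G (n + 1)" for n
      by (simp add: mult.assoc fcoeff_monomial_times fcoeff_chi_times[OF GL])
    moreover have "(monomial (- 1) * chi \<beta>) * G \<in> Lp 1"
      by (intro Linf_times_Lp Linf_times Linf_chi GL) auto
    ultimately show ?thesis using G by (auto simp: Hardy_bar_def)
  qed
  have "(monomial (- 1) * chi \<beta>) ^ n * F \<in> Hardy_bar 1 \<and>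
    fcoeff ((monomial (- 1) * chi \<beta>) ^ n * F) 0 = (cnj \<beta> / lam \<beta>) ^ n * fcoeff F 0"
  proof (induction n)
    case (Suc n)
    then show ?case using step[of "(monomial (- 1) * chi \<beta>) ^ n * F"] by (simp add: mult.assoc)
  qed (use assms in simp)
  then show "(monomial (- 1) * chi \<beta>) ^ n * F \<in> Hardy_bar 1"
    "fcoeff ((monomial (- 1) * chi \<beta>) ^ n * F) 0 = (cnj \<beta> / lam \<beta>) ^ n * fcoeff F 0" by auto
qed

lemma alpha_chi:
  "\<A> (monomial 1) * chi \<beta> = lscale (1 / lam \<beta>) (monomial 1) - lscale (\<beta> / lam \<beta>) 1"
proof (rule lfun_eqI_AE[where F = "\<lambda>t. (t - \<beta>) / lam \<beta>"])
  show "AE t in circ. rep_lfun (\<A> (monomial 1) * chi \<beta>) t = (t - \<beta>) / lam \<beta>"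
    using rep_lfun_times[of "\<A> (monomial 1)" "chi \<beta>"] rep_lfun_compose[of \<beta> "monomial 1"]
      AE_alpha[OF rep_lfun_monomial[of 1]] rep_lfun_chi[of \<beta>] AE_circ_norm
    by eventually_elim (use den_nz' in \<open>simp add: alpha_def\<close>)
  show "AE t in circ. rep_lfun (lscale (1 / lam \<beta>) (monomial 1) - lscale (\<beta> / lam \<beta>) 1) t = (t - \<beta>) / lam \<beta>"
    using rep_lfun_minus[of "lscale (1 / lam \<beta>) (monomial 1)" "lscale (\<beta> / lam \<beta>) 1"]
      rep_lfun_lscale[of "1 / lam \<beta>" "monomial 1"] rep_lfun_lscale[of "\<beta> / lam \<beta>" 1] rep_lfun_monomial[of 1] rep_lfun_one
    by eventually_elim (simp add: diff_divide_distrib)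
qed

lemma alpha_chi_power_Hardy:
  assumes "F \<in> Hardy 1" shows "(\<A> (monomial 1) * chi \<beta>) ^ n * F \<in> Hardy 1"
proof -
  have step: "(\<A> (monomial 1) * chi \<beta>) * G \<in> Hardy 1" if G: "G \<in> Hardy 1" for G
  proof -
    have GL: "G \<in> Lp 1" using G by (simp add: Hardy_def)
    have "(\<A> (monomial 1) * chi \<beta>) * G = lscale (1 / lam \<beta>) (monomial 1 * G) - lscale (\<beta> / lam \<beta>) G"
      by (simp add: alpha_chi left_diff_distrib lscale_times_left)
    then show ?thesis
      using G GL by (auto simp: Hardy_def fcoeff_diff Lp_lscale Lp_monomial_times fcoeff_lscale fcoeff_monomial_times
          intro!: Lp_diff)
  qed
  show ?thesis by (induction n) (use assms step in \<open>auto simp: mult.assoc\<close>)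
qed

text \<open>The constant \<open>\<rho>\<close> below is the \<open>\<alpha>\<close>-signature.  With \<open>\<alpha>\<chi> = (t - \<beta>)/\<lambda>\<close> the identity \<open>g g\<^sub>\<alpha> = 1\<close> reads
  \<open>g\<^sub>- (g\<^sub>+)\<^sub>\<alpha> (t\<inverse>\<chi>)\<^sup>n = g\<^sub>+\<inverse> (g\<^sub>-\<inverse>)\<^sub>\<alpha> (\<alpha>\<chi>)\<^sup>n\<close>; the left side is antianalytic and the right side is
  analytic, so both are constant, and composition with \<open>\<alpha>\<close> exchanges this constant with its inverse.\<close>

lemma signature:
  assumes p: "p > 1" and W: "wiener_hopf p g gm gp" and g: "g * \<A> g = 1"
    and n: "fredholm_index p (toeplitz g) = int n"
  defines "\<rho> \<equiv> alpha_signature p \<beta> g"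
  shows "\<rho> * \<rho> = 1"
    "\<And>j. j < n \<Longrightarrow> J (g * (inverse gp * chi \<beta> ^ j)) = lscale \<rho> (inverse gp * chi \<beta> ^ (n - 1 - j))"
proof -
  define q where "q = conj_exp p"
  have q: "q > 1" "conj_exp q = p" using conj_exp[OF p] by (auto simp: q_def)
  define x where "x = inverse gp"
  define y where "y = inverse gm"
  have W': "g = gm * monomial (- int n) * gp" "fcoeff gm 0 = 1" "gp * x = 1" "gm * y = 1"
    "gp \<in> Hardy q" "x \<in> Hardy p" "gm \<in> Hardy_bar p" "y \<in> Hardy_bar q"
    using W by (auto simp: wiener_hopf_def n q_def x_def y_def)
  have y0: "fcoeff y 0 = 1"
  proof -
    have "fcoeff (gm * y) 0 = fcoeff y 0" using Hardy_bar_times(2)[OF p W'(7), of y] W'(2,8) by (simp add: q_def)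
    then show ?thesis using W'(4) by (simp add: fcoeff_one)
  qed
  define T where "T = monomial (1::int)"
  define T' where "T' = monomial (- 1)"
  define A where "A = \<A> T"
  define A' where "A' = \<A> T'"
  define X where "X = chi \<beta>"
  define X' where "X' = inverse (chi \<beta>)"
  define gma where "gma = \<A> gm"
  define gpa where "gpa = \<A> gp"
  define xa where "xa = \<A> x"
  define ya where "ya = \<A> y"
  have TT: "T * T' = 1" by (simp add: T_def T'_def)
  have XX: "X * X' = 1" unfolding X_def X'_def by (rule chi_inverse)
  have AA: "A * A' = 1" unfolding A_def A'_def by (simp add: compose_times[symmetric] TT compose_one)
  have gxa: "gpa * xa = 1" unfolding gpa_def xa_def by (simp add: compose_times[symmetric] W'(3) compose_one)
  have gya: "gma * ya = 1" unfolding gma_def ya_def by (simp add: compose_times[symmetric] W'(4) compose_one)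
  have pw: "u ^ n * v ^ n = 1" if "u * v = 1" for u v :: lfun using that by (metis power_mult_distrib power_one)
  have mn: "monomial (- int n) = T' ^ n"
  proof (induction n)
    case (Suc n)
    have "monomial (- int (Suc n)) = monomial (- 1) * monomial (- int n)" unfolding monomial_mult by simp
    then show ?case by (simp add: T'_def Suc)
  qed simp
  have ga: "\<A> g = gma * A' ^ n * gpa"
    unfolding W'(1) mn gma_def A'_def gpa_def by (simp add: compose_times compose_power)
  have gg: "(gm * T' ^ n * gp) * (gma * A' ^ n * gpa) = 1" using g unfolding ga unfolding W'(1) mn .
  define U where "U = x * ya * (A * X) ^ n"
  have U2: "U = gm * gpa * (T' * X) ^ n"
  proof -
    have "U = U * ((gm * T' ^ n * gp) * (gma * A' ^ n * gpa))" by (simp add: gg)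
    also have "\<dots> = (gp * x) * (gma * ya) * (A ^ n * A' ^ n) * (gm * gpa * (T' * X) ^ n)"
      by (simp add: U_def power_mult_distrib mult_ac)
    also have "\<dots> = gm * gpa * (T' * X) ^ n" by (simp add: W'(3) gya pw[OF AA])
    finally show ?thesis .
  qed
  have yaH: "ya \<in> Hardy q" unfolding ya_def by (rule compose_Hardy_bar[OF q(1) W'(8)])
  have gpaH: "gpa \<in> Hardy_bar q" unfolding gpa_def by (rule compose_Hardy[OF q(1) W'(5)])
  have xaH: "xa \<in> Hardy_bar p" unfolding xa_def by (rule compose_Hardy[OF p W'(6)])
  have "x * ya \<in> Hardy 1" using Hardy_times(1)[OF p W'(6)] yaH by (simp add: q_def)
  then have UH: "U \<in> Hardy 1"
    using alpha_chi_power_Hardy[of "x * ya" n] by (simp add: U_def A_def T_def X_def mult.commute)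
  have "gm * gpa \<in> Hardy_bar 1" using Hardy_bar_times(1)[OF p W'(7)] gpaH by (simp add: q_def)
  then have "U \<in> Hardy_bar 1"
    unfolding U2 using Hardy_bar_times_power(1)[of "gm * gpa" n] by (simp add: T'_def X_def mult.commute)
  then obtain r where r: "U = lscale r 1" using lfun_const[OF UH] by blast
  have Ua: "\<A> U = lscale r 1" unfolding r by (simp add: compose_lscale compose_one)
  have Xa: "\<A> X = X'" unfolding X_def X'_def by (rule compose_chi)
  have Aa: "\<A> A = T" unfolding A_def by (rule compose_compose)
  have "\<A> U = xa * y * (T * X') ^ n"
    unfolding U_def ya_def xa_def
    by (simp add: compose_times compose_power Xa Aa compose_compose)
  \<comment> \<open>Composing U = r with \<alpha> and multiplying by (\<chi>/t)^n isolates a product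
    of two antianalytic functions, which can be evaluated at infinity.\<close>
  then have "lscale r ((T' * X) ^ n) = xa * y * ((T * X') ^ n * (T' * X) ^ n)"
    using Ua by (metis lfun_one_scale mult.assoc)
  also have "(T * X') ^ n * (T' * X) ^ n = 1"
    by (rule pw) (metis TT XX mult.assoc mult.left_commute mult.right_neutral)
  finally have key: "lscale r ((T' * X) ^ n) = xa * y" by simp
  have "lscale r (lscale r 1) = 1"
  proof -
    have "lscale r (lscale r 1) = lscale r U" by (simp only: r)
    also have "\<dots> = gm * gpa * lscale r ((T' * X) ^ n)" by (simp add: U2 lscale_times_right)
    also have "\<dots> = (gm * y) * (gpa * xa)" by (simp only: key mult_ac)
    finally show ?thesis by (simp add: W'(4) gxa)
  qed
  then have "fcoeff (lscale (r * r) 1) 0 = 1" by (simp add: fcoeff_one)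
  then have rr: "r * r = 1" by (simp add: fcoeff_lscale fcoeff_one)
  \<comment> \<open>Constant coefficients of \<open>key\<close>: the composed factor contributes the
    disc value of x at 1/cnj \<beta>, the factor y contributes 1, and the power of \<chi>/t gives
    the constant by which the signature is normalised.\<close>
  have "fcoeff (xa * y) 0 = disc_value x (1 / cnj \<beta>)"
    using Hardy_bar_times(2)[OF p xaH, of y] W'(8) y0 fcoeff_compose_0[OF p W'(6)] by (simp add: q_def xa_def)
  moreover have "fcoeff ((T' * X) ^ n) 0 = (cnj \<beta> / lam \<beta>) ^ n"
    using Hardy_bar_times_power(2)[of 1 n] monomial_Hardy[of 1 0] lcnj_Hardy[of 1 1] by (simp add: T'_def X_def fcoeff_one)
  ultimately have D: "disc_value x (1 / cnj \<beta>) = r * (cnj \<beta> / lam \<beta>) ^ n"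
    using arg_cong[OF key, of "\<lambda>f. fcoeff f 0"] by (simp add: fcoeff_lscale)
  have "\<rho> = (lam \<beta> / cnj \<beta>) ^ n * disc_value x (1 / cnj \<beta>)"
    unfolding \<rho>_def alpha_signature_def wh_plus_eq[OF p W] n x_def by simp
  also have "\<dots> = r * ((lam \<beta> / cnj \<beta>) ^ n * (cnj \<beta> / lam \<beta>) ^ n)" unfolding D by (simp add: mult_ac)
  also have "(lam \<beta> / cnj \<beta>) ^ n * (cnj \<beta> / lam \<beta>) ^ n = 1"
    using lam_nz \<beta> by (subst power_mult_distrib[symmetric]) auto
  finally have \<rho>: "\<rho> = r" by simp
  show "\<rho> * \<rho> = 1" using rr by (simp add: \<rho>)
  fix j assume j: "j < n"
  \<comment> \<open>Solving U = r for the composed minus factor gives r x \<chi>^n. The composition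
    of \<chi>^j gives \<chi>^{-j}, and the prefactor of \<open>J\<close> lowers the exponent once
    more, hence n - 1 - j.\<close>
  have "lscale r (gma * A' ^ n) = U * (gma * A' ^ n)" unfolding r by (simp add: lscale_times_left)
  also have "\<dots> = (gma * ya) * (A ^ n * A' ^ n) * (x * X ^ n)" by (simp add: U_def power_mult_distrib mult_ac)
  also have "\<dots> = x * X ^ n" by (simp add: gya pw[OF AA])
  finally have "lscale r (lscale r (gma * A' ^ n)) = lscale r (x * X ^ n)" by simp
  then have gA: "gma * A' ^ n = lscale r (x * X ^ n)" by (simp add: rr)
  have "g * (x * X ^ j) = (gp * x) * (gm * T' ^ n * X ^ j)" unfolding W'(1) mn by (simp only: mult_ac)
  then have gx: "g * (x * X ^ j) = gm * T' ^ n * X ^ j" by (simp add: W'(3))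
  have "J (g * (x * X ^ j)) = X' * (gma * A' ^ n * X' ^ j)"
    unfolding gx J_alpha_def X'_def[symmetric] gma_def A'_def
    by (simp add: compose_times compose_power Xa)
  also have "\<dots> = lscale r (x * (X ^ n * X' ^ Suc j))" unfolding gA by (simp add: lscale_times_left lscale_times_right mult_ac)
  also have "X ^ n = X ^ (n - 1 - j) * X ^ Suc j" using j by (subst power_add[symmetric]) simp
  also have "X ^ (n - 1 - j) * X ^ Suc j * X' ^ Suc j = X ^ (n - 1 - j)"
    by (simp only: mult.assoc power_mult_distrib[symmetric] XX) simp
  finally show "J (g * (inverse gp * chi \<beta> ^ j)) = lscale \<rho> (inverse gp * chi \<beta> ^ (n - 1 - j))"
    by (simp add: x_def X_def \<rho>)
qed

text \<open>The functions e j = x \<chi>^j with j < n form a basis of the kernel of T(g), on which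
  the involution acts as the reflection j to n - 1 - j times the signature. Its eigenvectors are the
  symmetrised pairs, indexed from the middle outwards.\<close>

lemma im_proj_bases:
  assumes p: "p > 1" and g: "g \<in> Linf" "g * \<A> g = 1" and F: "fredholm p (toeplitz g)"
    and s: "s = 1 \<or> s = - 1"
  shows "m > 0 \<Longrightarrow> fredholm_index p (toeplitz g) = 2 * int m \<Longrightarrow>
      is_basis {inverse (wh_plus p g) *
           (chi \<beta> ^ (m - k - 1) + lscale (s * alpha_signature p \<beta> g) (chi \<beta> ^ (m + k))) | k. k < m}
        (im_proj p \<beta> s g)"
    "fredholm_index p (toeplitz g) = 2 * int m + 1 \<Longrightarrow>
      is_basis ({inverse (wh_plus p g) *
           (chi \<beta> ^ (m + k) + lscale (s * alpha_signature p \<beta> g) (chi \<beta> ^ (m - k))) | k. k \<le> m} - {0})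
        (im_proj p \<beta> s g)"
    "fredholm_index p (toeplitz g) = 0 \<Longrightarrow> im_proj p \<beta> s g = {0}"
proof -
  have p1: "p \<ge> 1" using p by simp
  have ss: "s * s = 1" using s by auto
  have im: "im_proj p \<beta> s g = Eig p s g" by (rule im_proj_eq_Eig[OF p g ss])
  obtain gm gp where W: "wiener_hopf p g gm gp" using wiener_hopf_exists[OF p g F] .
  have wh: "wh_plus p g = gp" by (rule wh_plus_eq[OF p W])
  define x where "x = inverse gp"
  have x: "x \<in> Hardy p" "gp * x = 1" using W by (auto simp: wiener_hopf_def x_def)
  define \<rho> where "\<rho> = alpha_signature p \<beta> g"
  define e where "e j = x * chi \<beta> ^ j" for j :: nat
  define c where "c = s * \<rho>"
  have eH: "e j \<in> Hardy p" for j unfolding e_def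
    using chi_power_times_Hardy[OF p1 x(1), of j] by (simp add: mult.commute)
  have fam: "\<forall>j<n. u j = 0" if "(\<Sum>j<n. lscale (u j) (e j)) = 0" for n u
  proof -
    have "x * (\<Sum>j<n. lscale (u j) (chi \<beta> ^ j)) = x * 0"
      using that by (simp add: e_def sum_distrib_left lscale_times_right)
    then have "(\<Sum>j<n. lscale (u j) (chi \<beta> ^ j)) = 0" using x(2) lfun_mult_cancel[of x gp] by (simp add: mult.commute)
    then show ?thesis by (rule chi_power_family)
  qed
  have main: "\<rho> * \<rho> = 1 \<and> Eig p s g = lfun.span ((\<lambda>j. e j + lscale c (e (n - 1 - j))) ` {..<n})"
    if n: "fredholm_index p (toeplitz g) = int n" for n
  proof -
    note sig = signature[OF p W g(2) n, folded x_def \<rho>_def]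
    have J: "J (g * e j) = lscale \<rho> (e (n - 1 - j))" if "j < n" for j
      using sig(2)[OF that] by (simp add: e_def)
    have ek: "e j \<in> ker p (toeplitz g)" if "j < n" for j
    proof -
      have "g * e j = J (lscale \<rho> (e (n - 1 - j)))" using J[OF that] J_J[of "g * e j"] by simp
      also have "\<dots> \<in> Hneg p" by (intro J_Hardy[OF p] Hardy_lscale[OF p] eH)
      finally show ?thesis using eH ker_toeplitz[OF p g(1)] by simp
    qed
    have sK: "lfun.subspace (ker p (toeplitz g))" by (rule ker_toeplitz_subspace[OF p g(1)])
    have "ker (conj_exp p) (toeplitz (lcnj g)) = {0}" using ker_trivial(2)[OF p g F] n by simp
    then have dim: "lfun.dim (ker p (toeplitz g)) = n"
      using fredholm_index_toeplitz(1)[OF p g(1)] n by simp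
    obtain B where B: "finite B" "lfun.span B = ker p (toeplitz g)" "card B = n"
      using fin_dim_basis[OF fin_dim_ker(1)[OF p g(1) F] sK] dim by metis
    have fe: "inj_on e {..<n}" "lfun.independent (e ` {..<n})"
      using family_independent[of "{..<n}" e] fam[of _ n] by auto
    have esub: "e ` {..<n} \<subseteq> ker p (toeplitz g)" using ek by auto
    have span: "lfun.span (e ` {..<n}) = ker p (toeplitz g)"
    proof (rule ccontr)
      assume "\<not> ?thesis"
      moreover have "lfun.span (e ` {..<n}) \<subseteq> ker p (toeplitz g)" using lfun.span_minimal[OF esub sK] .
      ultimately obtain f where f: "f \<in> ker p (toeplitz g)" "f \<notin> lfun.span (e ` {..<n})" by blast
      have "lfun.independent (insert f (e ` {..<n}))" by (rule lfun.independent_insertI[OF f(2) fe(2)])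
      moreover have "insert f (e ` {..<n}) \<subseteq> lfun.span B" using f(1) esub B(2) by auto
      ultimately have "card (insert f (e ` {..<n})) \<le> n" using lfun.independent_span_bound[OF B(1)] B(3) by metis
      moreover have "f \<notin> e ` {..<n}" using f(2) lfun.span_base[of f "e ` {..<n}"] by blast
      ultimately show False using card_image[OF fe(1)] by simp
    qed
    have "Eig p s g = lfun.span ((\<lambda>j. e j + lscale c (e (n - 1 - j))) ` {..<n})"
    proof
      show "lfun.span ((\<lambda>j. e j + lscale c (e (n - 1 - j))) ` {..<n}) \<subseteq> Eig p s g"
      proof (rule lfun.span_minimal[OF _ Eig_subspace[OF p]], safe)
        fix j assume j: "j < n"
        have j': "n - 1 - j < n" "n - 1 - (n - 1 - j) = j" using j by auto
        have "J (g * (e j + lscale c (e (n - 1 - j)))) = lscale \<rho> (e (n - 1 - j)) + lscale (c * \<rho>) (e j)"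
          using J[OF j] J[OF j'(1)] j'(2)
          by (simp add: distrib_left lscale_times_right J_add J_lscale)
        also have "\<dots> = lscale s (e j + lscale c (e (n - 1 - j)))"
          using ss sig(1) by (simp add: c_def lfun.scale_right_distrib mult.assoc[symmetric] add.commute)
        finally show "e j + lscale c (e (n - 1 - j)) \<in> Eig p s g"
          using Hardy_add[OF p eH Hardy_lscale[OF p eH]] by (simp add: Eig_def)
      qed
      show "Eig p s g \<subseteq> lfun.span ((\<lambda>j. e j + lscale c (e (n - 1 - j))) ` {..<n})"
      proof
        fix h assume h: "h \<in> Eig p s g"
        then have hE: "J (g * h) = lscale s h" by (simp add: Eig_def)
        have "h \<in> lfun.span (e ` {..<n})" unfolding span by (rule Eig_ker[OF p g(1) h])
        then obtain u where "h = (\<Sum>v\<in>e ` {..<n}. lscale (u v) v)"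
          using lfun.span_finite[of "e ` {..<n}"] by auto
        then have hu: "h = (\<Sum>j<n. lscale (u (e j)) (e j))" by (subst (asm) sum.reindex[OF fe(1)]) simp
        have Jsum: "J (g * sum w I) = (\<Sum>j\<in>I. J (g * w j))" if "finite I" for w and I :: "nat set"
          using that by (induction I) (auto simp: distrib_left J_add J_zero)
        have "h = lscale (1/2) (h + lscale s (lscale s h))"
        proof -
          have "h + lscale s (lscale s h) = lscale 2 h"
            using ss lfun.scale_left_distrib[of 1 1 h] by simp
          then show ?thesis by simp
        qed
        also have "lscale s h = (\<Sum>j<n. lscale (u (e j) * \<rho>) (e (n - 1 - j)))"
          unfolding hE[symmetric] by (subst hu) (auto simp: Jsum lscale_times_right J_lscale J intro!: sum.cong)
        also have "lscale (1/2) (h + lscale s (\<Sum>j<n. lscale (u (e j) * \<rho>) (e (n - 1 - j)))) =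
            (\<Sum>j<n. lscale (u (e j) / 2) (e j + lscale c (e (n - 1 - j))))"
          by (subst hu) (simp add: lfun.scale_sum_right lfun.scale_right_distrib sum.distrib c_def mult_ac)
        also have "\<dots> \<in> lfun.span ((\<lambda>j. e j + lscale c (e (n - 1 - j))) ` {..<n})"
          by (intro lfun.span_sum lfun.span_scale lfun.span_base) auto
        finally show "h \<in> lfun.span ((\<lambda>j. e j + lscale c (e (n - 1 - j))) ` {..<n})" .
      qed
    qed
    with sig(1) show ?thesis by blast
  qed
  \<comment> \<open>As c is a sign, the pairs (j, i) and (i, j) span the same line, so half of the
    indices suffice.\<close>
  have sw: "e j + lscale c (e i) = lscale c (e i + lscale c (e j))" if "\<rho> * \<rho> = 1" for i j
  proof -
    have "c * c = 1" using ss that by (simp add: c_def mult_ac)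
    then show ?thesis by (simp add: lfun.scale_right_distrib add.commute)
  qed
  show "is_basis {inverse (wh_plus p g) *
           (chi \<beta> ^ (m - k - 1) + lscale (s * alpha_signature p \<beta> g) (chi \<beta> ^ (m + k))) | k. k < m}
        (im_proj p \<beta> s g)" if m: "m > 0" and idx: "fredholm_index p (toeplitz g) = 2 * int m"
  proof -
    define b where "b k = e (m - k - 1) + lscale c (e (m + k))" for k
    have n: "fredholm_index p (toeplitz g) = int (2 * m)" using idx by simp
    note M = main[OF n]
    have set: "{inverse (wh_plus p g) *
           (chi \<beta> ^ (m - k - 1) + lscale (s * alpha_signature p \<beta> g) (chi \<beta> ^ (m + k))) | k. k < m} = b ` {..<m}"
      unfolding wh by (auto simp: b_def e_def c_def \<rho>_def x_def distrib_left lscale_times_right image_iff)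
    have "\<forall>k\<in>{..<m}. v k = 0" if "(\<Sum>k\<in>{..<m}. lscale (v k) (b k)) = 0" for v
      by (rule family_pairs[where n = "2 * m" and e = e and i = "\<lambda>k. m - k - 1" and i' = "\<lambda>k. m + k" and c = c])
         (use fam that in \<open>auto simp: b_def inj_on_def\<close>)
    then have ind: "lfun.independent (b ` {..<m})" by (intro family_independent) auto
    have "lfun.span ((\<lambda>j. e j + lscale c (e (2 * m - 1 - j))) ` {..<2 * m}) = lfun.span (b ` {..<m})"
    proof (rule lfun.span_eq[THEN iffD2], intro conjI subsetI)
      fix f assume "f \<in> (\<lambda>j. e j + lscale c (e (2 * m - 1 - j))) ` {..<2 * m}"
      then obtain j where j: "j < 2 * m" "f = e j + lscale c (e (2 * m - 1 - j))" by auto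
      show "f \<in> lfun.span (b ` {..<m})"
      proof (cases "j < m")
        case True
        then have "m - (m - 1 - j) - 1 = j" "m + (m - 1 - j) = 2 * m - 1 - j" by auto
        then have "f = b (m - 1 - j)" unfolding b_def j(2) by (simp only:)
        then show ?thesis using True by (intro lfun.span_base) auto
      next
        case False
        then have "m - (j - m) - 1 = 2 * m - 1 - j" "m + (j - m) = j" using j by auto
        then have "f = lscale c (b (j - m))" unfolding b_def j(2) using sw[OF conjunct1[OF M], of j "2 * m - 1 - j"] by (simp only:)
        moreover have "b (j - m) \<in> b ` {..<m}" using False j by auto
        ultimately show ?thesis by (simp add: lfun.span_scale lfun.span_base)
      qed
    next
      fix f assume "f \<in> b ` {..<m}"
      then obtain k where k: "k < m" "f = b k" by auto
      have "2 * m - 1 - (m - k - 1) = m + k" using k by auto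
      then have "f = e (m - k - 1) + lscale c (e (2 * m - 1 - (m - k - 1)))" using k by (simp add: b_def)
      then show "f \<in> lfun.span ((\<lambda>j. e j + lscale c (e (2 * m - 1 - j))) ` {..<2 * m})"
        using k by (intro lfun.span_base image_eqI[of _ _ "m - k - 1"]) auto
    qed
    then show ?thesis unfolding is_basis_def set im using ind M by simp
  qed
  show "is_basis ({inverse (wh_plus p g) *
           (chi \<beta> ^ (m + k) + lscale (s * alpha_signature p \<beta> g) (chi \<beta> ^ (m - k))) | k. k \<le> m} - {0})
        (im_proj p \<beta> s g)" if idx: "fredholm_index p (toeplitz g) = 2 * int m + 1"
  proof -
    define b where "b k = e (m + k) + lscale c (e (m - k))" for k
    have n: "fredholm_index p (toeplitz g) = int (2 * m + 1)" using idx by simp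
    note M = main[OF n]
    have set: "{inverse (wh_plus p g) *
           (chi \<beta> ^ (m + k) + lscale (s * alpha_signature p \<beta> g) (chi \<beta> ^ (m - k))) | k. k \<le> m} = b ` {..m}"
      unfolding wh by (auto simp: b_def e_def c_def \<rho>_def x_def distrib_left lscale_times_right image_iff)
    \<comment> \<open>For n = 2 m + 1 the entry k = 0 is (1 + c) e m; it vanishes when c = -1 and is
      then left out.\<close>
    define K where "K = {k. k \<le> m \<and> b k \<noteq> 0}"
    have K: "finite K" "b ` {..m} - {0} = b ` K" by (auto simp: K_def)
    have "\<forall>k\<in>K. v k = 0" if "(\<Sum>k\<in>K. lscale (v k) (b k)) = 0" for v
    proof (rule family_pairs[where n = "2 * m + 1" and e = e and i = "\<lambda>k. m + k" and i' = "\<lambda>k. m - k" and c = c])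
      show "1 + c \<noteq> 0" if k: "k \<in> K" "m - k = m + k" for k
      proof
        assume "1 + c = 0"
        then have "lscale (1 + c) (e m) = 0" by simp
        moreover have "k = 0" using k by simp
        ultimately have "b k = 0" by (simp add: b_def lfun.scale_left_distrib)
        then show False using k(1) by (simp add: K_def)
      qed
      show "\<forall>j<2 * m + 1. u j = 0" if "(\<Sum>j<2 * m + 1. lscale (u j) (e j)) = 0" for u
        by (rule fam[OF that])
    qed (use that K in \<open>auto simp: b_def inj_on_def K_def\<close>)
    then have ind: "lfun.independent (b ` K)" using K by (intro family_independent)
    have bspan: "b k \<in> lfun.span (b ` K)" if "k \<le> m" for k
      using that by (cases "b k = 0") (auto intro: lfun.span_zero lfun.span_base simp: K_def)
    have "lfun.span ((\<lambda>j. e j + lscale c (e (2 * m + 1 - 1 - j))) ` {..<2 * m + 1}) = lfun.span (b ` K)"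
    proof (rule lfun.span_eq[THEN iffD2], intro conjI subsetI)
      fix f assume "f \<in> (\<lambda>j. e j + lscale c (e (2 * m + 1 - 1 - j))) ` {..<2 * m + 1}"
      then obtain i where "i < 2 * m + 1" "f = e i + lscale c (e (2 * m - i))" by auto
      then obtain j where j: "j \<le> 2 * m" "f = e j + lscale c (e (2 * m - j))" using that[of i] by (simp add: less_Suc_eq_le)
      show "f \<in> lfun.span (b ` K)"
      proof (cases "j \<ge> m")
        case True
        then have "m - (j - m) = 2 * m - j" "m + (j - m) = j" using j by auto
        then have "f = b (j - m)" unfolding b_def j(2) by (simp only:)
        then show ?thesis using bspan[of "j - m"] j True by simp
      next
        case False
        then have "m + (m - j) = 2 * m - j" "m - (m - j) = j" using j by auto
        then have "f = lscale c (b (m - j))" unfolding b_def j(2) using sw[OF conjunct1[OF M], of j "2 * m - j"] by (simp only:)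
        then show ?thesis using bspan[of "m - j"] by (auto intro: lfun.span_scale)
      qed
    next
      fix f assume "f \<in> b ` K"
      then obtain k where k: "k \<le> m" "f = b k" by (auto simp: K_def)
      have "2 * m + 1 - 1 - (m + k) = m - k" using k by auto
      then have "f = e (m + k) + lscale c (e (2 * m + 1 - 1 - (m + k)))" using k by (simp add: b_def)
      then show "f \<in> lfun.span ((\<lambda>j. e j + lscale c (e (2 * m + 1 - 1 - j))) ` {..<2 * m + 1})"
        using k by (intro lfun.span_base image_eqI[of _ _ "m + k"]) auto
    qed
    then show ?thesis unfolding is_basis_def set im K(2) using ind M by simp
  qed
  show "im_proj p \<beta> s g = {0}" if "fredholm_index p (toeplitz g) = 0"
    using main[of 0] that im by simp
qed

section \<open>The equation g f + s J f = w\<close>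

text \<open>The formula for \<phi> as a function of the right-hand side w. In this generality it
  also serves for the pair component d with the opposite sign, in the construction of right
  inverses.\<close>

definition carl :: "real \<Rightarrow> complex \<Rightarrow> lfun \<Rightarrow> lfun \<Rightarrow> lfun" where
  "carl p s g w =
     (let u = toeplitz_right_inv p g (Riesz_P w)
      in lscale (1 / 2) (u - lscale s (J (Riesz_Q (g * Riesz_P u))) + lscale s (J (Riesz_Q w))))"

lemma phi_alpha_eq_carl:
  "phi_alpha p \<beta> s a b f = carl p s (sub_c a b) (inverse (\<A> a) * f)"
  by (simp add: phi_alpha_def carl_def toeplitz_def Let_def)

lemma lscale_half_double: "lscale (1 / 2) (x + x) = x"
  unfolding lfun.scale_right_distrib lfun.scale_left_distrib[symmetric] by simp

text \<open>On \<open>w\<close> with \<open>g \<cdot> Jw = s w\<close> the equation \<open>g f + s Jf = w\<close> splits: \<open>u\<close> solves its \<open>P\<close>-part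
  \<open>T(g) u = P w\<close>, and averaging \<open>u\<close> with its reflection \<open>-s J(g u - w)\<close> solves it completely.\<close>

lemma carl_solves:
  assumes p: "p > 1" and s: "s = 1 \<or> s = - 1"
    and g: "g \<in> Linf" "g * \<A> g = 1" and \<kappa>: "fredholm_index p (toeplitz g) \<ge> 0"
    and bij: "toeplitz_bij p (g * monomial (fredholm_index p (toeplitz g)))"
    and w: "w \<in> Lp p" "g * J w = lscale s w"
  shows "carl p s g w \<in> Hardy p"
    "g * carl p s g w + lscale s (J (carl p s g w)) = w"
proof -
  have p1: "p \<ge> 1" "p > 0" using p by auto
  note R = toeplitz_right_inv[OF p g(1) refl bij]
  have Pw: "Riesz_P w \<in> Hardy p" by (rule Riesz_P_Hardy[OF p w(1)])
  define u where "u = toeplitz_right_inv p g (Riesz_P w)"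
  have u: "u \<in> Hardy p" "Riesz_P (g * u) = Riesz_P w"
    using blinD(1)[OF R(1) Pw] R(2)[OF \<kappa> Pw] by (auto simp: u_def toeplitz_def)
  have guL: "g * u \<in> Lp p" by (rule Linf_times_Lp[OF g(1) p1(2) Hardy_Lp[OF u(1)]])
  define r where "r = g * u - w"
  have "r \<in> Lp p" unfolding r_def by (rule Lp_diff[OF guL w(1) p1(1)])
  moreover have "Riesz_P r = 0" unfolding r_def using Riesz_P_diff[OF p guL w(1)] u(2) by simp
  ultimately have rN: "r \<in> Hneg p" using Riesz_P_eq_0_iff[OF p] by blast
  have Pu: "Riesz_P u = u" by (rule Riesz_P_id[OF p1(1) u(1)])
  define f where "f = carl p s g w"
  have "f = lscale (1/2) (u - lscale s (J (Riesz_Q (g * u) - Riesz_Q w)))"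
    by (simp add: f_def carl_def Let_def Pu u_def[symmetric] J_diff lfun.scale_right_diff_distrib
        algebra_simps del: lfun.scale_left_commute)
  then have f: "f = lscale (1/2) (u - lscale s (J r))"
    by (simp add: r_def Riesz_Q_def u(2))
  have JrH: "J r \<in> Hardy p" by (rule J_Hneg[OF p rN])
  show "carl p s g w \<in> Hardy p" unfolding f_def[symmetric] f
    by (rule Hardy_lscale[OF p Hardy_diff[OF p u(1) Hardy_lscale[OF p JrH]]])
  \<comment> \<open>The defect r satisfies the reflected equation thanks to g g(\<alpha>) = 1 and
    the compatibility of w; it lets the unwanted terms cancel in the average.\<close>
  have "g * J r = (g * \<A> g) * J u - g * J w"
    by (simp add: r_def J_diff J_times right_diff_distrib mult.assoc)
  then have gJr: "g * J r = J u - lscale s w" by (simp add: g(2) w(2))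
  have Jf: "J f = lscale (1/2) (J u - lscale s r)"
    unfolding f J_lscale J_diff J_J ..
  have gf: "g * f = lscale (1/2) (g * u - lscale s (J u - lscale s w))"
    unfolding f gJr[symmetric] by (simp add: lscale_times_right right_diff_distrib)
  have "g * f + lscale s (J f) = lscale (1/2) (g * u - lscale s (J u - lscale s w) +
      lscale s (J u - lscale s r))"
    unfolding gf Jf lfun.scale_right_distrib lfun.scale_left_commute[of s "1/2"] ..
  also have "g * u - lscale s (J u - lscale s w) + lscale s (J u - lscale s r) = w + w"
    using s by (auto simp: r_def)
  finally show "g * carl p s g w + lscale s (J (carl p s g w)) = w"
    unfolding f_def[symmetric] lscale_half_double .
qed

lemma blin_carl:
  assumes p: "p > 1" and g: "g \<in> Linf"
    and bij: "toeplitz_bij p (g * monomial (fredholm_index p (toeplitz g)))"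
  shows "blin p (Lp p) (Lp p) (carl p s g)"
proof -
  have p1: "p \<ge> 1" "p > 0" using p by auto
  have u: "blin p (Lp p) (Lp p) (\<lambda>w. toeplitz_right_inv p g (Riesz_P w))"
    by (rule blin_mono[OF blin_comp[OF blin_Riesz_P[OF p] toeplitz_right_inv(1)[OF p g refl bij]]])
      (auto simp: Hardy_Lp)
  note T = blin_comp[OF blin_comp[OF blin_comp[OF blin_Riesz_P'[OF p] blin_times[OF g p1(2)]]
        blin_Riesz_Q[OF p]] blin_J[OF p1(2)]]
  show ?thesis
    unfolding carl_def Let_def
    by (rule blin_lscale[OF blin_add[OF blin_diff[OF u blin_lscale[OF blin_comp[OF u T] p1(2)] p1(1)]
          blin_lscale[OF blin_comp[OF blin_Riesz_Q[OF p] blin_J[OF p1(2)]] p1(2)] p1(1)] p1(2)])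
qed

lemma Eig_trivial:
  assumes p: "p > 1" and g: "g \<in> Linf" and k: "ker p (toeplitz g) = {0}"
  shows "Eig p s g = {0}"
proof -
  have "h = 0" if "h \<in> Eig p s g" for h using Eig_ker[OF p g that] unfolding k by simp
  moreover have "0 \<in> Eig p s g" by (rule lfun.subspace_0[OF Eig_subspace[OF p]])
  ultimately show ?thesis by auto
qed

section \<open>Toeplitz plus Hankel operators: kernels, adjoints and one-sided inverses\<close>

definition toeplitz_hankel :: "complex \<Rightarrow> lfun \<Rightarrow> lfun \<Rightarrow> lfun \<Rightarrow> lfun" where
  "toeplitz_hankel s a b f = toeplitz a f + lscale s (hankel \<beta> b f)"

text \<open>For f in H^p the function \<open>J f\<close> already lies in the range of Q, so the
  inner Q disappears and one projection acts on the whole expression.\<close>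

lemma toeplitz_hankel_eq:
  assumes p: "p > 1" and a: "a \<in> Linf" and b: "b \<in> Linf" and f: "f \<in> Hardy p"
  shows "a * f + lscale s (b * J f) \<in> Lp p"
    "toeplitz_hankel s a b f = Riesz_P (a * f + lscale s (b * J f))"
proof -
  have p0: "p > 0" "p \<ge> 1" using p by auto
  have JN: "J f \<in> Hneg p" by (rule J_Hardy[OF p f])
  have L: "a * f \<in> Lp p" "b * J f \<in> Lp p"
    by (rule Linf_times_Lp[OF a p0(1) Hardy_Lp[OF f]], rule Linf_times_Lp[OF b p0(1) Hneg_Lp[OF JN]])
  have L': "lscale s (b * J f) \<in> Lp p" by (rule Lp_lscale[OF L(2)])
  show "a * f + lscale s (b * J f) \<in> Lp p" by (rule Lp_add[OF L(1) L' p0(2)])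
  have "Riesz_Q (J f) = J f" using Riesz_P_Hneg[OF JN] by (simp add: Riesz_Q_def)
  then show "toeplitz_hankel s a b f = Riesz_P (a * f + lscale s (b * J f))"
    by (simp add: toeplitz_hankel_def toeplitz_def hankel_def Riesz_P_add[OF p L(1) L'] Riesz_P_lscale[OF p L(2)])
qed

lemma blin_toeplitz_hankel:
  assumes p: "p > 1" and a: "a \<in> Linf" and b: "b \<in> Linf"
  shows "blin p (Hardy p) (Hardy p) (toeplitz_hankel s a b)"
proof -
  have p1: "p \<ge> 1" "p > 0" using p by auto
  have "blin p (Lp p) (Lp p) (\<lambda>f. a * f + lscale s (b * J f))"
    by (rule blin_add[OF blin_times[OF a p1(2)] blin_lscale[OF blin_comp[OF blin_J[OF p1(2)] blin_times[OF b p1(2)]] p1(2)] p1(1)])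
  then have "blin p (Hardy p) (Hardy p) (\<lambda>f. Riesz_P (a * f + lscale s (b * J f)))"
    by (rule blin_mono[OF blin_comp[OF _ blin_Riesz_P[OF p]] Hardy_subset_Lp subset_refl])
  then show ?thesis
    by (rule blin_cong) (simp_all add: toeplitz_hankel_eq(2)[OF p a b] Hardy_subspace[OF p])
qed

text \<open>Under the pairing b J has the adjoint J cnj b, and moving \<open>J\<close> past the
  multiplier composes it with \<alpha>. The sign is real and therefore survives conjugation.\<close>

lemma coker_toeplitz_hankel:
  assumes p: "p > 1" and a: "a \<in> Linf" and b: "b \<in> Linf" and s: "s = 1 \<or> s = - 1"
  shows "coker p (toeplitz_hankel s a b) =
    ker (conj_exp p) (toeplitz_hankel s (lcnj a) (lcnj (\<A> b)))"
proof -
  define q where "q = conj_exp p"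
  have q: "q > 1" using conj_exp[OF p] by (simp add: q_def)
  have pq0: "p > 0" "q > 0" using p q by auto
  let ?a = "lcnj a" and ?b = "lcnj (\<A> b)"
  have ab: "?a \<in> Linf" "?b \<in> Linf" by (rule Linf_lcnj[OF a], rule Linf_lcnj[OF Linf_compose[OF b]])
  show ?thesis
  proof (rule coker_eqI[OF p], fold q_def)
    show "toeplitz_hankel s ?a ?b k \<in> Hardy q" if "k \<in> Hardy q" for k
      by (rule blinD(1)[OF blin_toeplitz_hankel[OF q ab] that])
    fix f k assume f: "f \<in> Hardy p" and k: "k \<in> Hardy q"
    have L: "a * f \<in> Lp p" "lscale s (b * J f) \<in> Lp p"
      by (rule Linf_times_Lp[OF a pq0(1) Hardy_Lp[OF f]],
        rule Lp_lscale[OF Linf_times_Lp[OF b pq0(1) Hneg_Lp[OF J_Hardy[OF p f]]]])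
    have M: "?a * k \<in> Lp q" "lscale s (?b * J k) \<in> Lp q"
      by (rule Linf_times_Lp[OF ab(1) pq0(2) Hardy_Lp[OF k]],
        rule Lp_lscale[OF Linf_times_Lp[OF ab(2) pq0(2) Hneg_Lp[OF J_Hardy[OF q k]]]])
    have "pairing (b * J f) k = pairing f (J (lcnj b * k))"
      unfolding pairing_times pairing_J ..
    also have "J (lcnj b * k) = ?b * J k"
      unfolding J_times compose_lcnj ..
    finally have H: "pairing (b * J f) k = pairing f (?b * J k)" .
    have "pairing (toeplitz_hankel s a b f) k = pairing (a * f + lscale s (b * J f)) k"
      unfolding toeplitz_hankel_eq(2)[OF p a b f]
      by (rule pairing_Hardy_left[OF p toeplitz_hankel_eq(1)[OF p a b f], folded q_def, OF k])
    also have "\<dots> = pairing (a * f) k + s * pairing (b * J f) k"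
      using pairing_add_left(1)[OF p L, folded q_def, OF Hardy_Lp[OF k]] by (simp add: pairing_lscale)
    also have "\<dots> = pairing f (?a * k) + cnj s * pairing f (?b * J k)"
      unfolding H pairing_times[of a] using s by auto
    also have "\<dots> = pairing f (?a * k + lscale s (?b * J k))"
      using pairing_add_right(1)[OF p Hardy_Lp[OF f], folded q_def, OF M] by (simp add: pairing_lscale)
    also have "\<dots> = pairing f (toeplitz_hankel s ?a ?b k)"
      unfolding toeplitz_hankel_eq(2)[OF q ab k]
      by (rule pairing_Hardy_right[OF p f, folded q_def, OF toeplitz_hankel_eq(1)[OF q ab k], symmetric])
    finally show "pairing (toeplitz_hankel s a b f) k = pairing f (toeplitz_hankel s ?a ?b k)" .
  qed
qed

text \<open>The inverses a' and b' are explicit elements, since \<open>inverse\<close> on classes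
  cancels only for almost everywhere nonzero functions; with them all identities are computations in
  a commutative ring.\<close>

context
  fixes p :: real and s :: complex and a b c d a' b' :: lfun
  assumes p: "p > 1" and s: "s = 1 \<or> s = - 1"
    and Linf: "a \<in> Linf" "b \<in> Linf" "a' \<in> Linf" "b' \<in> Linf"
    and inv: "a * a' = 1" "b * b' = 1"
    and matching: "a * \<A> a = b * \<A> b"
    and c: "c = a * b'" and d: "d = b * \<A> a'"
begin

lemma matching_sub:
  shows "c \<in> Linf" "d \<in> Linf" "c * \<A> c = 1" "d * \<A> d = 1"
    "d = a * \<A> b'" "\<A> a * \<A> a' = 1"
    "\<A> b * \<A> b' = 1"
proof -
  show ca: "\<A> a * \<A> a' = 1" and cb: "\<A> b * \<A> b' = 1"
    by (simp_all add: compose_times[symmetric] inv compose_one)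
  show "c \<in> Linf" "d \<in> Linf" unfolding c d by (rule Linf_times Linf Linf_compose)+
  have "c * \<A> c = (a * \<A> a) * (b' * \<A> b')"
    unfolding c compose_times by (simp only: mult_ac)
  also have "\<dots> = (b * b') * (\<A> b * \<A> b')" unfolding matching by (simp only: mult_ac)
  finally show "c * \<A> c = 1" unfolding inv cb by simp
  have "d * \<A> d = (b * \<A> b) * (a' * \<A> a')"
    unfolding d compose_times compose_compose by (simp only: mult_ac)
  also have "\<dots> = (a * a') * (\<A> a * \<A> a')" unfolding matching[symmetric] by (simp only: mult_ac)
  finally show "d * \<A> d = 1" unfolding inv ca by simp
  have "d = d * (\<A> b * \<A> b')" unfolding cb by simp
  also have "\<dots> = (b * \<A> b) * (\<A> a' * \<A> b')"
    unfolding d by (simp only: mult_ac)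
  also have "\<dots> = a * \<A> b' * (\<A> a * \<A> a')"
    unfolding matching[symmetric] by (simp only: mult_ac)
  finally show "d = a * \<A> b'" unfolding ca by simp
qed

lemma reflected_equations:
  "c * J (b' * v) = d * (b' * J v)"
  "b * (\<A> a' * v) = d * v" "c * f = b' * (a * f)" "b' * (b * v) = v"
proof -
  show "c * J (b' * v) = d * (b' * J v)"
    unfolding matching_sub(5) c J_times by (simp only: mult_ac)
  show "b * (\<A> a' * v) = d * v" unfolding d by (simp only: mult_ac)
  show "c * f = b' * (a * f)" unfolding c by (simp only: mult_ac)
  have "b' * (b * v) = (b * b') * v" by (simp only: mult_ac)
  then show "b' * (b * v) = v" unfolding inv by simp
qed

text \<open>The second identity holds for every f, not only in the kernel. It is what allows the
  left inverse to recover the lost Q-part of a f + s b J f from its P-part.\<close>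

lemma residual:
  "c * f + lscale s (J f) = b' * (a * f + lscale s (b * J f))"
  "d * J (a * f + lscale s (b * J f)) = lscale s (a * f + lscale s (b * J f))"
proof -
  show "c * f + lscale s (J f) = b' * (a * f + lscale s (b * J f))"
    unfolding distrib_left lscale_times_right reflected_equations(3,4) ..
  have 1: "d * (\<A> a * J f) = b * J f"
  proof -
    have "d * (\<A> a * J f) = (\<A> a * \<A> a') * (b * J f)"
      unfolding d by (simp only: mult_ac)
    then show ?thesis unfolding matching_sub(6) by simp
  qed
  have 2: "d * (\<A> b * f) = a * f"
  proof -
    have "d * (\<A> b * f) = (\<A> b * \<A> b') * (a * f)"
      unfolding matching_sub(5) by (simp only: mult_ac)
    then show ?thesis unfolding matching_sub(7) by simp
  qed
  have "d * J (a * f + lscale s (b * J f)) = b * J f + lscale s (a * f)"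
    unfolding J_add J_lscale J_times[of a] J_times[of b] J_J
      distrib_left lscale_times_right 1 2 ..
  then show "d * J (a * f + lscale s (b * J f)) = lscale s (a * f + lscale s (b * J f))"
    using s by (auto simp: add.commute)
qed

text \<open>Always b (c f + s J f) = k, and multiplication by b turns the right-hand side
  \<open>\<A> a' * h\<close> into d h. This lies in \<open>Hneg\<close> because eigenvectors belong
  to the kernel of T(d), which settles the converse direction.\<close>

lemma ker_toeplitz_hankel:
  "f \<in> ker p (toeplitz_hankel s a b) \<longleftrightarrow> f \<in> Hardy p \<and>
    (\<exists>h\<in>Eig p s d. c * f + lscale s (J f) = \<A> a' * h)"
proof (cases "f \<in> Hardy p")
  case f: True
  define k where "k = a * f + lscale s (b * J f)"
  have kL: "k \<in> Lp p" and A: "toeplitz_hankel s a b f = Riesz_P k"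
    using toeplitz_hankel_eq[OF p Linf(1,2) f] by (simp_all add: k_def)
  note bk = residual(1)[of f, folded k_def]
  have bc: "b * (c * f + lscale s (J f)) = k"
    unfolding bk using reflected_equations(4)[of k] by (simp only: mult_ac)
  note dJk = residual(2)[of f, folded k_def]
  show ?thesis
  proof
    assume "f \<in> ker p (toeplitz_hankel s a b)"
    then have kN: "k \<in> Hneg p" using Riesz_P_eq_0_iff[OF p kL] by (simp add: ker_def A)
    define h where "h = lscale s (J k)"
    have dh: "d * h = k" unfolding h_def lscale_times_right dJk using s by auto
    have hE: "h \<in> Eig p s d"
    proof -
      have "J (d * h) = lscale s h" unfolding dh unfolding h_def using s by auto
      moreover have "h \<in> Hardy p" unfolding h_def by (rule Hardy_lscale[OF p J_Hneg[OF p kN]])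
      ultimately show ?thesis by (simp add: Eig_def)
    qed
    have "b' * k = \<A> a' * h"
      unfolding dh[symmetric] reflected_equations(2)[symmetric] reflected_equations(4) ..
    then show "f \<in> Hardy p \<and> (\<exists>h\<in>Eig p s d. c * f + lscale s (J f) = \<A> a' * h)"
      using hE f bk by auto
  next
    assume "f \<in> Hardy p \<and> (\<exists>h\<in>Eig p s d. c * f + lscale s (J f) = \<A> a' * h)"
    then obtain h where h: "h \<in> Eig p s d" "c * f + lscale s (J f) = \<A> a' * h" by blast
    have k: "k = d * h" using bc unfolding h(2) reflected_equations(2) by simp
    have "k \<in> Hneg p" unfolding k using Eig_ker[OF p matching_sub(2) h(1)] ker_toeplitz[OF p matching_sub(2)] by blast
    then show "f \<in> ker p (toeplitz_hankel s a b)" using f Riesz_P_Hneg by (simp add: ker_def A)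
  qed
qed (simp add: ker_def)

text \<open>Applying \<open>J\<close> to the homogeneous equation shows where the opposite sign in
  front of the component c comes from.\<close>

lemma Eig_iff: "f \<in> Eig p (- s) c \<longleftrightarrow> f \<in> Hardy p \<and> c * f + lscale s (J f) = 0"
proof -
  have "J (c * f) = lscale (- s) f \<longleftrightarrow> c * f = J (lscale (- s) f)"
    using J_J[of "c * f"] J_J[of "lscale (- s) f"] by auto
  also have "\<dots> \<longleftrightarrow> c * f + lscale s (J f) = 0"
    unfolding J_lscale by (simp add: eq_neg_iff_add_eq_0)
  finally show ?thesis by (simp add: Eig_def)
qed

lemma ker_toeplitz_hankel_trivial_d:
  assumes "ker p (toeplitz d) = {0}"
  shows "ker p (toeplitz_hankel s a b) = Eig p (- s) c"
proof -
  have E: "Eig p s d = {0}" by (rule Eig_trivial[OF p matching_sub(2) assms])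
  show ?thesis
    by (rule set_eqI) (simp only: ker_toeplitz_hankel Eig_iff E bex_simps mult_zero_right simp_thms)
qed

context
  assumes \<kappa>: "fredholm_index p (toeplitz c) \<ge> 0"
    and bij: "toeplitz_bij p (c * monomial (fredholm_index p (toeplitz c)))"
begin

text \<open>Particular plus homogeneous solutions. The sum is direct because a particular solution
  that is also homogeneous has right-hand side 0, and the solution operator sends 0 to 0.\<close>

lemma ker_toeplitz_hankel_sum:
  "is_direct_sum (ker p (toeplitz_hankel s a b)) (Eig p (- s) c)
     ((\<lambda>h. carl p s c (\<A> a' * h)) ` Eig p s d)"
proof -
  have p0: "p > 0" using p by simp
  define \<phi> where "\<phi> h = carl p s c (\<A> a' * h)" for h
  have a': "\<A> a' \<in> Linf" by (rule Linf_compose[OF Linf(3)])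
  have E: "h \<in> Lp p" if "h \<in> Eig p s d" for h using that by (simp add: Eig_def Hardy_Lp)
  have sol: "\<phi> h \<in> Hardy p" "c * \<phi> h + lscale s (J (\<phi> h)) = \<A> a' * h"
    if h: "h \<in> Eig p s d" for h
  proof -
    have dh: "d * h = lscale s (J h)"
      using h J_J[of "d * h"] by (simp add: Eig_def J_lscale)
    have "c * J (\<A> a' * h) = b' * (a * a') * J h"
      unfolding c J_times compose_compose by (simp only: mult_ac)
    also have "J h = lscale s (d * h)" unfolding dh using s by auto
    also have "b' * (a * a') * lscale s (d * h) = lscale s (\<A> a' * h)"
      unfolding inv reflected_equations(2)[symmetric] mult_1_right lscale_times_right reflected_equations(4) ..
    finally have w: "c * J (\<A> a' * h) = lscale s (\<A> a' * h)" .
    note C = carl_solves[OF p s matching_sub(1,3) \<kappa> bij Linf_times_Lp[OF a' p0 E[OF h]] w]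
    show "\<phi> h \<in> Hardy p" "c * \<phi> h + lscale s (J (\<phi> h)) = \<A> a' * h"
      using C by (simp_all add: \<phi>_def)
  qed
  have lin: "blin p (Lp p) (Lp p) \<phi>"
    unfolding \<phi>_def by (rule blin_comp[OF blin_times[OF a' p0] blin_carl[OF p matching_sub(1) bij]])
  have sE: "lfun.subspace (Eig p s d)" and sE': "lfun.subspace (Eig p (- s) c)" by (rule Eig_subspace[OF p])+
  have \<phi>0: "\<phi> 0 = 0" using blinD(3)[OF lin E[OF lfun.subspace_0[OF sE]], of 0] by simp
  have sub: "lfun.subspace (\<phi> ` Eig p s d)"
    unfolding lfun.subspace_def
  proof (intro conjI ballI allI)
    show "0 \<in> \<phi> ` Eig p s d" using \<phi>0 lfun.subspace_0[OF sE] by (metis imageI)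
    show "x + y \<in> \<phi> ` Eig p s d" if xy: "x \<in> \<phi> ` Eig p s d" "y \<in> \<phi> ` Eig p s d" for x y
    proof -
      obtain h k where "h \<in> Eig p s d" "x = \<phi> h" "k \<in> Eig p s d" "y = \<phi> k" using xy by blast
      then show ?thesis using blinD(2)[OF lin E E, of h k] lfun.subspace_add[OF sE, of h k] by (metis imageI)
    qed
    show "lscale r x \<in> \<phi> ` Eig p s d" if x: "x \<in> \<phi> ` Eig p s d" for r x
    proof -
      obtain h where "h \<in> Eig p s d" "x = \<phi> h" using x by blast
      then show ?thesis using blinD(3)[OF lin E, of h r] lfun.subspace_scale[OF sE, of h r] by (metis imageI)
    qed
  qed
  have ker: "ker p (toeplitz_hankel s a b) = {x + y | x y. x \<in> Eig p (- s) c \<and> y \<in> \<phi> ` Eig p s d}"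
  proof (intro equalityI subsetI)
    fix f assume "f \<in> ker p (toeplitz_hankel s a b)"
    then obtain h where f: "f \<in> Hardy p" and h: "h \<in> Eig p s d"
      "c * f + lscale s (J f) = \<A> a' * h"
      using ker_toeplitz_hankel by blast
    have "f - \<phi> h \<in> Eig p (- s) c"
      unfolding Eig_iff using Hardy_diff[OF p f sol(1)[OF h(1)]] h(2) sol(2)[OF h(1)]
      by (simp add: J_diff right_diff_distrib lfun.scale_right_diff_distrib algebra_simps)
    moreover have "f = (f - \<phi> h) + \<phi> h" by simp
    ultimately show "f \<in> {x + y | x y. x \<in> Eig p (- s) c \<and> y \<in> \<phi> ` Eig p s d}" using h(1) by blast
  next
    fix f assume "f \<in> {x + y | x y. x \<in> Eig p (- s) c \<and> y \<in> \<phi> ` Eig p s d}"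
    then obtain x h where f: "f = x + \<phi> h" and x: "x \<in> Eig p (- s) c" and h: "h \<in> Eig p s d" by blast
    have "c * f + lscale s (J f) =
        (c * x + lscale s (J x)) + (c * \<phi> h + lscale s (J (\<phi> h)))"
      by (simp add: f J_add distrib_left lfun.scale_right_distrib)
    also have "\<dots> = \<A> a' * h" using x sol(2)[OF h] by (simp add: Eig_iff)
    finally show "f \<in> ker p (toeplitz_hankel s a b)"
      unfolding ker_toeplitz_hankel using h Hardy_add[OF p _ sol(1)[OF h], of x] x by (auto simp: f Eig_iff)
  qed
  have "Eig p (- s) c \<inter> \<phi> ` Eig p s d \<subseteq> {0}"
  proof
    fix x assume "x \<in> Eig p (- s) c \<inter> \<phi> ` Eig p s d"
    then obtain h where h: "h \<in> Eig p s d" "x = \<phi> h" "\<phi> h \<in> Eig p (- s) c" by blast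
    have "\<A> a' * h = 0" using h(3) sol(2)[OF h(1)] by (simp add: Eig_iff)
    then show "x \<in> {0}" using \<phi>0 unfolding h(2) \<phi>_def by simp
  qed
  then have "Eig p (- s) c \<inter> \<phi> ` Eig p s d = {0}"
    using lfun.subspace_0[OF sE'] lfun.subspace_0[OF sub] by blast
  then show ?thesis
    unfolding is_direct_sum_def \<phi>_def[symmetric] using sE' sub ker by blast
qed

text \<open>The image a f + s b J f must be y plus a function with negative frequencies, written J
  h, and must satisfy the residual identity. That is an equation for h of the same type, with d and
  sign -s; once h is found, the equation for f with c is compatible.\<close>

lemma toeplitz_hankel_right_invertible:
  assumes \<kappa>d: "fredholm_index p (toeplitz d) \<ge> 0"
    and bijd: "toeplitz_bij p (d * monomial (fredholm_index p (toeplitz d)))"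
  shows "right_invertible p (toeplitz_hankel s a b)"
proof -
  have p1: "p \<ge> 1" "p > 0" using p by auto
  have s': "- s = 1 \<or> - s = - 1" using s by auto
  define z where "z y = lscale s y - d * J y" for y
  define H where "H y = carl p (- s) d (z y)" for y
  define W where "W y = b' * (y + J (H y))" for y
  define B where "B y = carl p s c (W y)" for y
  have zL: "blin p (Lp p) (Lp p) z" unfolding z_def
    by (rule blin_diff[OF blin_lscale[OF blin_id[OF subset_refl] p1(2)]
          blin_comp[OF blin_J[OF p1(2)] blin_times[OF matching_sub(2) p1(2)]] p1(1)])
  have HL: "blin p (Lp p) (Lp p) H" unfolding H_def
    by (rule blin_comp[OF zL blin_carl[OF p matching_sub(2) bijd]])
  have WL: "blin p (Lp p) (Lp p) W" unfolding W_def
    by (rule blin_comp[OF blin_add[OF blin_id[OF subset_refl] blin_comp[OF HL blin_J[OF p1(2)]] p1(1)]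
          blin_times[OF Linf(4) p1(2)]])
  have BL: "blin p (Lp p) (Lp p) B" unfolding B_def
    by (rule blin_comp[OF WL blin_carl[OF p matching_sub(1) bij]])
  have sol: "B y \<in> Hardy p \<and> toeplitz_hankel s a b (B y) = y" if y: "y \<in> Hardy p" for y
  proof -
    have yL: "y \<in> Lp p" by (rule Hardy_Lp[OF y])
    have "d * J (z y) = lscale s (d * J y) - (d * \<A> d) * y"
      unfolding z_def J_diff J_lscale J_times J_J
      by (simp add: right_diff_distrib lscale_times_right mult.assoc)
    \<comment> \<open>The compatibility condition for the equation with d; its sign -s matches the
      sign with which \<open>carl\<close> is applied in H.\<close>
    then have "d * J (z y) = lscale (- s) (z y)"
      unfolding matching_sub(4) z_def using s by auto
    note h = carl_solves[OF p s' matching_sub(2,4) \<kappa>d bijd blinD(1)[OF zL yL] this, folded H_def]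
    have "d * (J y + H y) = lscale s (y + J (H y))"
      using h(2) s unfolding z_def by (auto simp: algebra_simps)
    then have "c * J (W y) = lscale s (W y)"
      unfolding W_def reflected_equations(1) J_add J_J mult.left_commute[of d]
      by (simp add: lscale_times_right)
    note f = carl_solves[OF p s matching_sub(1,3) \<kappa> bij blinD(1)[OF WL yL] this, folded B_def]
    have "a * B y + lscale s (b * J (B y)) = b * (c * B y + lscale s (J (B y)))"
      unfolding reflected_equations(3) distrib_left lscale_times_right
      using reflected_equations(4)[of "a * B y"] by (simp only: mult_ac)
    also have "\<dots> = y + J (H y)"
      unfolding f(2) W_def using reflected_equations(4)[of "y + J (H y)"] by (simp only: mult_ac)
    finally have eq: "a * B y + lscale s (b * J (B y)) = y + J (H y)" .
    have JN: "J (H y) \<in> Hneg p" by (rule J_Hardy[OF p h(1)])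
    show ?thesis
      using f(1) Riesz_P_id[OF p1(1) y] Riesz_P_Hneg[OF JN]
      unfolding toeplitz_hankel_eq(2)[OF p Linf(1,2) f(1)] eq Riesz_P_add[OF p yL Hneg_Lp[OF JN]] by simp
  qed
  have "blin p (Hardy p) (Hardy p) B"
    using BL sol Hardy_subset_Lp[of p] unfolding blin_def by (meson subset_iff)
  then show ?thesis
    unfolding right_invertible_def
    using blin_imp_bounded_op[OF blin_toeplitz_hankel[OF p Linf(1,2)]] blin_imp_bounded_op sol by blast
qed

end

text \<open>Writing the image as y + J h, the residual identity determines T(d) h from y, and a left
  inverse of T(d) returns h. With h known the whole image is known, hence T(c) f, and a left inverse
  of T(c) returns f.\<close>

lemma toeplitz_hankel_left_invertible:
  assumes \<kappa>: "fredholm_index p (toeplitz c) \<le> 0" "fredholm_index p (toeplitz d) \<le> 0"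
    and bij: "toeplitz_bij p (c * monomial (fredholm_index p (toeplitz c)))"
      "toeplitz_bij p (d * monomial (fredholm_index p (toeplitz d)))"
  shows "left_invertible p (toeplitz_hankel s a b)"
proof -
  have p1: "p \<ge> 1" "p > 0" using p by auto
  note Rc = toeplitz_right_inv[OF p matching_sub(1) refl bij(1)]
  note Rd = toeplitz_right_inv[OF p matching_sub(2) refl bij(2)]
  define z where "z y = lscale s y - d * J y" for y
  define H where "H y = toeplitz_right_inv p d (Riesz_P (z y))" for y
  define W where "W y = b' * (y + J (H y))" for y
  define B where "B y = toeplitz_right_inv p c (Riesz_P (W y))" for y
  have zL: "blin p (Lp p) (Lp p) z" unfolding z_def
    by (rule blin_diff[OF blin_lscale[OF blin_id[OF subset_refl] p1(2)]
          blin_comp[OF blin_J[OF p1(2)] blin_times[OF matching_sub(2) p1(2)]] p1(1)])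
  have HL: "blin p (Lp p) (Lp p) H" unfolding H_def
    by (rule blin_mono[OF blin_comp[OF blin_comp[OF zL blin_Riesz_P[OF p]] Rd(1)] subset_refl Hardy_subset_Lp])
  have WL: "blin p (Lp p) (Lp p) W" unfolding W_def
    by (rule blin_comp[OF blin_add[OF blin_id[OF subset_refl] blin_comp[OF HL blin_J[OF p1(2)]] p1(1)]
          blin_times[OF Linf(4) p1(2)]])
  have BL: "blin p (Hardy p) (Hardy p) B" unfolding B_def
    by (rule blin_mono[OF blin_comp[OF blin_comp[OF WL blin_Riesz_P[OF p]] Rc(1)] Hardy_subset_Lp subset_refl])
  have sol: "B (toeplitz_hankel s a b f) = f" if f: "f \<in> Hardy p" for f
  proof -
    define k where "k = a * f + lscale s (b * J f)"
    have kL: "k \<in> Lp p" and A: "toeplitz_hankel s a b f = Riesz_P k"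
      using toeplitz_hankel_eq[OF p Linf(1,2) f] by (simp_all add: k_def)
    define y where "y = Riesz_P k"
    define h where "h = J (Riesz_Q k)"
    have hH: "h \<in> Hardy p" unfolding h_def by (rule J_Hneg[OF p Riesz_Q_Hneg[OF p kL]])
    have JN: "lscale s (J v) \<in> Lp p" "Riesz_P (lscale s (J v)) = 0" if "v \<in> Hardy p" for v
      using J_Hardy[OF p that] Riesz_P_lscale[OF p Hneg_Lp[OF J_Hardy[OF p that]], of s]
      by (auto simp: Lp_lscale Hneg_Lp Riesz_P_Hneg)
    have k: "k = y + J h" by (simp add: h_def J_J y_def Riesz_Q_def)
    have "d * J y + d * h = lscale s y + lscale s (J h)"
      using residual(2)[of f, folded k_def] unfolding k J_add J_J distrib_left lfun.scale_right_distrib .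
    then have z: "z y = d * h - lscale s (J h)" by (simp add: z_def algebra_simps)
    have "Riesz_P (z y) = toeplitz d h"
      unfolding z toeplitz_def
      using Riesz_P_diff[OF p Linf_times_Lp[OF matching_sub(2) p1(2) Hardy_Lp[OF hH]] JN(1)[OF hH]] JN(2)[OF hH] by simp
    then have "H y = h" unfolding H_def using Rd(3)[OF \<kappa>(2) hH] by simp
    then have W: "W y = c * f + lscale s (J f)"
      unfolding W_def residual(1) k_def[symmetric] k by simp
    have "Riesz_P (W y) = toeplitz c f"
      unfolding W toeplitz_def
      using Riesz_P_add[OF p Linf_times_Lp[OF matching_sub(1) p1(2) Hardy_Lp[OF f]] JN(1)[OF f]] JN(2)[OF f] by simp
    then have "B y = f" unfolding B_def using Rc(3)[OF \<kappa>(1) f] by simp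
    then show ?thesis unfolding A y_def .
  qed
  show ?thesis
    unfolding left_invertible_def
    using blin_imp_bounded_op[OF blin_toeplitz_hankel[OF p Linf(1,2)]] blin_imp_bounded_op[OF BL] sol by blast
qed

end

section \<open>Matching pairs, their conjugates and the combination of all cases\<close>

lemma matching_pairE:
  assumes m: "matching_pair \<beta> a b"
  obtains a' b' where "a \<in> Linf" "b \<in> Linf" "a' \<in> Linf" "b' \<in> Linf" "a * a' = 1" "b * b' = 1"
    "a * \<A> a = b * \<A> b" "inverse (\<A> a) = \<A> a'"
    "sub_c a b = a * b'" "sub_d \<beta> a b = b * \<A> a'"
proof -
  obtain a' where a: "a \<in> Linf" "b \<in> Linf" "a' \<in> Linf" "a * a' = 1"
    "a * \<A> a = b * \<A> b"
    using m unfolding matching_pair_def by blast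
  have ca: "\<A> a * \<A> a' = 1"
    by (simp add: compose_times[symmetric] a(4) compose_one)
  \<comment> \<open>The inverse of b is read off from b b(\<alpha>) = a a(\<alpha>); it is bounded
    since b, 1/a and their compositions are.\<close>
  define b' where "b' = \<A> b * (a' * \<A> a')"
  have "b * b' = (b * \<A> b) * (a' * \<A> a')" unfolding b'_def by (simp only: mult_ac)
  also have "\<dots> = (a * a') * (\<A> a * \<A> a')" unfolding a(5)[symmetric] by (simp only: mult_ac)
  finally have b: "b * b' = 1" unfolding a(4) ca by simp
  have b'L: "b' \<in> Linf" unfolding b'_def by (rule Linf_times Linf_compose a)+
  have inv: "inverse (\<A> a) = \<A> a'" "inverse b = b'"
    by (rule lfun_inverse_unique[OF ca], rule lfun_inverse_unique[OF b])
  show ?thesis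
    by (rule that[of a' b']) (use a b b'L inv in \<open>simp_all add: sub_c_def sub_d_def\<close>)
qed

lemma matching_pair_conj:
  assumes m: "matching_pair \<beta> a b"
  shows "matching_pair \<beta> (lcnj a) (lcnj (\<A> b))"
    "sub_c (lcnj a) (lcnj (\<A> b)) = lcnj (sub_d \<beta> a b)"
    "sub_d \<beta> (lcnj a) (lcnj (\<A> b)) = lcnj (sub_c a b)"
proof -
  obtain a' b' where M: "a \<in> Linf" "b \<in> Linf" "a' \<in> Linf" "b' \<in> Linf" "a * a' = 1" "b * b' = 1"
    "a * \<A> a = b * \<A> b" "inverse (\<A> a) = \<A> a'"
    "sub_c a b = a * b'" "sub_d \<beta> a b = b * \<A> a'"
    by (rule matching_pairE[OF m])
  \<comment> \<open>The algebra of subordinated pairs involves neither exponent nor sign; 2 and 1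
    are arbitrary values that open the context.\<close>
  have p2: "(2::real) > 1" and s1: "(1::complex) = 1 \<or> (1::complex) = - 1" by simp_all
  note S = matching_sub[OF p2 s1 M(1-7) refl refl]
  have inv: "inverse (lcnj (\<A> b)) = lcnj (\<A> b')"
    "inverse (lcnj (\<A> a)) = lcnj (\<A> a')"
    using S(6,7) by (intro lfun_inverse_unique; metis lcnj_simps)+
  have "lcnj a * lcnj a' = 1" using M(5) by (metis lcnj_simps)
  then show "matching_pair \<beta> (lcnj a) (lcnj (\<A> b))"
    unfolding matching_pair_def compose_lcnj compose_compose
    using Linf_lcnj[OF M(1)] Linf_lcnj[OF Linf_compose[OF M(2)]] Linf_lcnj[OF M(3)] M(7)
    by (metis lcnj_simps mult.commute)
  show "sub_c (lcnj a) (lcnj (\<A> b)) = lcnj (sub_d \<beta> a b)"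
    unfolding sub_c_def inv M(10) S(5) by simp
  have "\<A> b * \<A> a' = (b * b') * (\<A> b * \<A> a')"
    unfolding M(6) by simp
  also have "\<dots> = (b * \<A> b) * (\<A> a' * b')" by (simp only: mult_ac)
  also have "\<dots> = (\<A> a * \<A> a') * (a * b')" unfolding M(7)[symmetric] by (simp only: mult_ac)
  finally have "\<A> b * \<A> a' = a * b'" unfolding S(6) by simp
  then show "sub_d \<beta> (lcnj a) (lcnj (\<A> b)) = lcnj (sub_c a b)"
    unfolding sub_d_def compose_lcnj inv M(9) by (metis lcnj_simps)
qed

text \<open>Stated for an arbitrary matching pair and exponent so as to apply both to the given pair
  on H^p and to the conjugate pair on H^q, where kernels are the cokernels sought.\<close>

lemma ker_toeplitz_hankel_cases:
  fixes c d :: lfun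
  assumes p: "p > 1" and m: "matching_pair \<beta> a b" and s: "s = 1 \<or> s = - 1"
    and c: "c = sub_c a b" and d: "d = sub_d \<beta> a b"
  shows "c \<in> Linf" "d \<in> Linf" "c * \<A> c = 1" "d * \<A> d = 1"
    "fredholm_index p (toeplitz c) \<ge> 0 \<Longrightarrow> toeplitz_bij p (c * monomial (fredholm_index p (toeplitz c))) \<Longrightarrow>
      is_direct_sum (ker p (toeplitz_hankel s a b)) (im_proj p \<beta> (- s) c) (phi_alpha p \<beta> s a b ` im_proj p \<beta> s d)"
    "ker p (toeplitz d) = {0} \<Longrightarrow> ker p (toeplitz_hankel s a b) = im_proj p \<beta> (- s) c"
    "ker p (toeplitz d) = {0} \<Longrightarrow> im_proj p \<beta> s d = {0}"
    "ker p (toeplitz c) = {0} \<Longrightarrow> im_proj p \<beta> s c = {0}"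
proof -
  obtain a' b' where M: "a \<in> Linf" "b \<in> Linf" "a' \<in> Linf" "b' \<in> Linf" "a * a' = 1" "b * b' = 1"
    "a * \<A> a = b * \<A> b" "inverse (\<A> a) = \<A> a'"
    "sub_c a b = a * b'" "sub_d \<beta> a b = b * \<A> a'"
    by (rule matching_pairE[OF m])
  have cd: "c = a * b'" "d = b * \<A> a'" using M c d by simp_all
  note S = matching_sub[OF p s M(1-7) cd]
  show "c \<in> Linf" "d \<in> Linf" "c * \<A> c = 1" "d * \<A> d = 1" by (rule S)+
  have ss: "s * s = 1" "(- s) * (- s) = 1" using s by auto
  note im = im_proj_eq_Eig[OF p S(1,3)] im_proj_eq_Eig[OF p S(2,4)]
  have "phi_alpha p \<beta> s a b = (\<lambda>h. carl p s c (\<A> a' * h))"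
    by (rule ext) (simp add: phi_alpha_eq_carl M(8) c)
  then show "is_direct_sum (ker p (toeplitz_hankel s a b)) (im_proj p \<beta> (- s) c) (phi_alpha p \<beta> s a b ` im_proj p \<beta> s d)"
    if "fredholm_index p (toeplitz c) \<ge> 0" "toeplitz_bij p (c * monomial (fredholm_index p (toeplitz c)))"
    using ker_toeplitz_hankel_sum[OF p s M(1-7) cd that] unfolding im(1)[OF ss(2)] im(2)[OF ss(1)] by simp
  show "ker p (toeplitz_hankel s a b) = im_proj p \<beta> (- s) c" if "ker p (toeplitz d) = {0}"
    unfolding im(1)[OF ss(2)] by (rule ker_toeplitz_hankel_trivial_d[OF p s M(1-7) cd that])
  show "im_proj p \<beta> s d = {0}" if "ker p (toeplitz d) = {0}"
    unfolding im(2)[OF ss(1)] by (rule Eig_trivial[OF p S(2) that])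
  show "im_proj p \<beta> s c = {0}" if "ker p (toeplitz c) = {0}"
    unfolding im(1)[OF ss(1)] by (rule Eig_trivial[OF p S(1) that])
qed

end

theorem theorem5p1:
  fixes p q :: real and \<beta> :: complex and a b c d :: lfun and \<kappa>1 \<kappa>2 :: int
    and Aplus Aminus :: "lfun \<Rightarrow> lfun"
  assumes p: "1 < p" and q: "1 / p + 1 / q = 1"
    and beta: "cmod \<beta> > 1"
    and matching: "matching_pair \<beta> a b"
    and fredholm: "fredholm_pair p \<beta> a b"
    and c: "c = sub_c a b" and d: "d = sub_d \<beta> a b"
    and k1: "\<kappa>1 = fredholm_index p (toeplitz c)"
    and k2: "\<kappa>2 = fredholm_index p (toeplitz d)"
    and Aplus: "Aplus = (\<lambda>f. toeplitz a f + hankel \<beta> b f)"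
    and Aminus: "Aminus = (\<lambda>f. toeplitz a f - hankel \<beta> b f)"
  shows
    "(\<kappa>1 \<ge> 0 \<and> \<kappa>2 \<ge> 1 \<longrightarrow>
        right_invertible p Aplus \<and> right_invertible p Aminus \<and>
        is_direct_sum (ker p Aplus)
          (im_proj p \<beta> (-1) c) (phi_alpha p \<beta> 1 a b ` im_proj p \<beta> 1 d) \<and>
        is_direct_sum (ker p Aminus)
          (im_proj p \<beta> 1 c) (phi_alpha p \<beta> (-1) a b ` im_proj p \<beta> (-1) d) \<and>
        (\<forall>g\<in>{c, d}. \<forall>s\<in>{1, -1}.
           (\<forall>m::nat. m > 0 \<and> fredholm_index p (toeplitz g) = 2 * int m \<longrightarrow>
              is_basis
                {inverse (wh_plus p g) *
                   (chi \<beta> ^ (m - k - 1) + lscale (s * alpha_signature p \<beta> g) (chi \<beta> ^ (m + k))) | k. k < m}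
                (im_proj p \<beta> s g)) \<and>
           (\<forall>m::nat. fredholm_index p (toeplitz g) = 2 * int m + 1 \<longrightarrow>
              is_basis
                ({inverse (wh_plus p g) *
                   (chi \<beta> ^ (m + k) + lscale (s * alpha_signature p \<beta> g) (chi \<beta> ^ (m - k))) | k. k \<le> m} - {0})
                (im_proj p \<beta> s g)) \<and>
           (fredholm_index p (toeplitz g) = 0 \<longrightarrow> im_proj p \<beta> s g = {0}))) \<and>
     (\<kappa>1 \<le> -1 \<and> \<kappa>2 \<le> 0 \<longrightarrow>
        left_invertible p Aplus \<and> left_invertible p Aminus \<and>
        is_direct_sum (coker p Aplus)
          (im_proj q \<beta> (-1) (lcnj d))
          (phi_alpha q \<beta> 1 (lcnj a) (lcnj (compose_alpha \<beta> b)) ` im_proj q \<beta> 1 (lcnj c)) \<and>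
        is_direct_sum (coker p Aminus)
          (im_proj q \<beta> 1 (lcnj d))
          (phi_alpha q \<beta> (-1) (lcnj a) (lcnj (compose_alpha \<beta> b)) ` im_proj q \<beta> (-1) (lcnj c)) \<and>
        (\<kappa>2 = 0 \<longrightarrow> im_proj q \<beta> 1 (lcnj d) = {0} \<and> im_proj q \<beta> (-1) (lcnj d) = {0})) \<and>
     (\<kappa>1 \<ge> 0 \<and> \<kappa>2 \<le> 0 \<longrightarrow>
        ker p Aplus = im_proj p \<beta> (-1) c \<and> coker p Aplus = im_proj q \<beta> (-1) (lcnj d) \<and>
        ker p Aminus = im_proj p \<beta> 1 c \<and> coker p Aminus = im_proj q \<beta> 1 (lcnj d))"
proof -
  interpret carleman_shift \<beta> by unfold_locales (rule beta)
  have qc: "q = conj_exp p" by (rule conj_exp_eq[OF p q])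
  have q1: "q > 1" using conj_exp[OF p] by (simp add: qc)
  have A: "Aplus = toeplitz_hankel 1 a b" "Aminus = toeplitz_hankel (- 1) a b"
    unfolding Aplus Aminus by (simp_all add: fun_eq_iff toeplitz_hankel_def)
  obtain a' b' where M: "a \<in> Linf" "b \<in> Linf" "a' \<in> Linf" "b' \<in> Linf" "a * a' = 1" "b * b' = 1"
    "a * compose_alpha \<beta> a = b * compose_alpha \<beta> b" "inverse (compose_alpha \<beta> a) = compose_alpha \<beta> a'"
    "sub_c a b = a * b'" "sub_d \<beta> a b = b * compose_alpha \<beta> a'"
    by (rule matching_pairE[OF matching])
  have cd: "c = a * b'" "d = b * compose_alpha \<beta> a'" using M c d by simp_all
  have sgn: "(1::complex) = 1 \<or> (1::complex) = - 1" "(- 1::complex) = 1 \<or> (- 1::complex) = - 1" by auto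
  note K = ker_toeplitz_hankel_cases[OF p matching _ c d]
  have F: "fredholm p (toeplitz c)" "fredholm p (toeplitz d)" using fredholm by (simp_all add: fredholm_pair_def c d)
  note L = K(1,2)[OF sgn(1)] and U = K(3,4)[OF sgn(1)]
  have bij: "toeplitz_bij p (c * monomial \<kappa>1)" "toeplitz_bij p (d * monomial \<kappa>2)"
    unfolding k1 k2 by (rule toeplitz_bij_index[OF p L(1) U(1) F(1)], rule toeplitz_bij_index[OF p L(2) U(2) F(2)])
  note N = matching_pair_conj[OF matching, folded c d]
  \<comment> \<open>The conjugate pair has cnj d in the place of c and cnj c in the place of d, with
    the same sign.\<close>
  note K' = ker_toeplitz_hankel_cases[OF q1 N(1) _ N(2)[symmetric] N(3)[symmetric]]
  have idx: "fredholm_index q (toeplitz (lcnj d)) = - \<kappa>2"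
    unfolding qc k2 by (rule fredholm_index_toeplitz(2)[OF p L(2)])
  \<comment> \<open>Bijectivity on H^q is the adjoint of bijectivity for d on H^p; the exponent
    -\<kappa>2 is the index of T(cnj d) there.\<close>
  have "lcnj (d * monomial \<kappa>2) = lcnj d * monomial (- \<kappa>2)" by simp
  then have bij': "toeplitz_bij q (lcnj d * monomial (fredholm_index q (toeplitz (lcnj d))))"
    using toeplitz_bij_adjoint[OF p bij(2)] unfolding idx unfolding qc by simp
  have coker: "coker p (toeplitz_hankel s a b) = ker q (toeplitz_hankel s (lcnj a) (lcnj (compose_alpha \<beta> b)))"
    if "s = 1 \<or> s = - 1" for s
    unfolding qc by (rule coker_toeplitz_hankel[OF p M(1,2) that])
  have i: "right_invertible p (toeplitz_hankel s a b) \<and>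
      is_direct_sum (ker p (toeplitz_hankel s a b)) (im_proj p \<beta> (- s) c) (phi_alpha p \<beta> s a b ` im_proj p \<beta> s d)"
    if "\<kappa>1 \<ge> 0" "\<kappa>2 \<ge> 1" and s: "s = 1 \<or> s = - 1" for s
    using that(1,2) K(5)[OF s] bij toeplitz_hankel_right_invertible[OF p s M(1-7) cd] unfolding k1 k2 by simp
  have ii: "left_invertible p (toeplitz_hankel s a b) \<and>
      is_direct_sum (coker p (toeplitz_hankel s a b)) (im_proj q \<beta> (- s) (lcnj d))
        (phi_alpha q \<beta> s (lcnj a) (lcnj (compose_alpha \<beta> b)) ` im_proj q \<beta> s (lcnj c))"
    if "\<kappa>1 \<le> - 1" "\<kappa>2 \<le> 0" and s: "s = 1 \<or> s = - 1" for s
  proof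
    show "left_invertible p (toeplitz_hankel s a b)"
      using that(1,2) bij unfolding k1 k2
      by (intro toeplitz_hankel_left_invertible[OF p s M(1-7) cd]) simp_all
    show "is_direct_sum (coker p (toeplitz_hankel s a b)) (im_proj q \<beta> (- s) (lcnj d))
        (phi_alpha q \<beta> s (lcnj a) (lcnj (compose_alpha \<beta> b)) ` im_proj q \<beta> s (lcnj c))"
      unfolding coker[OF s] using that(2) by (intro K'(5)[OF s _ bij']) (simp add: idx)
  qed
  \<comment> \<open>At index 0 the kernel of T(cnj d) vanishes as well, by the half of the
    alternative that covers nonnegative index.\<close>
  have ii0: "im_proj q \<beta> s (lcnj d) = {0}" if "\<kappa>2 = 0" and s: "s = 1 \<or> s = - 1" for s
  proof (rule K'(8)[OF s])
    show "ker q (toeplitz (lcnj d)) = {0}"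
      unfolding qc by (rule ker_trivial(2)[OF p L(2) U(2) F(2)]) (use that(1) k2 in simp)
  qed
  \<comment> \<open>The nonpositive index of T(d) removes \<phi> from the kernel; the nonnegative
    index of T(c) kills the kernel of T(cnj c) and so removes \<phi> from the cokernel.\<close>
  have iii: "ker p (toeplitz_hankel s a b) = im_proj p \<beta> (- s) c \<and>
      coker p (toeplitz_hankel s a b) = im_proj q \<beta> (- s) (lcnj d)"
    if "\<kappa>1 \<ge> 0" "\<kappa>2 \<le> 0" and s: "s = 1 \<or> s = - 1" for s
  proof
    show "ker p (toeplitz_hankel s a b) = im_proj p \<beta> (- s) c"
      by (rule K(6)[OF s ker_trivial(1)[OF p L(2) U(2) F(2)]]) (use that k2 in simp)
    have "ker q (toeplitz (lcnj c)) = {0}"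
      unfolding qc by (rule ker_trivial(2)[OF p L(1) U(1) F(1)]) (use that k1 in simp)
    then show "coker p (toeplitz_hankel s a b) = im_proj q \<beta> (- s) (lcnj d)"
      unfolding coker[OF s] by (rule K'(6)[OF s])
  qed
  have F': "g \<in> Linf" "g * compose_alpha \<beta> g = 1" "fredholm p (toeplitz g)" if "g \<in> {c, d}" for g
    using that L U F by auto
  have basis:
    "\<forall>g\<in>{c, d}. \<forall>s\<in>{1, -1}.
       (\<forall>m::nat. m > 0 \<and> fredholm_index p (toeplitz g) = 2 * int m \<longrightarrow>
          is_basis
            {inverse (wh_plus p g) *
               (chi \<beta> ^ (m - k - 1) + lscale (s * alpha_signature p \<beta> g) (chi \<beta> ^ (m + k))) | k. k < m}
            (im_proj p \<beta> s g)) \<and>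
       (\<forall>m::nat. fredholm_index p (toeplitz g) = 2 * int m + 1 \<longrightarrow>
          is_basis
            ({inverse (wh_plus p g) *
               (chi \<beta> ^ (m + k) + lscale (s * alpha_signature p \<beta> g) (chi \<beta> ^ (m - k))) | k. k \<le> m} - {0})
            (im_proj p \<beta> s g)) \<and>
       (fredholm_index p (toeplitz g) = 0 \<longrightarrow> im_proj p \<beta> s g = {0})"
  proof (intro ballI conjI allI impI)
    fix g and s :: complex and m :: nat
    assume g: "g \<in> {c, d}" and s: "s \<in> {1, - 1}"
    have s': "s = 1 \<or> s = - 1" using s by simp
    note B = im_proj_bases[OF p F'[OF g] s']
    show "is_basis
          {inverse (wh_plus p g) *
             (chi \<beta> ^ (m - k - 1) + lscale (s * alpha_signature p \<beta> g) (chi \<beta> ^ (m + k))) | k. k < m}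
          (im_proj p \<beta> s g)" if "m > 0 \<and> fredholm_index p (toeplitz g) = 2 * int m"
      by (rule B(1)[OF conjunct1[OF that] conjunct2[OF that]])
    show "is_basis
          ({inverse (wh_plus p g) *
             (chi \<beta> ^ (m + k) + lscale (s * alpha_signature p \<beta> g) (chi \<beta> ^ (m - k))) | k. k \<le> m} - {0})
          (im_proj p \<beta> s g)" if "fredholm_index p (toeplitz g) = 2 * int m + 1"
      by (rule B(2)[OF that])
    show "im_proj p \<beta> s g = {0}" if "fredholm_index p (toeplitz g) = 0" by (rule B(3)[OF that])
  qed
  note P = i[OF _ _ sgn(1)] i[OF _ _ sgn(2), unfolded minus_minus]
    ii[OF _ _ sgn(1)] ii[OF _ _ sgn(2), unfolded minus_minus] ii0[OF _ sgn(1)] ii0[OF _ sgn(2)]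
    iii[OF _ _ sgn(1)] iii[OF _ _ sgn(2), unfolded minus_minus]
  show ?thesis
    unfolding A
  proof (rule conjI[OF impI conjI[OF impI impI]], goal_cases)
    case 1
    then show ?case using P(1)[OF conjunct1[OF 1] conjunct2[OF 1]] P(2)[OF conjunct1[OF 1] conjunct2[OF 1]] basis
      by (elim conjE) (intro conjI; assumption)
  next
    case 2
    then show ?case
      using P(3)[OF conjunct1[OF 2] conjunct2[OF 2]] P(4)[OF conjunct1[OF 2] conjunct2[OF 2]] P(5,6)
      by (elim conjE) (intro conjI impI; (assumption | blast))
  next
    case 3
    then show ?case using P(7)[OF conjunct1[OF 3] conjunct2[OF 3]] P(8)[OF conjunct1[OF 3] conjunct2[OF 3]]
      by (elim conjE) (intro conjI; assumption)
  qed
qed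

end
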